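(* Let $M$ be a rank set with $\#M=k$ and all intervals contained in $[n]$, and let $\kappa M=\{[a,b+1]:[a,b]\in M\}$, so $\Sigma_{\kappa M}\subseteq\operatorname{Gr}(k,n+1)$. Let $\iota:\operatorname{Gr}(k,n)\hookrightarrow\operatorname{Gr}(k,n+1)$ be the inclusion induced by an inclusion $\mathbb{C}^n\hookrightarrow\mathbb{C}^{n+1}$. Then $\iota^*[\Sigma_{\kappa M}]=[\Sigma_M]$.
   Context: A rank set is a finite set of intervals $[a_i,b_i]$ of positive integers with $a_i\le b_i$, all $a_i$ distinct and all $b_i$ distinct; for a set $S$, $S(M)$ is the set of intervals of $M$ contained in $S$. For a rank set $N$ with $\#N=k$ and intervals in $[m]$, the rank variety $\Sigma_N\subseteq\operatorname{Gr}(k,m)$ is the closure of $\{V:\dim(V\cap\langle S\cap T\rangle)=\#(S\cap T)(N)\ \forall S,T\in N\}$, where $\langle X\rangle$ is the span of the standard basis vectors $e_i$, $i\in X$, of $\mathbb{C}^m$. $[\cdot]$ denotes cohomology class and $\iota^*$ the pullback on cohomology. *)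

theory Defs
  imports
    "HOL-Analysis.Analysis"
    "HOL-Homology.Homology"
    "HOL-Library.Function_Algebras"
begin

section \<open>Coordinate spaces\<close>

definition cscale :: "complex \<Rightarrow> (nat \<Rightarrow> complex) \<Rightarrow> (nat \<Rightarrow> complex)" where
  "cscale c v = (\<lambda>i. c * v i)"

global_interpretation cvec: vector_space cscale
  defines cspan = cvec.span and csubspace = cvec.subspace and cdim = cvec.dim
    and cindependent = cvec.independent
  by unfold_locales (auto simp: cscale_def algebra_simps fun_eq_iff)

text \<open>\<open>cspace m\<close> is \<open>\<complex>\<^sup>m\<close>, with coordinates indexed by \<open>1, \<dots>, m\<close>.\<close>

definition cspace :: "nat \<Rightarrow> (nat \<Rightarrow> complex) set" where
  "cspace m = {v. \<forall>i. i \<notin> {1..m} \<longrightarrow> v i = 0}"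

definition unit_vec :: "nat \<Rightarrow> (nat \<Rightarrow> complex)" where
  "unit_vec i = (\<lambda>j. if j = i then 1 else 0)"

definition coord_span :: "nat set \<Rightarrow> (nat \<Rightarrow> complex) set" where
  "coord_span S = cspan (unit_vec ` S)"

definition linear_inclusion :: "nat \<Rightarrow> nat \<Rightarrow> ((nat \<Rightarrow> complex) \<Rightarrow> (nat \<Rightarrow> complex)) \<Rightarrow> bool" where
  "linear_inclusion n m j \<longleftrightarrow>
     j \<in> cspace n \<rightarrow> cspace m \<and> inj_on j (cspace n) \<and>
     (\<forall>v\<in>cspace n. \<forall>w\<in>cspace n. j (v + w) = j v + j w) \<and>
     (\<forall>c. \<forall>v\<in>cspace n. j (cscale c v) = cscale c (j v))"

section \<open>Grassmannians\<close>

definition Gr :: "nat \<Rightarrow> nat \<Rightarrow> (nat \<Rightarrow> complex) set set" where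
  "Gr k m = {V. csubspace V \<and> V \<subseteq> cspace m \<and> cdim V = k}"

text \<open>A \<open>k \<times> m\<close> matrix of rank \<open>k\<close> is the function \<open>A\<close> whose rows are
  \<open>A 0, \<dots>, A (k - 1)\<close>; all entries outside the matrix are \<open>0\<close>.\<close>

definition row_space :: "nat \<Rightarrow> (nat \<Rightarrow> nat \<Rightarrow> complex) \<Rightarrow> (nat \<Rightarrow> complex) set" where
  "row_space k A = cspan (A ` {..<k})"

definition frames :: "nat \<Rightarrow> nat \<Rightarrow> (nat \<Rightarrow> nat \<Rightarrow> complex) set" where
  "frames k m = {A. (\<forall>i<k. A i \<in> cspace m) \<and> (\<forall>i\<ge>k. A i = 0) \<and> cdim (row_space k A) = k}"

text \<open>The quotient topology along \<open>row_space k : frames k m \<rightarrow> Gr k m\<close>.\<close>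

definition Gr_top :: "nat \<Rightarrow> nat \<Rightarrow> (nat \<Rightarrow> complex) set topology" where
  "Gr_top k m = topology (\<lambda>U. U \<subseteq> Gr k m \<and>
     openin (top_of_set (frames k m)) {A \<in> frames k m. row_space k A \<in> U})"

lemma openin_Gr_top:
  "openin (Gr_top k m) U \<longleftrightarrow> U \<subseteq> Gr k m \<and>
     openin (top_of_set (frames k m)) {A \<in> frames k m. row_space k A \<in> U}"
proof -
  let ?P = "\<lambda>U. {A \<in> frames k m. row_space k A \<in> U}"
  have "istopology (\<lambda>U. U \<subseteq> Gr k m \<and> openin (top_of_set (frames k m)) (?P U))"
    unfolding istopology_def
  proof (intro conjI allI impI)
    fix S T
    assume "S \<subseteq> Gr k m \<and> openin (top_of_set (frames k m)) (?P S)"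
      and "T \<subseteq> Gr k m \<and> openin (top_of_set (frames k m)) (?P T)"
    moreover have "?P (S \<inter> T) = ?P S \<inter> ?P T" by auto
    ultimately show "S \<inter> T \<subseteq> Gr k m" "openin (top_of_set (frames k m)) (?P (S \<inter> T))"
      by (auto intro: openin_Int)
  next
    fix \<K>
    assume *: "\<forall>K\<in>\<K>. K \<subseteq> Gr k m \<and> openin (top_of_set (frames k m)) (?P K)"
    then show "\<Union>\<K> \<subseteq> Gr k m" by blast
    have "?P (\<Union>\<K>) = \<Union>(?P ` \<K>)" by auto
    moreover have "openin (top_of_set (frames k m)) (\<Union>(?P ` \<K>))"
      by (rule openin_Union) (use * in blast)
    ultimately show "openin (top_of_set (frames k m)) (?P (\<Union>\<K>))"
      by (simp only:)
  qed
  then show ?thesis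
    by (simp add: Gr_top_def topology_inverse')
qed

lemma cspace_subspace: "csubspace (cspace m)"
  by (auto simp: cvec.subspace_def cspace_def cscale_def)

lemma row_space_in_Gr:
  assumes "A \<in> frames k m" shows "row_space k A \<in> Gr k m"
proof -
  have "A ` {..<k} \<subseteq> cspace m"
    using assms unfolding frames_def by blast
  then have "row_space k A \<subseteq> cspace m"
    unfolding row_space_def using cspace_subspace by (rule cvec.span_minimal)
  moreover have "csubspace (row_space k A)"
    unfolding row_space_def by (rule cvec.subspace_span)
  ultimately show ?thesis
    using assms unfolding frames_def Gr_def by blast
qed

lemma topspace_Gr_top: "topspace (Gr_top k m) = Gr k m"
proof -
  have "{A \<in> frames k m. row_space k A \<in> Gr k m} = frames k m"
    using row_space_in_Gr by auto
  then have "openin (Gr_top k m) (Gr k m)"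
    by (simp add: openin_Gr_top)
  then show ?thesis
    by (meson openin_Gr_top openin_subset openin_topspace subset_antisym)
qed

section \<open>Rank varieties\<close>

text \<open>The interval \<open>[a, b]\<close> is represented by the pair \<open>(a, b)\<close>.\<close>

definition rank_set :: "(nat \<times> nat) set \<Rightarrow> bool" where
  "rank_set M \<longleftrightarrow> finite M \<and> (\<forall>(a, b)\<in>M. 1 \<le> a \<and> a \<le> b) \<and> inj_on fst M \<and> inj_on snd M"

definition intervals_in :: "nat set \<Rightarrow> (nat \<times> nat) set \<Rightarrow> (nat \<times> nat) set" where
  "intervals_in S M = {(a, b) \<in> M. {a..b} \<subseteq> S}"

definition kappa :: "(nat \<times> nat) set \<Rightarrow> (nat \<times> nat) set" where
  "kappa M = {(a, b + 1) |a b. (a, b) \<in> M}"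

text \<open>The locus below is constructible, so its closure in the classical topology
  coincides with its Zariski closure.\<close>

definition rank_variety :: "nat \<Rightarrow> (nat \<times> nat) set \<Rightarrow> (nat \<Rightarrow> complex) set set" where
  "rank_variety m N = Gr_top (card N) m closure_of
     {V \<in> Gr (card N) m. \<forall>(a, b)\<in>N. \<forall>(c, d)\<in>N.
        cdim (V \<inter> coord_span ({a..b} \<inter> {c..d})) = card (intervals_in ({a..b} \<inter> {c..d}) N)}"

section \<open>Singular cohomology with integer coefficients\<close>

type_synonym 'a cochain = "'a chain \<Rightarrow> int"

definition cochain_group :: "nat \<Rightarrow> 'a topology \<Rightarrow> 'a cochain monoid" where
  "cochain_group p X =
    \<lparr>carrier = hom (chain_group p X) integer_group \<inter> extensional (carrier (chain_group p X)),
     monoid.mult = (\<lambda>\<phi> \<psi>. \<lambda>c\<in>carrier (chain_group p X). \<phi> c + \<psi> c),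
     one = (\<lambda>c\<in>carrier (chain_group p X). 0)\<rparr>"

definition coboundary_map :: "nat \<Rightarrow> 'a topology \<Rightarrow> 'a cochain \<Rightarrow> 'a cochain" where
  "coboundary_map p X \<phi> = (\<lambda>c\<in>carrier (chain_group (Suc p) X). \<phi> (chain_boundary (Suc p) c))"

definition cocycles :: "nat \<Rightarrow> 'a topology \<Rightarrow> 'a cochain set" where
  "cocycles p X =
     {\<phi> \<in> carrier (cochain_group p X). coboundary_map p X \<phi> = \<one>\<^bsub>cochain_group (Suc p) X\<^esub>}"

definition coboundaries :: "nat \<Rightarrow> 'a topology \<Rightarrow> 'a cochain set" where
  "coboundaries p X = (case p of
       0 \<Rightarrow> {\<one>\<^bsub>cochain_group 0 X\<^esub>}
     | Suc q \<Rightarrow> coboundary_map q X ` carrier (cochain_group q X))"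

definition cocycle_group :: "nat \<Rightarrow> 'a topology \<Rightarrow> 'a cochain monoid" where
  "cocycle_group p X = subgroup_generated (cochain_group p X) (cocycles p X)"

definition cohomology_group :: "nat \<Rightarrow> 'a topology \<Rightarrow> 'a cochain set monoid" where
  "cohomology_group p X = cocycle_group p X Mod coboundaries p X"

definition cohom_class :: "nat \<Rightarrow> 'a topology \<Rightarrow> 'a cochain \<Rightarrow> 'a cochain set" where
  "cohom_class p X \<phi> = coboundaries p X #>\<^bsub>cocycle_group p X\<^esub> \<phi>"

definition cochain_pullback ::
    "nat \<Rightarrow> 'a topology \<Rightarrow> ('a \<Rightarrow> 'b) \<Rightarrow> 'b cochain \<Rightarrow> 'a cochain" where
  "cochain_pullback p X f \<phi> = (\<lambda>c\<in>carrier (chain_group p X). \<phi> (chain_map p f c))"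

text \<open>An element of \<open>H\<^sup>*(X) = \<Oplus>\<^sub>p H\<^sup>p(X)\<close> is the family of its homogeneous components.
  For a continuous \<open>f : X \<rightarrow> Y\<close>, the pullbacks of all the cocycles in one class of \<open>Y\<close>
  differ by coboundaries of \<open>X\<close>, so multiplying by \<open>coboundaries p X\<close> gives a single coset.\<close>

definition cohom_pullback ::
    "'a topology \<Rightarrow> ('a \<Rightarrow> 'b) \<Rightarrow> (nat \<Rightarrow> 'b cochain set) \<Rightarrow> (nat \<Rightarrow> 'a cochain set)" where
  "cohom_pullback X f \<xi> =
     (\<lambda>p. coboundaries p X <#>\<^bsub>cocycle_group p X\<^esub> (cochain_pullback p X f ` \<xi> p))"

lemma cochain_group_carrier_iff:
  "\<phi> \<in> carrier (cochain_group p X) \<longleftrightarrow>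
     (\<forall>c d. singular_chain p X c \<longrightarrow> singular_chain p X d \<longrightarrow> \<phi> (c + d) = \<phi> c + \<phi> d) \<and>
     \<phi> \<in> extensional (singular_chain_set p X)"
  by (auto simp: cochain_group_def hom_def)

lemma cochain_group_mult:
  "\<phi> \<otimes>\<^bsub>cochain_group p X\<^esub> \<psi> = (\<lambda>c\<in>singular_chain_set p X. \<phi> c + \<psi> c)"
  by (simp add: cochain_group_def)

lemma cochain_group_one: "\<one>\<^bsub>cochain_group p X\<^esub> = (\<lambda>c\<in>singular_chain_set p X. 0)"
  by (simp add: cochain_group_def)

lemma comm_group_cochain_group: "comm_group (cochain_group p X)"
proof (rule comm_groupI)
  fix \<phi> assume \<phi>: "\<phi> \<in> carrier (cochain_group p X)"
  show "\<exists>\<psi>\<in>carrier (cochain_group p X). \<psi> \<otimes>\<^bsub>cochain_group p X\<^esub> \<phi> = \<one>\<^bsub>cochain_group p X\<^esub>"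
  proof (rule bexI[of _ "\<lambda>c\<in>singular_chain_set p X. - \<phi> c"])
    show "(\<lambda>c\<in>singular_chain_set p X. - \<phi> c) \<in> carrier (cochain_group p X)"
      using \<phi> by (simp add: cochain_group_carrier_iff singular_chain_add)
  qed (simp add: cochain_group_mult cochain_group_one cong: restrict_cong)
  show "\<one>\<^bsub>cochain_group p X\<^esub> \<otimes>\<^bsub>cochain_group p X\<^esub> \<phi> = \<phi>"
    using \<phi> by (simp add: cochain_group_carrier_iff cochain_group_mult cochain_group_one
        extensional_restrict cong: restrict_cong)
qed (simp_all add: cochain_group_carrier_iff cochain_group_mult cochain_group_one
      singular_chain_add algebra_simps cong: restrict_cong)

lemma coboundary_map_hom:
  "coboundary_map p X \<in> hom (cochain_group p X) (cochain_group (Suc p) X)"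
proof (rule homI)
  fix \<phi> \<psi>
  assume "\<phi> \<in> carrier (cochain_group p X)" "\<psi> \<in> carrier (cochain_group p X)"
  show "coboundary_map p X (\<phi> \<otimes>\<^bsub>cochain_group p X\<^esub> \<psi>)
      = coboundary_map p X \<phi> \<otimes>\<^bsub>cochain_group (Suc p) X\<^esub> coboundary_map p X \<psi>"
    by (rule ext) (simp add: coboundary_map_def cochain_group_mult restrict_def
        singular_chain_boundary_alt)
qed (simp add: cochain_group_carrier_iff coboundary_map_def chain_boundary_add
      singular_chain_add singular_chain_boundary_alt)

lemma coboundary_map_coboundary_map:
  assumes "\<phi> \<in> carrier (cochain_group p X)"
  shows "coboundary_map (Suc p) X (coboundary_map p X \<phi>) = \<one>\<^bsub>cochain_group (Suc (Suc p)) X\<^esub>"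
proof -
  have "\<phi> 0 = 0"
  proof -
    have "\<phi> (0 + 0) = \<phi> 0 + \<phi> 0"
      using assms by (auto simp: cochain_group_def hom_def simp del: add_0 add_0_right)
    then show ?thesis by simp
  qed
  then show ?thesis
    by (intro ext) (simp add: coboundary_map_def cochain_group_one restrict_def
        singular_chain_boundary_alt chain_boundary_boundary_alt)
qed

lemma subgroup_cocycles: "subgroup (cocycles p X) (cochain_group p X)"
proof -
  interpret group_hom "cochain_group p X" "cochain_group (Suc p) X" "coboundary_map p X"
    by (intro group_hom.intro group_hom_axioms.intro coboundary_map_hom
        comm_group.axioms(2) comm_group_cochain_group)
  show ?thesis
    using subgroup_kernel unfolding kernel_def cocycles_def .
qed

lemma coboundaries_subset_cocycles: "coboundaries p X \<subseteq> cocycles p X"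
proof (cases p)
  case 0
  then show ?thesis
    using subgroup.one_closed[OF subgroup_cocycles[of 0 X]] by (simp add: coboundaries_def)
next
  case (Suc q)
  then show ?thesis
    using hom_in_carrier[OF coboundary_map_hom[of q X]]
    by (auto simp: coboundaries_def cocycles_def coboundary_map_coboundary_map)
qed

lemma subgroup_coboundaries: "subgroup (coboundaries p X) (cochain_group p X)"
proof (cases p)
  case 0
  then show ?thesis
    using group.triv_subgroup[OF comm_group.axioms(2)[OF comm_group_cochain_group[of 0 X]]]
    by (simp add: coboundaries_def)
next
  case (Suc q)
  interpret group_hom "cochain_group q X" "cochain_group (Suc q) X" "coboundary_map q X"
    by (intro group_hom.intro group_hom_axioms.intro coboundary_map_hom
        comm_group.axioms(2) comm_group_cochain_group)
  show ?thesis
    using Suc img_is_subgroup by (simp add: coboundaries_def)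
qed

lemma carrier_cocycle_group: "carrier (cocycle_group p X) = cocycles p X"
  unfolding cocycle_group_def
  by (rule subgroup.carrier_subgroup_generated_subgroup[OF subgroup_cocycles])

lemma comm_group_cohomology_group: "comm_group (cohomology_group p X)"
proof -
  have g: "group (cochain_group p X)"
    by (rule comm_group.axioms(2)[OF comm_group_cochain_group])
  have cg: "comm_group (cocycle_group p X)"
    unfolding cocycle_group_def
    by (intro group.abelian_subgroup_generated g comm_group_cochain_group)
  have "subgroup (coboundaries p X) (cocycle_group p X)"
    unfolding cocycle_group_def
    by (intro group.subgroup_of_subgroup_generated g coboundaries_subset_cocycles
        subgroup_coboundaries)
  then show ?thesis
    unfolding cohomology_group_def by (rule comm_group.abelian_FactGroup[OF cg])
qed

section \<open>The cohomology class of a subvariety of a Grassmannian\<close>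

text \<open>Since \<open>row_space k\<close> is a holomorphic submersion from the open set \<open>frames k m\<close> of
  \<open>k \<times> m\<close> matrices onto \<open>Gr k m\<close>, a function on an open subset of \<open>Gr k m\<close> is holomorphic,
  respectively a submersion, iff its composition with \<open>row_space k\<close> is. Holomorphy in several
  variables is continuity together with holomorphy in every single matrix entry.\<close>

definition entry_slice ::
    "((nat \<Rightarrow> nat \<Rightarrow> complex) \<Rightarrow> complex) \<Rightarrow> (nat \<Rightarrow> nat \<Rightarrow> complex) \<Rightarrow> nat \<Rightarrow> nat \<Rightarrow> complex \<Rightarrow> complex"
  where "entry_slice g A i j = (\<lambda>z. g (A(i := (A i)(j := z))))"

definition Gr_holomorphic_on ::
    "nat \<Rightarrow> nat \<Rightarrow> ((nat \<Rightarrow> complex) set \<Rightarrow> complex) \<Rightarrow> (nat \<Rightarrow> complex) set set \<Rightarrow> bool" where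
  "Gr_holomorphic_on k m f U \<longleftrightarrow>
     continuous_on {A \<in> frames k m. row_space k A \<in> U} (f \<circ> row_space k) \<and>
     (\<forall>A\<in>frames k m. row_space k A \<in> U \<longrightarrow> (\<forall>i<k. \<forall>j\<in>{1..m}.
        entry_slice (f \<circ> row_space k) A i j field_differentiable at (A i j)))"

definition Gr_partial ::
    "nat \<Rightarrow> ((nat \<Rightarrow> complex) set \<Rightarrow> complex) \<Rightarrow> (nat \<Rightarrow> nat \<Rightarrow> complex) \<Rightarrow> nat \<Rightarrow> nat \<Rightarrow> complex" where
  "Gr_partial k f A i j = deriv (entry_slice (f \<circ> row_space k) A i j) (A i j)"

text \<open>\<open>(f 0, \<dots>, f (c - 1)) : U \<rightarrow> \<complex>\<^sup>c\<close> is a holomorphic submersion with zero set \<open>Z \<inter> U\<close>.\<close>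

definition local_equations ::
    "nat \<Rightarrow> nat \<Rightarrow> nat \<Rightarrow> (nat \<Rightarrow> complex) set set \<Rightarrow> (nat \<Rightarrow> complex) set set
      \<Rightarrow> (nat \<Rightarrow> (nat \<Rightarrow> complex) set \<Rightarrow> complex) \<Rightarrow> bool" where
  "local_equations k m c Z U f \<longleftrightarrow>
     openin (Gr_top k m) U \<and>
     (\<forall>s<c. Gr_holomorphic_on k m (f s) U) \<and>
     (\<forall>A\<in>frames k m. row_space k A \<in> U \<longrightarrow>
        (\<forall>t. (\<forall>i<k. \<forall>j\<in>{1..m}. (\<Sum>s<c. t s * Gr_partial k (f s) A i j) = 0)
              \<longrightarrow> (\<forall>s<c. t s = 0))) \<and>
     Z \<inter> U = {V \<in> U. \<forall>s<c. f s V = 0}"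

definition regular_points ::
    "nat \<Rightarrow> nat \<Rightarrow> nat \<Rightarrow> (nat \<Rightarrow> complex) set set \<Rightarrow> (nat \<Rightarrow> complex) set set" where
  "regular_points k m c Z = {V \<in> Z. \<exists>U f. V \<in> U \<and> local_equations k m c Z U f}"

text \<open>The complex codimension of a nonempty closed subvariety of pure dimension, i.e. the
  codimension at its smooth points, which are dense.\<close>

definition Gr_codim :: "nat \<Rightarrow> nat \<Rightarrow> (nat \<Rightarrow> complex) set set \<Rightarrow> nat" where
  "Gr_codim k m Z = (THE c. Z \<subseteq> Gr_top k m closure_of regular_points k m c Z)"

text \<open>A small simplex normal to \<open>Z\<close>: in terms of local equations \<open>f\<close> it is the affine simplex
  in \<open>\<complex>\<^sup>c\<close> with vertices
  \<open>- r (\<epsilon>\<^sub>1 + i \<epsilon>\<^sub>1 + \<dots> + \<epsilon>\<^sub>c + i \<epsilon>\<^sub>c), r \<epsilon>\<^sub>1, r i \<epsilon>\<^sub>1, \<dots>, r \<epsilon>\<^sub>c, r i \<epsilon>\<^sub>c\<close>, where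
  \<open>\<epsilon>\<^sub>1, \<dots>, \<epsilon>\<^sub>c\<close> is the standard basis. It is positively oriented for the complex orientation and
  contains the origin in its interior, so the canonical generator of
  \<open>H\<^sup>2\<^sup>c(\<complex>\<^sup>c, \<complex>\<^sup>c - 0)\<close> takes the value \<open>1\<close> on it.\<close>

definition normal_simplex ::
    "nat \<Rightarrow> nat \<Rightarrow> nat \<Rightarrow> (nat \<Rightarrow> complex) set set
      \<Rightarrow> ((nat \<Rightarrow> real) \<Rightarrow> (nat \<Rightarrow> complex) set) \<Rightarrow> bool" where
  "normal_simplex k m c Z \<sigma> \<longleftrightarrow>
     (\<exists>U f r. local_equations k m c Z U f \<and> r > 0 \<and>
        singular_simplex (2 * c) (subtopology (Gr_top k m) U) \<sigma> \<and>
        (\<forall>x\<in>standard_simplex (2 * c). \<forall>s<c.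
           f s (\<sigma> x) = of_real r * Complex (x (2 * s + 1) - x 0) (x (2 * s + 2) - x 0)))"

text \<open>A cocycle representing the canonical class of \<open>Z\<close> in \<open>H\<^sup>2\<^sup>c(X, X - Z)\<close>, where
  \<open>X = Gr k m\<close>: it vanishes on \<open>X - Z\<close> and restricts to the Thom class of the normal
  bundle, with its complex orientation, at the smooth points of \<open>Z\<close>.\<close>

definition fundamental_cocycle ::
    "nat \<Rightarrow> nat \<Rightarrow> nat \<Rightarrow> (nat \<Rightarrow> complex) set set \<Rightarrow> (nat \<Rightarrow> complex) set cochain \<Rightarrow> bool" where
  "fundamental_cocycle k m c Z \<phi> \<longleftrightarrow>
     \<phi> \<in> cocycles (2 * c) (Gr_top k m) \<and>
     (\<forall>d. singular_chain (2 * c) (subtopology (Gr_top k m) (- Z)) d \<longrightarrow> \<phi> d = 0) \<and>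
     (\<forall>\<sigma>. normal_simplex k m c Z \<sigma> \<longrightarrow> \<phi> (frag_of \<sigma>) = 1)"

text \<open>The class \<open>[Z] \<in> H\<^sup>*(Gr k m)\<close>, homogeneous of degree twice the codimension of \<open>Z\<close>: the
  image under \<open>H\<^sup>2\<^sup>c(X, X - Z) \<rightarrow> H\<^sup>2\<^sup>c(X)\<close> of the canonical class, as in Fulton, Young Tableaux,
  Appendix B.\<close>

definition subvariety_class ::
    "nat \<Rightarrow> nat \<Rightarrow> (nat \<Rightarrow> complex) set set \<Rightarrow> (nat \<Rightarrow> (nat \<Rightarrow> complex) set cochain set)" where
  "subvariety_class k m Z =
     (let c = Gr_codim k m Z in
      (\<lambda>p. \<one>\<^bsub>cohomology_group p (Gr_top k m)\<^esub>)
        (2 * c := (THE \<xi>. \<exists>\<phi>. fundamental_cocycle k m c Z \<phi> \<and>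
                               \<xi> = cohom_class (2 * c) (Gr_top k m) \<phi>)))"

end

theory Submission
  imports Defs "Jordan_Normal_Form.Determinant" "HOL-Complex_Analysis.Cauchy_Integral_Formula"
begin

text \<open>
  A rank set \<open>N\<close> with \<open>k\<close> intervals in \<open>[m]\<close> determines a cell of \<open>Gr k m\<close>: the row spaces of the
  matrices whose \<open>i\<close>-th row is supported on the \<open>i\<close>-th interval and nonzero at both of its ends. The
  cells partition \<open>Gr k m\<close>, on the cell of \<open>N\<close> the dimension of \<open>V \<inter> \<langle>[p, q]\<rangle>\<close> is the number of
  intervals inside \<open>[p, q]\<close>, and the rank variety is the closure of the cell. It lies in the closed set
  \<open>R\<^sub>N\<close> where all these dimensions are at least these numbers, whose other strata have larger
  codimension. In an explicit chart the cell is a coordinate subspace. Therefore, for every closed \<open>Z\<close>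
  between the cell and \<open>R\<^sub>N\<close>, the homology of \<open>(Gr k m, Gr k m - Z)\<close> vanishes below degree \<open>2c\<close> and is
  generated in degree \<open>2c\<close> by small simplices normal to the cell, where \<open>c\<close> is the codimension. Hence a
  cocycle of degree \<open>2c\<close> that vanishes off \<open>Z\<close> is determined up to coboundaries by its values on these
  simplices, and the fundamental cocycle exists.

  Any two linear inclusions of \<open>\<complex>\<^sup>n\<close> into \<open>\<complex>\<^sup>n\<^sup>+\<^sup>1\<close> induce homotopic maps. For the inclusion
  \<open>e\<^sub>p \<mapsto> e\<^sub>p - e\<^sub>p\<^sub>+\<^sub>1\<close> a vector lies in \<open>\<langle>[p, q]\<rangle>\<close> iff its image lies in \<open>\<langle>[p, q + 1]\<rangle>\<close>, so the preimage of
  \<open>R\<^sub>N\<close> for \<open>N = kappa M\<close> is \<open>R\<^sub>M\<close>, and simplices normal to the cell of \<open>M\<close> are mapped to simplices on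
  which the local equations for \<open>kappa M\<close> have degree \<open>1\<close>.
\<close>

section \<open>Relative homology in terms of chains\<close>

definition homology_vanishes :: "nat \<Rightarrow> 'a topology \<Rightarrow> 'a set \<Rightarrow> bool" where
  "homology_vanishes p X S \<longleftrightarrow> (\<forall>z. singular_relcycle p X S z \<longrightarrow> singular_relboundary p X S z)"

definition homology_generated_by :: "nat \<Rightarrow> 'a topology \<Rightarrow> 'a set \<Rightarrow> ((nat \<Rightarrow> real) \<Rightarrow> 'a) set \<Rightarrow> bool" where
  "homology_generated_by p X S G \<longleftrightarrow> (\<forall>z. singular_relcycle p X S z \<longrightarrow>
     (\<exists>c. Poly_Mapping.keys c \<subseteq> G \<and> homologous_rel p X S z c))"

definition free_homology_generator :: "nat \<Rightarrow> 'a topology \<Rightarrow> 'a set \<Rightarrow> 'a chain \<Rightarrow> bool" where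
  "free_homology_generator p X S w \<longleftrightarrow> singular_relcycle p X S w \<and>
     bij_betw (\<lambda>a. homologous_rel_set p X S (frag_cmul a w)) UNIV
       (carrier (relative_homology_group (int p) X S))"

lemma homology_vanishes_iff_trivial_group:
  "homology_vanishes p X S \<longleftrightarrow> trivial_group (relative_homology_group (int p) X S)"
  unfolding group.trivial_group_subset[OF group_relative_homology_group]
    carrier_relative_homology_group one_relative_homology_group homology_vanishes_def
  by (simp add: image_subset_iff homologous_rel_set_eq_relboundary)

lemma homology_vanishes_iff_generated_by_empty:
  "homology_vanishes p X S \<longleftrightarrow> homology_generated_by p X S {}"
  by (simp add: homology_vanishes_def homology_generated_by_def homologous_rel_def)

lemma homology_vanishes_imp_generated: "homology_vanishes p X S \<Longrightarrow> homology_generated_by p X S G"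
  unfolding homology_vanishes_iff_generated_by_empty homology_generated_by_def by blast

lemma homology_vanishes_UNIV: "homology_vanishes p X UNIV"
  unfolding homology_vanishes_def by (simp add: singular_relcycle singular_chain_imp_relboundary)

lemma relative_homology_cong:
  assumes "topspace X \<inter> S = topspace X \<inter> T"
  shows "homology_vanishes p X S = homology_vanishes p X T"
    and "singular_relcycle p X S = singular_relcycle p X T"
    and "homologous_rel p X S = homologous_rel p X T"
    and "relative_homology_group i X S = relative_homology_group i X T"
  using assms
  by (metis homology_vanishes_def singular_relboundary_restrict singular_relcycle_restrict,
      metis singular_relcycle_restrict, metis homologous_rel_restrict,
      metis relative_homology_group_restrict)

lemma hom_induced_cong:
  assumes "topspace X \<inter> S = topspace X \<inter> S'" "topspace Y \<inter> T = topspace Y \<inter> T'"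
  shows "hom_induced p X S Y T f = hom_induced p X S' Y T' f"
  using assms by (metis hom_induced_restrict)

lemma singular_relcycle_mono:
  assumes "singular_relcycle p (subtopology X V) S z" "V \<subseteq> W" "V \<inter> S \<subseteq> T"
  shows "singular_relcycle p (subtopology X W) T z"
  using assms
  by (fastforce simp: singular_relcycle subtopology_subtopology singular_chain_subtopology)

lemma singular_relcycle_subtopology:
  "singular_relcycle p (subtopology X W) S c \<Longrightarrow> singular_relcycle p X S c"
  using singular_relcycle_mono[of p X W S c UNIV S] by simp

lemma singular_relboundary_mono:
  assumes "singular_relboundary p (subtopology X V) S z" "V \<subseteq> W" "V \<inter> S \<subseteq> T"
  shows "singular_relboundary p (subtopology X W) T z"
proof -
  obtain d e where "singular_chain (Suc p) (subtopology X V) d"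
    "singular_chain p (subtopology (subtopology X V) S) e" "chain_boundary (Suc p) d + e = z"
    using assms(1) singular_relboundary by blast
  moreover from this have "singular_chain (Suc p) (subtopology X W) d"
    "singular_chain p (subtopology (subtopology X W) T) e"
    using assms by (fastforce simp: subtopology_subtopology singular_chain_subtopology)+
  ultimately show ?thesis
    using singular_relboundary by blast
qed

lemma homologous_rel_mono:
  assumes "homologous_rel p (subtopology X V) S z z'" "V \<subseteq> W" "V \<inter> S \<subseteq> T"
  shows "homologous_rel p (subtopology X W) T z z'"
  using assms singular_relboundary_mono unfolding homologous_rel_def by blast

lemma homologous_rel_chain_map:
  assumes "homologous_rel p X S a b" "continuous_map X Y f" "f \<in> topspace X \<inter> S \<rightarrow> T"
  shows "homologous_rel p Y T (chain_map p f a) (chain_map p f b)"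
proof -
  have "singular_relboundary p X (topspace X \<inter> S) (a - b)"
    using assms(1) by (simp add: homologous_rel_def)
  then have "singular_relboundary p Y T (chain_map p f (a - b))"
    by (rule singular_relboundary_chain_map) (use assms in auto)
  then show ?thesis
    by (simp add: homologous_rel_def chain_map_diff)
qed

lemma singular_relcycle_chain_map_gen:
  assumes "singular_relcycle p X S c" "continuous_map X Y f" "f \<in> topspace X \<inter> S \<rightarrow> T"
  shows "singular_relcycle p Y T (chain_map p f c)"
  using singular_relcycle_chain_map[of p X "topspace X \<inter> S" c Y f T] assms by auto

lemma homotopic_imp_homologous_rel:
  assumes "homotopic_with (\<lambda>h. h \<in> topspace X \<inter> S \<rightarrow> T) X Y f g" "singular_relcycle p X S c"
  shows "homologous_rel p Y T (chain_map p f c) (chain_map p g c)"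
  using homotopic_imp_homologous_rel_chain_maps[OF assms(1)] assms(2) by simp

lemma chain_map_restrict:
  "chain_map n F (frag_of (\<lambda>x\<in>standard_simplex n. g x)) = frag_of (\<lambda>x\<in>standard_simplex n. F (g x))"
  by (auto simp: simplex_map_def fun_eq_iff restrict_def intro: arg_cong[where f = frag_of])

lemma chain_map_chain_map: "chain_map p g (chain_map p f c) = chain_map p (\<lambda>x. g (f x)) c"
  using fun_cong[OF chain_map_compose[of p g f], of c] by (simp add: o_def)

lemma singular_relcycle_of_simplex:
  assumes f: "singular_simplex p X f"
    and S: "\<And>x k. \<lbrakk>x \<in> standard_simplex p; k \<le> p; x k = 0\<rbrakk> \<Longrightarrow> f x \<in> S"
  shows "singular_relcycle p X S (frag_of f)"
proof -
  have "singular_chain (p - 1) (subtopology X S) (chain_boundary p (frag_of f))"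
  proof (cases "p = 0")
    case False
    have "singular_simplex (p - 1) (subtopology X S) (singular_face p k f)" if "k \<le> p" for k
    proof -
      have "f (simplical_face k x) \<in> S" if "x \<in> standard_simplex (p - Suc 0)" for x
        using S[OF simplical_face_in_standard_simplex[OF _ \<open>k \<le> p\<close> that] \<open>k \<le> p\<close>] False
        by (simp add: simplical_face_def)
      then show ?thesis
        using singular_simplex_singular_face[OF f _ that] False
        by (auto simp: singular_simplex_subtopology singular_face_def)
    qed
    then show ?thesis
      using False by (auto simp: chain_boundary_of singular_chain_of
          intro!: singular_chain_sum singular_chain_cmul)
  qed (simp add: chain_boundary_def)
  then show ?thesis
    using f by (simp add: singular_relcycle singular_chain_of)
qed

lemma singular_chain_compact_support:
  assumes "singular_chain p X c"
  obtains K where "compactin X K" "singular_chain p (subtopology X K) c"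
proof
  let ?K = "\<Union>f\<in>Poly_Mapping.keys c. f ` standard_simplex p"
  have "compactin X (f ` standard_simplex p)" if "f \<in> Poly_Mapping.keys c" for f
  proof (rule image_compactin)
    show "compactin (subtopology (powertop_real UNIV) (standard_simplex p)) (standard_simplex p)"
      using compactin_standard_simplex by (simp add: compactin_subtopology)
    show "continuous_map (subtopology (powertop_real UNIV) (standard_simplex p)) X f"
      using assms that by (auto simp: singular_chain_def singular_simplex_def)
  qed
  then show "compactin X ?K"
    by (intro compactin_Union) auto
  show "singular_chain p (subtopology X ?K) c"
    using assms by (auto simp: singular_chain_subtopology)
qed

lemma homology_generated_by_compact_support:
  assumes "\<And>K. compactin X K \<Longrightarrow> \<exists>B. K \<subseteq> B \<and> homology_generated_by p (subtopology X B) S G"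
  shows "homology_generated_by p X S G"
  unfolding homology_generated_by_def
proof (intro allI impI)
  fix z assume z: "singular_relcycle p X S z"
  then obtain K where K: "compactin X K" "singular_chain p (subtopology X K) z"
    using singular_chain_compact_support by (metis singular_relcycle)
  obtain B where B: "K \<subseteq> B" "homology_generated_by p (subtopology X B) S G"
    using assms[OF K(1)] by blast
  have zB: "singular_chain p (subtopology X B) z"
    using K(2) B(1) singular_chain_mono by blast
  have "singular_relcycle p (subtopology X B) S z"
    using z zB singular_chain_boundary[OF zB]
    by (auto simp: singular_relcycle singular_chain_subtopology)
  then obtain c where c: "Poly_Mapping.keys c \<subseteq> G" "homologous_rel p (subtopology X B) S z c"
    using B(2) unfolding homology_generated_by_def by blast
  then have "homologous_rel p X S z c"
    using homologous_rel_mono[of p X B S z c UNIV S] by simp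
  with c(1) show "\<exists>c. Poly_Mapping.keys c \<subseteq> G \<and> homologous_rel p X S z c"
    by blast
qed

subsection \<open>Transfer along isomorphisms\<close>

lemma hom_induced_iso_reflects_relboundary:
  assumes iso: "hom_induced (int p) X S Y T f
      \<in> iso (relative_homology_group (int p) X S) (relative_homology_group (int p) Y T)"
    and f: "continuous_map X Y f" "f \<in> topspace X \<inter> S \<rightarrow> T"
    and z: "singular_relcycle p X S z" and b: "singular_relboundary p Y T (chain_map p f z)"
  shows "singular_relboundary p X S z"
proof -
  have "homologous_rel_set p Y T (chain_map p f z) = homologous_rel_set p Y T 0"
    unfolding homologous_rel_set_eq using b by (simp add: homologous_rel_def)
  then have "hom_induced (int p) X S Y T f (homologous_rel_set p X S z)
      = hom_induced (int p) X S Y T f (homologous_rel_set p X S 0)"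
    using hom_induced_chain_map_gen[OF f z] hom_induced_chain_map_gen[OF f, of p 0] by simp
  then have "homologous_rel_set p X S z = homologous_rel_set p X S 0"
    using iso z by (auto simp: iso_def bij_betw_def carrier_relative_homology_group inj_on_def)
  then show ?thesis
    unfolding homologous_rel_set_eq by (simp add: homologous_rel_def)
qed

lemma hom_induced_iso_lifts_relcycle:
  assumes iso: "hom_induced (int p) X S Y T f
      \<in> iso (relative_homology_group (int p) X S) (relative_homology_group (int p) Y T)"
    and f: "continuous_map X Y f" "f \<in> topspace X \<inter> S \<rightarrow> T"
    and w: "singular_relcycle p Y T w"
  obtains z where "singular_relcycle p X S z" "homologous_rel p Y T w (chain_map p f z)"
proof -
  let ?h = "hom_induced (int p) X S Y T f"
  have "homologous_rel_set p Y T w \<in> ?h ` carrier (relative_homology_group (int p) X S)"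
    using iso w by (simp add: iso_def bij_betw_def carrier_relative_homology_group)
  then obtain z where z: "singular_relcycle p X S z"
    "homologous_rel_set p Y T w = ?h (homologous_rel_set p X S z)"
    by (auto simp: carrier_relative_homology_group)
  then have "homologous_rel p Y T w (chain_map p f z)"
    using hom_induced_chain_map_gen[OF f z(1)] homologous_rel_set_eq by metis
  with z that show ?thesis by blast
qed

lemma homology_vanishes_iso:
  assumes "h \<in> iso (relative_homology_group (int p) X S) (relative_homology_group (int q) Y T)"
  shows "homology_vanishes p X S \<longleftrightarrow> homology_vanishes q Y T"
  unfolding homology_vanishes_iff_trivial_group
  by (meson group_relative_homology_group assms is_isoI isomorphic_group_triviality)

lemma free_homology_generator_iso:
  assumes iso: "h \<in> iso (relative_homology_group (int p) X S) (relative_homology_group (int q) Y T)"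
    and h: "\<And>a. h (homologous_rel_set p X S (frag_cmul a w)) = homologous_rel_set q Y T (frag_cmul a w')"
    and w: "singular_relcycle p X S w" "singular_relcycle q Y T w'"
  shows "free_homology_generator p X S w \<longleftrightarrow> free_homology_generator q Y T w'"
proof -
  let ?c = "\<lambda>a. homologous_rel_set p X S (frag_cmul a w)"
  have "?c ` UNIV \<subseteq> carrier (relative_homology_group (int p) X S)"
    using w by (auto simp: carrier_relative_homology_group singular_relcycle_cmul)
  then have "bij_betw ?c UNIV (carrier (relative_homology_group (int p) X S)) \<longleftrightarrow>
      bij_betw (h \<circ> ?c) UNIV (carrier (relative_homology_group (int q) Y T))"
    using iso by (intro bij_betw_comp_iff2) (auto simp: iso_def)
  then show ?thesis
    using w h by (simp add: free_homology_generator_def o_def)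
qed

lemma free_homology_generator_hom_induced:
  assumes iso: "hom_induced (int p) X S Y T f
      \<in> iso (relative_homology_group (int p) X S) (relative_homology_group (int p) Y T)"
    and f: "continuous_map X Y f" "f \<in> topspace X \<inter> S \<rightarrow> T" and w: "singular_relcycle p X S w"
  shows "free_homology_generator p X S w \<longleftrightarrow> free_homology_generator p Y T (chain_map p f w)"
  by (rule free_homology_generator_iso[OF iso])
    (use w f in \<open>simp_all add: hom_induced_chain_map_gen singular_relcycle_cmul
        singular_relcycle_chain_map_gen\<close>)

lemma homology_generated_by_iso:
  assumes iso: "hom_induced (int p) X S Y T f
      \<in> iso (relative_homology_group (int p) X S) (relative_homology_group (int p) Y T)"
    and f: "continuous_map X Y f" "f \<in> topspace X \<inter> S \<rightarrow> T"
    and G: "homology_generated_by p X S {\<sigma>. simplex_map p f \<sigma> \<in> G}"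
  shows "homology_generated_by p Y T G"
  unfolding homology_generated_by_def
proof (intro allI impI)
  fix w assume "singular_relcycle p Y T w"
  then obtain z where z: "singular_relcycle p X S z" "homologous_rel p Y T w (chain_map p f z)"
    using hom_induced_iso_lifts_relcycle[OF iso f] by blast
  obtain c where c: "Poly_Mapping.keys c \<subseteq> {\<sigma>. simplex_map p f \<sigma> \<in> G}" "homologous_rel p X S z c"
    using G z(1) unfolding homology_generated_by_def by blast
  have "Poly_Mapping.keys (chain_map p f c) \<subseteq>
      (\<Union>\<sigma>\<in>Poly_Mapping.keys c. Poly_Mapping.keys ((frag_of \<circ> simplex_map p f) \<sigma>))"
    unfolding chain_map_def by (rule keys_frag_extend)
  then have "Poly_Mapping.keys (chain_map p f c) \<subseteq> G"
    using c(1) by auto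
  moreover have "homologous_rel p Y T w (chain_map p f c)"
    using z(2) homologous_rel_chain_map[OF c(2) f] homologous_rel_trans by blast
  ultimately show "\<exists>c. Poly_Mapping.keys c \<subseteq> G \<and> homologous_rel p Y T w c"
    by blast
qed

lemma functional_along_iso:
  fixes h :: "'a chain \<Rightarrow> int"
  assumes iso: "hom_induced (int p) X S Y T f
      \<in> iso (relative_homology_group (int p) X S) (relative_homology_group (int p) Y T)"
    and f: "continuous_map X Y f" "f \<in> topspace X \<inter> S \<rightarrow> T"
    and add: "\<And>a b. \<lbrakk>singular_relcycle p X S a; singular_relcycle p X S b\<rbrakk> \<Longrightarrow> h (a + b) = h a + h b"
    and zero: "\<And>a. singular_relboundary p X S a \<Longrightarrow> h a = 0"
  obtains h' :: "'b chain \<Rightarrow> int" where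
    "\<And>a b. \<lbrakk>singular_relcycle p Y T a; singular_relcycle p Y T b\<rbrakk> \<Longrightarrow> h' (a + b) = h' a + h' b"
    "\<And>a. singular_relboundary p Y T a \<Longrightarrow> h' a = 0"
    "\<And>e. singular_relcycle p X S e \<Longrightarrow> h' (chain_map p f e) = h e"
proof -
  define R where "R z e \<longleftrightarrow> singular_relcycle p X S e \<and> homologous_rel p Y T z (chain_map p f e)" for z e
  define h' where "h' z = h (SOME e. R z e)" for z
  have h': "h' z = h e" if R: "R z e" for z e
  proof -
    let ?e = "SOME e. R z e"
    have "R z ?e"
      using R by (rule someI)
    then have e: "singular_relcycle p X S ?e" "singular_relcycle p X S e"
      and "homologous_rel p Y T (chain_map p f ?e) (chain_map p f e)"
      using R unfolding R_def by (meson homologous_rel_sym homologous_rel_trans)+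
    then have "singular_relboundary p X S (?e - e)"
      by (intro hom_induced_iso_reflects_relboundary[OF iso f singular_relcycle_diff])
        (simp_all add: chain_map_diff homologous_rel_def)
    then show ?thesis
      using add[OF singular_relcycle_diff[OF e] e(2)] zero[of "?e - e"] by (simp add: h'_def)
  qed
  have ex: "\<exists>e. R z e" if "singular_relcycle p Y T z" for z
    using hom_induced_iso_lifts_relcycle[OF iso f that] unfolding R_def by metis
  show ?thesis
  proof (rule that[of h'])
    fix a b assume "singular_relcycle p Y T a" "singular_relcycle p Y T b"
    then obtain e e' where e: "R a e" "R b e'"
      using ex by blast
    then have "R (a + b) (e + e')"
      unfolding R_def by (simp add: singular_relcycle_add homologous_rel_add chain_map_add)
    then show "h' (a + b) = h' a + h' b"
      using h' e add unfolding R_def by metis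
  next
    fix a assume "singular_relboundary p Y T a"
    then have "R a 0"
      unfolding R_def by (simp add: homologous_rel_def)
    then show "h' a = 0"
      using h' zero[of 0] by simp
  qed (simp add: h' R_def)
qed

lemma free_homology_generator_homologous:
  assumes "free_homology_generator p X S w" "homologous_rel p X S w w'"
  shows "free_homology_generator p X S w'"
proof -
  have "frag_cmul a (w - w') = frag_cmul a w - frag_cmul a w'" for a
    by (rule poly_mapping_eqI) (simp add: lookup_minus right_diff_distrib)
  then have "homologous_rel_set p X S (frag_cmul a w) = homologous_rel_set p X S (frag_cmul a w')" for a
    unfolding homologous_rel_set_eq using singular_relboundary_cmul[of p X S "w - w'" a] assms(2)
    by (simp add: homologous_rel_def)
  then show ?thesis
    using assms homologous_rel_singular_relcycle[OF assms(2)]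
    by (simp add: free_homology_generator_def)
qed

lemma free_homology_generator_minus:
  assumes "free_homology_generator p X S w" shows "free_homology_generator p X S (- w)"
proof -
  have "frag_cmul a (- w) = frag_cmul (- a) w" for a
    by (rule poly_mapping_eqI) simp
  moreover have "bij_betw ((\<lambda>a. homologous_rel_set p X S (frag_cmul a w)) \<circ> uminus) UNIV
      (carrier (relative_homology_group (int p) X S))"
    using assms bij_uminus unfolding free_homology_generator_def by (blast intro: bij_betw_trans)
  ultimately show ?thesis
    using assms by (simp add: free_homology_generator_def singular_relcycle_minus o_def)
qed

lemma free_homology_generatorD:
  assumes "free_homology_generator p X S w"
  shows "singular_relcycle p X S w"
    and "singular_relcycle p X S z \<Longrightarrow> \<exists>a. homologous_rel p X S z (frag_cmul a w)"
    and "homologous_rel p X S (frag_cmul a w) (frag_cmul b w) \<Longrightarrow> a = b"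
proof -
  show "singular_relcycle p X S w"
    using assms by (simp add: free_homology_generator_def)
  show "a = b" if "homologous_rel p X S (frag_cmul a w) (frag_cmul b w)"
    using assms that by (simp add: free_homology_generator_def bij_betw_def inj_on_def homologous_rel_set_eq)
  show "\<exists>a. homologous_rel p X S z (frag_cmul a w)" if "singular_relcycle p X S z"
  proof -
    have "homologous_rel_set p X S z \<in> range (\<lambda>a. homologous_rel_set p X S (frag_cmul a w))"
      using assms that
      by (simp add: free_homology_generator_def bij_betw_def carrier_relative_homology_group)
    then show ?thesis
      by (auto simp: homologous_rel_set_eq)
  qed
qed

subsection \<open>Excision and the exact sequence of a triple\<close>

lemma excision_iso:
  assumes U: "openin X (topspace X \<inter> U)" and Z: "closedin X (topspace X \<inter> Z)" "topspace X \<inter> Z \<subseteq> U"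
  shows "hom_induced p (subtopology X U) (- Z) X (- Z) id
    \<in> iso (relative_homology_group p (subtopology X U) (- Z)) (relative_homology_group p X (- Z))"
proof -
  let ?A = "topspace X - topspace X \<inter> U" and ?T = "topspace X - topspace X \<inter> Z"
  have "X closure_of ?A \<subseteq> X interior_of ?T"
  proof -
    have "closedin X ?A" "openin X ?T"
      using U Z by blast+
    then show ?thesis
      using Z(2) by (auto simp: closure_of_closedin interior_of_openin)
  qed
  then have "hom_induced p (subtopology X (topspace X - ?A)) (?T - ?A) (subtopology X (topspace X)) ?T id
      \<in> iso (relative_homology_group p (subtopology X (topspace X - ?A)) (?T - ?A))
          (relative_homology_group p (subtopology X (topspace X)) ?T)"
    by (rule homology_excision_axiom) auto
  moreover have "topspace X - ?A = topspace X \<inter> U"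
    by auto
  moreover have "topspace (subtopology X U) \<inter> (?T - ?A) = topspace (subtopology X U) \<inter> - Z"
    "topspace X \<inter> ?T = topspace X \<inter> - Z"
    by auto
  ultimately show ?thesis
    using hom_induced_cong[of "subtopology X U" "?T - ?A" "- Z" X ?T "- Z" p id]
      relative_homology_cong(4)[of "subtopology X U" "?T - ?A" "- Z" p]
      relative_homology_cong(4)[of X ?T "- Z" p]
    by (simp add: subtopology_restrict)
qed

lemma exact_seq_trivial_middle:
  assumes "exact_seq ([C, B, A], [g, f])" "trivial_group A" "trivial_group C"
  shows "trivial_group B"
proof -
  have f: "group_hom A B f" and g: "group_hom B C g" and fg: "f ` carrier A = kernel B C g"
    using assms(1) by (simp_all add: group_hom_def group_hom_axioms_def)
  then have "carrier B = {\<one>\<^bsub>B\<^esub>}"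
    using group_hom.image_from_trivial_group[OF f assms(2)] group_hom.kernel_to_trivial_group[OF g assms(3)]
    by simp
  then show ?thesis
    using f by (simp add: trivial_group_def group_hom_def)
qed

lemma homology_vanishes_triple:
  assumes "T \<subseteq> S" "homology_vanishes p (subtopology X S) T" "homology_vanishes p X S"
  shows "homology_vanishes p X T"
  using exact_seq_trivial_middle[OF homology_exactness_triple_3[OF assms(1)]] assms(2,3)
  unfolding homology_vanishes_iff_trivial_group by blast

lemma homology_vanishes_larger:
  assumes "T \<subseteq> S" "homology_vanishes p X T" "p = 0 \<or> homology_vanishes (p - 1) (subtopology X S) T"
  shows "homology_vanishes p X S"
proof -
  have "trivial_group (relative_homology_group (int p - 1) (subtopology X S) T)"
  proof (cases p)
    case (Suc q)
    then show ?thesis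
      using assms(3) unfolding homology_vanishes_iff_trivial_group by simp
  qed simp
  then show ?thesis
    using exact_seq_trivial_middle[OF homology_exactness_triple_1[OF assms(1)]] assms(2)
    unfolding homology_vanishes_iff_trivial_group by blast
qed

lemma inclusion_iso_triple:
  assumes "T \<subseteq> S" "homology_vanishes p X S" "homology_vanishes (Suc p) X S"
  shows "hom_induced (int p) (subtopology X S) T X T id
    \<in> iso (relative_homology_group (int p) (subtopology X S) T) (relative_homology_group (int p) X T)"
proof (rule very_short_exact_sequence)
  show "exact_seq ([relative_homology_group (int p) X S, relative_homology_group (int p) X T,
      relative_homology_group (int p) (subtopology X S) T, relative_homology_group (int (Suc p)) X S],
     [hom_induced (int p) X T X S id, hom_induced (int p) (subtopology X S) T X T id,
      hom_relboundary (int (Suc p)) X S T])"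
    using homology_exactness_triple_2[OF assms(1), of "int (Suc p)" X]
      homology_exactness_triple_3[OF assms(1), of "int p" X]
    by simp
qed (use assms in \<open>simp_all only: homology_vanishes_iff_trivial_group\<close>)

lemma hom_relboundary_iso:
  assumes "T \<subseteq> S" "homology_vanishes p X T" "homology_vanishes (Suc p) X T"
  shows "hom_relboundary (int (Suc p)) X S T
    \<in> iso (relative_homology_group (int (Suc p)) X S) (relative_homology_group (int p) (subtopology X S) T)"
proof (rule very_short_exact_sequence)
  show "exact_seq ([relative_homology_group (int p) X T, relative_homology_group (int p) (subtopology X S) T,
      relative_homology_group (int (Suc p)) X S, relative_homology_group (int (Suc p)) X T],
     [hom_induced (int p) (subtopology X S) T X T id, hom_relboundary (int (Suc p)) X S T,
      hom_induced (int (Suc p)) X T X S id])"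
    using homology_exactness_triple_1[OF assms(1), of "int (Suc p)" X]
      homology_exactness_triple_2[OF assms(1), of "int (Suc p)" X]
    by simp
qed (use assms in \<open>simp_all only: homology_vanishes_iff_trivial_group\<close>)

lemma hom_relboundary_chain_boundary:
  assumes "T \<subseteq> S" "singular_relcycle (Suc p) X S c"
  shows "hom_relboundary (int (Suc p)) X S T (homologous_rel_set (Suc p) X S c)
    = homologous_rel_set p (subtopology X S) T (chain_boundary (Suc p) c)"
proof -
  have b: "singular_chain p (subtopology X S) (chain_boundary (Suc p) c)"
    and c: "singular_chain (Suc p) X c"
    using assms by (auto simp: singular_relcycle)
  then have "singular_relcycle p (subtopology X S) {} (chain_boundary (Suc p) c)"
    using chain_boundary_boundary_alt singular_cycle by blast
  then show ?thesis
    using hom_boundary_chain_boundary[OF assms(2)] chain_map_ident[OF b]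
      hom_induced_chain_map[of "subtopology X S" "subtopology X S" id "{}" T p]
    by (simp add: hom_relboundary_def)
qed

lemma free_homology_generator_boundary:
  assumes TS: "T \<subseteq> S" and van: "homology_vanishes p X T" "homology_vanishes (Suc p) X T"
    and w: "singular_relcycle (Suc p) X S w"
    and free: "free_homology_generator p (subtopology X S) T (chain_boundary (Suc p) w)"
  shows "free_homology_generator (Suc p) X S w"
  using free free_homology_generator_iso[OF hom_relboundary_iso[OF TS van], of w "chain_boundary (Suc p) w"]
    hom_relboundary_chain_boundary[OF TS] w free_homology_generatorD(1)[OF free]
  by (simp add: chain_boundary_cmul singular_relcycle_cmul)

subsection \<open>Mayer--Vietoris\<close>

lemma singular_chain_split:
  assumes "singular_chain p X c"
    and "\<And>f. f \<in> Poly_Mapping.keys c \<Longrightarrow> f \<in> standard_simplex p \<rightarrow> U \<or> f \<in> standard_simplex p \<rightarrow> V"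
  obtains c1 c2 where "singular_chain p (subtopology X U) c1" "singular_chain p (subtopology X V) c2"
    "c1 + c2 = c"
proof -
  have "Poly_Mapping.keys c \<subseteq>
      {f. singular_simplex p (subtopology X U) f} \<union> {f. singular_simplex p (subtopology X V) f}"
    using assms by (fastforce simp: singular_chain_def singular_simplex_subtopology)
  from frag_split[OF this] that show ?thesis
    unfolding singular_chain_def by metis
qed

lemma relcycle_split_correction:
  assumes van: "homology_vanishes p (subtopology X (U \<inter> V)) S"
    and z1: "singular_chain (Suc p) (subtopology X U) z1"
    and z2: "singular_chain (Suc p) (subtopology X V) z2"
    and b: "singular_chain p (subtopology X S) (chain_boundary (Suc p) (z1 + z2))"
  obtains u where "singular_relcycle (Suc p) (subtopology X U) S (z1 - u)"
    "singular_relcycle (Suc p) (subtopology X V) S (z2 + u)"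
proof -
  let ?b = "chain_boundary (Suc p)"
  note b1 = singular_chain_boundary_alt[OF z1] and b2 = singular_chain_boundary_alt[OF z2]
  obtain w1 w2 where w: "singular_chain p (subtopology (subtopology X S) U) w1"
    "singular_chain p (subtopology (subtopology X S) V) w2" "w1 + w2 = ?b (z1 + z2)"
  proof (rule singular_chain_split[OF b])
    fix f assume "f \<in> Poly_Mapping.keys (?b (z1 + z2))"
    then have "f \<in> Poly_Mapping.keys (?b z1) \<union> Poly_Mapping.keys (?b z2)"
      using Poly_Mapping.keys_add[of "?b z1" "?b z2"] by (auto simp: chain_boundary_add)
    then show "f \<in> standard_simplex p \<rightarrow> U \<or> f \<in> standard_simplex p \<rightarrow> V"
      using b1 b2 unfolding singular_chain_def singular_simplex_subtopology image_subset_iff_funcset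
      by auto
  qed
  have w': "singular_chain p (subtopology X U) w1" "singular_chain p (subtopology X V) w2"
    using w by (auto simp: singular_chain_subtopology)
  define y where "y = ?b z1 - w1"
  have y2: "y = w2 - ?b z2"
    using w(3) by (simp add: y_def chain_boundary_add algebra_simps)
  have bd: "chain_boundary p y = - chain_boundary p w1" "chain_boundary p y = chain_boundary p w2"
    using chain_boundary_boundary_alt[OF z1] chain_boundary_boundary_alt[OF z2]
    by (simp add: y_def chain_boundary_diff, simp add: y2 chain_boundary_diff)
  have "singular_relcycle p (subtopology X (U \<inter> V)) S y"
  proof -
    have "singular_chain p (subtopology X (U \<inter> V)) y"
      using singular_chain_diff[OF b1 w'(1)] singular_chain_diff[OF w'(2) b2]
      by (simp add: y_def[symmetric] y2[symmetric] singular_chain_subtopology)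
    moreover have "singular_chain (p - 1) (subtopology (subtopology X (U \<inter> V)) S) (chain_boundary p y)"
      using singular_chain_minus[THEN iffD2, OF singular_chain_boundary[OF w(1)]]
        singular_chain_boundary[OF w(2)]
      by (fastforce simp: bd(1)[symmetric] bd(2)[symmetric] singular_chain_subtopology)
    ultimately show ?thesis
      by (simp add: singular_relcycle)
  qed
  then obtain u v where u: "singular_chain (Suc p) (subtopology X (U \<inter> V)) u"
    and v: "singular_chain p (subtopology (subtopology X (U \<inter> V)) S) v" and uv: "?b u + v = y"
    using van unfolding homology_vanishes_def singular_relboundary by blast
  have "?b z1 = ?b u + v + w1" "?b z2 = w2 - (?b u + v)"
    unfolding uv by (simp add: y_def) (simp only: y2 diff_diff_eq2 add_diff_cancel_left')
  then have "?b (z1 - u) = w1 + v" "?b (z2 + u) = w2 - v"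
    by (simp_all add: chain_boundary_diff chain_boundary_add)
  moreover have "singular_chain p (subtopology (subtopology X U) S) (w1 + v)"
    "singular_chain p (subtopology (subtopology X V) S) (w2 - v)"
    using w(1,2) v by (intro singular_chain_add singular_chain_diff; force simp: singular_chain_subtopology)+
  moreover have "singular_chain (Suc p) (subtopology X U) (z1 - u)"
    "singular_chain (Suc p) (subtopology X V) (z2 + u)"
    using z1 z2 singular_chain_mono[OF u] by (auto intro: singular_chain_diff singular_chain_add)
  ultimately show ?thesis
    using that[of u] by (simp add: singular_relcycle)
qed

lemma relcycle_split:
  assumes U: "openin X U" "openin X V" "topspace X \<subseteq> U \<union> V"
    and van: "p = 0 \<or> homology_vanishes (p - 1) (subtopology X (U \<inter> V)) S"
    and z: "singular_relcycle p X S z"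
  obtains z1 z2 where "singular_relcycle p (subtopology X U) S z1"
    "singular_relcycle p (subtopology X V) S z2" "homologous_rel p X S z (z1 + z2)"
proof -
  obtain z' where z': "singular_relcycle p X S z'" "homologous_rel p X S z z'"
    and small: "\<And>f. f \<in> Poly_Mapping.keys z' \<Longrightarrow> \<exists>W\<in>{U, V}. f \<in> standard_simplex p \<rightarrow> W"
    using small_homologous_rel_relcycle_exists[of "{U, V}", OF _ _ z] U by auto
  obtain z1 z2 where zz: "singular_chain p (subtopology X U) z1" "singular_chain p (subtopology X V) z2"
    "z1 + z2 = z'"
    by (rule singular_chain_split[of p X z' U V]) (use z'(1) small in \<open>auto simp: singular_relcycle\<close>)
  show ?thesis
  proof (cases p)
    case 0
    with that zz z'(2) show ?thesis
      by (simp add: singular_relcycle chain_boundary_def)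
  next
    case (Suc q)
    obtain u where "singular_relcycle p (subtopology X U) S (z1 - u)"
      "singular_relcycle p (subtopology X V) S (z2 + u)"
      using relcycle_split_correction[of q X U V S z1 z2] van zz z'(1) Suc
      by (auto simp: singular_relcycle)
    then show ?thesis
      using that[of "z1 - u" "z2 + u"] zz(3) z'(2) by simp
  qed
qed

lemma homology_generated_by_Un:
  assumes U: "openin X U" "openin X V" "topspace X \<subseteq> U \<union> V"
    and van: "p = 0 \<or> homology_vanishes (p - 1) (subtopology X (U \<inter> V)) S"
    and G: "homology_generated_by p (subtopology X U) S G" "homology_generated_by p (subtopology X V) S G"
  shows "homology_generated_by p X S G"
  unfolding homology_generated_by_def
proof (intro allI impI)
  fix z assume "singular_relcycle p X S z"
  then obtain z1 z2 where z: "singular_relcycle p (subtopology X U) S z1"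
    "singular_relcycle p (subtopology X V) S z2" "homologous_rel p X S z (z1 + z2)"
    using relcycle_split[OF U van] by blast
  then obtain c1 c2 where c: "Poly_Mapping.keys c1 \<subseteq> G" "homologous_rel p (subtopology X U) S z1 c1"
    "Poly_Mapping.keys c2 \<subseteq> G" "homologous_rel p (subtopology X V) S z2 c2"
    using G unfolding homology_generated_by_def by meson
  have "homologous_rel p X S (z1 + z2) (c1 + c2)"
    using homologous_rel_mono[OF c(2), of UNIV S] homologous_rel_mono[OF c(4), of UNIV S]
    by (simp add: homologous_rel_add)
  moreover have "Poly_Mapping.keys (c1 + c2) \<subseteq> G"
    using c Poly_Mapping.keys_add[of c1 c2] by blast
  ultimately show "\<exists>c. Poly_Mapping.keys c \<subseteq> G \<and> homologous_rel p X S z c"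
    using z(3) homologous_rel_trans by blast
qed

section \<open>The local homology of Euclidean space\<close>

lemma continuous_on_coordinate [continuous_intros]:
  "continuous_on S (\<lambda>x :: 'i \<Rightarrow> 'a :: topological_space. x i)"
  by (rule continuous_on_subset[OF continuous_on_product_coordinates]) simp

lemma powertop_real_eq_euclidean: "powertop_real UNIV = (euclidean :: (nat \<Rightarrow> real) topology)"
  by (simp add: euclidean_product_topology)

lemma homotopic_with_linear_path:
  fixes f g :: "'a \<Rightarrow> nat \<Rightarrow> real"
  assumes f: "continuous_map X euclidean f" and g: "continuous_map X euclidean g"
    and T: "\<And>t x. \<lbrakk>0 \<le> t; t \<le> 1; x \<in> topspace X\<rbrakk> \<Longrightarrow> (\<lambda>i. (1 - t) * f x i + t * g x i) \<in> T"
    and P: "\<And>t. \<lbrakk>0 \<le> t; t \<le> 1\<rbrakk> \<Longrightarrow> P (\<lambda>x i. (1 - t) * f x i + t * g x i)"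
  shows "homotopic_with P X (top_of_set T) f g"
  unfolding homotopic_with_def
proof (intro exI conjI ballI allI)
  let ?C = "prod_topology (top_of_set {0..1::real}) X"
  let ?h = "\<lambda>(t, x). \<lambda>i. (1 - t) * f x i + t * g x i"
  have coord: "continuous_map ?C euclideanreal (\<lambda>y. k (snd y) i)"
    if "continuous_map X euclidean k" for k :: "'a \<Rightarrow> nat \<Rightarrow> real" and i
    using continuous_map_compose[OF continuous_map_snd, of X euclideanreal "\<lambda>x. k x i"] that
    by (simp add: continuous_map_componentwise_UNIV o_def flip: powertop_real_eq_euclidean)
  have "continuous_map ?C euclideanreal fst"
    using continuous_map_fst continuous_map_into_fulltopology by blast
  then have "continuous_map ?C euclideanreal (\<lambda>y. (1 - fst y) * f (snd y) i + fst y * g (snd y) i)" for i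
    by (intro continuous_map_add continuous_map_real_mult continuous_map_diff coord f g) auto
  then show "continuous_map ?C (top_of_set T) ?h"
    using T by (auto simp: continuous_map_in_subtopology continuous_map_componentwise_UNIV
        case_prod_unfold simp flip: powertop_real_eq_euclidean)
  show "P (\<lambda>x. ?h (t, x))" if "t \<in> {0..1}" for t
    using P that by simp
qed auto

definition Euclidean_set :: "nat \<Rightarrow> (nat \<Rightarrow> real) set" where
  "Euclidean_set n = {x. \<forall>i\<ge>n. x i = 0}"

lemma Euclidean_space_eq: "Euclidean_space n = top_of_set (Euclidean_set n)"
  by (simp add: Euclidean_space_def Euclidean_set_def euclidean_product_topology)

definition coord_subspace :: "nat \<Rightarrow> (nat \<Rightarrow> real) set" where
  "coord_subspace n = {y. \<forall>j<n. y j = 0}"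

lemma closed_coord_subspace: "closed (coord_subspace n)"
proof -
  have "coord_subspace n = (\<Inter>j\<in>{..<n}. {y. y j = 0})"
    by (auto simp: coord_subspace_def)
  then show ?thesis
    by (auto intro!: closed_INT closed_Collect_eq continuous_intros)
qed

definition take_coords :: "nat \<Rightarrow> (nat \<Rightarrow> real) \<Rightarrow> nat \<Rightarrow> real" where
  "take_coords n y = (\<lambda>j. if j < n then y j else 0)"

lemma continuous_on_take_coords: "continuous_on A (take_coords n)"
  unfolding take_coords_def
proof (rule continuous_on_coordinatewise_then_product)
  show "continuous_on A (\<lambda>y. if j < n then y j else 0 :: real)" for j
    by (cases "j < n") (auto intro: continuous_intros)
qed

lemma take_coords_in_Euclidean_set: "take_coords n y \<in> Euclidean_set n"
  by (simp add: take_coords_def Euclidean_set_def)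

lemma take_coords_eq_0_iff: "take_coords n y = 0 \<longleftrightarrow> y \<in> coord_subspace n"
  by (auto simp: take_coords_def coord_subspace_def fun_eq_iff)

lemma take_coords_iso:
  assumes g: "continuous_on (Euclidean_set n) g" "\<And>v. g v \<in> A"
    and \<rho>: "\<And>v j. j < n \<Longrightarrow> g v j = \<rho> v * v j" "\<And>v. \<rho> v > 0"
    and line: "\<And>x t. \<lbrakk>x \<in> A; 0 \<le> t; t \<le> 1\<rbrakk> \<Longrightarrow> (\<lambda>i. (1 - t) * g (take_coords n x) i + t * x i) \<in> A"
  shows "hom_induced p (top_of_set A) (- coord_subspace n) (Euclidean_space n) (- {0}) (take_coords n)
    \<in> iso (relative_homology_group p (top_of_set A) (- coord_subspace n))
        (relative_homology_group p (Euclidean_space n) (- {0}))"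
proof -
  let ?E = "Euclidean_set n" and ?\<pi> = "take_coords n"
  let ?S = "A \<inter> - coord_subspace n" and ?T = "Euclidean_set n \<inter> - {0}"
  have S: "y \<in> ?S \<longleftrightarrow> y \<in> A \<and> (\<exists>j<n. y j \<noteq> 0)" for y
    by (auto simp: coord_subspace_def)
  have T: "y \<in> ?T \<longleftrightarrow> y \<in> ?E \<and> (\<exists>j<n. y j \<noteq> 0)" for y
    by (auto simp: Euclidean_set_def fun_eq_iff) (metis not_less)
  have pos: "(1 - t) * \<rho> v + t > 0" if "0 \<le> t" "t \<le> 1" for t v
    using \<rho>(2)[of v] that by (cases "t = 1") (auto simp: add_pos_nonneg)
  have coord: "(1 - t) * (g \<circ> ?\<pi>) x j + t * id x j = ((1 - t) * \<rho> (?\<pi> x) + t) * x j"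
    "(1 - t) * (?\<pi> \<circ> g) x j + t * id x j = ((1 - t) * \<rho> x + t) * x j" if "j < n" for j t x
    using that \<rho>(1) by (simp_all add: take_coords_def algebra_simps)
  have c\<pi>: "continuous_map (top_of_set A) (top_of_set ?E) ?\<pi>"
    and cg: "continuous_map (top_of_set ?E) (top_of_set A) g"
    using continuous_on_take_coords take_coords_in_Euclidean_set g by auto
  have "?\<pi> \<in> ?S \<rightarrow> ?T" "g \<in> ?T \<rightarrow> ?S"
    unfolding Pi_iff Ball_def S T using take_coords_in_Euclidean_set g(2) \<rho>
    by (auto simp: take_coords_def less_imp_neq[THEN not_sym])
  moreover have "homotopic_with (\<lambda>h. h \<in> ?S \<rightarrow> ?S) (top_of_set A) (top_of_set A) (g \<circ> ?\<pi>) id"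
  proof (rule homotopic_with_linear_path)
    show "continuous_map (top_of_set A) euclidean (g \<circ> ?\<pi>)"
      using continuous_map_compose[OF c\<pi> cg] continuous_map_into_fulltopology by blast
    show "(\<lambda>x i. (1 - t) * (g \<circ> ?\<pi>) x i + t * id x i) \<in> ?S \<rightarrow> ?S" if t: "0 \<le> t" "t \<le> 1" for t
    proof
      fix x assume "x \<in> ?S"
      then obtain j where j: "x \<in> A" "j < n" "x j \<noteq> 0" unfolding S by blast
      have "(1 - t) * (g \<circ> ?\<pi>) x j + t * id x j \<noteq> 0"
        unfolding coord[OF j(2)] using pos[OF t, of "?\<pi> x"] j(3) by simp
      then show "(\<lambda>i. (1 - t) * (g \<circ> ?\<pi>) x i + t * id x i) \<in> ?S"
        unfolding S using line[OF j(1) t] j(2) by (auto simp: o_def)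
    qed
  qed (use line in auto)
  moreover have "homotopic_with (\<lambda>h. h \<in> ?T \<rightarrow> ?T) (top_of_set ?E) (top_of_set ?E) (?\<pi> \<circ> g) id"
  proof (rule homotopic_with_linear_path)
    show "continuous_map (top_of_set ?E) euclidean (?\<pi> \<circ> g)"
      using continuous_map_compose[OF cg c\<pi>] continuous_map_into_fulltopology by blast
    show E: "(\<lambda>i. (1 - t) * (?\<pi> \<circ> g) x i + t * id x i) \<in> ?E"
      if "0 \<le> t" "t \<le> 1" "x \<in> topspace (top_of_set ?E)" for t x
      using that by (auto simp: Euclidean_set_def take_coords_def)
    show "(\<lambda>x i. (1 - t) * (?\<pi> \<circ> g) x i + t * id x i) \<in> ?T \<rightarrow> ?T" if t: "0 \<le> t" "t \<le> 1" for t
    proof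
      fix x assume "x \<in> ?T"
      then obtain j where j: "x \<in> ?E" "j < n" "x j \<noteq> 0" unfolding T by blast
      have "(1 - t) * (?\<pi> \<circ> g) x j + t * id x j \<noteq> 0"
        unfolding coord[OF j(2)] using pos[OF t, of x] j(3) by simp
      then show "(\<lambda>i. (1 - t) * (?\<pi> \<circ> g) x i + t * id x i) \<in> ?T"
        unfolding T using E[OF t, of x] j by (auto simp del: o_apply)
    qed
  qed auto
  ultimately have "hom_induced p (top_of_set A) ?S (top_of_set ?E) ?T ?\<pi>
    \<in> iso (relative_homology_group p (top_of_set A) ?S) (relative_homology_group p (top_of_set ?E) ?T)"
    by (intro homotopy_equivalence_relative_homology_group_isomorphism[OF c\<pi> _ cg])
  then show ?thesis
    using hom_induced_cong[of "top_of_set A" ?S "- coord_subspace n" "top_of_set ?E" ?T "- {0}" p ?\<pi>]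
      relative_homology_cong(4)[of "top_of_set A" ?S "- coord_subspace n" p]
      relative_homology_cong(4)[of "top_of_set ?E" ?T "- {0}" p]
    by (simp add: Euclidean_space_eq)
qed

subsection \<open>Affine simplices transverse to a coordinate subspace\<close>

definition transverse_simplex :: "nat \<Rightarrow> (nat \<Rightarrow> real) \<Rightarrow> real \<Rightarrow> (nat \<Rightarrow> real) \<Rightarrow> nat \<Rightarrow> real" where
  "transverse_simplex n q r =
     (\<lambda>x\<in>standard_simplex n. \<lambda>j. if j < n then r * (x (Suc j) - x 0) else q j)"

lemma singular_transverse_simplex:
  assumes "n \<le> N" "q \<in> Euclidean_set N"
  shows "singular_simplex n (Euclidean_space N) (transverse_simplex n q r)"
proof -
  have "continuous_on (standard_simplex n) (\<lambda>x. \<lambda>j. if j < n then r * (x (Suc j) - x 0) else q j)"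
  proof (rule continuous_on_coordinatewise_then_product)
    show "continuous_on (standard_simplex n) (\<lambda>x. if j < n then r * (x (Suc j) - x 0) else q j)" for j
      by (cases "j < n") (auto intro!: continuous_intros)
  qed
  then have "continuous_on (standard_simplex n) (transverse_simplex n q r)"
    by (rule continuous_on_eq) (simp add: transverse_simplex_def)
  then show ?thesis
    unfolding singular_simplex_def Euclidean_space_eq powertop_real_eq_euclidean
    using assms by (auto simp: transverse_simplex_def Euclidean_set_def)
qed

lemma standard_simplex_face_not_constant:
  assumes "x \<in> standard_simplex n" "k \<le> n" "x k = 0"
  shows "\<exists>j<n. x (Suc j) \<noteq> x 0"
proof (rule ccontr)
  assume "\<not> ?thesis"
  then have "x i = x 0" if "i \<le> n" for i
    using that by (cases i) auto
  then have "x i = 0" if "i \<le> n" for i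
    using that assms(2,3) by metis
  then have "(\<Sum>i\<le>n. x i) = 0" by simp
  then show False using assms(1) by (simp add: standard_simplex_def)
qed

lemma transverse_simplex_boundary:
  assumes "x \<in> standard_simplex n" "k \<le> n" "x k = 0" "r > 0"
  shows "transverse_simplex n q r x \<notin> coord_subspace n"
  using standard_simplex_face_not_constant[OF assms(1-3)] assms
  by (auto simp: coord_subspace_def transverse_simplex_def)

lemma transverse_simplex_relcycle:
  assumes "r > 0"
  shows "singular_relcycle n (Euclidean_space n) (- {0}) (frag_of (transverse_simplex n 0 r))"
proof (rule singular_relcycle_of_simplex)
  show "singular_simplex n (Euclidean_space n) (transverse_simplex n 0 r)"
    by (rule singular_transverse_simplex) (simp_all add: Euclidean_set_def)
  show "transverse_simplex n 0 r x \<in> - {0}" if "x \<in> standard_simplex n" "k \<le> n" "x k = 0" for x k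
    using transverse_simplex_boundary[OF that assms, of 0] by (auto simp: coord_subspace_def)
qed

lemma take_coords_transverse_simplex:
  "chain_map n (take_coords n) (frag_of (transverse_simplex n q r)) = frag_of (transverse_simplex n 0 r)"
  unfolding transverse_simplex_def chain_map_restrict
  by (intro arg_cong[where f = frag_of]) (auto simp: take_coords_def fun_eq_iff restrict_def)

subsection \<open>Induction on the dimension\<close>

text \<open>The pair \<open>(\<real>\<^sup>n\<^sup>+\<^sup>1 - 0, \<real>\<^sup>n\<^sup>+\<^sup>1 - ray)\<close>, for a closed half-line \<open>ray\<close> in the last direction, is
  excised to a neighbourhood of the open half-line, on which \<open>take_coords\<close> is an equivalence to
  \<open>(\<real>\<^sup>n, \<real>\<^sup>n - 0)\<close>.\<close>

definition ray :: "nat \<Rightarrow> (nat \<Rightarrow> real) set" where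
  "ray n = coord_subspace n \<inter> {y. y n \<le> 0}"

definition ray_nhd :: "nat \<Rightarrow> (nat \<Rightarrow> real) set" where
  "ray_nhd n = {y. y n < 0} \<union> - coord_subspace n"

lemma closed_ray: "closed (ray n)"
  unfolding ray_def
  by (intro closed_Int closed_coord_subspace closed_Collect_le continuous_intros)

lemma open_ray_nhd: "open (ray_nhd n)"
  unfolding ray_nhd_def
  by (intro open_Un open_Compl closed_coord_subspace open_Collect_less continuous_intros)

lemma contractible_starlike:
  fixes a :: "nat \<Rightarrow> real"
  assumes "a \<in> T" "\<And>x t. \<lbrakk>x \<in> T; 0 \<le> t; t \<le> 1\<rbrakk> \<Longrightarrow> (\<lambda>i. (1 - t) * x i + t * a i) \<in> T"
  shows "contractible_space (top_of_set T)"
proof -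
  have "homotopic_with (\<lambda>x. True) (top_of_set T) (top_of_set T) id (\<lambda>x. a)"
    by (rule homotopic_with_linear_path) (use assms in auto)
  then show ?thesis
    unfolding contractible_space_def by blast
qed

lemma homology_vanishes_off_ray: "homology_vanishes p (Euclidean_space (Suc n)) (- ray n)"
  unfolding homology_vanishes_iff_trivial_group
proof (rule trivial_relative_homology_group_contractible_spaces)
  let ?e = "(\<lambda>i. if i = n then 1 else 0) :: nat \<Rightarrow> real" and ?T = "Euclidean_set (Suc n) \<inter> - ray n"
  have e: "?e \<in> ?T"
    by (auto simp: Euclidean_set_def ray_def)
  then show "topspace (Euclidean_space (Suc n)) \<inter> - ray n \<noteq> {}"
    by (auto simp: Euclidean_space_eq)
  have "contractible_space (top_of_set ?T)"
  proof (rule contractible_starlike[OF e])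
    fix x :: "nat \<Rightarrow> real" and t :: real assume x: "x \<in> ?T" and t: "0 \<le> t" "t \<le> 1"
    have "(\<lambda>i. (1 - t) * x i + t * ?e i) \<notin> ray n"
    proof (cases "t = 1 \<or> x \<notin> coord_subspace n")
      case True
      then show ?thesis by (auto simp: ray_def coord_subspace_def)
    next
      case False
      then have "(1 - t) * x n > 0"
        using x t by (auto simp: ray_def)
      then show ?thesis
        using t by (auto simp: ray_def)
    qed
    then show "(\<lambda>i. (1 - t) * x i + t * ?e i) \<in> ?T"
      using x by (auto simp: Euclidean_set_def)
  qed
  then show "contractible_space (subtopology (Euclidean_space (Suc n)) (- ray n))"
    by (simp add: Euclidean_space_eq subtopology_subtopology)
qed simp

lemma take_coords_ray_nhd_iso:
  "hom_induced p (subtopology (Euclidean_space (Suc n)) (ray_nhd n)) (- ray n) (Euclidean_space n) (- {0}) (take_coords n)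
   \<in> iso (relative_homology_group p (subtopology (Euclidean_space (Suc n)) (ray_nhd n)) (- ray n))
       (relative_homology_group p (Euclidean_space n) (- {0}))"
proof -
  let ?A = "Euclidean_set (Suc n) \<inter> ray_nhd n"
  define g :: "(nat \<Rightarrow> real) \<Rightarrow> nat \<Rightarrow> real"
    where "g = (\<lambda>v j. if j < n then v j else if j = n then - 1 else 0)"
  have "hom_induced p (top_of_set ?A) (- coord_subspace n) (Euclidean_space n) (- {0}) (take_coords n)
   \<in> iso (relative_homology_group p (top_of_set ?A) (- coord_subspace n))
       (relative_homology_group p (Euclidean_space n) (- {0}))"
  proof (rule take_coords_iso[where \<rho> = "\<lambda>_. 1"])
    have "continuous_on (Euclidean_set n) (\<lambda>v. g v j)" for j
      by (cases "j < n") (auto simp: g_def intro: continuous_intros)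
    then show "continuous_on (Euclidean_set n) g"
      by (rule continuous_on_coordinatewise_then_product)
    show "g v \<in> ?A" for v
      by (auto simp: g_def Euclidean_set_def ray_nhd_def)
    fix x :: "nat \<Rightarrow> real" and t :: real assume x: "x \<in> ?A" and t: "0 \<le> t" "t \<le> 1"
    let ?l = "\<lambda>i. (1 - t) * g (take_coords n x) i + t * x i"
    have l: "?l j = x j" if "j < n" for j
      using that by (simp add: g_def take_coords_def algebra_simps)
    have "?l \<in> ray_nhd n"
    proof (cases "x \<in> coord_subspace n")
      case True
      then have "x n < 0" using x by (auto simp: ray_nhd_def)
      then have "t * x n < 1 - t \<or> t = 1"
        using t mult_nonneg_nonpos[of t "x n"] by linarith
      then show ?thesis
        using \<open>x n < 0\<close> by (auto simp: ray_nhd_def g_def)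
    next
      case False
      then show ?thesis using l by (auto simp: ray_nhd_def coord_subspace_def)
    qed
    then show "?l \<in> ?A"
      using x by (auto simp: Euclidean_set_def g_def)
  qed (auto simp: g_def)
  moreover have "topspace (top_of_set ?A) \<inter> - coord_subspace n = topspace (top_of_set ?A) \<inter> - ray n"
    by (auto simp: ray_nhd_def ray_def)
  ultimately show ?thesis
    using hom_induced_cong[of "top_of_set ?A" "- coord_subspace n" "- ray n" "Euclidean_space n" "- {0}" "- {0}"]
      relative_homology_cong(4)[of "top_of_set ?A" "- coord_subspace n" "- ray n"]
    by (simp add: Euclidean_space_eq subtopology_subtopology)
qed

lemma excise_ray_nhd_iso:
  "hom_induced p (subtopology (Euclidean_space (Suc n)) (ray_nhd n)) (- ray n)
      (subtopology (Euclidean_space (Suc n)) (- {0})) (- ray n) id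
   \<in> iso (relative_homology_group p (subtopology (Euclidean_space (Suc n)) (ray_nhd n)) (- ray n))
       (relative_homology_group p (subtopology (Euclidean_space (Suc n)) (- {0})) (- ray n))"
proof -
  let ?Y = "subtopology (Euclidean_space (Suc n)) (- {0})"
  have Y: "?Y = top_of_set (Euclidean_set (Suc n) \<inter> - {0})"
    by (simp add: Euclidean_space_eq subtopology_subtopology)
  have "0 \<notin> ray_nhd n"
    by (simp add: ray_nhd_def coord_subspace_def)
  then have "subtopology ?Y (ray_nhd n) = subtopology (Euclidean_space (Suc n)) (ray_nhd n)"
    unfolding subtopology_subtopology by (metis Int_absorb1 Compl_iff singletonD subsetI)
  moreover have "hom_induced p (subtopology ?Y (ray_nhd n)) (- ray n) ?Y (- ray n) id
    \<in> iso (relative_homology_group p (subtopology ?Y (ray_nhd n)) (- ray n))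
        (relative_homology_group p ?Y (- ray n))"
  proof (rule excision_iso)
    show "openin ?Y (topspace ?Y \<inter> ray_nhd n)" "closedin ?Y (topspace ?Y \<inter> ray n)"
      unfolding Y using open_ray_nhd closed_ray by (simp_all add: openin_open_Int closedin_closed_Int)
    show "topspace ?Y \<inter> ray n \<subseteq> ray_nhd n"
    proof
      fix y assume y: "y \<in> topspace ?Y \<inter> ray n"
      then have "y j = 0" if "j \<noteq> n" for j
        using that by (cases "j < n") (auto simp: Y Euclidean_set_def ray_def coord_subspace_def)
      then have "y n = 0 \<Longrightarrow> y = 0"
        by (metis ext zero_fun_apply)
      then have "y n \<noteq> 0"
        using y by auto
      then show "y \<in> ray_nhd n"
        using y by (auto simp: ray_def ray_nhd_def)
    qed
  qed
  ultimately show ?thesis by simp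
qed

lemma singular_unit_simplex_face:
  assumes "k \<le> Suc n"
  shows "singular_simplex n (Euclidean_space (Suc n)) (singular_face (Suc n) k (transverse_simplex (Suc n) 0 1))"
  using singular_simplex_singular_face[OF singular_transverse_simplex[of "Suc n" "Suc n" 0 1]] assms
  by (simp add: Euclidean_set_def)

lemma free_homology_generator_last_face:
  assumes IH: "free_homology_generator n (Euclidean_space n) (- {0}) (frag_of (transverse_simplex n 0 1))"
  shows "free_homology_generator n (subtopology (Euclidean_space (Suc n)) (- {0})) (- ray n)
    (frag_of (singular_face (Suc n) (Suc n) (transverse_simplex (Suc n) 0 1)))"
proof -
  let ?Y = "subtopology (Euclidean_space (Suc n)) (- {0})"
    and ?H = "subtopology (Euclidean_space (Suc n)) (ray_nhd n)"
  let ?F = "singular_face (Suc n) (Suc n) (transverse_simplex (Suc n) 0 1)"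
  have F: "?F x = (\<lambda>j. if j < n then x (Suc j) - x 0 else if j = n then - x 0 else 0)"
    if "x \<in> standard_simplex n" for x
    using that simplical_face_in_standard_simplex[of "Suc n" "Suc n" x]
    by (auto simp: singular_face_def transverse_simplex_def simplical_face_def fun_eq_iff)
  have "?F x \<in> ray_nhd n" if x: "x \<in> standard_simplex n" for x
  proof (cases "x 0 = 0")
    case True
    then obtain j where "j < n" "x (Suc j) \<noteq> x 0"
      using standard_simplex_face_not_constant[of x n 0] x by auto
    then show ?thesis
      unfolding F[OF x] ray_nhd_def coord_subspace_def by auto
  next
    case False
    moreover have "0 \<le> x 0"
      using x unfolding standard_simplex_def by blast
    ultimately show ?thesis
      unfolding F[OF x] ray_nhd_def by simp
  qed
  then have FH: "singular_simplex n ?H ?F"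
    using singular_unit_simplex_face[of "Suc n" n]
    by (simp only: singular_simplex_subtopology image_subset_iff) blast
  have "?F x \<in> - ray n" if "x \<in> standard_simplex n" "k \<le> n" "x k = 0" for x k
    using standard_simplex_face_not_constant[OF that]
    unfolding F[OF that(1)] ray_def coord_subspace_def by auto
  then have Fc: "singular_relcycle n ?H (- ray n) (frag_of ?F)"
    using singular_relcycle_of_simplex[OF FH] by blast
  have "simplex_map n (take_coords n) ?F = transverse_simplex n 0 1"
    using F by (auto simp: simplex_map_def take_coords_def transverse_simplex_def fun_eq_iff restrict_def)
  moreover have "continuous_map ?H (Euclidean_space n) (take_coords n)"
    "take_coords n \<in> topspace ?H \<inter> - ray n \<rightarrow> - {0}"
    using continuous_on_take_coords[of _ n] take_coords_in_Euclidean_set[of n]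
    by (auto simp: Euclidean_space_eq subtopology_subtopology take_coords_eq_0_iff ray_def ray_nhd_def)
  ultimately have "free_homology_generator n ?H (- ray n) (frag_of ?F)"
    using free_homology_generator_hom_induced[OF take_coords_ray_nhd_iso _ _ Fc] IH by simp
  moreover have "continuous_map ?H ?Y id"
    by (auto simp: Euclidean_space_eq subtopology_subtopology ray_nhd_def coord_subspace_def)
  ultimately show ?thesis
    using free_homology_generator_hom_induced[OF excise_ray_nhd_iso _ _ Fc]
      chain_map_ident[of n ?H "frag_of ?F"] FH by (auto simp: singular_chain_of)
qed

lemma other_face_off_ray:
  assumes x: "x \<in> standard_simplex n" and k: "k \<le> n"
  shows "singular_face (Suc n) k (transverse_simplex (Suc n) 0 1) x \<notin> ray n"
proof
  let ?x = "simplical_face k x"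
  have std: "?x \<in> standard_simplex (Suc n)"
    using simplical_face_in_standard_simplex[of "Suc n" k x] x k by simp
  assume "singular_face (Suc n) k (transverse_simplex (Suc n) 0 1) x \<in> ray n"
  then have r: "\<And>j. j < n \<Longrightarrow> ?x (Suc j) = ?x 0" "?x (Suc n) \<le> ?x 0"
    using std x by (auto simp: ray_def coord_subspace_def transverse_simplex_def singular_face_def)
  have "?x i = ?x 0" if "i \<le> n" for i
    using r(1) that by (cases i) auto
  moreover have "?x k = 0"
    by (simp add: simplical_face_def)
  ultimately have z: "?x i = 0" if "i \<le> n" for i
    using that k by metis
  then have "(\<Sum>i\<le>Suc n. ?x i) \<le> 0"
    using r(2) by simp
  then show False
    using std by (simp add: standard_simplex_def)
qed

lemma ray_complement_subset: "- ray n \<subseteq> - {0}"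
  by (auto simp: ray_def coord_subspace_def)

theorem homology_vanishes_Euclidean:
  assumes "p \<noteq> n" shows "homology_vanishes p (Euclidean_space n) (- {0})"
  using assms
proof (induction n arbitrary: p)
  case 0
  have t: "topspace (Euclidean_space 0) = {0}"
    by (auto simp: Euclidean_space_eq Euclidean_set_def fun_eq_iff)
  have "homology_vanishes p (Euclidean_space 0) {}"
    unfolding homology_vanishes_iff_trivial_group using homology_dimension_axiom[OF t] 0 by simp
  moreover have "topspace (Euclidean_space 0) \<inter> {} = topspace (Euclidean_space 0) \<inter> - {0}"
    unfolding t by auto
  ultimately show ?case
    using relative_homology_cong(1) by blast
next
  case (Suc n)
  have "homology_vanishes (p - 1) (subtopology (Euclidean_space (Suc n)) (- {0})) (- ray n)" if "p \<noteq> 0"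
  proof -
    have "homology_vanishes (p - 1) (Euclidean_space n) (- {0})"
      by (rule Suc.IH) (use Suc.prems that in auto)
    then show ?thesis
      using homology_vanishes_iso[OF excise_ray_nhd_iso] homology_vanishes_iso[OF take_coords_ray_nhd_iso]
      by blast
  qed
  then show ?case
    by (intro homology_vanishes_larger[OF ray_complement_subset homology_vanishes_off_ray]) auto
qed

lemma free_homology_generator_Euclidean_0:
  "free_homology_generator 0 (Euclidean_space 0) (- {0}) (frag_of (transverse_simplex 0 0 1))"
proof -
  let ?X = "Euclidean_space 0" and ?\<sigma> = "transverse_simplex 0 0 1"
  have t: "topspace ?X = {0}"
    by (auto simp: Euclidean_space_eq Euclidean_set_def fun_eq_iff)
  then have e: "topspace ?X \<inter> - {0} = topspace ?X \<inter> {}" by auto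
  have \<sigma>: "?\<sigma> = restrict (\<lambda>x. 0) (standard_simplex 0)"
    by (auto simp: transverse_simplex_def fun_eq_iff restrict_def)
  have cycle: "singular_relcycle 0 ?X {} z \<longleftrightarrow> (\<exists>a. z = frag_cmul a (frag_of ?\<sigma>))" for z
    unfolding singular_cycle_singleton[OF t] singular_chain_singleton[OF t] \<sigma> by simp
  have "a = b" if "homologous_rel 0 ?X {} (frag_cmul a (frag_of ?\<sigma>)) (frag_cmul b (frag_of ?\<sigma>))" for a b
  proof -
    have "frag_cmul (a - b) (frag_of ?\<sigma>) = 0"
      using that by (simp add: homologous_rel_def singular_boundary_singleton[OF t] frag_cmul_diff_distrib)
    then show ?thesis by simp
  qed
  moreover have "singular_relcycle_set 0 ?X {} = range (\<lambda>a. frag_cmul a (frag_of ?\<sigma>))"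
    unfolding cycle by blast
  ultimately have "bij_betw (\<lambda>a. homologous_rel_set 0 ?X {} (frag_cmul a (frag_of ?\<sigma>))) UNIV
      (carrier (relative_homology_group (int 0) ?X {}))"
    unfolding bij_betw_def carrier_relative_homology_group inj_on_def homologous_rel_set_eq
    by (simp add: image_image)
  moreover have "singular_relcycle 0 ?X {} (frag_of ?\<sigma>)"
    unfolding cycle by (metis frag_cmul_one)
  ultimately show ?thesis
    unfolding free_homology_generator_def relative_homology_cong[OF e] by blast
qed

theorem free_homology_generator_Euclidean:
  "free_homology_generator n (Euclidean_space n) (- {0}) (frag_of (transverse_simplex n 0 1))"
proof (induction n)
  case (Suc n)
  let ?X = "Euclidean_space (Suc n)" and ?Y = "subtopology (Euclidean_space (Suc n)) (- {0})"
  let ?\<sigma> = "transverse_simplex (Suc n) 0 1"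
  let ?f = "\<lambda>k. singular_face (Suc n) k ?\<sigma>"
  let ?c = "frag_cmul ((-1) ^ Suc n) (frag_of (?f (Suc n)))"
  show ?case
  proof (rule free_homology_generator_boundary[OF ray_complement_subset homology_vanishes_off_ray
        homology_vanishes_off_ray])
    show "singular_relcycle (Suc n) ?X (- {0}) (frag_of ?\<sigma>)"
      by (rule transverse_simplex_relcycle) simp
    have "?c = frag_of (?f (Suc n)) \<or> ?c = - frag_of (?f (Suc n))"
      by (cases "even n") simp_all
    then have free: "free_homology_generator n ?Y (- ray n) ?c"
      using free_homology_generator_last_face[OF Suc.IH] free_homology_generator_minus by fastforce
    have "singular_chain n (subtopology ?Y (- ray n)) (frag_of (?f k))" if "k \<le> n" for k
      using singular_unit_simplex_face[of k n] other_face_off_ray[OF _ that] ray_complement_subset that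
      by (auto simp: singular_chain_of subtopology_subtopology singular_simplex_subtopology Int_absorb1)
    then have "singular_relboundary n ?Y (- ray n) (\<Sum>k\<le>n. frag_cmul ((-1) ^ k) (frag_of (?f k)))"
      by (intro singular_chain_imp_relboundary singular_chain_sum singular_chain_cmul) auto
    moreover have boundary: "chain_boundary (Suc n) (frag_of ?\<sigma>)
        = (\<Sum>k\<le>n. frag_cmul ((-1) ^ k) (frag_of (?f k))) + ?c"
      by (simp only: chain_boundary_of) simp
    ultimately have "homologous_rel n ?Y (- ray n) (chain_boundary (Suc n) (frag_of ?\<sigma>)) ?c"
      unfolding boundary homologous_rel_def add_diff_cancel_right' by blast
    then show "free_homology_generator n ?Y (- ray n) (chain_boundary (Suc n) (frag_of ?\<sigma>))"
      using free_homology_generator_homologous[OF free] homologous_rel_sym by metis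
  qed
qed (rule free_homology_generator_Euclidean_0)

lemma homologous_transverse_simplex:
  assumes "r > 0"
  shows "homologous_rel n (Euclidean_space n) (- {0})
    (frag_of (transverse_simplex n 0 1)) (frag_of (transverse_simplex n 0 r))"
proof -
  let ?s = "\<lambda>(y :: nat \<Rightarrow> real) j. r * y j" and ?E = "Euclidean_space n"
  have "homotopic_with (\<lambda>h. h \<in> topspace ?E \<inter> - {0} \<rightarrow> - {0}) ?E (top_of_set (Euclidean_set n)) id ?s"
  proof (rule homotopic_with_linear_path)
    show "continuous_map ?E euclidean ?s"
      unfolding Euclidean_space_eq
      by (auto intro!: continuous_on_coordinatewise_then_product continuous_intros)
    show "(\<lambda>i. (1 - t) * id x i + t * (r * x i)) \<in> Euclidean_set n"
      if "x \<in> topspace ?E" for t :: real and x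
      using that by (simp add: Euclidean_space_eq Euclidean_set_def)
    have pos: "(1 - t) + t * r > 0" if "0 \<le> t" "t \<le> 1" for t
      using that assms by (cases "t = 0") (auto simp: add_nonneg_pos)
    show "(\<lambda>x i. (1 - t) * id x i + t * (r * x i)) \<in> topspace ?E \<inter> - {0} \<rightarrow> - {0}"
      if t: "0 \<le> t" "t \<le> 1" for t
    proof
      fix x assume "x \<in> topspace ?E \<inter> - {0}"
      then obtain i where "x i \<noteq> 0" by (auto simp: fun_eq_iff)
      moreover have "(1 - t) * id x i + t * (r * x i) = ((1 - t) + t * r) * x i"
        by (simp add: algebra_simps)
      ultimately have "(1 - t) * id x i + t * (r * x i) \<noteq> 0"
        using pos[OF t] by simp
      then show "(\<lambda>i. (1 - t) * id x i + t * (r * x i)) \<in> - {0}"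
        by (auto simp: fun_eq_iff)
    qed
  qed (simp add: Euclidean_space_eq)
  from homotopic_imp_homologous_rel[OF this transverse_simplex_relcycle[of 1 n]]
  have "homologous_rel n ?E (- {0}) (chain_map n id (frag_of (transverse_simplex n 0 1)))
      (chain_map n ?s (frag_of (transverse_simplex n 0 1)))"
    by (simp add: Euclidean_space_eq)
  moreover have "chain_map n ?s (frag_of (transverse_simplex n 0 1)) = frag_of (transverse_simplex n 0 r)"
    unfolding transverse_simplex_def chain_map_restrict
    by (intro arg_cong[where f = frag_of]) (auto simp: fun_eq_iff restrict_def)
  moreover have "chain_map n id (frag_of (transverse_simplex n 0 1)) = frag_of (transverse_simplex n 0 1)"
    unfolding transverse_simplex_def chain_map_restrict by (simp only: id_apply)
  ultimately show ?thesis by (simp only:)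
qed

subsection \<open>The local degree\<close>

definition local_degree :: "nat \<Rightarrow> (nat \<Rightarrow> real) chain \<Rightarrow> int" where
  "local_degree n z = (THE a. homologous_rel n (Euclidean_space n) (- {0}) z
     (frag_cmul a (frag_of (transverse_simplex n 0 1))))"

lemma local_degree_eqI:
  assumes "homologous_rel n (Euclidean_space n) (- {0}) z (frag_cmul a (frag_of (transverse_simplex n 0 1)))"
  shows "local_degree n z = a"
  unfolding local_degree_def
proof (rule the_equality, rule assms)
  show "b = a" if "homologous_rel n (Euclidean_space n) (- {0}) z
      (frag_cmul b (frag_of (transverse_simplex n 0 1)))" for b
    using homologous_rel_trans[OF assms homologous_rel_sym[THEN iffD1, OF that]]
    by (rule free_homology_generatorD(3)[OF free_homology_generator_Euclidean])
qed

lemma homologous_rel_local_degree: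
  assumes "singular_relcycle n (Euclidean_space n) (- {0}) z"
  shows "homologous_rel n (Euclidean_space n) (- {0}) z
    (frag_cmul (local_degree n z) (frag_of (transverse_simplex n 0 1)))"
  using free_homology_generatorD(2)[OF free_homology_generator_Euclidean assms] local_degree_eqI by blast

lemma local_degree_cong:
  assumes "homologous_rel n (Euclidean_space n) (- {0}) z w" "singular_relcycle n (Euclidean_space n) (- {0}) w"
  shows "local_degree n z = local_degree n w"
  by (rule local_degree_eqI[OF homologous_rel_trans[OF homologous_rel_local_degree[OF assms(2)] assms(1)]])

lemma local_degree_add:
  assumes "singular_relcycle n (Euclidean_space n) (- {0}) z" "singular_relcycle n (Euclidean_space n) (- {0}) w"
  shows "local_degree n (z + w) = local_degree n z + local_degree n w"
  by (rule local_degree_eqI)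
    (simp add: frag_cmul_distrib homologous_rel_add homologous_rel_local_degree assms)

lemma local_degree_relboundary:
  assumes "singular_relboundary n (Euclidean_space n) (- {0}) z"
  shows "local_degree n z = 0"
  by (rule local_degree_eqI) (use assms in \<open>simp add: homologous_rel_def\<close>)

lemma local_degree_transverse_simplex:
  assumes "r > 0" shows "local_degree n (frag_of (transverse_simplex n 0 r)) = 1"
  using local_degree_cong[OF homologous_transverse_simplex transverse_simplex_relcycle, OF assms assms, of n]
    local_degree_eqI[of n "frag_of (transverse_simplex n 0 1)" 1] by simp

section \<open>Open sets relative to a coordinate subspace\<close>

definition transverse_homology :: "nat \<Rightarrow> (nat \<Rightarrow> real) set \<Rightarrow> ((nat \<Rightarrow> real) \<Rightarrow> nat \<Rightarrow> real) set \<Rightarrow> bool" where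
  "transverse_homology n A G \<longleftrightarrow>
     (\<forall>p\<le>n. homology_generated_by p (top_of_set A) (- coord_subspace n) (if p = n then G else {}))"

definition has_transverse_simplices :: "nat \<Rightarrow> (nat \<Rightarrow> real) set \<Rightarrow> ((nat \<Rightarrow> real) \<Rightarrow> nat \<Rightarrow> real) set \<Rightarrow> bool" where
  "has_transverse_simplices n A G \<longleftrightarrow>
     (\<forall>q \<in> A \<inter> coord_subspace n. \<exists>\<^sub>F r in at_right 0. transverse_simplex n q r \<in> G)"

definition is_open_box :: "nat \<Rightarrow> (nat \<Rightarrow> real) set \<Rightarrow> bool" where
  "is_open_box N A \<longleftrightarrow> (\<exists>I. (\<forall>j. open (I j) \<and> convex (I j)) \<and> A = Euclidean_set N \<inter> Pi {..<N} I)"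

lemma is_open_box_subset: "is_open_box N A \<Longrightarrow> A \<subseteq> Euclidean_set N"
  unfolding is_open_box_def by blast

lemma is_open_box_Euclidean_set: "is_open_box N (Euclidean_set N)"
  unfolding is_open_box_def by (rule exI[of _ "\<lambda>_. UNIV"]) simp

lemma is_open_box_Int:
  assumes "is_open_box N A" "is_open_box N B" shows "is_open_box N (A \<inter> B)"
proof -
  obtain I where I: "\<forall>j. open (I j) \<and> convex (I j)" "A = Euclidean_set N \<inter> Pi {..<N} I"
    using assms(1) unfolding is_open_box_def by blast
  obtain J where J: "\<forall>j. open (J j) \<and> convex (J j)" "B = Euclidean_set N \<inter> Pi {..<N} J"
    using assms(2) unfolding is_open_box_def by blast
  show ?thesis
    unfolding is_open_box_def I(2) J(2) using I(1) J(1)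
    by (intro exI[of _ "\<lambda>j. I j \<inter> J j"]) (auto intro: convex_Int)
qed

lemma is_open_box_imp_openin:
  assumes "is_open_box N A" shows "openin (Euclidean_space N) A"
proof -
  obtain I where I: "\<forall>j. open (I j) \<and> convex (I j)" "A = Euclidean_set N \<inter> Pi {..<N} I"
    using assms unfolding is_open_box_def by blast
  have "Pi {..<N} I = (\<Inter>j<N. (\<lambda>y. y j) -` I j)"
    by auto
  moreover have "open (\<Inter>j<N. (\<lambda>y :: nat \<Rightarrow> real. y j) -` I j)"
    using I(1) by (intro open_INT ballI open_vimage continuous_intros) auto
  ultimately show ?thesis
    unfolding Euclidean_space_eq I(2) by (simp add: openin_open_Int)
qed

lemma is_open_box_convex:
  assumes "is_open_box N A" "x \<in> A" "y \<in> A" "0 \<le> t" "t \<le> 1"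
  shows "(\<lambda>i. (1 - t) * x i + t * y i) \<in> A"
proof -
  obtain I where I: "\<forall>j. open (I j) \<and> convex (I j)" "A = Euclidean_set N \<inter> Pi {..<N} I"
    using assms(1) unfolding is_open_box_def by blast
  have "(1 - t) * x j + t * y j \<in> I j" if "j < N" for j
    using convexD_alt[OF spec[OF I(1), THEN conjunct2, of j], of "x j" "y j" t] assms that I(2) by auto
  then show ?thesis
    using assms by (simp add: I(2) Euclidean_set_def)
qed

lemma open_box_neighbourhood:
  assumes A: "openin (Euclidean_space N) A" and y: "y \<in> A"
  obtains B where "is_open_box N B" "y \<in> B" "B \<subseteq> A"
proof -
  obtain T where T: "open T" "A = Euclidean_set N \<inter> T"
    using A unfolding Euclidean_space_eq openin_open by blast
  then have "openin (powertop_real UNIV) T" "y \<in> T"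
    using y by (auto simp: powertop_real_eq_euclidean)
  then obtain X where X: "y \<in> (\<Pi>\<^sub>E i\<in>UNIV. X i)" "\<And>i. open (X i)" "(\<Pi>\<^sub>E i\<in>UNIV. X i) \<subseteq> T"
    using product_topology_open_contains_basis[of "\<lambda>_. euclideanreal" UNIV T y] by auto
  then have "\<exists>e>0. ball (y i) e \<subseteq> X i" for i
    by (simp add: open_contains_ball PiE_iff)
  then obtain e where e: "\<And>i. e i > 0" "\<And>i. ball (y i) (e i) \<subseteq> X i"
    by metis
  let ?B = "Euclidean_set N \<inter> Pi {..<N} (\<lambda>i. ball (y i) (e i))"
  have "is_open_box N ?B"
    unfolding is_open_box_def by (rule exI[of _ "\<lambda>i. ball (y i) (e i)"]) simp
  moreover have "y \<in> ?B"
    using y T e(1) by simp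
  moreover have "?B \<subseteq> A"
  proof
    fix w assume w: "w \<in> ?B"
    have "w i \<in> X i" for i
    proof (cases "i < N")
      case False
      then have "w i = y i"
        using w y T(2) by (simp add: Euclidean_set_def)
      then show ?thesis
        using X(1) by (simp add: PiE_iff)
    qed (use w e(2) in blast)
    then show "w \<in> A"
      using X(3) w T(2) by auto
  qed
  ultimately show ?thesis
    by (rule that)
qed

lemma open_box_coords_near_0:
  assumes "is_open_box N A" "n \<le> N" "q \<in> A \<inter> coord_subspace n"
  shows "\<forall>\<^sub>F d in at_right 0. \<forall>y \<in> Euclidean_set N.
    (\<forall>j<n. \<bar>y j\<bar> \<le> d) \<and> (\<forall>j\<ge>n. y j = q j) \<longrightarrow> y \<in> A"
proof -
  obtain I where I: "\<forall>j. open (I j) \<and> convex (I j)" "A = Euclidean_set N \<inter> Pi {..<N} I"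
    using assms(1) unfolding is_open_box_def by blast
  have "\<forall>\<^sub>F d in at_right 0. cball 0 d \<subseteq> I j" if j: "j < n" for j
  proof -
    have "q j = 0" "q \<in> Pi {..<N} I"
      using assms(3) j by (auto simp: I(2) coord_subspace_def)
    then have "0 \<in> I j"
      using assms(2) j by (metis PiE lessThan_iff order_less_le_trans)
    then obtain e where "e > 0" "cball 0 e \<subseteq> I j"
      using I(1) open_contains_cball by meson
    moreover have "cball 0 d \<subseteq> cball 0 e" if "d < e" for d :: real
      using that by auto
    ultimately show ?thesis
      unfolding eventually_at_right_field by (metis subset_trans)
  qed
  then have "\<forall>\<^sub>F d in at_right 0. \<forall>j\<in>{..<n}. cball 0 d \<subseteq> I j"
    by (intro eventually_ball_finite) auto
  then show ?thesis
  proof (rule eventually_mono, intro ballI impI)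
    fix d y assume d: "\<forall>j\<in>{..<n}. cball 0 d \<subseteq> I j" and "y \<in> Euclidean_set N"
      and y: "(\<forall>j<n. \<bar>y j\<bar> \<le> d) \<and> (\<forall>j\<ge>n. y j = q j)"
    moreover have "y j \<in> I j" if "j < N" for j
      using d y assms(3) that by (cases "j < n") (auto simp: I(2) subset_iff)
    ultimately show "y \<in> A"
      by (simp add: I(2))
  qed
qed

lemma take_coords_open_box_iso:
  assumes A: "is_open_box N A" and nN: "n \<le> N" and q: "q \<in> A \<inter> coord_subspace n"
  shows "hom_induced p (top_of_set A) (- coord_subspace n) (Euclidean_space n) (- {0}) (take_coords n)
    \<in> iso (relative_homology_group p (top_of_set A) (- coord_subspace n))
        (relative_homology_group p (Euclidean_space n) (- {0}))"
proof -
  have "\<forall>\<^sub>F d in at_right 0. (\<forall>y \<in> Euclidean_set N.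
      (\<forall>j<n. \<bar>y j\<bar> \<le> d) \<and> (\<forall>j\<ge>n. y j = q j) \<longrightarrow> y \<in> A) \<and> d > 0"
    using open_box_coords_near_0[OF A nN q] eventually_at_right_less by (rule eventually_conj)
  from eventually_happens'[OF trivial_limit_at_right_real this] obtain d
    where d: "\<forall>y \<in> Euclidean_set N. (\<forall>j<n. \<bar>y j\<bar> \<le> d) \<and> (\<forall>j\<ge>n. y j = q j) \<longrightarrow> y \<in> A" "d > 0"
    by blast
  have qN: "q \<in> Euclidean_set N"
    using is_open_box_subset[OF A] q by blast
  define \<rho> where "\<rho> v = d / (1 + (\<Sum>j<n. \<bar>v j\<bar>))" for v :: "nat \<Rightarrow> real"
  define g where "g v j = (if j < n then \<rho> v * v j else q j)" for v j
  have den: "1 + (\<Sum>j<n. \<bar>v j\<bar>) > 0" for v :: "nat \<Rightarrow> real"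
    by (simp add: add_pos_nonneg sum_nonneg)
  have gA: "g v \<in> A" for v
  proof -
    have "\<bar>g v j\<bar> \<le> d" if "j < n" for j
    proof -
      have "\<bar>v j\<bar> \<le> 1 + (\<Sum>j<n. \<bar>v j\<bar>)"
        using member_le_sum[of j "{..<n}" "\<lambda>j. \<bar>v j\<bar>"] that by simp
      then have "d * \<bar>v j\<bar> / (1 + (\<Sum>j<n. \<bar>v j\<bar>)) \<le> d"
        using den[of v] d(2) by (simp add: pos_divide_le_eq)
      then show ?thesis
        using that d(2) den[of v] by (simp add: g_def \<rho>_def abs_mult)
    qed
    moreover have "g v \<in> Euclidean_set N"
      using qN nN by (auto simp: g_def Euclidean_set_def)
    ultimately show ?thesis
      using d(1) by (simp add: g_def)
  qed
  show ?thesis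
  proof (rule take_coords_iso[where g = g and \<rho> = \<rho>, OF _ gA])
    have "continuous_on (Euclidean_set n) (\<lambda>v. if j < n then \<rho> v * v j else q j)" for j
      unfolding \<rho>_def using den
      by (cases "j < n") (auto intro!: continuous_intros simp: less_imp_neq[THEN not_sym])
    then show "continuous_on (Euclidean_set n) g"
      unfolding g_def[abs_def] by (rule continuous_on_coordinatewise_then_product)
    show "(\<lambda>i. (1 - t) * g (take_coords n x) i + t * x i) \<in> A" if "x \<in> A" "0 \<le> t" "t \<le> 1" for x t
      using is_open_box_convex[OF A gA] that by blast
  qed (use den d(2) in \<open>auto simp: g_def \<rho>_def\<close>)
qed

lemma eventually_transverse_simplex_in_open_box:
  assumes A: "is_open_box N A" and nN: "n \<le> N" and q: "q \<in> A \<inter> coord_subspace n"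
  shows "\<forall>\<^sub>F r in at_right 0. transverse_simplex n q r ` standard_simplex n \<subseteq> A"
  using open_box_coords_near_0[OF assms] eventually_at_right_less[of 0]
proof eventually_elim
  case (elim r)
  have "\<bar>r * (x (Suc j) - x 0)\<bar> \<le> r" if "x \<in> standard_simplex n" for x j
  proof -
    have "\<bar>x (Suc j) - x 0\<bar> \<le> 1"
      using that unfolding standard_simplex_def by (smt (verit) mem_Collect_eq)
    then show ?thesis
      using elim(2) by (simp add: abs_mult mult_left_le)
  qed
  moreover have "q \<in> Euclidean_set N"
    using is_open_box_subset[OF A] q by blast
  ultimately show ?case
    using elim(1) nN by (auto simp: transverse_simplex_def Euclidean_set_def)
qed

lemma free_homology_generator_transverse_simplex:
  assumes A: "is_open_box N A" and nN: "n \<le> N" and q: "q \<in> A \<inter> coord_subspace n" and r: "r > 0"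
    and im: "transverse_simplex n q r ` standard_simplex n \<subseteq> A"
  shows "free_homology_generator n (top_of_set A) (- coord_subspace n) (frag_of (transverse_simplex n q r))"
proof -
  have "singular_simplex n (top_of_set A) (transverse_simplex n q r)"
    using singular_transverse_simplex[OF nN, of q r] q im is_open_box_subset[OF A]
    by (auto simp: Euclidean_space_eq singular_simplex_subtopology)
  then have cycle: "singular_relcycle n (top_of_set A) (- coord_subspace n) (frag_of (transverse_simplex n q r))"
    by (rule singular_relcycle_of_simplex) (use transverse_simplex_boundary r in auto)
  have "continuous_map (top_of_set A) (Euclidean_space n) (take_coords n)"
    "take_coords n \<in> topspace (top_of_set A) \<inter> - coord_subspace n \<rightarrow> - {0}"
    using continuous_on_take_coords[of _ n] take_coords_in_Euclidean_set[of n]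
    by (auto simp: Euclidean_space_eq take_coords_eq_0_iff)
  from free_homology_generator_hom_induced[OF take_coords_open_box_iso[OF A nN q] this cycle] show ?thesis
    using free_homology_generator_homologous[OF free_homology_generator_Euclidean homologous_transverse_simplex[OF r]]
    by (simp only: take_coords_transverse_simplex)
qed

lemma transverse_homology_open_box:
  assumes A: "is_open_box N A" and nN: "n \<le> N" and G: "has_transverse_simplices n A G"
  shows "transverse_homology n A G"
proof (cases "A \<inter> coord_subspace n = {}")
  case True
  then have "topspace (top_of_set A) \<inter> - coord_subspace n = topspace (top_of_set A) \<inter> UNIV"
    by auto
  then have "homology_vanishes p (top_of_set A) (- coord_subspace n)" for p
    using relative_homology_cong(1) homology_vanishes_UNIV by blast
  then show ?thesis
    unfolding transverse_homology_def using homology_vanishes_imp_generated by blast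
next
  case False
  then obtain q where q: "q \<in> A \<inter> coord_subspace n" by blast
  have "\<exists>\<^sub>F r in at_right 0. transverse_simplex n q r \<in> G"
    using G q unfolding has_transverse_simplices_def by blast
  then have "\<exists>\<^sub>F r in at_right 0. (r > 0 \<and> transverse_simplex n q r ` standard_simplex n \<subseteq> A)
      \<and> transverse_simplex n q r \<in> G"
    by (intro frequently_eventually_conj eventually_conj eventually_at_right_less
        eventually_transverse_simplex_in_open_box[OF A nN q])
  then obtain r where r: "transverse_simplex n q r \<in> G" "r > 0"
      "transverse_simplex n q r ` standard_simplex n \<subseteq> A"
    using frequently_ex by blast
  have "homology_generated_by n (top_of_set A) (- coord_subspace n) G"
    unfolding homology_generated_by_def
  proof (intro allI impI)
    fix z assume "singular_relcycle n (top_of_set A) (- coord_subspace n) z"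
    from free_homology_generatorD(2)[OF free_homology_generator_transverse_simplex[OF A nN q r(2,3)] this]
    obtain a where "homologous_rel n (top_of_set A) (- coord_subspace n) z
        (frag_cmul a (frag_of (transverse_simplex n q r)))" by blast
    moreover have "Poly_Mapping.keys (frag_cmul a (frag_of (transverse_simplex n q r))) \<subseteq> G"
      using keys_cmul[of a "frag_of (transverse_simplex n q r)"] r(1) by auto
    ultimately show "\<exists>c. Poly_Mapping.keys c \<subseteq> G \<and> homologous_rel n (top_of_set A) (- coord_subspace n) z c"
      by blast
  qed
  moreover have "homology_vanishes p (top_of_set A) (- coord_subspace n)" if "p \<noteq> n" for p
    using homology_vanishes_iso[OF take_coords_open_box_iso[OF A nN q]] homology_vanishes_Euclidean[OF that] by blast
  ultimately show ?thesis
    unfolding transverse_homology_def by (simp add: homology_vanishes_imp_generated)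
qed

lemma transverse_homology_Un:
  assumes op: "openin (Euclidean_space N) A" "openin (Euclidean_space N) B"
    and AB: "transverse_homology n A G" "transverse_homology n B G" "transverse_homology n (A \<inter> B) G"
  shows "transverse_homology n (A \<union> B) G"
  unfolding transverse_homology_def
proof (intro allI impI)
  fix p assume p: "p \<le> n"
  let ?X = "top_of_set (A \<union> B)"
  have sub: "subtopology ?X A = top_of_set A" "subtopology ?X B = top_of_set B"
    "subtopology ?X (A \<inter> B) = top_of_set (A \<inter> B)"
    by (auto simp: subtopology_subtopology intro: arg_cong[where f = top_of_set])
  have "openin ?X A" "openin ?X B"
    using op unfolding Euclidean_space_eq
    by (metis openin_subset openin_subset_trans topspace_euclidean_subtopology Un_upper1 Un_upper2 Un_least)+
  moreover have "p = 0 \<or> homology_vanishes (p - 1) (subtopology ?X (A \<inter> B)) (- coord_subspace n)"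
    using AB(3) p unfolding transverse_homology_def sub homology_vanishes_iff_generated_by_empty
    by (cases p) (auto dest: spec[of _ "p - 1"])
  ultimately show "homology_generated_by p ?X (- coord_subspace n) (if p = n then G else {})"
    using AB(1,2) p by (intro homology_generated_by_Un[of ?X A B p]) (auto simp: transverse_homology_def sub)
qed

lemma transverse_homology_Union_open_boxes:
  assumes "finite \<B>" "\<And>B. B \<in> \<B> \<Longrightarrow> is_open_box N B" "n \<le> N" "has_transverse_simplices n (\<Union>\<B>) G"
    and "is_open_box N C"
  shows "transverse_homology n (C \<inter> \<Union>\<B>) G"
  using assms(1,2,4,5)
proof (induction \<B> arbitrary: C rule: finite_induct)
  case empty
  then show ?case
    unfolding transverse_homology_def
    by (auto simp: homology_generated_by_def singular_relcycle singular_chain_empty)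
next
  case (insert B \<B>)
  have sub: "has_transverse_simplices n A G" if "A \<subseteq> \<Union>(insert B \<B>)" for A
    using insert.prems(2) that unfolding has_transverse_simplices_def by blast
  have IH: "transverse_homology n (D \<inter> \<Union>\<B>) G" if "is_open_box N D" for D
    by (rule insert.IH) (use insert.prems that sub in auto)
  have CB: "is_open_box N (C \<inter> B)"
    using is_open_box_Int insert.prems by blast
  have "openin (Euclidean_space N) (C \<inter> \<Union>\<B>)"
    using insert.prems(1,3) by (intro openin_Int openin_Union) (auto simp: is_open_box_imp_openin)
  then have "transverse_homology n ((C \<inter> B) \<union> (C \<inter> \<Union>\<B>)) G"
  proof (rule transverse_homology_Un[OF is_open_box_imp_openin[OF CB]])
    show "transverse_homology n (C \<inter> B) G"
      by (rule transverse_homology_open_box[OF CB assms(3)]) (use sub in auto)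
    have "C \<inter> B \<inter> (C \<inter> \<Union>\<B>) = (C \<inter> B) \<inter> \<Union>\<B>" by blast
    then show "transverse_homology n (C \<inter> B \<inter> (C \<inter> \<Union>\<B>)) G"
      using IH[OF CB] by simp
  qed (rule IH[OF insert.prems(3)])
  then show ?case
    by (simp add: Int_Un_distrib)
qed

theorem transverse_homology_open:
  assumes nN: "n \<le> N" and A: "openin (Euclidean_space N) A" and G: "has_transverse_simplices n A G"
  shows "transverse_homology n A G"
  unfolding transverse_homology_def
proof (intro allI impI homology_generated_by_compact_support)
  fix p K assume p: "p \<le> n" and K: "compactin (top_of_set A) K"
  have AN: "A \<subseteq> Euclidean_set N"
    using openin_subset[OF A] by (simp add: Euclidean_space_eq)
  then have "top_of_set A = subtopology (Euclidean_space N) A"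
    by (simp add: Euclidean_space_eq subtopology_subtopology Int_absorb1)
  then have KA: "compactin (Euclidean_space N) K" "K \<subseteq> A"
    using K by (auto simp: compactin_subtopology)
  let ?\<C> = "{B. B \<subseteq> A \<and> is_open_box N B}"
  have "K \<subseteq> \<Union>?\<C>"
  proof
    fix y assume "y \<in> K"
    then obtain B where "is_open_box N B" "y \<in> B" "B \<subseteq> A"
      using open_box_neighbourhood[OF A, of y] KA(2) by blast
    then show "y \<in> \<Union>?\<C>" by blast
  qed
  then obtain \<F> where \<F>: "finite \<F>" "\<F> \<subseteq> ?\<C>" "K \<subseteq> \<Union>\<F>"
    using compactinD[OF KA(1), of ?\<C>] is_open_box_imp_openin by auto
  then have \<F>A: "\<Union>\<F> \<subseteq> A"
    by blast
  have "transverse_homology n (Euclidean_set N \<inter> \<Union>\<F>) G"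
    by (rule transverse_homology_Union_open_boxes[OF \<F>(1) _ nN _ is_open_box_Euclidean_set])
      (use \<F>(2) \<F>A G in \<open>auto simp: has_transverse_simplices_def\<close>)
  moreover have "Euclidean_set N \<inter> \<Union>\<F> = \<Union>\<F>" "subtopology (top_of_set A) (\<Union>\<F>) = top_of_set (\<Union>\<F>)"
    using \<F>A AN by (auto simp: subtopology_subtopology Int_absorb1)
  ultimately show "\<exists>B. K \<subseteq> B \<and> homology_generated_by p (subtopology (top_of_set A) B) (- coord_subspace n)
      (if p = n then G else {})"
    using \<F>(3) p unfolding transverse_homology_def by metis
qed

section \<open>Cocycles from functionals on relative homology\<close>

definition relative_contraction :: "nat \<Rightarrow> 'a topology \<Rightarrow> 'a set \<Rightarrow> ('a chain \<Rightarrow> 'a chain) \<Rightarrow> bool" where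
  "relative_contraction n X S s \<longleftrightarrow> (\<forall>a b. s (a + b) = s a + s b) \<and>
     (\<forall>c. singular_chain (n - 1) X c \<longrightarrow> singular_chain n X (s c)) \<and>
     (\<forall>c. singular_chain (n - 1) (subtopology X S) c \<longrightarrow> s c = 0) \<and>
     (\<forall>c. singular_chain n X c \<longrightarrow> singular_relcycle n X S (c - s (chain_boundary n c)))"

lemma relative_contraction_0: "relative_contraction 0 X S (\<lambda>_. 0)"
  by (simp add: relative_contraction_def singular_relcycle chain_boundary_def)

lemma relative_contraction_simplex:
  assumes s: "relative_contraction n X S s" and van: "homology_vanishes n X S" and f: "singular_simplex n X f"
  shows "\<exists>d. singular_chain (Suc n) X d \<and>
    singular_chain n (subtopology X S) (frag_of f - s (chain_boundary n (frag_of f)) - chain_boundary (Suc n) d) \<and>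
    (singular_simplex n (subtopology X S) f \<longrightarrow> d = 0)"
proof (cases "singular_simplex n (subtopology X S) f")
  case True
  have "s 0 + s 0 = s 0"
    using s unfolding relative_contraction_def by (metis add_0)
  then have "s (chain_boundary n (frag_of f)) = 0"
    using s True singular_chain_boundary[of n "subtopology X S" "frag_of f"]
    by (simp add: relative_contraction_def singular_chain_of)
  then show ?thesis
    using True by (intro exI[of _ 0]) (simp add: singular_chain_of)
next
  case False
  have "singular_relboundary n X S (frag_of f - s (chain_boundary n (frag_of f)))"
    using s van f by (simp add: relative_contraction_def homology_vanishes_def singular_chain_of)
  then obtain d e where d: "singular_chain (Suc n) X d" and e: "singular_chain n (subtopology X S) e"
      "chain_boundary (Suc n) d + e = frag_of f - s (chain_boundary n (frag_of f))"
    unfolding singular_relboundary by blast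
  have "frag_of f - s (chain_boundary n (frag_of f)) - chain_boundary (Suc n) d = e"
    using e(2) by (metis add_diff_cancel_left')
  then show ?thesis
    using d e(1) False by auto
qed

lemma relative_contraction_Suc:
  assumes s: "relative_contraction n X S s" and van: "homology_vanishes n X S"
  obtains t where "relative_contraction (Suc n) X S t"
proof -
  have s_diff: "s (a - b) = s a - s b" for a b
    using s unfolding relative_contraction_def by (metis add_diff_cancel diff_add_cancel)
  let ?rest = "\<lambda>g c. c - s (chain_boundary n c) - chain_boundary (Suc n) (frag_extend g c)"
  obtain g where g: "\<And>f. singular_simplex n X f \<Longrightarrow> singular_chain (Suc n) X (g f) \<and>
      singular_chain n (subtopology X S) (?rest g (frag_of f)) \<and> (singular_simplex n (subtopology X S) f \<longrightarrow> g f = 0)"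
    using relative_contraction_simplex[OF assms] unfolding frag_extend_of by metis
  have rest: "singular_chain n (subtopology X S) (?rest g c)" if "singular_chain n X c" for c
    using that unfolding singular_chain_def[of n X]
  proof (induction c rule: frag_induction)
    case (diff a b)
    have "?rest g a - ?rest g b = ?rest g (a - b)"
      by (simp add: frag_extend_diff chain_boundary_diff s_diff)
    then show ?case
      using singular_chain_diff[OF diff] by (simp only:)
  qed (use g s_diff[of 0 0] in simp_all)
  have chain: "singular_chain (Suc n) X (frag_extend g c)" if "singular_chain n X c" for c
    using that g by (intro singular_chain_extend) (auto simp: singular_chain_def)
  have "singular_relcycle (Suc n) X S (c - frag_extend g (chain_boundary (Suc n) c))"
    if c: "singular_chain (Suc n) X c" for c
  proof -
    let ?b = "chain_boundary (Suc n) c"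
    have b: "singular_chain n X ?b" "chain_boundary n ?b = 0"
      using c singular_chain_boundary_alt chain_boundary_boundary_alt by blast+
    then have "singular_chain n (subtopology X S) (?b - chain_boundary (Suc n) (frag_extend g ?b))"
      using rest[OF b(1)] s_diff[of 0 0] by simp
    then show ?thesis
      using b chain c by (simp add: singular_relcycle chain_boundary_diff singular_chain_diff)
  qed
  moreover have "frag_extend g c = 0" if "singular_chain n (subtopology X S) c" for c
    using that g unfolding singular_chain_def
    by (intro frag_extend_eq_0) (auto simp: singular_simplex_subtopology)
  ultimately have "relative_contraction (Suc n) X S (frag_extend g)"
    using chain by (simp add: relative_contraction_def frag_extend_add)
  then show ?thesis
    by (rule that)
qed

lemma relative_contraction_exists:
  assumes "\<And>i. i < n \<Longrightarrow> homology_vanishes i X S"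
  obtains s where "relative_contraction n X S s"
  using assms
proof (induction n arbitrary: thesis)
  case 0
  then show ?case using relative_contraction_0 by blast
next
  case (Suc n)
  then show ?case
    by (metis less_Suc_eq relative_contraction_Suc)
qed

theorem cocycle_of_relative_functional:
  fixes h :: "'a chain \<Rightarrow> int"
  assumes van: "\<And>i. i < n \<Longrightarrow> homology_vanishes i X S"
    and add: "\<And>a b. \<lbrakk>singular_relcycle n X S a; singular_relcycle n X S b\<rbrakk> \<Longrightarrow> h (a + b) = h a + h b"
    and zero: "\<And>a. singular_relboundary n X S a \<Longrightarrow> h a = 0"
  obtains \<phi> where "\<phi> \<in> cocycles n X" "\<And>d. singular_chain n (subtopology X S) d \<Longrightarrow> \<phi> d = 0"
    "\<And>z. singular_relcycle n X S z \<Longrightarrow> \<phi> z = h z"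
proof -
  obtain s where s: "\<And>a b. s (a + b) = s a + s b"
      "\<And>c. singular_chain (n - 1) (subtopology X S) c \<Longrightarrow> s c = 0"
      "\<And>c. singular_chain n X c \<Longrightarrow> singular_relcycle n X S (c - s (chain_boundary n c))"
    using relative_contraction_exists[OF van] unfolding relative_contraction_def by metis
  define \<phi> where "\<phi> = (\<lambda>c\<in>singular_chain_set n X. h (c - s (chain_boundary n c)))"
  have extends: "\<phi> z = h z" if "singular_relcycle n X S z" for z
    using that s(2) by (simp add: \<phi>_def singular_relcycle)
  have "\<phi> (c + d) = \<phi> c + \<phi> d" if "singular_chain n X c" "singular_chain n X d" for c d
    using that add[OF s(3) s(3), of c d]
    by (simp add: \<phi>_def singular_chain_add chain_boundary_add s(1) algebra_simps)
  then have "\<phi> \<in> carrier (cochain_group n X)"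
    by (simp add: cochain_group_carrier_iff \<phi>_def)
  moreover have "\<phi> (chain_boundary (Suc n) e) = 0" if "singular_chain (Suc n) X e" for e
  proof -
    have "singular_relboundary n X S (chain_boundary (Suc n) e)"
      using that singular_relboundary by (metis add.right_neutral singular_chain_0)
    then show ?thesis
      using extends zero singular_relboundary_imp_relcycle by metis
  qed
  then have "coboundary_map n X \<phi> = \<one>\<^bsub>cochain_group (Suc n) X\<^esub>"
    by (auto simp: coboundary_map_def cochain_group_one fun_eq_iff restrict_def)
  ultimately have "\<phi> \<in> cocycles n X"
    by (simp add: cocycles_def)
  moreover have "\<phi> d = 0" if "singular_chain n (subtopology X S) d" for d
    using singular_chain_imp_relboundary[OF that] extends zero singular_relboundary_imp_relcycle by metis
  ultimately show ?thesis
    using extends that by blast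
qed

theorem cocycle_vanishing_on_relcycles_is_coboundary:
  assumes van: "\<And>i. i < n \<Longrightarrow> homology_vanishes i X S"
    and \<delta>: "\<delta> \<in> cocycles n X" and zero: "\<And>z. singular_relcycle n X S z \<Longrightarrow> \<delta> z = 0"
  shows "\<delta> \<in> coboundaries n X"
proof -
  obtain s where s: "\<And>a b. s (a + b) = s a + s b"
      "\<And>c. singular_chain (n - 1) X c \<Longrightarrow> singular_chain n X (s c)"
      "\<And>c. singular_chain n X c \<Longrightarrow> singular_relcycle n X S (c - s (chain_boundary n c))"
    using relative_contraction_exists[OF van] unfolding relative_contraction_def by metis
  have \<delta>_add: "\<delta> (c + d) = \<delta> c + \<delta> d" if "singular_chain n X c" "singular_chain n X d" for c d
    using \<delta> that by (simp add: cocycles_def cochain_group_carrier_iff)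
  have \<delta>_ext: "\<delta> \<in> extensional (singular_chain_set n X)"
    using \<delta> by (simp add: cocycles_def cochain_group_carrier_iff)
  show ?thesis
  proof (cases n)
    case 0
    then have "\<delta> c = 0" if "singular_chain 0 X c" for c
      using zero[of c] that by (simp add: singular_relcycle chain_boundary_def)
    then show ?thesis
      using \<delta>_ext 0 by (auto simp: coboundaries_def cochain_group_one fun_eq_iff restrict_def extensional_def)
  next
    case (Suc m)
    define \<eta> where "\<eta> = (\<lambda>c\<in>singular_chain_set m X. \<delta> (s c))"
    have "\<eta> \<in> carrier (cochain_group m X)"
      using \<delta>_add s(2) Suc by (simp add: cochain_group_carrier_iff \<eta>_def singular_chain_add s(1))
    moreover have "coboundary_map m X \<eta> c = \<delta> c" for c
    proof (cases "singular_chain n X c")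
      case True
      then have b: "singular_chain m X (chain_boundary n c)"
        using Suc singular_chain_boundary_alt by blast
      then have "\<delta> c = \<delta> (c - s (chain_boundary n c)) + \<delta> (s (chain_boundary n c))"
        using \<delta>_add[of "c - s (chain_boundary n c)" "s (chain_boundary n c)"] s(2,3) True Suc
        by (simp add: singular_relcycle)
      then show ?thesis
        using zero[OF s(3)] True b Suc by (simp add: coboundary_map_def \<eta>_def)
    qed (use \<delta>_ext Suc in \<open>simp add: coboundary_map_def extensional_def\<close>)
    then have "coboundary_map m X \<eta> = \<delta>" by (rule ext)
    ultimately show ?thesis
      using Suc by (auto simp: coboundaries_def)
  qed
qed

section \<open>Closed subsets that are linear in a chart, away from a negligible set\<close>

locale linear_chart =
  fixes X :: "'a topology" and N n :: nat and U :: "'a set" and A :: "(nat \<Rightarrow> real) set"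
    and \<theta> :: "'a \<Rightarrow> nat \<Rightarrow> real" and \<psi> :: "(nat \<Rightarrow> real) \<Rightarrow> 'a"
  assumes nN: "n \<le> N" and openU: "openin X U" and openA: "openin (Euclidean_space N) A"
    and homeo: "homeomorphic_maps (subtopology X U) (top_of_set A) \<theta> \<psi>"
begin

definition has_normal_simplices :: "'a set \<Rightarrow> ((nat \<Rightarrow> real) \<Rightarrow> 'a) set \<Rightarrow> bool" where
  "has_normal_simplices W G \<longleftrightarrow> (\<forall>x \<in> W \<inter> U. \<theta> x \<in> coord_subspace n \<longrightarrow>
     (\<exists>\<^sub>F r in at_right 0. simplex_map n \<psi> (transverse_simplex n (\<theta> x) r) \<in> G))"

lemma chart_inverse: "x \<in> U \<Longrightarrow> \<psi> (\<theta> x) = x" "y \<in> A \<Longrightarrow> \<theta> (\<psi> y) = y" "x \<in> U \<Longrightarrow> \<theta> x \<in> A" "y \<in> A \<Longrightarrow> \<psi> y \<in> U"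
  using homeo openin_subset[OF openU] unfolding homeomorphic_maps_def continuous_map_def by auto

lemma homeomorphic_map_chart:
  assumes "openin X W" "W \<subseteq> U"
  shows "homeomorphic_map (top_of_set (\<theta> ` W)) (subtopology X W) \<psi>" "openin (Euclidean_space N) (\<theta> ` W)"
proof -
  have W: "\<theta> ` W \<subseteq> A" "subtopology (subtopology X U) W = subtopology X W"
      "subtopology (top_of_set A) (\<theta> ` W) = top_of_set (\<theta> ` W)"
    using assms chart_inverse(3) by (auto simp: subtopology_subtopology Int_absorb1 intro!: arg_cong[where f = top_of_set])
  have \<psi>: "homeomorphic_map (top_of_set A) (subtopology X U) \<psi>"
    using homeo homeomorphic_map_maps homeomorphic_maps_sym by blast
  have "\<psi> ` \<theta> ` W = W"
    using assms(2) chart_inverse(1) by (force simp: image_image)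
  then have "\<psi> ` (topspace (top_of_set A) \<inter> \<theta> ` W) = topspace (subtopology X U) \<inter> W"
    using W(1) assms openin_subset[OF openU] by (simp add: Int_absorb1 Int_absorb2)
  from homeomorphic_map_subtopologies[OF \<psi> this]
  show "homeomorphic_map (top_of_set (\<theta> ` W)) (subtopology X W) \<psi>"
    unfolding W .
  have "openin (subtopology X U) W"
    using assms openU openin_open_subtopology by blast
  then have "openin (top_of_set A) (\<theta> ` W)"
    using homeo homeomorphic_map_maps homeomorphic_map_openness_eq by blast
  moreover have "top_of_set A = subtopology (Euclidean_space N) A"
    using openin_subset[OF openA] by (simp add: Euclidean_space_eq subtopology_subtopology Int_absorb1)
  ultimately show "openin (Euclidean_space N) (\<theta> ` W)"
    using openA openin_open_subtopology by metis
qed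

theorem homology_in_chart:
  assumes W: "openin X W" "W \<subseteq> U" and Z: "\<And>x. x \<in> U \<Longrightarrow> x \<in> Z \<longleftrightarrow> \<theta> x \<in> coord_subspace n"
    and G: "has_normal_simplices W G" and p: "p \<le> n"
  shows "homology_generated_by p (subtopology X W) (- Z) (if p = n then G else {})"
proof -
  let ?B = "\<theta> ` W" and ?L = "coord_subspace n" and ?G = "{\<sigma>. simplex_map n \<psi> \<sigma> \<in> G}"
  note \<psi> = homeomorphic_map_chart(1)[OF W]
  have image: "\<psi> ` (?B \<inter> - ?L) = topspace (subtopology X W) \<inter> - Z"
    using W openin_subset[OF W(1)] Z chart_inverse(1) by (force simp: image_iff)
  have "hom_induced p (top_of_set ?B) (- ?L) (subtopology X W) (- Z) \<psi>
      \<in> iso (relative_homology_group p (top_of_set ?B) (- ?L)) (relative_homology_group p (subtopology X W) (- Z))"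
    using homeomorphic_map_relative_homology_iso[OF \<psi> _ image]
      hom_induced_cong[of "top_of_set ?B" "?B \<inter> - ?L" "- ?L" "subtopology X W" "topspace (subtopology X W) \<inter> - Z" "- Z"]
      relative_homology_cong(4)[of "top_of_set ?B" "?B \<inter> - ?L" "- ?L"]
      relative_homology_cong(4)[of "subtopology X W" "topspace (subtopology X W) \<inter> - Z" "- Z"]
    by auto
  moreover have "continuous_map (top_of_set ?B) (subtopology X W) \<psi>" "\<psi> \<in> topspace (top_of_set ?B) \<inter> - ?L \<rightarrow> - Z"
    using homeomorphic_imp_continuous_map[OF \<psi>] image by auto
  moreover have "transverse_homology n ?B ?G"
    using transverse_homology_open[OF nN homeomorphic_map_chart(2)[OF W]] G W(2)
    by (force simp: has_transverse_simplices_def has_normal_simplices_def)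
  then have "homology_generated_by p (top_of_set ?B) (- ?L) {\<sigma>. simplex_map p \<psi> \<sigma> \<in> (if p = n then G else {})}"
    using p unfolding transverse_homology_def by (cases "p = n") auto
  ultimately show ?thesis
    by (rule homology_generated_by_iso)
qed

corollary homology_vanishes_in_chart:
  assumes "openin X W" "W \<subseteq> U" "\<And>x. x \<in> U \<Longrightarrow> x \<in> Z \<longleftrightarrow> \<theta> x \<in> coord_subspace n" "p < n"
  shows "homology_vanishes p (subtopology X W) (- Z)"
  using homology_in_chart[OF assms(1-3), of UNIV p] assms(4)
  by (simp add: homology_vanishes_iff_generated_by_empty has_normal_simplices_def)

end

locale linear_chart_pair = linear_chart +
  fixes Z S :: "'a set"
  assumes closedZ: "closedin X Z" and SZ: "S \<subseteq> Z" and US: "U \<inter> S = {}" and ZU: "Z - S \<subseteq> U"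
    and Z_chart: "\<And>x. x \<in> U \<Longrightarrow> x \<in> Z \<longleftrightarrow> \<theta> x \<in> coord_subspace n"
    and S_negligible: "\<And>p W. \<lbrakk>p \<le> Suc n; openin X W\<rbrakk> \<Longrightarrow> homology_vanishes p (subtopology X W) (- S)"
begin

theorem restrict_to_chart_iso:
  assumes W: "openin X W" and p: "p \<le> n"
  shows "hom_induced p (subtopology X (W \<inter> U)) (- Z) (subtopology X W) (- Z) id
    \<in> iso (relative_homology_group p (subtopology X (W \<inter> U)) (- Z)) (relative_homology_group p (subtopology X W) (- Z))"
proof -
  let ?Y = "subtopology X (W \<inter> - S)"
  have sub: "subtopology ?Y U = subtopology X (W \<inter> U)" "subtopology (subtopology X W) (- S) = ?Y"
    using US by (auto simp: subtopology_subtopology intro: arg_cong[where f = "subtopology X"])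
  have "openin ?Y (topspace ?Y \<inter> U)" "closedin ?Y (topspace ?Y \<inter> Z)"
    using openU closedZ by (simp_all add: openin_subtopology closedin_subtopology) blast+
  moreover have "topspace ?Y \<inter> Z \<subseteq> U"
    using ZU by auto
  ultimately have exc: "hom_induced p (subtopology X (W \<inter> U)) (- Z) ?Y (- Z) id
      \<in> iso (relative_homology_group p (subtopology X (W \<inter> U)) (- Z)) (relative_homology_group p ?Y (- Z))"
    using excision_iso[of ?Y U Z] unfolding sub by blast
  have "hom_induced p ?Y (- Z) (subtopology X W) (- Z) id
      \<in> iso (relative_homology_group p ?Y (- Z)) (relative_homology_group p (subtopology X W) (- Z))"
    using inclusion_iso_triple[of "- Z" "- S" p "subtopology X W"] SZ S_negligible[OF _ W] p unfolding sub by simp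
  moreover have "continuous_map (subtopology X (W \<inter> U)) ?Y id" "continuous_map ?Y (subtopology X W) id"
    using US by (auto simp: continuous_map_in_subtopology intro!: continuous_map_from_subtopology)
  then have "hom_induced p ?Y (- Z) (subtopology X W) (- Z) id \<circ> hom_induced p (subtopology X (W \<inter> U)) (- Z) ?Y (- Z) id
      = hom_induced p (subtopology X (W \<inter> U)) (- Z) (subtopology X W) (- Z) id"
    using hom_induced_compose[of "subtopology X (W \<inter> U)" ?Y id "- Z" "- Z" "subtopology X W" id "- Z" p] by simp
  ultimately show ?thesis
    using iso_set_trans[OF exc] by metis
qed

theorem homology_vanishes_below_codim:
  assumes "openin X W" "p < n" shows "homology_vanishes p (subtopology X W) (- Z)"
  using homology_vanishes_iso[OF restrict_to_chart_iso[OF assms(1)], of p] assms(2)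
    homology_vanishes_in_chart[OF openin_Int[OF assms(1) openU] _ Z_chart] by simp

theorem homology_generated_by_normal_simplices:
  assumes W: "openin X W" and G: "has_normal_simplices W G"
  shows "homology_generated_by n (subtopology X W) (- Z) G"
proof (rule homology_generated_by_iso[OF restrict_to_chart_iso[OF W order_refl]])
  have "simplex_map n id (simplex_map n \<psi> \<tau>) = simplex_map n \<psi> \<tau>" for \<tau>
    by (auto simp: simplex_map_def)
  then have "has_normal_simplices (W \<inter> U) {\<sigma>. simplex_map n id \<sigma> \<in> G}"
    using G by (simp add: has_normal_simplices_def)
  then show "homology_generated_by n (subtopology X (W \<inter> U)) (- Z) {\<sigma>. simplex_map n id \<sigma> \<in> G}"
    using homology_in_chart[OF openin_Int[OF W openU] _ Z_chart, of _ n] by simp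
qed (auto intro: continuous_map_from_subtopology simp: continuous_map_in_subtopology)

definition normal_coords :: "'a \<Rightarrow> nat \<Rightarrow> real" where
  "normal_coords x = take_coords n (\<theta> x)"

lemma continuous_map_normal_coords: "continuous_map (subtopology X U) (Euclidean_space n) normal_coords"
proof -
  have "continuous_map (top_of_set A) (Euclidean_space n) (take_coords n)"
    unfolding Euclidean_space_eq using continuous_on_take_coords[of A n] take_coords_in_Euclidean_set[of n] by auto
  then show ?thesis
    unfolding normal_coords_def[abs_def] using homeo continuous_map_compose[unfolded o_def]
    unfolding homeomorphic_maps_def by blast
qed

lemma normal_coords_eq_0_iff: "x \<in> U \<Longrightarrow> normal_coords x = 0 \<longleftrightarrow> x \<in> Z"
  using Z_chart by (simp add: normal_coords_def take_coords_eq_0_iff)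

theorem local_degree_extends:
  obtains h :: "'a chain \<Rightarrow> int" where
    "\<And>a b. \<lbrakk>singular_relcycle n X (- Z) a; singular_relcycle n X (- Z) b\<rbrakk> \<Longrightarrow> h (a + b) = h a + h b"
    "\<And>a. singular_relboundary n X (- Z) a \<Longrightarrow> h a = 0"
    "\<And>e. singular_relcycle n (subtopology X U) (- Z) e \<Longrightarrow> h e = local_degree n (chain_map n normal_coords e)"
proof -
  let ?d = "\<lambda>e. local_degree n (chain_map n normal_coords e)" and ?X = "subtopology X U"
  have off: "normal_coords \<in> topspace ?X \<inter> - Z \<rightarrow> - {0}"
    using normal_coords_eq_0_iff by auto
  note cycle = singular_relcycle_chain_map_gen[OF _ continuous_map_normal_coords off]
  have "hom_induced (int n) ?X (- Z) X (- Z) id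
      \<in> iso (relative_homology_group (int n) ?X (- Z)) (relative_homology_group (int n) X (- Z))"
    using restrict_to_chart_iso[of "topspace X" n] openin_subset[OF openU] by (simp add: Int_absorb1)
  moreover have "continuous_map ?X X id" "id \<in> topspace ?X \<inter> - Z \<rightarrow> - Z"
    by (auto intro: continuous_map_from_subtopology)
  moreover have "?d (a + b) = ?d a + ?d b" if "singular_relcycle n ?X (- Z) a" "singular_relcycle n ?X (- Z) b" for a b
    using that cycle by (simp add: chain_map_add local_degree_add)
  moreover have "?d a = 0" if "singular_relboundary n ?X (- Z) a" for a
    using homologous_rel_chain_map[OF _ continuous_map_normal_coords off, of n a 0] that
    by (simp add: homologous_rel_def local_degree_relboundary)
  ultimately show ?thesis
  proof (rule functional_along_iso[where h = ?d])
    fix h :: "'a chain \<Rightarrow> int"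
    assume additive: "\<And>a b. \<lbrakk>singular_relcycle n X (- Z) a; singular_relcycle n X (- Z) b\<rbrakk> \<Longrightarrow> h (a + b) = h a + h b"
      and zero: "\<And>a. singular_relboundary n X (- Z) a \<Longrightarrow> h a = 0"
      and h: "\<And>e. singular_relcycle n ?X (- Z) e \<Longrightarrow> h (chain_map n id e) = ?d e"
    have "h e = ?d e" if "singular_relcycle n ?X (- Z) e" for e
      using h[OF that] chain_map_ident[of n ?X e] that by (simp add: singular_relcycle)
    with additive zero show thesis
      by (rule that)
  qed
qed

end

section \<open>Rank sets and their dimension\<close>

definition interval_rank :: "(nat \<times> nat) set \<Rightarrow> nat \<Rightarrow> nat \<Rightarrow> nat" where
  "interval_rank M p q = card {x \<in> M. p \<le> fst x \<and> snd x \<le> q}"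

text \<open>The dimension of the rank variety of \<open>M\<close>, computed from the cell of \<open>M\<close>: a row
  supported in \<open>[a, b]\<close> matters modulo the rows supported in smaller intervals.\<close>

definition rank_dim :: "(nat \<times> nat) set \<Rightarrow> int" where
  "rank_dim M = (\<Sum>x\<in>M. int (Suc (snd x) - fst x) - int (interval_rank M (fst x) (snd x)))"

lemma rank_setD:
  assumes "rank_set M"
  shows "finite M" "inj_on fst M" "inj_on snd M" "x \<in> M \<Longrightarrow> 1 \<le> fst x" "x \<in> M \<Longrightarrow> fst x \<le> snd x"
  using assms unfolding rank_set_def by auto

lemma card_intervals_in:
  assumes "rank_set M" shows "card (intervals_in {p..q} M) = interval_rank M p q"
proof -
  have "{a..b} \<subseteq> {p..q} \<longleftrightarrow> p \<le> a \<and> b \<le> q" if "(a, b) \<in> M" for a b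
    using rank_setD(5)[OF assms that] by simp
  then have "intervals_in {p..q} M = {x \<in> M. p \<le> fst x \<and> snd x \<le> q}"
    unfolding intervals_in_def by (auto simp del: atLeastatMost_subset_iff)
  then show ?thesis by (simp add: interval_rank_def)
qed

lemma interval_rank_0:
  assumes "rank_set M" shows "interval_rank M p 0 = 0"
proof -
  have "{x \<in> M. p \<le> fst x \<and> snd x \<le> 0} = {}"
    using rank_setD(4,5)[OF assms] by fastforce
  then show ?thesis
    unfolding interval_rank_def by (simp only: card.empty)
qed

lemma interval_rank_eq_sum:
  "finite M \<Longrightarrow> int (interval_rank M p q) = (\<Sum>x\<in>M. of_bool (p \<le> fst x \<and> snd x \<le> q))"
  by (simp add: interval_rank_def Int_def)

lemma interval_rank_second_difference:
  assumes "finite M"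
  shows "of_bool ((p, Suc q) \<in> M) = int (interval_rank M p (Suc q)) - int (interval_rank M (Suc p) (Suc q))
    - int (interval_rank M p q) + int (interval_rank M (Suc p) q)"
proof -
  have "int (interval_rank M p (Suc q)) - int (interval_rank M (Suc p) (Suc q)) - int (interval_rank M p q)
      + int (interval_rank M (Suc p) q) = (\<Sum>x\<in>M. if x = (p, Suc q) then 1 else 0)"
    unfolding interval_rank_eq_sum[OF assms] sum_subtractf[symmetric] sum.distrib[symmetric]
    by (intro sum.cong refl) (auto simp: of_bool_def)
  then show ?thesis using assms by simp
qed

lemma interval_rank_inject:
  assumes N: "rank_set N" "rank_set N'" and eq: "\<And>p q. interval_rank N p q = interval_rank N' p q"
  shows "N = N'"
proof -
  have "x \<in> N \<longleftrightarrow> x \<in> N'" for x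
  proof (cases "snd x")
    case 0
    then show ?thesis
      using rank_setD(4,5)[OF N(1), of x] rank_setD(4,5)[OF N(2), of x] by auto
  next
    case (Suc q)
    then have x: "x = (fst x, Suc q)" by (simp add: prod_eq_iff)
    have "(of_bool ((fst x, Suc q) \<in> N) :: int) = of_bool ((fst x, Suc q) \<in> N')"
      by (simp only: interval_rank_second_difference[OF rank_setD(1)] N eq)
    then show ?thesis using x by (metis of_bool_eq_iff)
  qed
  then show ?thesis by blast
qed

text \<open>At the largest \<open>p\<close> and then the smallest \<open>q\<close> where the ranks differ, the second difference
  shows that \<open>[p, q]\<close> itself belongs to \<open>N'\<close> only.\<close>

lemma interval_rank_less_at_member:
  assumes N: "rank_set N" "rank_set N'" and le: "\<And>p q. interval_rank N p q \<le> interval_rank N' p q" and "N \<noteq> N'"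
  obtains x where "x \<in> N'" "interval_rank N (fst x) (snd x) < interval_rank N' (fst x) (snd x)"
proof -
  let ?differ = "\<lambda>p q. interval_rank N p q < interval_rank N' p q"
  have bound: "p \<le> Max (fst ` N')" if differ: "?differ p q" for p q
  proof -
    from differ have "0 < card {x \<in> N'. p \<le> fst x \<and> snd x \<le> q}"
      unfolding interval_rank_def by linarith
    then obtain x where x: "x \<in> N'" "p \<le> fst x"
      unfolding card_gt_0_iff by blast
    then have "fst x \<le> Max (fst ` N')"
      using rank_setD(1)[OF N(2)] by (intro Max_ge) auto
    with x(2) show ?thesis by (rule order_trans)
  qed
  obtain p0 where p0: "\<exists>q. ?differ p0 q"
    using interval_rank_inject[OF N] le \<open>N \<noteq> N'\<close> by (metis le_neq_implies_less)
  obtain p where p: "\<exists>q. ?differ p q" "\<forall>p'. (\<exists>q. ?differ p' q) \<longrightarrow> p' \<le> p"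
    using ex_has_greatest_nat[of "\<lambda>p. \<exists>q. ?differ p q" p0 "\<lambda>p. p" "Suc (Max (fst ` N'))", OF p0] bound
    by (auto simp: less_Suc_eq_le)
  define q where "q = (LEAST q. ?differ p q)"
  have q: "?differ p q"
    unfolding q_def using p(1) by (rule LeastI_ex)
  have below: "\<not> ?differ p q'" if "q' < q" for q'
    using that unfolding q_def by (rule not_less_Least)
  from q obtain q' where q': "q = Suc q'"
    using interval_rank_0[OF N(2)] by (cases q) auto
  have "\<not> ?differ (Suc p) r" for r
    using p(2) Suc_n_not_le_n by blast
  then have "interval_rank N (Suc p) r = interval_rank N' (Suc p) r" "interval_rank N p q' = interval_rank N' p q'" for r
    using le[of "Suc p" r] le[of p q'] below[of q'] q' by (auto intro: antisym simp: not_less)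
  then have "of_bool ((p, q) \<in> N') > (of_bool ((p, q) \<in> N) :: int)"
    using q unfolding q' interval_rank_second_difference[OF rank_setD(1)[OF N(1)]]
      interval_rank_second_difference[OF rank_setD(1)[OF N(2)]] by simp
  then have "(p, q) \<in> N'"
    by (auto simp: of_bool_def split: if_splits)
  then show ?thesis
    using that[of "(p, q)"] q by simp
qed

lemma rank_dim_eq:
  assumes M: "rank_set M" and D: "\<forall>x\<in>M. snd x \<le> D"
  shows "rank_dim M = int (card M) * (int D + 1) - (\<Sum>d<D. int (interval_rank M 0 d))
    - (\<Sum>c\<le>D. int (interval_rank M (Suc c) D)) - (\<Sum>x\<in>M. int (interval_rank M (fst x) (snd x)))"
proof -
  have length: "int (Suc (snd x) - fst x) = (int D + 1) - (\<Sum>d<D. of_bool (0 \<le> fst x \<and> snd x \<le> d))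
      - (\<Sum>c\<le>D. of_bool (Suc c \<le> fst x \<and> snd x \<le> D))" if x: "x \<in> M" for x
  proof -
    have b: "1 \<le> fst x" "fst x \<le> snd x" "snd x \<le> D"
      using rank_setD(4,5)[OF M x] D x by auto
    then have "{..<D} \<inter> {d. snd x \<le> d} = {snd x..<D}" "{..D} \<inter> {c. Suc c \<le> fst x} = {..<fst x}"
      by auto
    then show ?thesis using b by (simp add: of_nat_diff)
  qed
  have "rank_dim M = (\<Sum>x\<in>M. int (Suc (snd x) - fst x)) - (\<Sum>x\<in>M. int (interval_rank M (fst x) (snd x)))"
    unfolding rank_dim_def by (rule sum_subtractf)
  also have "(\<Sum>x\<in>M. int (Suc (snd x) - fst x)) = (\<Sum>x\<in>M. (int D + 1)
      - (\<Sum>d<D. of_bool (0 \<le> fst x \<and> snd x \<le> d)) - (\<Sum>c\<le>D. of_bool (Suc c \<le> fst x \<and> snd x \<le> D)))"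
    by (intro sum.cong refl length)
  also have "\<dots> = int (card M) * (int D + 1) - (\<Sum>d<D. int (interval_rank M 0 d))
      - (\<Sum>c\<le>D. int (interval_rank M (Suc c) D))"
    unfolding sum_subtractf interval_rank_eq_sum[OF rank_setD(1)[OF M]] sum.swap[of _ M] by simp
  finally show ?thesis .
qed

lemma sum_interval_rank_other:
  assumes M: "rank_set M" and L: "rank_set L" and D: "\<forall>x\<in>M. snd x \<le> D"
  shows "(\<Sum>x\<in>M. int (interval_rank L (fst x) (snd x)))
    = (\<Sum>y\<in>L. int (card M) - int (interval_rank M (Suc (fst y)) D) - int (interval_rank M 0 (snd y - 1))
        + int (interval_rank M (Suc (fst y)) (snd y - 1)))"
proof -
  have "(\<Sum>x\<in>M. int (interval_rank L (fst x) (snd x))) = (\<Sum>y\<in>L. \<Sum>x\<in>M. of_bool (fst x \<le> fst y \<and> snd y \<le> snd x))"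
    unfolding interval_rank_eq_sum[OF rank_setD(1)[OF L]] by (rule sum.swap)
  also have "\<dots> = (\<Sum>y\<in>L. \<Sum>x\<in>M. 1 - of_bool (Suc (fst y) \<le> fst x \<and> snd x \<le> D)
      - of_bool (0 \<le> fst x \<and> snd x \<le> snd y - 1) + of_bool (Suc (fst y) \<le> fst x \<and> snd x \<le> snd y - 1))"
  proof (intro sum.cong refl)
    fix x y assume "y \<in> L" "x \<in> M"
    then have "1 \<le> snd y" "snd x \<le> D"
      using rank_setD(4,5)[OF L, of y] D by auto
    then show "(of_bool (fst x \<le> fst y \<and> snd y \<le> snd x) :: int) = 1 - of_bool (Suc (fst y) \<le> fst x \<and> snd x \<le> D)
        - of_bool (0 \<le> fst x \<and> snd x \<le> snd y - 1) + of_bool (Suc (fst y) \<le> fst x \<and> snd x \<le> snd y - 1)"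
      by (auto simp: of_bool_def)
  qed
  finally show ?thesis
    unfolding sum.distrib sum_subtractf interval_rank_eq_sum[OF rank_setD(1)[OF M]] by simp
qed

lemma sum_over_endpoints_le:
  fixes g :: "nat \<Rightarrow> int"
  assumes N: "rank_set N" and D: "\<forall>x\<in>N. snd x \<le> D" and g: "\<And>i. 0 \<le> g i"
  shows "(\<Sum>x\<in>N. g (fst x)) \<le> (\<Sum>c\<le>D. g c)" "(\<Sum>x\<in>N. g (snd x - 1)) \<le> (\<Sum>d<D. g d)"
proof -
  have "(\<Sum>c\<in>fst ` N. g c) \<le> (\<Sum>c\<le>D. g c)"
    using D rank_setD(5)[OF N] g by (intro sum_mono2) (auto intro: order_trans)
  then show "(\<Sum>x\<in>N. g (fst x)) \<le> (\<Sum>c\<le>D. g c)"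
    by (simp add: sum.reindex[OF rank_setD(2)[OF N]])
  have pos: "1 \<le> snd x" if "x \<in> N" for x
    using rank_setD(4,5)[OF N that] by simp
  then have "inj_on (\<lambda>x. snd x - 1) N"
    using rank_setD(3)[OF N] by (intro inj_onI) (metis inj_onD le_add_diff_inverse2)
  moreover have "snd x - 1 < D" if "x \<in> N" for x
    using bspec[OF D that] pos[OF that] by simp
  then have "(\<Sum>d\<in>(\<lambda>x. snd x - 1) ` N. g d) \<le> (\<Sum>d<D. g d)"
    using g by (intro sum_mono2) auto
  ultimately show "(\<Sum>x\<in>N. g (snd x - 1)) \<le> (\<Sum>d<D. g d)"
    by (simp add: sum.reindex)
qed

text \<open>With \<open>f = interval_rank N' - interval_rank N \<ge> 0\<close>, expanding both numbers of nested pairs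
  through the mixed one \<open>(\<Sum>x\<in>N'. interval_rank N x)\<close> shows that \<open>rank_dim N - rank_dim N'\<close> is the
  sum of \<open>f\<close> over \<open>N'\<close> plus nonnegative terms.\<close>

theorem rank_dim_strict_mono:
  assumes N: "rank_set N" "rank_set N'" "card N = card N'"
    and le: "\<And>p q. interval_rank N p q \<le> interval_rank N' p q" and ne: "N \<noteq> N'"
  shows "rank_dim N' < rank_dim N"
proof -
  note fin = rank_setD(1)[OF N(1)] rank_setD(1)[OF N(2)]
  obtain D where "snd ` (N \<union> N') \<subseteq> {..D}"
    using fin finite_nat_iff_bounded_le[of "snd ` (N \<union> N')"] by auto
  then have D: "\<forall>x\<in>N. snd x \<le> D" "\<forall>x\<in>N'. snd x \<le> D" by auto
  define f where "f p q = int (interval_rank N' p q) - int (interval_rank N p q)" for p q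
  have f_nonneg: "0 \<le> f p q" for p q
    using le unfolding f_def by simp
  have "(\<Sum>x\<in>N'. int (interval_rank N (fst x) (snd x))) - (\<Sum>x\<in>N. int (interval_rank N (fst x) (snd x)))
      = (\<Sum>y\<in>N. f (Suc (fst y)) (snd y - 1)) - (\<Sum>y\<in>N. f (Suc (fst y)) D) - (\<Sum>y\<in>N. f 0 (snd y - 1))"
    unfolding sum_interval_rank_other[OF N(2,1) D(2)] sum_interval_rank_other[OF N(1,1) D(1)] N(3)
      sum_subtractf[symmetric] f_def by (intro sum.cong refl) simp
  moreover have "rank_dim N - rank_dim N' = (\<Sum>d<D. f 0 d) + (\<Sum>c\<le>D. f (Suc c) D) + (\<Sum>x\<in>N'. f (fst x) (snd x))
      + ((\<Sum>x\<in>N'. int (interval_rank N (fst x) (snd x))) - (\<Sum>x\<in>N. int (interval_rank N (fst x) (snd x))))"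
    unfolding rank_dim_eq[OF N(1) D(1)] rank_dim_eq[OF N(2) D(2)] N(3) f_def sum_subtractf by simp
  moreover have "(\<Sum>y\<in>N. f (Suc (fst y)) D) \<le> (\<Sum>c\<le>D. f (Suc c) D)"
    "(\<Sum>y\<in>N. f 0 (snd y - 1)) \<le> (\<Sum>d<D. f 0 d)" "0 \<le> (\<Sum>y\<in>N. f (Suc (fst y)) (snd y - 1))"
    using sum_over_endpoints_le(1)[OF N(1) D(1), of "\<lambda>c. f (Suc c) D"]
      sum_over_endpoints_le(2)[OF N(1) D(1), of "f 0"] f_nonneg by (auto intro: sum_nonneg)
  moreover obtain x where "x \<in> N'" "interval_rank N (fst x) (snd x) < interval_rank N' (fst x) (snd x)"
    using interval_rank_less_at_member[OF N(1,2) le ne] by blast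
  then have "0 < (\<Sum>x\<in>N'. f (fst x) (snd x))"
    using f_nonneg fin(2) by (intro sum_pos2[of _ x]) (auto simp: f_def)
  ultimately show ?thesis by linarith
qed

section \<open>Finite families of coordinate vectors\<close>

lemma sum_fun_apply: "(\<Sum>i\<in>T. f i) p = (\<Sum>i\<in>T. f i p :: 'b :: comm_monoid_add)"
  by (induction T rule: infinite_finite_induct) auto

definition lincomb :: "nat set \<Rightarrow> (nat \<Rightarrow> complex) \<Rightarrow> (nat \<Rightarrow> nat \<Rightarrow> complex) \<Rightarrow> nat \<Rightarrow> complex" where
  "lincomb T c v = (\<lambda>p. \<Sum>l\<in>T. c l * v l p)"

definition lin_indep :: "nat set \<Rightarrow> (nat \<Rightarrow> nat \<Rightarrow> complex) \<Rightarrow> bool" where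
  "lin_indep T v \<longleftrightarrow> (\<forall>c. lincomb T c v = 0 \<longrightarrow> (\<forall>l\<in>T. c l = 0))"

lemma lin_indepD: "lin_indep T v \<Longrightarrow> lincomb T c v = 0 \<Longrightarrow> l \<in> T \<Longrightarrow> c l = 0"
  unfolding lin_indep_def by blast

lemma lincomb_eq_sum: "lincomb T c v = (\<Sum>l\<in>T. cscale (c l) (v l))"
  by (simp add: lincomb_def fun_eq_iff sum_fun_apply cscale_def)

lemma lincomb_in_subspace:
  assumes "csubspace W" "v ` T \<subseteq> W" shows "lincomb T c v \<in> W"
  unfolding lincomb_eq_sum using assms by (intro cvec.subspace_sum cvec.subspace_scale) auto

lemma lincomb_cong:
  "\<lbrakk>\<And>l. l \<in> T \<Longrightarrow> c l = c' l; \<And>l. l \<in> T \<Longrightarrow> v l = v' l\<rbrakk> \<Longrightarrow> lincomb T c v = lincomb T c' v'"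
  unfolding lincomb_def by (intro ext sum.cong) auto

lemma lincomb_diff: "lincomb T c v - lincomb T d v = lincomb T (\<lambda>l. c l - d l) v"
  by (simp add: lincomb_def fun_eq_iff sum_subtractf algebra_simps)

lemma lincomb_single:
  assumes "finite T" "i \<in> T" "\<And>l. \<lbrakk>l \<in> T; l \<noteq> i\<rbrakk> \<Longrightarrow> c l * v l p = 0"
  shows "lincomb T c v p = c i * v i p"
proof -
  have "(\<Sum>l\<in>T - {i}. c l * v l p) = 0"
    using assms(3) by (intro sum.neutral) blast
  then show ?thesis
    by (simp add: lincomb_def sum.remove[OF assms(1,2)])
qed

lemma lincomb_restrict:
  "\<lbrakk>finite T; K \<subseteq> T\<rbrakk> \<Longrightarrow> lincomb T (\<lambda>l. if l \<in> K then c l else 0) v = lincomb K c v"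
  unfolding lincomb_def by (intro ext sum.mono_neutral_cong_right) auto

lemma lincomb_split:
  assumes "finite T" "K \<union> C \<subseteq> T" "K \<inter> C = {}" "\<And>l. l \<in> T - (K \<union> C) \<Longrightarrow> c l = 0"
  shows "lincomb T c v = lincomb K c v + lincomb C c v"
proof -
  have "lincomb T c v = lincomb (K \<union> C) c v"
    unfolding lincomb_def using assms by (intro ext sum.mono_neutral_right) auto
  also have "\<dots> = lincomb K c v + lincomb C c v"
    unfolding lincomb_eq_sum using assms by (intro sum.union_disjoint) (auto intro: finite_subset)
  finally show ?thesis .
qed

lemma lincomb_insert:
  "\<lbrakk>finite T; t \<notin> T\<rbrakk> \<Longrightarrow> lincomb (insert t T) c v = cscale (c t) (v t) + lincomb T c v"
  by (simp add: lincomb_eq_sum)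

lemma lincomb_insert_update:
  assumes "finite T" "t \<notin> T" shows "lincomb (insert t T) (c(t := a)) v = cscale a (v t) + lincomb T c v"
proof -
  have "lincomb T (c(t := a)) v = lincomb T c v"
    using assms(2) by (intro lincomb_cong) auto
  then show ?thesis
    using assms by (simp add: lincomb_insert)
qed

lemma in_span_image_iff:
  assumes "finite T" shows "x \<in> cspan (v ` T) \<longleftrightarrow> (\<exists>c. x = lincomb T c v)"
  using assms
proof (induction T arbitrary: x)
  case (insert t T)
  have "x \<in> cspan (v ` insert t T) \<longleftrightarrow> (\<exists>a c. x - cscale a (v t) = lincomb T c v)"
    by (simp add: cvec.span_insert insert.IH fun_diff_def)
  also have "\<dots> \<longleftrightarrow> (\<exists>a c. x = lincomb (insert t T) (c(t := a)) v)"
    by (simp add: lincomb_insert_update[OF insert.hyps] algebra_simps)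
  also have "\<dots> \<longleftrightarrow> (\<exists>c. x = lincomb (insert t T) c v)"
    by (metis fun_upd_triv)
  finally show ?case .
qed (simp add: lincomb_def fun_eq_iff)

lemma lin_indep_insert:
  assumes T: "finite T" "t \<notin> T"
  shows "lin_indep (insert t T) v \<longleftrightarrow> lin_indep T v \<and> v t \<notin> cspan (v ` T)"
proof (intro iffI conjI)
  assume indep: "lin_indep (insert t T) v"
  show "lin_indep T v"
    unfolding lin_indep_def
  proof (intro allI impI ballI)
    fix c l assume "lincomb T c v = 0" and l: "l \<in> T"
    then have "lincomb (insert t T) (c(t := 0)) v = 0"
      using T by (simp add: lincomb_insert_update cvec.scale_zero_left)
    then have "(c(t := 0)) l = 0"
      by (rule lin_indepD[OF indep]) (use l in simp)
    then show "c l = 0"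
      using l T(2) by (auto split: if_splits)
  qed
  show "v t \<notin> cspan (v ` T)"
  proof
    assume "v t \<in> cspan (v ` T)"
    then obtain c where "v t = lincomb T c v"
      using in_span_image_iff T(1) by blast
    then have "lincomb (insert t T) (c(t := - 1)) v = 0"
      using T by (simp add: lincomb_insert_update)
    from lin_indepD[OF indep this, of t] show False by simp
  qed
next
  assume indep: "lin_indep T v \<and> v t \<notin> cspan (v ` T)"
  show "lin_indep (insert t T) v"
    unfolding lin_indep_def
  proof (intro allI impI)
    fix c assume zero: "lincomb (insert t T) c v = 0"
    have "lincomb T c v \<in> cspan (v ` T)"
      using in_span_image_iff T(1) by blast
    moreover have "cscale (c t) (v t) = - lincomb T c v"
      using zero T by (simp add: lincomb_insert eq_neg_iff_add_eq_0)
    ultimately have "cscale (c t) (v t) \<in> cspan (v ` T)"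
      by (simp add: cvec.span_neg)
    then have "v t \<in> cspan (v ` T)" if "c t \<noteq> 0"
      using cvec.span_scale[of "cscale (c t) (v t)" "v ` T" "inverse (c t)"] that by simp
    then have "c t = 0"
      using indep by blast
    then show "\<forall>l\<in>insert t T. c l = 0"
      using zero indep T by (auto simp: lincomb_insert dest: lin_indepD)
  qed
qed

lemma lin_indep_iff:
  assumes "finite T" shows "lin_indep T v \<longleftrightarrow> inj_on v T \<and> cvec.independent (v ` T)"
  using assms
proof (induction T)
  case (insert t T)
  show ?case
    using insert.hyps cvec.span_base[of "v t" "v ` T"]
    by (auto simp: lin_indep_insert insert.IH cvec.independent_insert)
qed (simp add: lin_indep_def cvec.independent_empty)

lemma lin_indep_cong: "(\<And>l. l \<in> T \<Longrightarrow> v l = v' l) \<Longrightarrow> lin_indep T v = lin_indep T v'"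
  unfolding lin_indep_def using lincomb_cong[of T _ _ v v'] by metis

lemma lin_indep_subset: "\<lbrakk>finite T; lin_indep T v; K \<subseteq> T\<rbrakk> \<Longrightarrow> lin_indep K v"
  by (metis cvec.independent_mono finite_subset image_mono inj_on_subset lin_indep_iff)

lemma lin_indep_nonzero: "\<lbrakk>finite T; lin_indep T v; l \<in> T\<rbrakk> \<Longrightarrow> v l \<noteq> 0"
  by (metis cvec.dependent_zero image_eqI lin_indep_iff)

lemma lin_indep_disjoint:
  assumes T: "finite T" "lin_indep T v" and KC: "K \<subseteq> T" "C \<subseteq> T" "K \<inter> C = {}"
    and eq: "lincomb C c v = lincomb K d v" and l: "l \<in> C"
  shows "c l = 0"
proof -
  let ?e = "\<lambda>l. (if l \<in> C then c l else 0) - (if l \<in> K then d l else 0)"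
  have "lincomb T ?e v = 0"
    unfolding lincomb_diff[symmetric] by (simp add: lincomb_restrict T(1) KC eq)
  from lin_indepD[OF T(2) this subsetD[OF KC(2) l]] show ?thesis
    using l KC(3) by auto
qed

lemma lin_indep_row_operation:
  assumes T: "finite T" "l \<notin> T" "i \<in> T" and indep: "lin_indep (insert l T) v"
  shows "lin_indep (insert l T) (v(l := v l - cscale t (v i)))"
proof -
  let ?v = "v(l := v l - cscale t (v i))"
  have "?v ` T = v ` T" "lin_indep T ?v = lin_indep T v"
    using T(2) by (auto intro!: lin_indep_cong image_cong)
  moreover have "v l \<in> cspan (v ` T)" if "v l - cscale t (v i) \<in> cspan (v ` T)"
    using cvec.span_add[OF that cvec.span_scale[OF cvec.span_base, of "v i" "v ` T" t]] T(3) by simp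
  ultimately show ?thesis
    using indep T by (auto simp: lin_indep_insert)
qed

lemma coord_span_eq:
  assumes "finite S" shows "coord_span S = {v. \<forall>i. i \<notin> S \<longrightarrow> v i = 0}"
proof
  show "coord_span S \<subseteq> {v. \<forall>i. i \<notin> S \<longrightarrow> v i = 0}"
    unfolding coord_span_def
    by (rule cvec.span_minimal) (auto simp: Defs.unit_vec_def cvec.subspace_def cscale_def)
  have "v = lincomb S v Defs.unit_vec" if "\<forall>i. i \<notin> S \<longrightarrow> v i = 0" for v
    using that assms by (auto simp: lincomb_def Defs.unit_vec_def fun_eq_iff if_distrib sum.delta cong: if_cong)
  then show "{v. \<forall>i. i \<notin> S \<longrightarrow> v i = 0} \<subseteq> coord_span S"
    unfolding coord_span_def using in_span_image_iff[OF assms] by blast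
qed

lemma cspace_eq_coord_span: "cspace m = coord_span {1..m}"
  by (simp add: cspace_def coord_span_eq)

lemma coord_span_subspace_basis:
  assumes "finite S" "W \<subseteq> coord_span S"
  obtains B where "finite B" "B \<subseteq> W" "cvec.independent B" "W \<subseteq> cspan B" "card B = cdim W"
proof -
  obtain B where B: "B \<subseteq> W" "cvec.independent B" "W \<subseteq> cspan B" "card B = cdim W"
    using cvec.basis_exists by blast
  moreover have "finite B"
    using cvec.independent_span_bound[of "Defs.unit_vec ` S" B] assms B(1,2) by (auto simp: coord_span_def)
  ultimately show ?thesis using that by blast
qed

lemma coord_span_subspace_family_basis:
  assumes W: "csubspace W" and S: "finite S" "W \<subseteq> coord_span S"
  obtains v where "lin_indep {..<cdim W} v" "\<And>i. v i \<in> W" "\<And>w. w \<in> W \<Longrightarrow> \<exists>c. w = lincomb {..<cdim W} c v"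
proof -
  obtain B where B: "finite B" "B \<subseteq> W" "cvec.independent B" "W \<subseteq> cspan B" "card B = cdim W"
    using coord_span_subspace_basis[OF S] .
  obtain f where f: "bij_betw f {..<cdim W} B"
    using ex_bij_betw_nat_finite[OF B(1)] B(5) by (metis atLeast0LessThan)
  define v where "v i = (if i < cdim W then f i else 0)" for i
  have v: "v ` {..<cdim W} = B" "inj_on v {..<cdim W}"
    using f unfolding bij_betw_def v_def inj_on_def by auto
  show ?thesis
  proof (rule that[of v])
    show "v i \<in> W" for i
      using B(2) v(1) cvec.subspace_0[OF W] by (cases "i < cdim W") (auto simp: v_def)
    show "\<exists>c. w = lincomb {..<cdim W} c v" if "w \<in> W" for w
      using that B(4) v(1) in_span_image_iff[of "{..<cdim W}" w v] by auto
  qed (use lin_indep_iff[of "{..<cdim W}" v] v B(3) in simp)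
qed

lemma lin_indep_card_le:
  assumes "finite T" "lin_indep T v" "v ` T \<subseteq> W" "finite S" "W \<subseteq> coord_span S"
  shows "card T \<le> cdim W"
proof -
  obtain B where "finite B" "W \<subseteq> cspan B" "card B = cdim W"
    using coord_span_subspace_basis[OF assms(4,5)] by metis
  then show ?thesis
    using cvec.independent_span_bound[of B "v ` T"] lin_indep_iff[of T v] assms by (auto simp: card_image)
qed

lemma lin_indep_spans_subspace:
  assumes T: "finite T" "lin_indep T v" "v ` T \<subseteq> W" "card T = cdim W" and S: "finite S" "W \<subseteq> coord_span S" and w: "w \<in> W"
  shows "\<exists>c. w = lincomb T c v"
proof (rule ccontr)
  assume "\<nexists>c. w = lincomb T c v"
  then have w_span: "w \<notin> cspan (v ` T)"
    using in_span_image_iff[OF T(1)] by blast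
  obtain B where B: "finite B" "W \<subseteq> cspan B" "card B = cdim W"
    using coord_span_subspace_basis[OF S] by metis
  have v: "inj_on v T" "cvec.independent (v ` T)"
    using lin_indep_iff T by auto
  then have "cvec.independent (insert w (v ` T))" "w \<notin> v ` T"
    using w_span cvec.span_base by (auto simp: cvec.independent_insert)
  then show False
    using cvec.independent_span_bound[of B "insert w (v ` T)"] B T v(1) w by (auto simp: card_image)
qed

lemma cdim_eqI:
  assumes "finite T" "lin_indep T v" "v ` T \<subseteq> W" "\<And>w. w \<in> W \<Longrightarrow> \<exists>c. w = lincomb T c v"
  shows "cdim W = card T"
  using assms lin_indep_iff[of T v] in_span_image_iff[of T _ v]
  by (intro cvec.dim_unique[of "v ` T"]) (auto simp: card_image)

lemma in_row_space_iff: "v \<in> row_space k A \<longleftrightarrow> (\<exists>c. v = lincomb {..<k} c A)"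
  unfolding row_space_def by (simp add: in_span_image_iff)

lemma row_in_row_space: "i < k \<Longrightarrow> A i \<in> row_space k A"
  unfolding row_space_def by (intro cvec.span_base) auto

lemma cdim_row_space_iff: "cdim (row_space k A) = k \<longleftrightarrow> lin_indep {..<k} A"
proof
  assume "lin_indep {..<k} A"
  then have "cdim (row_space k A) = card {..<k}"
    by (intro cdim_eqI) (auto simp: in_row_space_iff[symmetric] intro: row_in_row_space)
  then show "cdim (row_space k A) = k" by simp
next
  assume dim: "cdim (row_space k A) = k"
  obtain B where B: "B \<subseteq> A ` {..<k}" "cvec.independent B" "A ` {..<k} \<subseteq> cspan B"
    using cvec.maximal_independent_subset by blast
  have "card B = k"
    using cvec.dim_unique[OF B(1,3,2) refl] dim cvec.dim_span unfolding row_space_def by metis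
  moreover have "card (A ` {..<k}) \<le> k"
    using card_image_le[of "{..<k}" A] by simp
  ultimately have "B = A ` {..<k}" "card (A ` {..<k}) = card {..<k}"
    using B(1) card_seteq[of "A ` {..<k}" B] by auto
  then show "lin_indep {..<k} A"
    using B(2) by (simp add: lin_indep_iff eq_card_imp_inj_on)
qed

lemma frames_iff: "A \<in> frames k m \<longleftrightarrow> (\<forall>i<k. A i \<in> cspace m) \<and> (\<forall>i\<ge>k. A i = 0) \<and> lin_indep {..<k} A"
  unfolding frames_def by (simp add: cdim_row_space_iff)

lemma row_space_eqI:
  assumes "lin_indep {..<k} A" "\<And>i. i < k \<Longrightarrow> A i \<in> V" "V \<in> Gr k m"
  shows "row_space k A = V"
proof
  have V: "csubspace V" "V \<subseteq> cspace m" "cdim V = k"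
    using assms(3) by (auto simp: Gr_def)
  have rows: "A ` {..<k} \<subseteq> V"
    using assms(2) by auto
  then show "row_space k A \<subseteq> V"
    unfolding row_space_def using V(1) by (rule cvec.span_minimal)
  show "V \<subseteq> row_space k A"
    unfolding in_row_space_iff subset_iff
    using lin_indep_spans_subspace[OF _ assms(1) rows _ _ V(2)[unfolded cspace_eq_coord_span]] V(3) by simp
qed

lemma Gr_frame:
  assumes "V \<in> Gr k m" obtains A where "A \<in> frames k m" "row_space k A = V"
proof -
  have V: "csubspace V" "V \<subseteq> cspace m" "cdim V = k"
    using assms by (auto simp: Gr_def)
  obtain v where v: "lin_indep {..<k} v" "\<And>i. v i \<in> V"
    using coord_span_subspace_family_basis[OF V(1) finite_atLeastAtMost V(2)[unfolded cspace_eq_coord_span]] V(3)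
    by metis
  let ?A = "\<lambda>i. if i < k then v i else 0"
  have "lin_indep {..<k} ?A"
    using v(1) lincomb_cong[of "{..<k}" _ _ ?A v] by (simp add: lin_indep_def)
  then show ?thesis
    using that[of ?A] v(2) V(2) row_space_eqI[OF _ _ assms, of ?A] by (auto simp: frames_iff)
qed

section \<open>Cells\<close>

definition subspace_rank :: "(nat \<Rightarrow> complex) set \<Rightarrow> nat \<Rightarrow> nat \<Rightarrow> nat" where
  "subspace_rank V p q = cdim (V \<inter> coord_span {p..q})"

lemma in_coord_span_interval: "v \<in> coord_span {p..q} \<longleftrightarrow> (\<forall>i. v i \<noteq> 0 \<longrightarrow> p \<le> i \<and> i \<le> q)"
  by (subst coord_span_eq) auto

lemma coord_span_mono: "S \<subseteq> T \<Longrightarrow> coord_span S \<subseteq> coord_span T"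
  unfolding coord_span_def by (intro cvec.span_mono image_mono)

lemma csubspace_coord_span: "csubspace (coord_span S)"
  unfolding coord_span_def by (rule cvec.subspace_span)

locale interval_family =
  fixes k m :: nat and a b :: "nat \<Rightarrow> nat"
  assumes inj_a: "inj_on a {..<k}" and inj_b: "inj_on b {..<k}"
    and ab: "\<And>i. i < k \<Longrightarrow> 1 \<le> a i \<and> a i \<le> b i \<and> b i \<le> m"
begin

definition intervals :: "(nat \<times> nat) set" where
  "intervals = (\<lambda>i. (a i, b i)) ` {..<k}"

lemma inj_intervals: "inj_on (\<lambda>i. (a i, b i)) {..<k}"
  using inj_a unfolding inj_on_def by auto

lemma rank_set_intervals: "rank_set intervals"
  unfolding rank_set_def
proof (intro conjI)
  show "inj_on fst intervals" "inj_on snd intervals"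
    using inj_a inj_b unfolding intervals_def inj_on_def by auto
qed (use ab in \<open>auto simp: intervals_def\<close>)

lemma card_intervals: "card intervals = k"
  unfolding intervals_def by (simp add: card_image[OF inj_intervals])

lemma interval_rank_intervals: "interval_rank intervals p q = card {i. i < k \<and> p \<le> a i \<and> b i \<le> q}"
proof -
  have "{x \<in> intervals. p \<le> fst x \<and> snd x \<le> q} = (\<lambda>i. (a i, b i)) ` {i. i < k \<and> p \<le> a i \<and> b i \<le> q}"
    unfolding intervals_def by auto
  moreover have "inj_on (\<lambda>i. (a i, b i)) {i. i < k \<and> p \<le> a i \<and> b i \<le> q}"
    using inj_intervals by (rule inj_on_subset) auto
  ultimately show ?thesis
    unfolding interval_rank_def by (simp add: card_image)
qed

definition supported_rows :: "(nat \<Rightarrow> nat \<Rightarrow> complex) \<Rightarrow> bool" where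
  "supported_rows B \<longleftrightarrow> (\<forall>i<k. B i \<in> coord_span {a i..b i} \<and> B i (a i) \<noteq> 0 \<and> B i (b i) \<noteq> 0) \<and> (\<forall>i\<ge>k. B i = 0)"

definition cell :: "(nat \<Rightarrow> complex) set set" where
  "cell = row_space k ` Collect supported_rows"

text \<open>The row with the leftmost left end among those occurring in a linear combination is the
  only one that contributes to the entry there, and symmetrically on the right.\<close>

lemma supported_rows_leftmost:
  assumes B: "supported_rows B" and i: "i < k" "c i \<noteq> 0"
  obtains j where "j < k" "c j \<noteq> 0" "\<forall>l<k. c l \<noteq> 0 \<longrightarrow> a j \<le> a l" "lincomb {..<k} c B (a j) \<noteq> 0"
proof -
  obtain j where j: "j < k" "c j \<noteq> 0" "\<forall>l. l < k \<and> c l \<noteq> 0 \<longrightarrow> a j \<le> a l"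
    using ex_has_least_nat[of "\<lambda>l. l < k \<and> c l \<noteq> 0" i a] i by blast
  have "c l * B l (a j) = 0" if "l \<in> {..<k}" "l \<noteq> j" for l
  proof (cases "c l = 0")
    case False
    then have "a j < a l"
      using that j inj_a by (auto simp: inj_on_def order.order_iff_strict)
    then show ?thesis
      using B that(1) unfolding supported_rows_def in_coord_span_interval by (metis lessThan_iff mult_zero_right not_less)
  qed simp
  then have "lincomb {..<k} c B (a j) = c j * B j (a j)"
    using j(1) by (intro lincomb_single) auto
  then show ?thesis
    using that[of j] j B by (auto simp: supported_rows_def)
qed

lemma supported_rows_rightmost:
  assumes B: "supported_rows B" and i: "i < k" "c i \<noteq> 0"
  obtains j where "j < k" "c j \<noteq> 0" "\<forall>l<k. c l \<noteq> 0 \<longrightarrow> b l \<le> b j" "lincomb {..<k} c B (b j) \<noteq> 0"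
proof -
  have "\<forall>l. l < k \<and> c l \<noteq> 0 \<longrightarrow> b l < Suc m"
    using ab by (simp add: less_Suc_eq_le)
  then obtain j where j: "j < k" "c j \<noteq> 0" "\<forall>l. l < k \<and> c l \<noteq> 0 \<longrightarrow> b l \<le> b j"
    using ex_has_greatest_nat[of "\<lambda>l. l < k \<and> c l \<noteq> 0" i b "Suc m"] i by blast
  have "c l * B l (b j) = 0" if "l \<in> {..<k}" "l \<noteq> j" for l
  proof (cases "c l = 0")
    case False
    then have "b l < b j"
      using that j inj_b by (auto simp: inj_on_def order.order_iff_strict)
    then show ?thesis
      using B that(1) unfolding supported_rows_def in_coord_span_interval by (metis lessThan_iff mult_zero_right not_less)
  qed simp
  then have "lincomb {..<k} c B (b j) = c j * B j (b j)"
    using j(1) by (intro lincomb_single) auto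
  then show ?thesis
    using that[of j] j B by (auto simp: supported_rows_def)
qed

lemma supported_rows_coeff_nonzero:
  assumes B: "supported_rows B" and v: "lincomb {..<k} c B \<in> coord_span {p..q}" and i: "i < k" "c i \<noteq> 0"
  shows "p \<le> a i \<and> b i \<le> q"
proof -
  obtain j where "a j \<le> a i" "lincomb {..<k} c B (a j) \<noteq> 0"
    using supported_rows_leftmost[of B i c] B i by metis
  moreover obtain j' where "b i \<le> b j'" "lincomb {..<k} c B (b j') \<noteq> 0"
    using supported_rows_rightmost[of B i c] B i by metis
  ultimately show ?thesis
    using v unfolding in_coord_span_interval by (meson order_trans)
qed

lemma supported_rows_lin_indep:
  assumes "supported_rows B" shows "lin_indep {..<k} B"
  unfolding lin_indep_def
proof (intro allI impI ballI, rule ccontr)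
  fix c l assume "lincomb {..<k} c B = 0" and l: "l \<in> {..<k}" "c l \<noteq> 0"
  then have "lincomb {..<k} c B \<in> coord_span {Suc m..0}"
    using csubspace_coord_span cvec.subspace_0 by metis
  then show False
    using supported_rows_coeff_nonzero[OF assms, of c "Suc m" 0 l] ab[of l] l by simp
qed

lemma coord_span_interval_subset_cspace: "i < k \<Longrightarrow> coord_span {a i..b i} \<subseteq> cspace m"
  unfolding cspace_eq_coord_span using ab[of i] by (intro coord_span_mono) auto

lemma supported_rows_frame: "supported_rows B \<Longrightarrow> B \<in> frames k m"
  unfolding frames_iff using coord_span_interval_subset_cspace supported_rows_lin_indep
  by (auto simp: supported_rows_def)

lemma cell_subset_Gr: "cell \<subseteq> Gr k m"
  unfolding cell_def using supported_rows_frame row_space_in_Gr by auto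

lemma subspace_rank_cell:
  assumes "V \<in> cell" shows "subspace_rank V p q = interval_rank intervals p q"
proof -
  obtain B where B: "supported_rows B" "V = row_space k B"
    using assms unfolding cell_def by blast
  let ?T = "{i. i < k \<and> p \<le> a i \<and> b i \<le> q}"
  have "cdim (V \<inter> coord_span {p..q}) = card ?T"
  proof (rule cdim_eqI[of ?T B])
    show "lin_indep ?T B"
      by (rule lin_indep_subset[OF _ supported_rows_lin_indep[OF B(1)]]) auto
    show "B ` ?T \<subseteq> V \<inter> coord_span {p..q}"
    proof
      fix w assume "w \<in> B ` ?T"
      then obtain i where i: "i \<in> ?T" "w = B i" by blast
      then have "w \<in> coord_span {a i..b i}" "{a i..b i} \<subseteq> {p..q}"
        using B(1) by (auto simp: supported_rows_def)
      then show "w \<in> V \<inter> coord_span {p..q}"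
        using i B(2) row_in_row_space coord_span_mono by blast
    qed
    show "\<exists>c. w = lincomb ?T c B" if w: "w \<in> V \<inter> coord_span {p..q}" for w
    proof -
      obtain c where c: "w = lincomb {..<k} c B"
        using w B(2) in_row_space_iff by auto
      then have "c i = 0" if "i < k" "i \<notin> ?T" for i
        using supported_rows_coeff_nonzero[OF B(1), of c p q i] w that by blast
      then have "w = lincomb {..<k} (\<lambda>l. if l \<in> ?T then c l else 0) B"
        unfolding c by (intro lincomb_cong) auto
      then show ?thesis
        using lincomb_restrict[of "{..<k}" ?T c B] by auto
    qed
  qed auto
  then show ?thesis
    unfolding subspace_rank_def interval_rank_intervals .
qed

end

definition lowest_index :: "(nat \<Rightarrow> complex) \<Rightarrow> nat" where "lowest_index v = Min {p. v p \<noteq> 0}"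
definition highest_index :: "(nat \<Rightarrow> complex) \<Rightarrow> nat" where "highest_index v = Max {p. v p \<noteq> 0}"

lemma index_bounds:
  assumes "v \<in> cspace m" "v \<noteq> 0"
  shows "v (lowest_index v) \<noteq> 0" "v (highest_index v) \<noteq> 0"
    and "v p \<noteq> 0 \<Longrightarrow> lowest_index v \<le> p" "v p \<noteq> 0 \<Longrightarrow> p \<le> highest_index v"
    and "1 \<le> lowest_index v" "lowest_index v \<le> highest_index v" "highest_index v \<le> m"
proof -
  let ?S = "{p. v p \<noteq> 0}"
  have S: "?S \<subseteq> {1..m}"
    using assms(1) unfolding cspace_def by blast
  then have fin: "finite ?S" by (rule finite_subset) simp
  have "?S \<noteq> {}"
    using assms(2) by (auto simp: fun_eq_iff)
  then have in_S: "Min ?S \<in> ?S" "Max ?S \<in> ?S"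
    using Min_in Max_in fin by blast+
  then show "v (lowest_index v) \<noteq> 0" "v (highest_index v) \<noteq> 0" "1 \<le> lowest_index v" "highest_index v \<le> m"
    using S by (auto simp: lowest_index_def highest_index_def)
  show "v p \<noteq> 0 \<Longrightarrow> lowest_index v \<le> p" "v p \<noteq> 0 \<Longrightarrow> p \<le> highest_index v" "lowest_index v \<le> highest_index v"
    using fin in_S by (auto simp: lowest_index_def highest_index_def)
qed

lemma cancel_end_reduces_width:
  assumes v: "v \<in> cspace m" "v \<noteq> 0" and w: "w \<in> cspace m" "w \<noteq> 0"
    and inside: "lowest_index w \<le> lowest_index v" "highest_index v \<le> highest_index w"
    and x: "x = lowest_index w \<or> x = highest_index w" "v x \<noteq> 0"
    and u: "u = w - cscale (w x / v x) v" "u \<in> cspace m" "u \<noteq> 0"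
  shows "highest_index u - lowest_index u < highest_index w - lowest_index w"
proof -
  have support: "lowest_index w \<le> p \<and> p \<le> highest_index w" if "u p \<noteq> 0" for p
  proof (cases "w p = 0")
    case True
    then have "v p \<noteq> 0"
      using that by (simp add: u(1) cscale_def)
    then show ?thesis
      using index_bounds(3,4)[OF v] inside by (meson order_trans)
  qed (use index_bounds(3,4)[OF w] in blast)
  have "u x = 0"
    using x(2) by (simp add: u(1) cscale_def)
  then have "lowest_index u \<noteq> x" "highest_index u \<noteq> x"
    using index_bounds(1,2)[OF u(2,3)] by metis+
  then show ?thesis
    using support[OF index_bounds(1)[OF u(2,3)]] support[OF index_bounds(2)[OF u(2,3)]]
      index_bounds(6)[OF u(2,3)] x(1) by linarith
qed

text \<open>Among the bases of \<open>V\<close> choose one of minimal total width: if two rows had an end in common,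
  the wider one could be shortened by a row operation.\<close>

theorem cell_exists:
  assumes V: "V \<in> Gr k m"
  obtains a b where "interval_family k m a b" "V \<in> interval_family.cell k a b"
proof -
  let ?basis = "\<lambda>A. A \<in> frames k m \<and> row_space k A = V"
  define width :: "(nat \<Rightarrow> nat \<Rightarrow> complex) \<Rightarrow> nat" where "width A = (\<Sum>i<k. highest_index (A i) - lowest_index (A i))" for A
  obtain A where A: "?basis A" and minimal: "\<forall>A'. ?basis A' \<longrightarrow> width A \<le> width A'"
    using ex_has_least_nat[of ?basis _ width] Gr_frame[OF V] by metis
  have rows: "\<And>i. i < k \<Longrightarrow> A i \<in> cspace m" "lin_indep {..<k} A" "\<And>i. k \<le> i \<Longrightarrow> A i = 0"
    using A frames_iff by auto
  then have nonzero: "\<And>i. i < k \<Longrightarrow> A i \<noteq> 0"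
    using lin_indep_nonzero[of "{..<k}" A] by simp
  note bounds = index_bounds[OF rows(1) nonzero]
  have no_reduction: False if il: "i < k" "l < k" "i \<noteq> l"
    and inside: "lowest_index (A l) \<le> lowest_index (A i)" "highest_index (A i) \<le> highest_index (A l)"
    and x: "x = lowest_index (A l) \<or> x = highest_index (A l)" "A i x \<noteq> 0" for i l x
  proof -
    let ?u = "A l - cscale (A l x / A i x) (A i)"
    let ?A = "A(l := ?u)"
    have k_eq: "insert l ({..<k} - {l}) = {..<k}"
      using il by auto
    then have indep: "lin_indep {..<k} ?A"
      using lin_indep_row_operation[of "{..<k} - {l}" l i A] rows(2) il by simp
    have u: "?u \<in> cspace m" "?u \<noteq> 0"
      using rows(1) il cspace_subspace lin_indep_nonzero[OF _ indep, of l]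
      by (auto intro!: cvec.subspace_diff cvec.subspace_scale)
    have "?A j \<in> V" if "j < k" for j
      using that A il V row_in_row_space[of _ k A] unfolding Gr_def
      by (auto intro!: cvec.subspace_diff cvec.subspace_scale)
    then have "?basis ?A"
      using indep u(1) rows il row_space_eqI[OF indep _ V] by (auto simp: frames_iff)
    then have "width A \<le> width ?A"
      using minimal by blast
    moreover have "width ?A < width A"
      unfolding width_def using il
        cancel_end_reduces_width[OF rows(1)[OF il(1)] nonzero[OF il(1)] rows(1)[OF il(2)] nonzero[OF il(2)] inside x refl u]
      by (intro sum_strict_mono_ex1) (auto intro!: bexI[of _ l])
    ultimately show False by simp
  qed
  let ?a = "\<lambda>i. lowest_index (A i)" and ?b = "\<lambda>i. highest_index (A i)"
  have family: "interval_family k m ?a ?b"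
  proof
    show "inj_on ?a {..<k}"
    proof (rule inj_onI, rule ccontr)
      fix i l assume "i \<in> {..<k}" "l \<in> {..<k}" "?a i = ?a l" "i \<noteq> l"
      then show False
        using no_reduction[of i l "?a l"] no_reduction[of l i "?a l"] bounds(1)[of i] bounds(1)[of l]
        by (cases "?b i \<le> ?b l") auto
    qed
    show "inj_on ?b {..<k}"
    proof (rule inj_onI, rule ccontr)
      fix i l assume "i \<in> {..<k}" "l \<in> {..<k}" "?b i = ?b l" "i \<noteq> l"
      then show False
        using no_reduction[of i l "?b l"] no_reduction[of l i "?b l"] bounds(2)[of i] bounds(2)[of l]
        by (cases "?a l \<le> ?a i") auto
    qed
  qed (use bounds in auto)
  have "interval_family.supported_rows k ?a ?b A"
    unfolding interval_family.supported_rows_def[OF family] in_coord_span_interval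
    using bounds(1-4) rows(3) by blast
  then have "V \<in> interval_family.cell k ?a ?b"
    unfolding interval_family.cell_def[OF family] using A by blast
  with family show ?thesis by (rule that)
qed

context interval_family
begin

definition has_intersection_ranks :: "(nat \<Rightarrow> complex) set \<Rightarrow> bool" where
  "has_intersection_ranks V \<longleftrightarrow> V \<in> Gr k m \<and> (\<forall>i<k. \<forall>l<k.
     cdim (V \<inter> coord_span ({a i..b i} \<inter> {a l..b l})) = card (intervals_in ({a i..b i} \<inter> {a l..b l}) intervals))"

definition adapted_family :: "(nat \<Rightarrow> complex) set \<Rightarrow> nat set \<Rightarrow> (nat \<Rightarrow> nat \<Rightarrow> complex) \<Rightarrow> bool" where
  "adapted_family V T v \<longleftrightarrow> (\<forall>l\<in>T. v l \<in> V \<inter> coord_span {a l..b l}) \<and> lin_indep T v"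

lemma has_intersection_ranksD:
  assumes "has_intersection_ranks V" "i < k" "l < k"
  shows "cdim (V \<inter> coord_span {max (a i) (a l)..min (b i) (b l)})
    = card {j. j < k \<and> max (a i) (a l) \<le> a j \<and> b j \<le> min (b i) (b l)}"
  using assms card_intervals_in[OF rank_set_intervals] interval_rank_intervals
  by (simp add: has_intersection_ranks_def)

lemma adapted_family_coeff_0:
  assumes V: "has_intersection_ranks V" and v: "adapted_family V {l. l < k \<and> a i < a l} v" and i: "i < k"
    and x: "lincomb {l. l < k \<and> a i < a l} c v \<in> coord_span {a i..b i}" and j: "j < k" "a i < a j" "b i < b j"
  shows "c j = 0"
proof (rule ccontr)
  assume "c j \<noteq> 0"
  let ?T = "{l. l < k \<and> a i < a l}"
  let ?K = "{l \<in> ?T. b l \<le> b i}" and ?C = "{l \<in> ?T. b i < b l \<and> c l \<noteq> 0}"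
  have vV: "csubspace V" "\<And>l. l \<in> ?T \<Longrightarrow> v l \<in> V \<inter> coord_span {a l..b l}" "lin_indep ?T v"
    using V v by (auto simp: has_intersection_ranks_def Gr_def adapted_family_def)
  obtain l0 where l0: "l0 \<in> ?C" "\<forall>l. l \<in> ?C \<longrightarrow> a l0 \<le> a l"
    using ex_has_least_nat[of "\<lambda>l. l \<in> ?C" j a] j \<open>c j \<noteq> 0\<close> by blast
  let ?K' = "{j. j < k \<and> a l0 \<le> a j \<and> b j \<le> b i}"
  have split: "lincomb ?T c v = lincomb ?K c v + lincomb ?C c v"
    by (rule lincomb_split) auto
  have "lincomb ?K c v \<in> coord_span {a i..b i}"
  proof (rule lincomb_in_subspace[OF csubspace_coord_span])
    have "coord_span {a l..b l} \<subseteq> coord_span {a i..b i}" if "l \<in> ?K" for l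
      using that by (intro coord_span_mono) auto
    then show "v ` ?K \<subseteq> coord_span {a i..b i}"
      using vV(2) by blast
  qed
  from cvec.subspace_diff[OF csubspace_coord_span x this]
  have "lincomb ?C c v \<in> coord_span {a i..b i}"
    unfolding split by (simp only: add_diff_cancel_left')
  moreover have "lincomb ?C c v \<in> V \<inter> coord_span {a l0..m}"
  proof (rule lincomb_in_subspace)
    have "coord_span {a l..b l} \<subseteq> coord_span {a l0..m}" if "l \<in> ?C" for l
      using that l0(2) ab[of l] by (intro coord_span_mono) auto
    then show "v ` ?C \<subseteq> V \<inter> coord_span {a l0..m}"
      using vV(2) by blast
  qed (intro cvec.subspace_inter vV(1) csubspace_coord_span)
  ultimately have y: "lincomb ?C c v \<in> V \<inter> coord_span {a l0..b i}"
    unfolding in_coord_span_interval Int_iff by blast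
  have "max (a i) (a l0) = a l0" "min (b i) (b l0) = b i"
    using l0(1) by auto
  then have dim: "card ?K' = cdim (V \<inter> coord_span {a l0..b i})"
    using has_intersection_ranksD[OF V i, of l0] l0(1) by simp
  have sub: "finite ?T" "finite ?K'" "?K' \<subseteq> ?T" "?C \<subseteq> ?T" "?K' \<inter> ?C = {}"
    using l0(1) by auto
  have "coord_span {a l..b l} \<subseteq> coord_span {a l0..b i}" if "l \<in> ?K'" for l
    using that by (intro coord_span_mono) auto
  then have "v ` ?K' \<subseteq> V \<inter> coord_span {a l0..b i}"
    using vV(2) sub(3) by blast
  then obtain d where "lincomb ?C c v = lincomb ?K' d v"
    using lin_indep_spans_subspace[OF sub(2) lin_indep_subset[OF sub(1) vV(3) sub(3)] _ dim finite_atLeastAtMost _ y] by blast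
  then have "c l0 = 0"
    using lin_indep_disjoint[OF sub(1) vV(3) sub(3-5)] l0(1) by blast
  then show False
    using l0(1) by simp
qed

lemma adapted_family_extend:
  assumes V: "has_intersection_ranks V" and v: "adapted_family V {l. l < k \<and> a i < a l} v" and i: "i < k"
  obtains u where "adapted_family V {l. l < k \<and> a i \<le> a l} (v(i := u))"
proof -
  let ?T = "{l. l < k \<and> a i < a l}" and ?W = "V \<inter> coord_span {a i..b i}"
  let ?K = "{l \<in> ?T. b l \<le> b i}"
  have T: "{l. l < k \<and> a i \<le> a l} = insert i ?T" "i \<notin> ?T"
    using i inj_a by (auto simp: inj_on_def order.order_iff_strict)
  have "{j. j < k \<and> a i \<le> a j \<and> b j \<le> b i} = insert i ?K"
    using T i by auto
  then have dim: "cdim ?W = Suc (card ?K)"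
    using has_intersection_ranksD[OF V i i] by simp
  have "\<not> ?W \<subseteq> cspan (v ` ?T)"
  proof
    assume span: "?W \<subseteq> cspan (v ` ?T)"
    have "?W \<subseteq> cspan (v ` ?K)"
    proof
      fix w assume w: "w \<in> ?W"
      then have "w \<in> cspan (v ` ?T)"
        using span by blast
      then obtain c where c: "w = lincomb ?T c v"
        using in_span_image_iff[of ?T w v] by auto
      then have "c l = 0" if "l \<in> ?T - ?K" for l
        using adapted_family_coeff_0[OF V v i, of c l] w that by auto
      then have "w = lincomb ?T (\<lambda>l. if l \<in> ?K then c l else 0) v"
        unfolding c by (intro lincomb_cong) auto
      then show "w \<in> cspan (v ` ?K)"
        using lincomb_restrict[of ?T ?K c v] in_span_image_iff[of ?K w v] by auto
    qed
    then have "cdim ?W \<le> card (v ` ?K)"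
      by (intro cvec.dim_le_card) auto
    also have "\<dots> \<le> card ?K"
      by (rule card_image_le) simp
    finally show False
      using dim by simp
  qed
  then obtain u where u: "u \<in> ?W" "u \<notin> cspan (v ` ?T)" by blast
  have "(v(i := u)) ` ?T = v ` ?T" "lin_indep ?T (v(i := u)) = lin_indep ?T v"
    using T(2) by (auto intro!: lin_indep_cong image_cong)
  then have "adapted_family V (insert i ?T) (v(i := u))"
    using v u T(2) lin_indep_insert[OF _ T(2), of "v(i := u)"] by (auto simp: adapted_family_def)
  then show ?thesis
    using that T(1) by simp
qed

theorem adapted_frame_exists:
  assumes V: "has_intersection_ranks V"
  obtains A where "A \<in> frames k m" "row_space k A = V" "\<And>i. i < k \<Longrightarrow> A i \<in> coord_span {a i..b i}"
proof -
  have "\<exists>v. adapted_family V {l. l < k \<and> s \<le> a l} v" if "s \<le> Suc m" for s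
    using that
  proof (induction rule: inc_induct)
    case base
    have empty: "{l. l < k \<and> Suc m \<le> a l} = {}"
      using ab by fastforce
    show ?case
      unfolding empty by (simp add: adapted_family_def lin_indep_def)
  next
    case (step s)
    then obtain v where v: "adapted_family V {l. l < k \<and> s < a l} v"
      by (auto simp: Suc_le_eq)
    show ?case
    proof (cases "\<exists>i<k. a i = s")
      case True
      then show ?thesis
        using adapted_family_extend[OF V] v by metis
    next
      case False
      then have "{l. l < k \<and> s \<le> a l} = {l. l < k \<and> s < a l}"
        using le_neq_implies_less by fastforce
      then show ?thesis
        using v by auto
    qed
  qed
  from this[of 0] obtain v where v: "adapted_family V {..<k} v"
    by (auto simp: lessThan_def)
  let ?A = "\<lambda>i. if i < k then v i else 0"
  have "lin_indep {..<k} ?A = lin_indep {..<k} v"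
    by (rule lin_indep_cong) simp
  then have A: "lin_indep {..<k} ?A" "\<And>i. i < k \<Longrightarrow> ?A i \<in> V \<inter> coord_span {a i..b i}"
    using v by (auto simp: adapted_family_def)
  have Gr: "V \<in> Gr k m"
    using V by (simp add: has_intersection_ranks_def)
  then have "?A \<in> frames k m"
    using A by (auto simp: frames_iff Gr_def)
  moreover have "row_space k ?A = V"
    by (rule row_space_eqI[OF A(1) _ Gr]) (use A(2) in blast)
  ultimately show ?thesis
    using that A(2) by blast
qed

end

section \<open>Determinants of square arrays\<close>

definition mat_of_array :: "nat \<Rightarrow> (nat \<Rightarrow> nat \<Rightarrow> complex) \<Rightarrow> complex Matrix.mat" where
  "mat_of_array k T = Matrix.mat k k (\<lambda>(i, j). T i j)"

definition array_det :: "nat \<Rightarrow> (nat \<Rightarrow> nat \<Rightarrow> complex) \<Rightarrow> complex" where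
  "array_det k T = Determinant.det (mat_of_array k T)"

definition array_adj :: "nat \<Rightarrow> (nat \<Rightarrow> nat \<Rightarrow> complex) \<Rightarrow> nat \<Rightarrow> nat \<Rightarrow> complex" where
  "array_adj k T i j = adj_mat (mat_of_array k T) $$ (i, j)"

lemma mat_of_array_carrier: "mat_of_array k T \<in> carrier_mat k k"
  by (simp add: mat_of_array_def)

lemma mat_of_array_index: "\<lbrakk>i < k; j < k\<rbrakk> \<Longrightarrow> mat_of_array k T $$ (i, j) = T i j"
  by (simp add: mat_of_array_def)

lemma array_det_eq_sum: "array_det k T = (\<Sum>p | p permutes {0..<k}. signof p * (\<Prod>i=0..<k. T i (p i)))"
  unfolding array_det_def det_def'[OF mat_of_array_carrier]
  by (intro sum.cong refl arg_cong2[where f = "(*)"] prod.cong)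
    (auto simp: mat_of_array_index intro: Permutations.permutes_nat_less)

lemma array_adj_mult:
  assumes "i < k" "l < k"
  shows "(\<Sum>j<k. array_adj k T i j * T j l) = (if i = l then array_det k T else 0)"
    and "(\<Sum>j<k. T i j * array_adj k T j l) = (if i = l then array_det k T else 0)"
proof -
  let ?M = "mat_of_array k T"
  note adj = adj_mat[OF mat_of_array_carrier[of k T]]
  have "(adj_mat ?M * ?M) $$ (i, l) = (\<Sum>j\<in>{0..<k}. array_adj k T i j * T j l)"
    "(?M * adj_mat ?M) $$ (i, l) = (\<Sum>j\<in>{0..<k}. T i j * array_adj k T j l)"
    using assms adj(1) mat_of_array_carrier[of k T]
    by (simp_all add: scalar_prod_def array_adj_def mat_of_array_index)
  then show "(\<Sum>j<k. array_adj k T i j * T j l) = (if i = l then array_det k T else 0)"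
    "(\<Sum>j<k. T i j * array_adj k T j l) = (if i = l then array_det k T else 0)"
    using assms unfolding adj(2,3) by (auto simp: array_det_def atLeast0LessThan)
qed

lemma array_adj_eq_minor:
  assumes "i < k" "j < k"
  shows "array_adj k T i j = (-1) ^ (j + i) *
    array_det (k - 1) (\<lambda>i' j'. T (if i' < j then i' else Suc i') (if j' < i then j' else Suc j'))"
proof -
  have "mat_delete (mat_of_array k T) j i
      = mat_of_array (k - 1) (\<lambda>i' j'. T (if i' < j then i' else Suc i') (if j' < i then j' else Suc j'))"
    using assms by (intro eq_matI) (auto simp: mat_delete_def mat_of_array_def)
  then show ?thesis
    using assms by (simp add: array_adj_def adj_mat_def cofactor_def array_det_def mat_of_array_def[of k T])
qed

lemma array_det_nonzero_iff:
  "array_det k T \<noteq> 0 \<longleftrightarrow> (\<forall>g. (\<forall>l<k. (\<Sum>j<k. g j * T j l) = 0) \<longrightarrow> (\<forall>j<k. g j = 0))"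
proof (intro iffI allI impI)
  fix g i assume det: "array_det k T \<noteq> 0" and g: "\<forall>l<k. (\<Sum>j<k. g j * T j l) = 0" and i: "i < k"
  have "0 = (\<Sum>l<k. (\<Sum>j<k. g j * T j l) * array_adj k T l i)"
    using g by simp
  also have "\<dots> = (\<Sum>j<k. g j * (\<Sum>l<k. T j l * array_adj k T l i))"
    unfolding sum_distrib_right sum_distrib_left mult.assoc by (rule sum.swap)
  also have "\<dots> = (\<Sum>j<k. if j = i then g i * array_det k T else 0)"
    by (intro sum.cong refl) (use i array_adj_mult(2)[of _ k i T] in auto)
  also have "\<dots> = g i * array_det k T"
    using i by simp
  finally show "g i = 0"
    using det by simp
next
  assume inj: "\<forall>g. (\<forall>l<k. (\<Sum>j<k. g j * T j l) = 0) \<longrightarrow> (\<forall>j<k. g j = 0)"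
  show "array_det k T \<noteq> 0"
  proof
    let ?M = "transpose_mat (mat_of_array k T)"
    assume "array_det k T = 0"
    then have "Determinant.det ?M = 0"
      unfolding array_det_def using det_transpose[OF mat_of_array_carrier] by metis
    moreover have M: "?M \<in> carrier_mat k k"
      using mat_of_array_carrier by simp
    ultimately obtain v where v: "v \<in> carrier_vec k" "v \<noteq> 0\<^sub>v k" "?M *\<^sub>v v = 0\<^sub>v k"
      using det_0_iff_vec_prod_zero[OF M] by blast
    have "(\<Sum>j<k. vec_index v j * T j l) = 0" if "l < k" for l
    proof -
      have "vec_index (?M *\<^sub>v v) l = (\<Sum>j\<in>{0..<k}. T j l * vec_index v j)"
        using that v(1) mat_of_array_carrier[of k T] by (simp add: scalar_prod_def mat_of_array_index)
      then show ?thesis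
        using v(3) that by (simp add: atLeast0LessThan mult.commute)
    qed
    then have "\<forall>j<k. vec_index v j = 0"
      using inj by blast
    then have "v = 0\<^sub>v k"
      using v(1) by (intro eq_vecI) auto
    then show False using v(2) by simp
  qed
qed

lemma continuous_on_array_det:
  assumes "\<And>i j. \<lbrakk>i < k; j < k\<rbrakk> \<Longrightarrow> continuous_on S (\<lambda>x. F x i j)"
  shows "continuous_on S (\<lambda>x. array_det k (F x))"
  unfolding array_det_eq_sum
  by (intro continuous_intros continuous_on_prod assms) (auto intro: Permutations.permutes_nat_less)

lemma field_differentiable_prod:
  fixes F :: "complex \<Rightarrow> 'i \<Rightarrow> complex"
  assumes "\<And>i. i \<in> I \<Longrightarrow> (\<lambda>z. F z i) field_differentiable at w"
  shows "(\<lambda>z. \<Prod>i\<in>I. F z i) field_differentiable at w"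
  using assms by (induction I rule: infinite_finite_induct) (auto intro: field_differentiable_mult)

lemma field_differentiable_array_det:
  assumes "\<And>i j. \<lbrakk>i < k; j < k\<rbrakk> \<Longrightarrow> (\<lambda>z. F z i j) field_differentiable at (w :: complex)"
  shows "(\<lambda>z. array_det k (F z)) field_differentiable at w"
  unfolding array_det_eq_sum
  by (intro field_differentiable_sum field_differentiable_mult field_differentiable_const
      field_differentiable_prod assms) (auto intro: Permutations.permutes_nat_less)

lemma continuous_on_array_adj:
  assumes "\<And>i j. \<lbrakk>i < k; j < k\<rbrakk> \<Longrightarrow> continuous_on S (\<lambda>x. F x i j)" "i < k" "j < k"
  shows "continuous_on S (\<lambda>x. array_adj k (F x) i j)"
  unfolding array_adj_eq_minor[OF assms(2,3)]
  by (intro continuous_intros continuous_on_array_det assms(1)) auto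

lemma field_differentiable_array_adj:
  assumes "\<And>i j. \<lbrakk>i < k; j < k\<rbrakk> \<Longrightarrow> (\<lambda>z. F z i j) field_differentiable at (w :: complex)" "i < k" "j < k"
  shows "(\<lambda>z. array_adj k (F z) i j) field_differentiable at w"
  unfolding array_adj_eq_minor[OF assms(2,3)]
  by (intro field_differentiable_mult field_differentiable_const field_differentiable_array_det assms(1)) auto

section \<open>Continuous separately holomorphic functions are differentiable\<close>

lemma eventually_cball_subset:
  fixes x :: "'a :: metric_space"
  assumes "open T" "x \<in> T" shows "\<forall>\<^sub>F d in at_right 0. cball x d \<subseteq> T"
proof -
  obtain e where e: "e > 0" "cball x e \<subseteq> T"
    using assms open_contains_cball by blast
  then have "cball x d \<subseteq> T" if "d < e" for d
    using that by (meson less_imp_le order_trans subset_cball)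
  then show ?thesis
    unfolding eventually_at_right_field using e(1) by blast
qed

definition polydisc :: "'i set \<Rightarrow> real \<Rightarrow> ('i \<Rightarrow> complex) set" where
  "polydisc I \<rho> = {x. (\<forall>i\<in>I. cmod (x i) \<le> \<rho>) \<and> (\<forall>i. i \<notin> I \<longrightarrow> x i = 0)}"

lemma zero_in_polydisc: "\<rho> \<ge> 0 \<Longrightarrow> 0 \<in> polydisc I \<rho>"
  by (simp add: polydisc_def)

lemma polydisc_mono: "\<rho> \<le> \<rho>' \<Longrightarrow> polydisc I \<rho> \<subseteq> polydisc I \<rho>'"
  by (auto simp: polydisc_def)

lemma polydisc_update: "\<lbrakk>x \<in> polydisc I \<rho>; i \<in> I; cmod z \<le> \<rho>\<rbrakk> \<Longrightarrow> x(i := z) \<in> polydisc I \<rho>"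
  by (auto simp: polydisc_def)

lemma eventually_polydisc_subset:
  assumes I: "finite I" and T: "open T" "0 \<in> T"
  shows "\<forall>\<^sub>F d in at_right 0. polydisc I d \<subseteq> T"
proof -
  have "openin (product_topology (\<lambda>i. euclidean) UNIV) T"
    using T(1) by (simp add: euclidean_product_topology)
  then obtain X where X: "0 \<in> (\<Pi>\<^sub>E i\<in>UNIV. X i)" "\<And>i. open (X i)" "(\<Pi>\<^sub>E i\<in>UNIV. X i) \<subseteq> T"
    using product_topology_open_contains_basis[of "\<lambda>_. euclidean" UNIV T 0] T(2) by auto
  then have zero: "0 \<in> X i" for i
    by (simp add: PiE_iff)
  have "\<forall>\<^sub>F d in at_right 0. \<forall>i\<in>I. cball 0 d \<subseteq> X i"
    using I X(2) zero by (intro eventually_ball_finite ballI eventually_cball_subset)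
  then show ?thesis
  proof (rule eventually_mono, intro subsetI)
    fix d x assume d: "\<forall>i\<in>I. cball 0 d \<subseteq> X i" and x: "x \<in> polydisc I d"
    have "x i \<in> X i" for i
      using d x zero by (cases "i \<in> I") (auto simp: polydisc_def subset_iff)
    then show "x \<in> T"
      using X(3) by (auto simp: PiE_iff)
  qed
qed

lemma slice_uniformly_close:
  fixes g :: "('i \<Rightarrow> complex) \<Rightarrow> complex"
  assumes I: "finite I" and g: "continuous_on (polydisc I \<rho>) g" and \<rho>: "\<rho> > 0" and i: "i \<in> I" and e: "e > 0"
  shows "\<forall>\<^sub>F d in at_right 0. \<forall>x\<in>polydisc I d. \<forall>z\<in>cball 0 \<rho>. cmod (g (x(i := z)) - g (0(i := z))) \<le> e"
proof -
  have "continuous_on UNIV (\<lambda>p :: ('i \<Rightarrow> complex) \<times> complex. (fst p)(i := snd p))"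
  proof (rule continuous_on_coordinatewise_then_product)
    show "continuous_on UNIV (\<lambda>p :: ('i \<Rightarrow> complex) \<times> complex. ((fst p)(i := snd p)) j)" for j
      using continuous_on_compose2[OF continuous_on_coordinate[of UNIV j] continuous_on_fst[OF continuous_on_id]]
      by (cases "j = i") (simp_all add: continuous_on_snd)
  qed
  then have update: "continuous_on (polydisc I \<rho> \<times> cball 0 \<rho>) (\<lambda>p. (fst p)(i := snd p))"
    by (rule continuous_on_subset) simp
  let ?g = "\<lambda>p. g ((fst p)(i := snd p))"
  have cont: "continuous_on (polydisc I \<rho> \<times> cball 0 \<rho>) ?g"
    using i by (intro continuous_on_compose2[OF g update]) (auto intro: polydisc_update)
  obtain T where T: "0 \<in> T" "open T"
      "\<forall>x\<in>T \<inter> polydisc I \<rho>. \<forall>z\<in>cball 0 \<rho>. dist (?g (x, z)) (?g (0, z)) \<le> e"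
    by (rule continuous_on_prod_compactE[OF cont compact_cball zero_in_polydisc[OF less_imp_le[OF \<rho>]] e])
  have "\<forall>\<^sub>F d in at_right 0. d \<le> \<rho>"
    using \<rho> eventually_at_right_field less_imp_le by blast
  then show ?thesis
    using eventually_polydisc_subset[OF I T(2,1)]
  proof eventually_elim
    case (elim d)
    show ?case
    proof (intro ballI)
      fix x and z :: complex assume x: "x \<in> polydisc I d" and z: "z \<in> cball 0 \<rho>"
      have "x \<in> T \<inter> polydisc I \<rho>"
        using x elim(2) polydisc_mono[OF elim(1), of I] by blast
      from bspec[OF bspec[OF T(3) this] z] show "cmod (g (x(i := z)) - g (0(i := z))) \<le> e"
        unfolding fst_conv snd_conv dist_norm .
    qed
  qed
qed

lemma holomorphic_increment_bound:
  assumes w: "w holomorphic_on ball 0 \<rho>" and bound: "\<And>z. z \<in> ball 0 \<rho> \<Longrightarrow> cmod (w z) \<le> \<omega>"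
    and \<rho>: "\<rho> > 0" and h: "cmod h < \<rho> / 2"
  shows "cmod (w h - w 0) \<le> 4 * \<omega> / \<rho> * cmod h"
proof -
  have deriv: "cmod (deriv w z) \<le> 4 * \<omega> / \<rho>" if z: "z \<in> ball 0 (\<rho> / 2)" for z
  proof -
    have sub: "cball z (\<rho> / 4) \<subseteq> ball 0 \<rho>"
      using z \<rho> by (simp add: cball_subset_ball_iff)
    have "cmod ((deriv ^^ 1) w z) \<le> fact 1 * \<omega> / (\<rho> / 4) ^ 1"
    proof (rule Cauchy_inequality)
      show "w holomorphic_on ball z (\<rho> / 4)"
        by (rule holomorphic_on_subset[OF w]) (use sub ball_subset_cball in blast)
      show "continuous_on (cball z (\<rho> / 4)) w"
        by (rule holomorphic_on_imp_continuous_on, rule holomorphic_on_subset[OF w sub])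
      show "cmod (w x) \<le> \<omega>" if "cmod (z - x) = \<rho> / 4" for x
        using bound[of x] sub that by (auto simp: dist_norm)
    qed (use \<rho> in simp)
    then show ?thesis by (simp add: field_simps)
  qed
  have "cmod (w h - w 0) \<le> 4 * \<omega> / \<rho> * cmod (h - 0)"
  proof (rule field_differentiable_bound[of "ball 0 (\<rho> / 2)" w "deriv w"])
    show "(w has_field_derivative deriv w z) (at z within ball 0 (\<rho> / 2))" if "z \<in> ball 0 (\<rho> / 2)" for z
      by (rule has_field_derivative_at_within[OF holomorphic_derivI[OF w open_ball]]) (use that \<rho> in simp)
  qed (use deriv h \<rho> in auto)
  then show ?thesis by simp
qed

lemma field_differentiable_first_order:
  fixes u :: "complex \<Rightarrow> complex"
  assumes "u field_differentiable at 0" "e > 0"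
  shows "\<forall>\<^sub>F d in at_right 0. \<forall>h. cmod h \<le> d \<longrightarrow> cmod (u h - u 0 - h * deriv u 0) \<le> e * cmod h"
proof -
  have "(u has_derivative (*) (deriv u 0)) (at 0)"
    using assms(1) by (simp add: DERIV_deriv_iff_field_differentiable flip: has_field_derivative_def)
  then obtain \<delta> where "\<delta> > 0" "\<forall>h. norm (h - 0) < \<delta> \<longrightarrow> norm (u h - u 0 - deriv u 0 * (h - 0)) \<le> e * norm (h - 0)"
    unfolding has_derivative_at_alt using assms(2) by blast
  then show ?thesis
    unfolding eventually_at_right_field by (intro exI[of _ \<delta>]) (auto simp: mult.commute)
qed

text \<open>Moving one coordinate from \<open>0\<close> to \<open>h\<close> at \<open>y\<close> instead of at \<open>0\<close> changes the increment of \<open>g\<close>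
  by that of a uniformly small holomorphic function, whose derivative is small by Cauchy's
  inequality.\<close>

lemma osgood_step:
  fixes g :: "('i \<Rightarrow> complex) \<Rightarrow> complex"
  assumes sep: "\<And>x z. \<lbrakk>x \<in> polydisc I \<rho>; cmod z < \<rho>\<rbrakk> \<Longrightarrow> (\<lambda>z. g (x(i := z))) field_differentiable at z"
    and \<rho>: "\<rho> > 0" and y: "y \<in> polydisc I \<rho>" "y i = 0" and h: "cmod h < \<rho> / 2"
    and close: "\<And>z. z \<in> cball 0 \<rho> \<Longrightarrow> cmod (g (y(i := z)) - g (0(i := z))) \<le> e * \<rho> / 8"
    and first: "cmod (g (0(i := h)) - g 0 - h * D) \<le> e / 2 * cmod h"
  shows "cmod (g (y(i := h)) - g y - h * D) \<le> e * cmod h"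
proof -
  define w where "w z = g (y(i := z)) - g (0(i := z))" for z
  have "w field_differentiable at z" if "cmod z < \<rho>" for z
    unfolding w_def using sep[OF y(1) that] sep[OF zero_in_polydisc that] \<rho> by (intro field_differentiable_diff) auto
  then have "w holomorphic_on ball 0 \<rho>"
    unfolding holomorphic_on_def by (auto intro: field_differentiable_at_within)
  then have "cmod (w h - w 0) \<le> 4 * (e * \<rho> / 8) / \<rho> * cmod h"
    by (rule holomorphic_increment_bound) (use close \<rho> h in \<open>auto simp: w_def\<close>)
  also have "4 * (e * \<rho> / 8) / \<rho> = e / 2"
    using \<rho> by simp
  finally have "cmod (w h - w 0) \<le> e / 2 * cmod h" .
  moreover have "y(i := 0) = y" "0(i := 0) = (0 :: 'i \<Rightarrow> complex)"
    using y(2) by auto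
  then have "g (y(i := h)) - g y - h * D = (w h - w 0) + (g (0(i := h)) - g 0 - h * D)"
    by (simp add: w_def)
  then have "cmod (g (y(i := h)) - g y - h * D) \<le> cmod (w h - w 0) + cmod (g (0(i := h)) - g 0 - h * D)"
    by (simp only: norm_triangle_ineq)
  ultimately show ?thesis
    using first by linarith
qed

lemma increment_telescope:
  fixes g :: "('i \<Rightarrow> complex) \<Rightarrow> complex"
  assumes I: "finite I" and x: "\<And>i. i \<notin> I \<Longrightarrow> x i = 0"
    and step: "\<And>y i. \<lbrakk>i \<in> I; y i = 0; \<And>j. y j = 0 \<or> y j = x j\<rbrakk> \<Longrightarrow>
      cmod (g (y(i := x i)) - g y - x i * D i) \<le> e * cmod (x i)"
  shows "cmod (g x - g 0 - (\<Sum>i\<in>I. x i * D i)) \<le> e * (\<Sum>i\<in>I. cmod (x i))"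
  using assms
proof (induction I arbitrary: x rule: finite_induct)
  case empty
  then have "x = 0" by auto
  then show ?case by simp
next
  case (insert i I)
  let ?y = "x(i := 0)"
  have "cmod (g ?y - g 0 - (\<Sum>i\<in>I. ?y i * D i)) \<le> e * (\<Sum>i\<in>I. cmod (?y i))"
  proof (rule insert.IH)
    fix y j assume j: "j \<in> I" "y j = 0" and y: "\<And>l. y l = 0 \<or> y l = ?y l"
    have "y l = 0 \<or> y l = x l" for l
      using y[of l] by (auto split: if_splits)
    moreover have "j \<noteq> i"
      using j insert.hyps by blast
    ultimately show "cmod (g (y(j := ?y j)) - g y - ?y j * D j) \<le> e * cmod (?y j)"
      using insert.prems(2)[of j y] j by (simp add: fun_upd_other del: fun_upd_apply)
  qed (use insert.prems(1) in auto)
  moreover have "(\<Sum>j\<in>I. ?y j * D j) = (\<Sum>j\<in>I. x j * D j)" "(\<Sum>j\<in>I. cmod (?y j)) = (\<Sum>j\<in>I. cmod (x j))"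
    using insert.hyps by (auto intro!: sum.cong)
  ultimately have "cmod (g ?y - g 0 - (\<Sum>j\<in>I. x j * D j)) \<le> e * (\<Sum>j\<in>I. cmod (x j))"
    by (simp only:)
  moreover have "cmod (g (?y(i := x i)) - g ?y - x i * D i) \<le> e * cmod (x i)"
    by (rule insert.prems(2)) auto
  moreover have "g x - g 0 - (\<Sum>j\<in>insert i I. x j * D j)
      = (g (?y(i := x i)) - g ?y - x i * D i) + (g ?y - g 0 - (\<Sum>j\<in>I. x j * D j))"
    using insert.hyps by simp
  then have "cmod (g x - g 0 - (\<Sum>j\<in>insert i I. x j * D j))
      \<le> cmod (g (?y(i := x i)) - g ?y - x i * D i) + cmod (g ?y - g 0 - (\<Sum>j\<in>I. x j * D j))"
    by (simp only: norm_triangle_ineq)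
  moreover have "e * (\<Sum>j\<in>insert i I. cmod (x j)) = e * cmod (x i) + e * (\<Sum>j\<in>I. cmod (x j))"
    using insert.hyps by (simp add: distrib_left)
  ultimately show ?case
    by linarith
qed

theorem osgood:
  fixes g :: "('i \<Rightarrow> complex) \<Rightarrow> complex"
  assumes I: "finite I" and g: "continuous_on (polydisc I \<rho>) g" and \<rho>: "\<rho> > 0"
    and sep: "\<And>x i z. \<lbrakk>x \<in> polydisc I \<rho>; i \<in> I; cmod z < \<rho>\<rbrakk> \<Longrightarrow> (\<lambda>z. g (x(i := z))) field_differentiable at z"
    and e: "e > 0"
  shows "\<forall>\<^sub>F d in at_right 0. \<forall>x\<in>polydisc I d.
    cmod (g x - g 0 - (\<Sum>i\<in>I. x i * deriv (\<lambda>z. g (0(i := z))) 0)) \<le> e * (\<Sum>i\<in>I. cmod (x i))"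
proof -
  let ?D = "\<lambda>i. deriv (\<lambda>z. g (0(i := z))) 0"
  have "\<forall>\<^sub>F d in at_right 0. \<forall>i\<in>I. \<forall>x\<in>polydisc I d. \<forall>z\<in>cball 0 \<rho>.
      cmod (g (x(i := z)) - g (0(i := z))) \<le> e * \<rho> / 8"
    using e \<rho> by (intro eventually_ball_finite I ballI slice_uniformly_close[OF I g \<rho>]) auto
  moreover have "\<forall>\<^sub>F d in at_right 0. \<forall>i\<in>I. \<forall>h. cmod h \<le> d \<longrightarrow>
      cmod (g (0(i := h)) - g 0 - h * ?D i) \<le> e / 2 * cmod h"
  proof (intro eventually_ball_finite I ballI)
    fix i assume "i \<in> I"
    then have "(\<lambda>z. g (0(i := z))) field_differentiable at 0"
      using sep[OF zero_in_polydisc] \<rho> by simp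
    moreover have "0(i := 0) = (0 :: 'i \<Rightarrow> complex)" by auto
    ultimately show "\<forall>\<^sub>F d in at_right 0. \<forall>h. cmod h \<le> d \<longrightarrow> cmod (g (0(i := h)) - g 0 - h * ?D i) \<le> e / 2 * cmod h"
      using field_differentiable_first_order[of "\<lambda>z. g (0(i := z))" "e / 2"] e by simp
  qed
  moreover have "\<forall>\<^sub>F d in at_right 0. d < \<rho> / 2"
    unfolding eventually_at_right_field using \<rho> by (intro exI[of _ "\<rho> / 2"]) simp
  ultimately show ?thesis
    using eventually_at_right_less[of 0]
  proof eventually_elim
    case (elim d)
    show ?case
    proof
      fix x assume x: "x \<in> polydisc I d"
      show "cmod (g x - g 0 - (\<Sum>i\<in>I. x i * ?D i)) \<le> e * (\<Sum>i\<in>I. cmod (x i))"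
      proof (rule increment_telescope[OF I])
        fix y i assume i: "i \<in> I" "y i = 0" and y: "\<And>j. y j = 0 \<or> y j = x j"
        have "cmod (y j) \<le> cmod (x j)" for j
          using y[of j] by auto
        then have yd: "y \<in> polydisc I d"
          using x unfolding polydisc_def by (auto intro: order_trans) (metis norm_le_zero_iff norm_zero)
        have xi: "cmod (x i) \<le> d"
          using x i(1) by (simp add: polydisc_def)
        show "cmod (g (y(i := x i)) - g y - x i * ?D i) \<le> e * cmod (x i)"
        proof (rule osgood_step[where g = g and i = i and I = I and \<rho> = \<rho> and y = y, OF _ \<rho> _ i(2)])
          show "(\<lambda>z. g (u(i := z))) field_differentiable at z" if "u \<in> polydisc I \<rho>" "cmod z < \<rho>" for u z
            using sep that i(1) by blast
          show "y \<in> polydisc I \<rho>"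
            using yd polydisc_mono[of d \<rho> I] elim(3) \<rho> by auto
          show "cmod (g (y(i := z)) - g (0(i := z))) \<le> e * \<rho> / 8" if "z \<in> cball 0 \<rho>" for z
            using elim(1) i(1) yd that by blast
          show "cmod (g (0(i := x i)) - g 0 - x i * ?D i) \<le> e / 2 * cmod (x i)"
            using elim(2) i(1) xi by blast
        qed (use xi elim(3) in auto)
      qed (use x in \<open>auto simp: polydisc_def\<close>)
    qed
  qed
qed

section \<open>The degree of a perturbed complex linear map\<close>

definition real_coords :: "nat \<Rightarrow> (nat \<Rightarrow> complex) \<Rightarrow> nat \<Rightarrow> real" where
  "real_coords c y j = (if j < 2 * c then (if even j then Re (y (j div 2)) else Im (y (j div 2))) else 0)"

definition simplex_coords :: "real \<Rightarrow> (nat \<Rightarrow> real) \<Rightarrow> nat \<Rightarrow> complex" where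
  "simplex_coords r x t = of_real r * Complex (x (2 * t + 1) - x 0) (x (2 * t + 2) - x 0)"

definition coords_simplex :: "nat \<Rightarrow> ((nat \<Rightarrow> real) \<Rightarrow> nat \<Rightarrow> complex) \<Rightarrow> (nat \<Rightarrow> real) \<Rightarrow> nat \<Rightarrow> real" where
  "coords_simplex c f = (\<lambda>x\<in>standard_simplex (2 * c). real_coords c (f x))"

lemma real_coords_simplex_coords:
  "real_coords c (simplex_coords r x) j = (if j < 2 * c then r * (x (Suc j) - x 0) else 0)"
  by (cases "even j") (auto simp: real_coords_def simplex_coords_def elim!: oddE)

lemma coords_simplex_simplex_coords: "coords_simplex c (simplex_coords r) = transverse_simplex (2 * c) 0 r"
  unfolding coords_simplex_def transverse_simplex_def
  by (intro restrict_ext ext) (simp add: real_coords_simplex_coords)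

lemma real_coords_eq_0_iff: "real_coords c y = 0 \<longleftrightarrow> (\<forall>s<c. y s = 0)"
proof (intro iffI allI impI)
  fix s assume "real_coords c y = 0" "s < c"
  then have "real_coords c y (2 * s) = 0" "real_coords c y (2 * s + 1) = 0"
    by auto
  with \<open>s < c\<close> show "y s = 0"
    by (simp add: real_coords_def complex_eq_iff)
next
  assume "\<forall>s<c. y s = 0"
  moreover have "j div 2 < c" if "j < 2 * c" for j
    using that by simp
  ultimately show "real_coords c y = 0"
    by (auto simp: real_coords_def fun_eq_iff)
qed

lemma real_coords_cong: "(\<And>s. s < c \<Longrightarrow> y s = z s) \<Longrightarrow> real_coords c y = real_coords c z"
  by (auto simp: real_coords_def fun_eq_iff less_mult_imp_div_less mult.commute)

lemma real_coords_in_Euclidean_set: "real_coords c y \<in> Euclidean_set (2 * c)"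
  by (simp add: real_coords_def Euclidean_set_def)

lemma continuous_on_real_coords:
  assumes "\<And>s. s < c \<Longrightarrow> continuous_on S (\<lambda>x. f x s)"
  shows "continuous_on S (\<lambda>x. real_coords c (f x))"
proof (rule continuous_on_coordinatewise_then_product)
  show "continuous_on S (\<lambda>x. real_coords c (f x) j)" for j
    using assms[of "j div 2"] by (cases "j < 2 * c"; cases "even j") (auto simp: real_coords_def intro: continuous_intros)
qed

lemma continuous_on_simplex_coords: "continuous_on S (\<lambda>x. simplex_coords r x t)"
proof -
  have "simplex_coords r x t = of_real r * (of_real (x (2 * t + 1) - x 0) + \<i> * of_real (x (2 * t + 2) - x 0))" for x
    by (simp add: simplex_coords_def complex_eq_iff)
  then show ?thesis
    by (auto intro!: continuous_intros)
qed

lemma simplex_coords_boundary_nonzero: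
  assumes "x \<in> standard_simplex (2 * c)" "k \<le> 2 * c" "x k = 0" "r > 0"
  shows "\<exists>s<c. simplex_coords r x s \<noteq> 0"
proof -
  obtain j where "j < 2 * c" "x (Suc j) \<noteq> x 0"
    using standard_simplex_face_not_constant[OF assms(1-3)] by blast
  then have "real_coords c (simplex_coords r x) j \<noteq> 0"
    using assms(4) by (simp add: real_coords_simplex_coords)
  then show ?thesis
    using real_coords_eq_0_iff[of c "simplex_coords r x"] by auto
qed

definition array_apply :: "nat \<Rightarrow> (nat \<Rightarrow> nat \<Rightarrow> complex) \<Rightarrow> (nat \<Rightarrow> complex) \<Rightarrow> nat \<Rightarrow> complex" where
  "array_apply c D y s = (\<Sum>t<c. D s t * y t)"

definition array_inj :: "nat \<Rightarrow> (nat \<Rightarrow> nat \<Rightarrow> complex) \<Rightarrow> bool" where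
  "array_inj c D \<longleftrightarrow> (\<forall>y. (\<forall>s<c. array_apply c D y s = 0) \<longrightarrow> (\<forall>t<c. y t = 0))"

lemma array_apply_id: "s < c \<Longrightarrow> array_apply c (\<lambda>s t. of_bool (s = t)) y s = y s"
  unfolding array_apply_def by (subst sum.remove[of _ s]) (auto intro!: sum.neutral)

lemma array_inj_iff_det: "array_inj c D \<longleftrightarrow> array_det c (\<lambda>i j. D j i) \<noteq> 0"
  unfolding array_inj_def array_apply_def array_det_nonzero_iff by (simp add: mult.commute)

lemma array_inj_left_inverse:
  assumes "array_inj c D"
  obtains B where "\<And>y t. t < c \<Longrightarrow> array_apply c B (array_apply c D y) t = y t"
proof
  let ?T = "\<lambda>i j. D j i" and ?d = "array_det c (\<lambda>i j. D j i)"
  fix y t assume t: "t < c"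
  have "array_apply c (\<lambda>t s. array_adj c ?T s t / ?d) (array_apply c D y) t
      = (\<Sum>s<c. \<Sum>l<c. y l * (?T l s * array_adj c ?T s t)) / ?d"
    by (simp add: array_apply_def sum_divide_distrib sum_distrib_left mult_ac)
  also have "\<dots> = (\<Sum>l<c. y l * (\<Sum>s<c. ?T l s * array_adj c ?T s t)) / ?d"
    by (subst sum.swap) (simp add: sum_distrib_left)
  also have "\<dots> = (\<Sum>l<c. if l = t then y t * ?d else 0) / ?d"
    by (intro arg_cong2[where f = "(/)"] sum.cong refl) (use t array_adj_mult(2)[of _ c t ?T] in auto)
  also have "\<dots> = y t"
    using t assms array_inj_iff_det by simp
  finally show "array_apply c (\<lambda>t s. array_adj c ?T s t / ?d) (array_apply c D y) t = y t" .
qed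

lemma array_inj_expansive:
  assumes "array_inj c D"
  obtains \<mu> where "\<mu> > 0" "\<And>y. \<mu> * (\<Sum>t<c. cmod (y t)) \<le> (\<Sum>s<c. cmod (array_apply c D y s))"
proof -
  obtain B where B: "\<And>y t. t < c \<Longrightarrow> array_apply c B (array_apply c D y) t = y t"
    using array_inj_left_inverse[OF assms] by blast
  define K where "K = 1 + (\<Sum>t<c. \<Sum>s<c. cmod (B t s))"
  have K: "K > 0"
    unfolding K_def by (intro add_pos_nonneg sum_nonneg) auto
  have "(\<Sum>t<c. cmod (y t)) \<le> K * (\<Sum>s<c. cmod (array_apply c D y s))" for y
  proof -
    let ?S = "\<Sum>s<c. cmod (array_apply c D y s)"
    have "cmod (y t) \<le> (\<Sum>s<c. cmod (B t s)) * ?S" if t: "t < c" for t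
    proof -
      have "cmod (y t) = cmod (\<Sum>s<c. B t s * array_apply c D y s)"
        using B[OF t] by (simp add: array_apply_def[of c B])
      also have "\<dots> \<le> (\<Sum>s<c. cmod (B t s) * ?S)"
        by (intro sum_norm_le) (auto simp: norm_mult intro!: mult_left_mono member_le_sum)
      finally show ?thesis
        by (simp add: sum_distrib_right)
    qed
    then have "(\<Sum>t<c. cmod (y t)) \<le> (\<Sum>t<c. (\<Sum>s<c. cmod (B t s)) * ?S)"
      by (intro sum_mono) auto
    also have "\<dots> = (\<Sum>t<c. \<Sum>s<c. cmod (B t s)) * ?S"
      by (simp only: sum_distrib_right)
    also have "\<dots> \<le> K * ?S"
      unfolding K_def by (intro mult_right_mono sum_nonneg) auto
    finally show ?thesis .
  qed
  then show ?thesis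
    using that[of "1 / K"] K by (simp add: field_simps)
qed

lemma path_avoiding_roots:
  fixes P :: "complex poly"
  assumes "poly P a \<noteq> 0" "poly P b \<noteq> 0"
  obtains \<zeta> :: "real \<Rightarrow> complex" where "continuous_on {0..1} \<zeta>" "\<zeta> 0 = a" "\<zeta> 1 = b" "\<And>\<tau>. \<tau> \<in> {0..1} \<Longrightarrow> poly P (\<zeta> \<tau>) \<noteq> 0"
proof -
  have "finite {z. poly P z = 0}"
    using assms(1) by (intro poly_roots_finite) auto
  then have "path_connected (- {z. poly P z = 0})"
    by (intro path_connected_complement_countable) (auto intro: countable_finite)
  then obtain \<zeta> where "path \<zeta>" "path_image \<zeta> \<subseteq> - {z. poly P z = 0}" "pathstart \<zeta> = a" "pathfinish \<zeta> = b"
    unfolding path_connected_def using assms by blast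
  then have "poly P (\<zeta> \<tau>) \<noteq> 0" if "\<tau> \<in> {0..1}" for \<tau>
    using that unfolding path_image_def by blast
  with \<open>path \<zeta>\<close> \<open>pathstart \<zeta> = a\<close> \<open>pathfinish \<zeta> = b\<close> show ?thesis
    by (intro that[of \<zeta>]) (auto simp: path_def pathstart_def pathfinish_def)
qed

lemma array_det_pencil_poly:
  obtains P where "\<And>z. poly P z = array_det c (\<lambda>i j. (1 - z) * A i j + z * B i j)"
proof
  show "poly (\<Sum>p | p permutes {0..<c}. [:signof p:] * (\<Prod>i=0..<c. [:A i (p i), B i (p i) - A i (p i):])) z
      = array_det c (\<lambda>i j. (1 - z) * A i j + z * B i j)" for z
    unfolding array_det_eq_sum by (simp add: poly_sum poly_prod algebra_simps)
qed

lemma array_inj_path: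
  assumes D: "array_inj c D"
  obtains \<gamma> :: "real \<Rightarrow> nat \<Rightarrow> nat \<Rightarrow> complex" where
    "\<And>s t. continuous_on {0..1} (\<lambda>\<tau>. \<gamma> \<tau> s t)" "\<gamma> 0 = D" "\<gamma> 1 = (\<lambda>s t. of_bool (s = t))"
    "\<And>\<tau>. \<tau> \<in> {0..1} \<Longrightarrow> array_inj c (\<gamma> \<tau>)"
proof -
  let ?M = "\<lambda>z s t. (1 - z) * D s t + z * of_bool (s = t)"
  obtain P where "\<And>z. poly P z = array_det c (\<lambda>i j. (1 - z) * D j i + z * of_bool (j = i))"
    using array_det_pencil_poly[of c "\<lambda>i j. D j i" "\<lambda>i j. of_bool (j = i)"] by blast
  then have P: "poly P z \<noteq> 0 \<longleftrightarrow> array_inj c (?M z)" for z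
    by (simp add: array_inj_iff_det)
  have "array_inj c (?M 1)"
    by (simp add: array_inj_def array_apply_id)
  then obtain \<zeta> :: "real \<Rightarrow> complex" where \<zeta>: "continuous_on {0..1} \<zeta>" "\<zeta> 0 = 0" "\<zeta> 1 = 1" "\<And>\<tau>. \<tau> \<in> {0..1} \<Longrightarrow> poly P (\<zeta> \<tau>) \<noteq> 0"
    using path_avoiding_roots[of P 0 1] D P[of 0] P[of 1] by auto
  show ?thesis
  proof (rule that[of "\<lambda>\<tau>. ?M (\<zeta> \<tau>)"])
    show "array_inj c (?M (\<zeta> \<tau>))" if "\<tau> \<in> {0..1}" for \<tau>
      using \<zeta>(4)[OF that] P by blast
  qed (use \<zeta> in \<open>auto intro!: continuous_intros\<close>)
qed

lemma prod_topology_top_of_set: "prod_topology (top_of_set S) (top_of_set T) = top_of_set (S \<times> T)"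
  by (simp add: prod_topology_subtopology subtopology_subtopology Times_Int_Times flip: prod_topology_euclidean)

lemma homologous_rel_coords_simplex:
  fixes H :: "real \<Rightarrow> (nat \<Rightarrow> real) \<Rightarrow> nat \<Rightarrow> complex"
  assumes H: "\<And>s. s < c \<Longrightarrow> continuous_on ({0..1} \<times> standard_simplex (2 * c)) (\<lambda>p. H (fst p) (snd p) s)"
    and nonzero: "\<And>\<tau> x k. \<lbrakk>\<tau> \<in> {0..1}; x \<in> standard_simplex (2 * c); k \<le> 2 * c; x k = 0\<rbrakk> \<Longrightarrow> \<exists>s<c. H \<tau> x s \<noteq> 0"
  shows "homologous_rel (2 * c) (Euclidean_space (2 * c)) (- {0})
    (frag_of (coords_simplex c (H 0))) (frag_of (coords_simplex c (H 1)))"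
proof -
  let ?\<Delta> = "standard_simplex (2 * c)" and ?E = "Euclidean_space (2 * c)"
  let ?boundary = "{x. \<exists>k\<le>2 * c. x k = (0 :: real)}"
  have top: "subtopology (powertop_real UNIV) ?\<Delta> = top_of_set ?\<Delta>"
    by (simp add: powertop_real_eq_euclidean)
  have "singular_simplex (2 * c) (top_of_set ?\<Delta>) (restrict id ?\<Delta>)"
    using simplicial_imp_singular_simplex[of "2 * c" ?\<Delta>] by (simp flip: top)
  then have cycle: "singular_relcycle (2 * c) (top_of_set ?\<Delta>) ?boundary (frag_of (restrict id ?\<Delta>))"
    by (rule singular_relcycle_of_simplex) auto
  have "continuous_on ({0..1} \<times> ?\<Delta>) (\<lambda>p. real_coords c (H (fst p) (snd p)))"
    by (rule continuous_on_real_coords) (rule H)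
  then have "continuous_map (prod_topology (top_of_set {0..1}) (top_of_set ?\<Delta>)) ?E (\<lambda>(\<tau>, x). real_coords c (H \<tau> x))"
    using real_coords_in_Euclidean_set unfolding Euclidean_space_eq prod_topology_top_of_set
    by (auto simp: case_prod_unfold)
  moreover have "real_coords c (H \<tau> x) \<noteq> 0" if "\<tau> \<in> {0..1}" "x \<in> ?\<Delta> \<inter> ?boundary" for \<tau> x
    using nonzero[of \<tau> x] that real_coords_eq_0_iff by fastforce
  ultimately have "homotopic_with (\<lambda>h. h \<in> topspace (top_of_set ?\<Delta>) \<inter> ?boundary \<rightarrow> - {0}) (top_of_set ?\<Delta>) ?E
      (\<lambda>x. real_coords c (H 0 x)) (\<lambda>x. real_coords c (H 1 x))"
    unfolding homotopic_with_def by (intro exI[of _ "\<lambda>(\<tau>, x). real_coords c (H \<tau> x)"]) auto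
  from homotopic_imp_homologous_rel[OF this cycle] show ?thesis
    unfolding coords_simplex_def chain_map_of
    by (simp add: simplex_map_def restrict_def cong: if_cong)
qed

lemma perturbed_linear_nonzero:
  assumes \<mu>: "\<mu> > 0" "\<mu> * (\<Sum>t<c. cmod (y t)) \<le> (\<Sum>s<c. cmod (array_apply c D y s))"
    and close: "(\<Sum>s<c. cmod (v s - array_apply c D y s)) \<le> \<mu> / 2 * (\<Sum>t<c. cmod (y t))"
    and \<tau>: "\<tau> \<in> {0..1}" and y: "\<exists>t<c. y t \<noteq> 0"
  shows "\<exists>s<c. of_real (1 - \<tau>) * v s + of_real \<tau> * array_apply c D y s \<noteq> 0"
proof (rule ccontr)
  let ?L = "array_apply c D y"
  assume "\<not> ?thesis"
  then have "?L s = of_real (1 - \<tau>) * (?L s - v s)" if "s < c" for s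
    using that by (auto simp: algebra_simps)
  then have "cmod (?L s) \<le> cmod (v s - ?L s)" if "s < c" for s
    using that \<tau> norm_mult[of "of_real (1 - \<tau>)" "?L s - v s"]
      mult_left_le_one_le[of "cmod (?L s - v s)" "1 - \<tau>"] by (simp add: norm_minus_commute del: of_real_diff)
  then have "(\<Sum>s<c. cmod (?L s)) \<le> (\<Sum>s<c. cmod (v s - ?L s))"
    by (intro sum_mono) auto
  moreover have "(\<Sum>t<c. cmod (y t)) > 0"
    using y by (auto intro: sum_pos2)
  ultimately show False
    using \<mu> close by (smt (verit) mult_less_cancel_right_disj field_sum_of_halves)
qed

theorem local_degree_perturbed_linear:
  assumes D: "array_inj c D"
  obtains \<mu> where "\<mu> > 0"
    "\<And>r f. \<lbrakk>r > 0; \<And>s. s < c \<Longrightarrow> continuous_on (standard_simplex (2 * c)) (\<lambda>x. f x s);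
        \<And>x. x \<in> standard_simplex (2 * c) \<Longrightarrow> (\<Sum>s<c. cmod (f x s - array_apply c D (simplex_coords r x) s))
          \<le> \<mu> * (\<Sum>t<c. cmod (simplex_coords r x t))\<rbrakk> \<Longrightarrow>
      (\<forall>x\<in>standard_simplex (2 * c). \<forall>k\<le>2 * c. x k = 0 \<longrightarrow> (\<exists>s<c. f x s \<noteq> 0)) \<and>
      local_degree (2 * c) (frag_of (coords_simplex c f)) = 1"
proof -
  obtain \<mu> where \<mu>: "\<mu> > 0" "\<And>y. \<mu> * (\<Sum>t<c. cmod (y t)) \<le> (\<Sum>s<c. cmod (array_apply c D y s))"
    using array_inj_expansive[OF D] by blast
  obtain \<gamma> :: "real \<Rightarrow> nat \<Rightarrow> nat \<Rightarrow> complex" where \<gamma>: "\<And>s t. continuous_on {0..1} (\<lambda>\<tau>. \<gamma> \<tau> s t)"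
      "\<gamma> 0 = D" "\<gamma> 1 = (\<lambda>s t. of_bool (s = t))" "\<And>\<tau>. \<tau> \<in> {0..1} \<Longrightarrow> array_inj c (\<gamma> \<tau>)"
    using array_inj_path[OF D] by blast
  let ?\<Delta> = "standard_simplex (2 * c)" and ?E = "Euclidean_space (2 * c)"
  show ?thesis
  proof (rule that[of "\<mu> / 2"])
    fix r :: real and f :: "(nat \<Rightarrow> real) \<Rightarrow> nat \<Rightarrow> complex"
    assume r: "r > 0" and f: "\<And>s. s < c \<Longrightarrow> continuous_on ?\<Delta> (\<lambda>x. f x s)"
      and close: "\<And>x. x \<in> ?\<Delta> \<Longrightarrow> (\<Sum>s<c. cmod (f x s - array_apply c D (simplex_coords r x) s))
        \<le> \<mu> / 2 * (\<Sum>t<c. cmod (simplex_coords r x t))"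
    let ?L = "\<lambda>x. array_apply c D (simplex_coords r x)"
    let ?line = "\<lambda>\<tau> x s. of_real (1 - \<tau>) * f x s + of_real \<tau> * ?L x s"
    let ?turn = "\<lambda>\<tau> x. array_apply c (\<gamma> \<tau>) (simplex_coords r x)"
    have y_cont: "continuous_on ({0..1} \<times> ?\<Delta>) (\<lambda>p. simplex_coords r (snd p) t)" for t :: nat
      by (rule continuous_on_compose2[OF continuous_on_simplex_coords[of UNIV]]) (auto intro: continuous_intros)
    have line_nonzero: "\<exists>s<c. ?line \<tau> x s \<noteq> 0"
      if \<tau>: "\<tau> \<in> {0..1}" and x: "x \<in> ?\<Delta>" "k \<le> 2 * c" "x k = 0" for \<tau> x k
      using perturbed_linear_nonzero[OF \<mu>(1) \<mu>(2) close[OF x(1)] \<tau> simplex_coords_boundary_nonzero[OF x r]] .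
    have hom_line: "homologous_rel (2 * c) ?E (- {0}) (frag_of (coords_simplex c (?line 0))) (frag_of (coords_simplex c (?line 1)))"
    proof (rule homologous_rel_coords_simplex[OF _ line_nonzero])
      show "continuous_on ({0..1} \<times> ?\<Delta>) (\<lambda>p. ?line (fst p) (snd p) s)" if "s < c" for s
        unfolding array_apply_def
        by (intro continuous_intros y_cont continuous_on_compose2[OF f[OF that] continuous_on_snd[OF continuous_on_id]]) auto
    qed
    have hom_turn: "homologous_rel (2 * c) ?E (- {0}) (frag_of (coords_simplex c (?turn 0))) (frag_of (coords_simplex c (?turn 1)))"
    proof (rule homologous_rel_coords_simplex)
      show "continuous_on ({0..1} \<times> ?\<Delta>) (\<lambda>p. ?turn (fst p) (snd p) s)" for s
        unfolding array_apply_def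
        by (intro continuous_intros y_cont continuous_on_compose2[OF \<gamma>(1)]) auto
      show "\<exists>s<c. ?turn \<tau> x s \<noteq> 0" if "\<tau> \<in> {0..1}" "x \<in> ?\<Delta>" "k \<le> 2 * c" "x k = 0" for \<tau> x k
        using \<gamma>(4)[OF that(1)] simplex_coords_boundary_nonzero[OF that(2-) r] unfolding array_inj_def by blast
    qed
    have lines: "?line 0 = f" "?line 1 = ?turn 0"
      using \<gamma>(2) by auto
    have "real_coords c (?turn 1 x) = real_coords c (simplex_coords r x)" for x
      unfolding \<gamma>(3) by (intro real_coords_cong array_apply_id)
    then have turn_1: "coords_simplex c (?turn 1) = transverse_simplex (2 * c) 0 r"
      unfolding coords_simplex_simplex_coords[symmetric] coords_simplex_def by simp
    have hom: "homologous_rel (2 * c) ?E (- {0}) (frag_of (coords_simplex c f)) (frag_of (transverse_simplex (2 * c) 0 r))"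
      by (rule homologous_rel_trans[OF hom_turn[unfolded turn_1] hom_line[unfolded lines]])
    moreover have "\<exists>s<c. f x s \<noteq> 0" if "x \<in> ?\<Delta>" "k \<le> 2 * c" "x k = 0" for x k
      using line_nonzero[of 0 x k] that by simp
    ultimately show "(\<forall>x\<in>?\<Delta>. \<forall>k\<le>2 * c. x k = 0 \<longrightarrow> (\<exists>s<c. f x s \<noteq> 0)) \<and>
        local_degree (2 * c) (frag_of (coords_simplex c f)) = 1"
      using local_degree_cong[OF hom transverse_simplex_relcycle[OF r]] local_degree_transverse_simplex[OF r] by simp
  qed (use \<mu> in simp)
qed

section \<open>Charts of the Grassmannian\<close>

lemma GrD: "V \<in> Gr k m \<Longrightarrow> csubspace V" "V \<in> Gr k m \<Longrightarrow> V \<subseteq> cspace m" "V \<in> Gr k m \<Longrightarrow> cdim V = k"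
  by (auto simp: Gr_def)

lemma continuous_on_entry: "continuous_on S (\<lambda>A :: 'i \<Rightarrow> 'j \<Rightarrow> 'a :: topological_space. A i j)"
  by (rule continuous_on_compose2[OF continuous_on_coordinate[of UNIV j] continuous_on_coordinate]) simp

lemma quotient_map_row_space: "quotient_map (top_of_set (frames k m)) (Gr_top k m) (row_space k)"
  unfolding quotient_map_def topspace_Gr_top openin_Gr_top
  using row_space_in_Gr Gr_frame by (auto simp: image_iff) metis

lemma continuous_map_from_Gr:
  assumes U: "openin (Gr_top k m) U"
    and f: "continuous_on {A \<in> frames k m. row_space k A \<in> U} (\<lambda>A. f (row_space k A))" "f ` U \<subseteq> T"
  shows "continuous_map (subtopology (Gr_top k m) U) (top_of_set T) f"
proof -
  let ?P = "{A \<in> frames k m. row_space k A \<in> U}"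
  have "quotient_map (subtopology (top_of_set (frames k m)) ?P) (subtopology (Gr_top k m) U) (row_space k)"
    by (rule quotient_map_restriction[OF quotient_map_row_space]) (use U in auto)
  moreover have "continuous_map (subtopology (top_of_set (frames k m)) ?P) (top_of_set T) (f \<circ> row_space k)"
    using f by (auto simp: subtopology_subtopology Int_absorb1 continuous_map_in_subtopology o_def image_subset_iff)
  ultimately show ?thesis
    using continuous_compose_quotient_map_eq by blast
qed

lemma openin_Gr_preimage:
  assumes U: "openin (Gr_top k m) U"
    and f: "continuous_on {A \<in> frames k m. row_space k A \<in> U} (\<lambda>A. f (row_space k A))" and T: "open T"
  shows "openin (Gr_top k m) {V \<in> U. f V \<in> T}"
proof -
  have "continuous_map (subtopology (Gr_top k m) U) euclidean f"
    using continuous_map_from_Gr[OF U f(1), of UNIV] by simp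
  then have "openin (subtopology (Gr_top k m) U) {V \<in> topspace (subtopology (Gr_top k m) U). f V \<in> T}"
    using T by (intro openin_continuous_map_preimage) auto
  moreover have "topspace (subtopology (Gr_top k m) U) = U"
    using openin_subset[OF U] by (simp add: Int_absorb1)
  ultimately show ?thesis
    using U openin_open_subtopology by metis
qed

subsection \<open>Vectors dual to the projection to some columns\<close>

definition injective_on_columns :: "nat \<Rightarrow> (nat \<Rightarrow> nat) \<Rightarrow> (nat \<Rightarrow> complex) set \<Rightarrow> bool" where
  "injective_on_columns k e V \<longleftrightarrow> (\<forall>v\<in>V. (\<forall>l<k. v (e l) = 0) \<longrightarrow> v = 0)"

definition dual_vector :: "nat \<Rightarrow> (nat \<Rightarrow> nat) \<Rightarrow> nat \<Rightarrow> (nat \<Rightarrow> complex) set \<Rightarrow> nat \<Rightarrow> complex" where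
  "dual_vector k e i V = (THE u. u \<in> V \<and> (\<forall>l<k. u (e l) = (if l = i then 1 else 0)))"

lemma injective_on_columns_iff_det:
  assumes "W \<in> frames k m"
  shows "injective_on_columns k e (row_space k W) \<longleftrightarrow> array_det k (\<lambda>i l. W i (e l)) \<noteq> 0"
proof -
  have zero: "lincomb {..<k} g W = 0 \<longleftrightarrow> (\<forall>j<k. g j = 0)" for g
    using assms lin_indepD[of "{..<k}" W g] unfolding frames_iff by (auto simp: lincomb_def fun_eq_iff)
  have "injective_on_columns k e (row_space k W)
      \<longleftrightarrow> (\<forall>g. (\<forall>l<k. lincomb {..<k} g W (e l) = 0) \<longrightarrow> lincomb {..<k} g W = 0)"
    unfolding injective_on_columns_def Ball_def in_row_space_iff by blast
  then show ?thesis
    unfolding array_det_nonzero_iff zero by (simp add: lincomb_def)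
qed

lemma frame_if_det_nonzero:
  assumes "\<And>i. i < k \<Longrightarrow> W i \<in> cspace m" "\<And>i. k \<le> i \<Longrightarrow> W i = 0" "array_det k (\<lambda>i l. W i (e l)) \<noteq> 0"
  shows "W \<in> frames k m"
  unfolding frames_iff lin_indep_def
proof (intro conjI allI impI ballI)
  fix c l assume c: "lincomb {..<k} c W = 0" and l: "l \<in> {..<k}"
  have "(\<Sum>j<k. c j * W j (e l)) = 0" for l
    using fun_cong[OF c, of "e l"] by (simp add: lincomb_def)
  then show "c l = 0"
    using assms(3) l unfolding array_det_nonzero_iff by blast
qed (use assms in auto)

lemma dual_vector_eqI:
  assumes "injective_on_columns k e V" "csubspace V" "u \<in> V" "\<And>l. l < k \<Longrightarrow> u (e l) = (if l = i then 1 else 0)"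
  shows "dual_vector k e i V = u"
  unfolding dual_vector_def
proof (rule the_equality)
  fix v assume v: "v \<in> V \<and> (\<forall>l<k. v (e l) = (if l = i then 1 else 0))"
  then have "v - u \<in> V"
    using assms cvec.subspace_diff by blast
  moreover have "\<forall>l<k. (v - u) (e l) = 0"
    using v assms by simp
  ultimately have "v - u = 0"
    using assms(1) unfolding injective_on_columns_def by blast
  then show "v = u" by simp
qed (use assms in auto)

lemma dual_vector_row_space:
  assumes W: "W \<in> frames k m" and T: "array_det k (\<lambda>i l. W i (e l)) \<noteq> 0" and i: "i < k"
  defines "u \<equiv> lincomb {..<k} (\<lambda>j. array_adj k (\<lambda>i l. W i (e l)) i j / array_det k (\<lambda>i l. W i (e l))) W"
  shows "dual_vector k e i (row_space k W) = u" "u \<in> row_space k W" "l < k \<Longrightarrow> u (e l) = (if l = i then 1 else 0)"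
proof -
  let ?T = "\<lambda>i l. W i (e l)"
  show u: "u \<in> row_space k W"
    unfolding in_row_space_iff u_def by blast
  have columns: "u (e l) = (if l = i then 1 else 0)" if l: "l < k" for l
  proof -
    have "u (e l) = (\<Sum>j<k. array_adj k ?T i j * ?T j l) / array_det k ?T"
      by (simp add: u_def lincomb_def sum_divide_distrib)
    then show ?thesis
      using array_adj_mult(1)[OF i l, of ?T] T by simp
  qed
  then show "l < k \<Longrightarrow> u (e l) = (if l = i then 1 else 0)" .
  show "dual_vector k e i (row_space k W) = u"
    by (rule dual_vector_eqI) (use W T u columns row_space_in_Gr[OF W] in \<open>auto simp: injective_on_columns_iff_det GrD\<close>)
qed

lemma dual_vector_properties:
  assumes V: "V \<in> Gr k m" and inj: "injective_on_columns k e V" and i: "i < k"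
  shows "dual_vector k e i V \<in> V" "l < k \<Longrightarrow> dual_vector k e i V (e l) = (if l = i then 1 else 0)"
proof -
  obtain W where W: "W \<in> frames k m" "row_space k W = V"
    using Gr_frame[OF V] .
  then have "array_det k (\<lambda>i l. W i (e l)) \<noteq> 0"
    using inj injective_on_columns_iff_det by blast
  then show "dual_vector k e i V \<in> V" "l < k \<Longrightarrow> dual_vector k e i V (e l) = (if l = i then 1 else 0)"
    using dual_vector_row_space[OF W(1) _ i] W(2) by auto
qed

lemma openin_injective_on_columns: "openin (Gr_top k m) {V \<in> Gr k m. injective_on_columns k e V}"
proof -
  have "{A \<in> frames k m. row_space k A \<in> {V \<in> Gr k m. injective_on_columns k e V}}
      = frames k m \<inter> (\<lambda>A. array_det k (\<lambda>i l. A i (e l))) -` (- {0})"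
    using row_space_in_Gr injective_on_columns_iff_det by auto
  moreover have "openin (top_of_set (frames k m)) (frames k m \<inter> (\<lambda>A. array_det k (\<lambda>i l. A i (e l))) -` (- {0}))"
    by (intro continuous_openin_preimage_gen continuous_on_array_det continuous_on_entry) auto
  ultimately show ?thesis
    unfolding openin_Gr_top by auto
qed

lemma continuous_on_dual_vector:
  assumes U: "\<And>V. V \<in> U \<Longrightarrow> injective_on_columns k e V" and i: "i < k"
  shows "continuous_on {A \<in> frames k m. row_space k A \<in> U} (\<lambda>A. dual_vector k e i (row_space k A) p)"
proof -
  let ?P = "{A \<in> frames k m. row_space k A \<in> U}"
  have det: "array_det k (\<lambda>i l. A i (e l)) \<noteq> 0" if "A \<in> ?P" for A
    using that U[of "row_space k A"] injective_on_columns_iff_det[of A k m e] by auto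
  have "continuous_on ?P (\<lambda>A. lincomb {..<k} (\<lambda>j. array_adj k (\<lambda>i l. A i (e l)) i j / array_det k (\<lambda>i l. A i (e l))) A p)"
    unfolding lincomb_def
    by (intro continuous_intros continuous_on_array_adj continuous_on_array_det continuous_on_entry) (use i det in auto)
  then show ?thesis
    by (rule continuous_on_cong[THEN iffD1, rotated -1]) (use dual_vector_row_space(1) det i in auto)
qed

lemma holomorphic_dual_vector:
  assumes U: "\<And>V. V \<in> U \<Longrightarrow> injective_on_columns k e V" and i: "i < k"
  shows "Gr_holomorphic_on k m (\<lambda>V. dual_vector k e i V p) U"
  unfolding Gr_holomorphic_on_def
proof (intro conjI ballI allI impI)
  show "continuous_on {A \<in> frames k m. row_space k A \<in> U} ((\<lambda>V. dual_vector k e i V p) \<circ> row_space k)"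
    unfolding o_def by (rule continuous_on_dual_vector[OF U i])
  fix A i' j assume A: "A \<in> frames k m" "row_space k A \<in> U" and ij: "i' < k" "j \<in> {1..m}"
  let ?A = "\<lambda>z. A(i' := (A i')(j := z))" and ?z = "A i' j"
  let ?T = "\<lambda>z i l. ?A z i (e l)"
  let ?F = "\<lambda>z. lincomb {..<k} (\<lambda>j. array_adj k (?T z) i j / array_det k (?T z)) (?A z) p"
  have entry: "(\<lambda>z. ?A z x y) field_differentiable at w" for x y w
    by (cases "x = i'"; cases "y = j") (auto intro: derivative_intros)
  then have det: "(\<lambda>z. array_det k (?T z)) field_differentiable at w" for w
    by (intro field_differentiable_array_det)
  have nonzero: "array_det k (?T ?z) \<noteq> 0"
    using A U[OF A(2)] injective_on_columns_iff_det[OF A(1)] by simp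
  have "\<forall>\<^sub>F z in nhds ?z. array_det k (?T z) \<noteq> 0"
    using field_differentiable_imp_continuous_at[OF det, of ?z] nonzero
    by (auto simp: eventually_nhds_conv_at isCont_def simp del: fun_upd_apply intro: tendsto_imp_eventually_ne)
  then have ev: "\<forall>\<^sub>F z in nhds ?z. ?F z = dual_vector k e i (row_space k (?A z)) p"
  proof (rule eventually_mono)
    fix z assume z: "array_det k (?T z) \<noteq> 0"
    have "?A z \<in> frames k m"
      by (rule frame_if_det_nonzero[where e = e, OF _ _ z]) (use A ij in \<open>auto simp: frames_iff cspace_def\<close>)
    then show "?F z = dual_vector k e i (row_space k (?A z)) p"
      using dual_vector_row_space(1)[where W = "?A z" and e = e, OF _ z i] by (simp only:)
  qed
  have "?F field_differentiable at ?z"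
    unfolding lincomb_def
    by (intro field_differentiable_sum field_differentiable_mult field_differentiable_divide
        field_differentiable_array_adj entry det i nonzero) auto
  then show "entry_slice ((\<lambda>V. dual_vector k e i V p) \<circ> row_space k) A i' j field_differentiable at ?z"
    unfolding field_differentiable_def entry_slice_def o_def using DERIV_cong_ev[OF refl ev refl] by blast
qed

lemma cdim_coord_span:
  assumes "finite T" shows "cdim (coord_span T) = card T"
proof (rule cdim_eqI[OF assms])
  show "lin_indep T Defs.unit_vec"
    unfolding lin_indep_def
  proof (intro allI impI ballI)
    fix c l assume "lincomb T c Defs.unit_vec = 0" "l \<in> T"
    then show "c l = 0"
      using lincomb_single[OF assms, of l c Defs.unit_vec l] by (auto simp: Defs.unit_vec_def)
  qed
qed (use in_span_image_iff[OF assms] cvec.span_superset in \<open>auto simp: coord_span_def\<close>)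

lemma injective_evaluation:
  fixes T :: "nat set"
  assumes W: "csubspace W" "finite S" "W \<subseteq> coord_span S" and T: "finite T"
    and inj: "\<And>w. \<lbrakk>w \<in> W; \<And>l. l \<in> T \<Longrightarrow> w (e l) = 0\<rbrakk> \<Longrightarrow> w = 0"
  shows "cdim W \<le> card T" and "card T \<le> cdim W \<Longrightarrow> \<exists>w\<in>W. \<forall>l\<in>T. w (e l) = g l"
proof -
  define ev where "ev w l = (if l \<in> T then w (e l) else 0)" for w :: "nat \<Rightarrow> complex" and l
  obtain v where v: "lin_indep {..<cdim W} v" "\<And>i. v i \<in> W" "\<And>w. w \<in> W \<Longrightarrow> \<exists>c. w = lincomb {..<cdim W} c v"
    using coord_span_subspace_family_basis[OF W] by blast
  have ev_lincomb: "lincomb {..<cdim W} c (\<lambda>i. ev (v i)) = ev (lincomb {..<cdim W} c v)" for c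
    unfolding lincomb_def ev_def by (auto simp: fun_eq_iff)
  have in_W: "lincomb {..<cdim W} c v \<in> W" for c
    by (rule lincomb_in_subspace) (use W v in auto)
  have "lin_indep {..<cdim W} (\<lambda>i. ev (v i))"
    unfolding lin_indep_def ev_lincomb
  proof (intro allI impI)
    fix c assume zero: "ev (lincomb {..<cdim W} c v) = 0"
    have "lincomb {..<cdim W} c v = 0"
      by (rule inj[OF in_W]) (metis ev_def fun_cong[OF zero] zero_fun_apply)
    then show "\<forall>l\<in>{..<cdim W}. c l = 0"
      using lin_indepD[OF v(1)] by blast
  qed
  moreover have "(\<lambda>i. ev (v i)) ` {..<cdim W} \<subseteq> coord_span T"
    using T by (auto simp: ev_def coord_span_eq)
  ultimately have ev_v: "finite {..<cdim W}" "lin_indep {..<cdim W} (\<lambda>i. ev (v i))"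
    "(\<lambda>i. ev (v i)) ` {..<cdim W} \<subseteq> coord_span T" by simp_all
  show le: "cdim W \<le> card T"
    using lin_indep_card_le[OF ev_v T order_refl] cdim_coord_span[OF T] by simp
  assume "card T \<le> cdim W"
  then have "card {..<cdim W} = cdim (coord_span T)"
    using le cdim_coord_span[OF T] by simp
  moreover have "(\<lambda>l. if l \<in> T then g l else 0) \<in> coord_span T"
    using T by (simp add: coord_span_eq)
  ultimately obtain c where "(\<lambda>l. if l \<in> T then g l else 0) = ev (lincomb {..<cdim W} c v)"
    using lin_indep_spans_subspace[OF ev_v _ T order_refl] unfolding ev_lincomb by blast
  then have "lincomb {..<cdim W} c v (e l) = g l" if "l \<in> T" for l
    using that by (auto simp: ev_def fun_eq_iff split: if_splits)
  then show "\<exists>w\<in>W. \<forall>l\<in>T. w (e l) = g l"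
    using in_W by blast
qed

lemma ex_enumeration_initial_subset:
  assumes "finite F" "A \<subseteq> F"
  shows "\<exists>e. bij_betw e {..<card F} F \<and> e ` {..<card A} = A"
proof -
  have fin: "finite A" "finite (F - A)"
    using assms finite_subset by auto
  obtain e1 e2 where e: "bij_betw e1 {..<card A} A" "bij_betw e2 {..<card (F - A)} (F - A)"
    using fin[THEN ex_bij_betw_nat_finite] unfolding atLeast0LessThan by blast
  let ?e = "\<lambda>s. if s < card A then e1 s else e2 (s - card A)"
  have card_F: "card F = card A + card (F - A)"
    using assms card_Diff_subset[OF fin(1)] card_mono[OF assms] by simp
  have initial: "bij_betw ?e {..<card A} A"
    by (rule bij_betw_cong[THEN iffD1, OF _ e(1)]) auto
  have "bij_betw (\<lambda>s. s - card A) {card A..<card F} {..<card (F - A)}"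
    by (rule bij_betw_byWitness[where f' = "\<lambda>s. s + card A"]) (auto simp: card_F)
  then have "bij_betw ?e {card A..<card F} (F - A)"
    by (intro bij_betw_cong[THEN iffD1, OF _ bij_betw_trans[OF _ e(2)]]) auto
  with initial have "bij_betw ?e ({..<card A} \<union> {card A..<card F}) (A \<union> (F - A))"
    by (rule bij_betw_combine) auto
  moreover have "{..<card A} \<union> {card A..<card F} = {..<card F}" "A \<union> (F - A) = F"
    using card_F assms by auto
  ultimately show ?thesis
    using initial unfolding bij_betw_def by (intro exI[of _ ?e]) auto
qed

subsection \<open>The chart around a cell\<close>

context interval_family
begin

text \<open>The projection of a member of the cell to the columns \<open>pivot_column p q l\<close> is bijective. For
  \<open>[p, q] = [a i, b i]\<close> the preimage of the \<open>i\<close>-th basis vector normalises the \<open>i\<close>-th row; its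
  other entries are the chart coordinates.\<close>

definition pivot_column :: "nat \<Rightarrow> nat \<Rightarrow> nat \<Rightarrow> nat" where
  "pivot_column p q l = (if a l < p then a l else if q < b l then b l else a l)"

abbreviation row_pivots :: "nat \<Rightarrow> nat \<Rightarrow> nat" where "row_pivots i \<equiv> pivot_column (a i) (b i)"
abbreviation normal_row :: "nat \<Rightarrow> (nat \<Rightarrow> complex) set \<Rightarrow> nat \<Rightarrow> complex" where "normal_row i \<equiv> dual_vector k (row_pivots i) i"

definition normal_frame :: "(nat \<Rightarrow> complex) set \<Rightarrow> nat \<Rightarrow> nat \<Rightarrow> complex" where
  "normal_frame V i = (if i < k then normal_row i V else 0)"

lemma inj_pivot_column: "inj_on (pivot_column p q) {..<k}"
proof (rule inj_onI)
  fix l l' assume l: "l \<in> {..<k}" "l' \<in> {..<k}" and eq: "pivot_column p q l = pivot_column p q l'"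
  have "a l \<le> b l" "a l' \<le> b l'"
    using ab l by auto
  then have "a l = a l' \<or> b l = b l'"
    using eq unfolding pivot_column_def by (auto split: if_splits)
  then show "l = l'"
    using l inj_a inj_b unfolding inj_on_def by blast
qed

lemma pivot_column_bounds: "l < k \<Longrightarrow> 1 \<le> pivot_column p q l \<and> pivot_column p q l \<le> m"
  using ab[of l] unfolding pivot_column_def by auto

lemma row_pivots_self: "row_pivots i i = a i"
  by (simp add: pivot_column_def)

lemma row_pivots_eq_iff: "\<lbrakk>l < k; i < k\<rbrakk> \<Longrightarrow> row_pivots i l = a i \<longleftrightarrow> l = i"
  using inj_on_eq_iff[OF inj_pivot_column, of l i "a i" "b i"] row_pivots_self by auto

lemma pivot_column_outside: "\<not> (p \<le> a l \<and> b l \<le> q) \<Longrightarrow> pivot_column p q l < p \<or> q < pivot_column p q l"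
  by (auto simp: pivot_column_def)

lemma cell_injective_on_columns:
  assumes "V \<in> cell" shows "injective_on_columns k (pivot_column p q) V"
  unfolding injective_on_columns_def
proof (intro ballI impI)
  fix v assume v: "v \<in> V" and zero: "\<forall>l<k. v (pivot_column p q l) = 0"
  obtain B where B: "supported_rows B" "V = row_space k B"
    using assms unfolding cell_def by blast
  obtain c where c: "v = lincomb {..<k} c B"
    using v B in_row_space_iff by blast
  have "c i = 0" if i: "i < k" for i
  proof (rule ccontr)
    assume nonzero: "c i \<noteq> 0"
    obtain j where j: "j < k" "c j \<noteq> 0" "\<forall>l<k. c l \<noteq> 0 \<longrightarrow> a j \<le> a l" "v (a j) \<noteq> 0"
      using supported_rows_leftmost[where c = c and i = i, OF B(1) i nonzero] unfolding c by metis
    obtain j' where j': "j' < k" "c j' \<noteq> 0" "\<forall>l<k. c l \<noteq> 0 \<longrightarrow> b l \<le> b j'" "v (b j') \<noteq> 0"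
      using supported_rows_rightmost[where c = c and i = i, OF B(1) i nonzero] unfolding c by metis
    have "v (pivot_column p q j) = 0" "v (pivot_column p q j') = 0" "a j \<le> a j'" "b j \<le> b j'"
      using zero j j' by auto
    then show False
      using j(4) j'(4) unfolding pivot_column_def by (auto split: if_splits)
  qed
  then show "v = 0"
    unfolding c lincomb_def by (auto simp: fun_eq_iff intro!: sum.neutral)
qed

lemma injective_on_columns_interval:
  assumes inj: "injective_on_columns k (pivot_column p q) V" and v: "v \<in> V \<inter> coord_span {p..q}"
    and zero: "\<And>l. l \<in> {l. l < k \<and> p \<le> a l \<and> b l \<le> q} \<Longrightarrow> v (pivot_column p q l) = 0"
  shows "v = 0"
proof -
  have "v (pivot_column p q l) = 0" if "l < k" for l
  proof (cases "p \<le> a l \<and> b l \<le> q")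
    case False
    then show ?thesis
      using v pivot_column_outside[OF False] unfolding Int_iff in_coord_span_interval by (meson not_less)
  qed (use zero that in auto)
  then show ?thesis
    using inj v unfolding injective_on_columns_def by blast
qed

lemma subspace_rank_le_interval_rank:
  assumes V: "V \<in> Gr k m" and inj: "injective_on_columns k (pivot_column p q) V"
  shows "subspace_rank V p q \<le> interval_rank intervals p q"
  unfolding subspace_rank_def interval_rank_intervals
  by (rule injective_evaluation(1)[where e = "pivot_column p q" and S = "{p..q}"])
    (use injective_on_columns_interval[OF inj] GrD[OF V] in \<open>auto intro: cvec.subspace_inter csubspace_coord_span\<close>)

lemma normal_row_in_coord_span:
  assumes V: "V \<in> Gr k m" and i: "i < k" and inj: "injective_on_columns k (row_pivots i) V"
    and rank: "interval_rank intervals (a i) (b i) \<le> subspace_rank V (a i) (b i)"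
  shows "normal_row i V \<in> coord_span {a i..b i}"
proof -
  let ?T = "{l. l < k \<and> a i \<le> a l \<and> b l \<le> b i}" and ?W = "V \<inter> coord_span {a i..b i}"
  have "\<exists>w\<in>?W. \<forall>l\<in>?T. w (row_pivots i l) = (if l = i then 1 else 0)"
    by (rule injective_evaluation(2)[where S = "{a i..b i}"])
      (use injective_on_columns_interval[OF inj] GrD[OF V] rank in
        \<open>auto simp: subspace_rank_def interval_rank_intervals intro: cvec.subspace_inter csubspace_coord_span\<close>)
  then obtain w where w: "w \<in> ?W" "\<And>l. l \<in> ?T \<Longrightarrow> w (row_pivots i l) = (if l = i then 1 else 0)"
    by blast
  have "w (row_pivots i l) = (if l = i then 1 else 0)" if "l < k" for l
  proof (cases "l \<in> ?T")
    case False
    then have "w (row_pivots i l) = 0" "l \<noteq> i"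
      using w(1) pivot_column_outside[of "a i" l "b i"] that i unfolding Int_iff in_coord_span_interval
      by (auto simp: not_less[symmetric])
    then show ?thesis by simp
  qed (use w(2) in blast)
  then have "normal_row i V = w"
    by (intro dual_vector_eqI) (use inj w GrD[OF V] in auto)
  then show ?thesis
    using w(1) by blast
qed

lemma supported_rows_normal_frame:
  assumes V: "V \<in> cell" shows "supported_rows (normal_frame V)"
proof -
  have Gr: "V \<in> Gr k m"
    using V cell_subset_Gr by blast
  obtain B where B: "supported_rows B" "V = row_space k B"
    using V unfolding cell_def by blast
  have "normal_row i V \<in> coord_span {a i..b i} \<and> normal_row i V (a i) \<noteq> 0 \<and> normal_row i V (b i) \<noteq> 0"
    if i: "i < k" for i
  proof -
    have support: "normal_row i V \<in> coord_span {a i..b i}"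
      by (rule normal_row_in_coord_span[OF Gr i cell_injective_on_columns[OF V]]) (simp add: subspace_rank_cell[OF V])
    have row: "normal_row i V \<in> V" "normal_row i V (a i) = 1"
      using dual_vector_properties[OF Gr cell_injective_on_columns[OF V, of "a i" "b i"] i] i row_pivots_self[of i] by fastforce+
    obtain c where c: "normal_row i V = lincomb {..<k} c B"
      using row(1) B in_row_space_iff by blast
    have inside: "a i \<le> a l \<and> b l \<le> b i" if "l < k" "c l \<noteq> 0" for l
      by (rule supported_rows_coeff_nonzero[where c = c and i = l and B = B]) (use B support c that in auto)
    have "(\<Sum>l<k. c l * B l (a i)) \<noteq> 0"
      using row(2) unfolding c lincomb_def by simp
    then obtain l where l: "l < k" "c l * B l (a i) \<noteq> 0"
      by (rule sum.not_neutral_contains_not_neutral) auto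
    then have "a l = a i"
      using B(1) inside[of l] unfolding supported_rows_def in_coord_span_interval by fastforce
    then have "l = i"
      using l(1) i inj_onD[OF inj_a] by blast
    then have "c i \<noteq> 0"
      using l by auto
    obtain j where "j < k" "c j \<noteq> 0" "\<forall>l<k. c l \<noteq> 0 \<longrightarrow> b l \<le> b j" "normal_row i V (b j) \<noteq> 0"
      unfolding c by (rule supported_rows_rightmost[where c = c and i = i, OF B(1) i \<open>c i \<noteq> 0\<close>])
    then have "normal_row i V (b i) \<noteq> 0"
      using inside[of j] \<open>c i \<noteq> 0\<close> i by (metis le_antisym)
    then show ?thesis
      using support row(2) by simp
  qed
  then show ?thesis
    by (simp add: supported_rows_def normal_frame_def)
qed

definition chart_domain :: "(nat \<Rightarrow> complex) set set" where
  "chart_domain = {V \<in> Gr k m. (\<forall>i<k. injective_on_columns k (row_pivots i) V) \<and> (\<forall>i<k. normal_row i V (b i) \<noteq> 0) \<and>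
     array_det k (\<lambda>i l. normal_row i V (b l)) \<noteq> 0}"

lemma chart_domainD:
  assumes "V \<in> chart_domain"
  shows "V \<in> Gr k m" "i < k \<Longrightarrow> injective_on_columns k (row_pivots i) V" "i < k \<Longrightarrow> normal_row i V (b i) \<noteq> 0"
    "array_det k (\<lambda>i l. normal_row i V (b l)) \<noteq> 0"
    "i < k \<Longrightarrow> normal_row i V \<in> V" "\<lbrakk>i < k; l < k\<rbrakk> \<Longrightarrow> normal_row i V (row_pivots i l) = (if l = i then 1 else 0)"
  using assms dual_vector_properties[of V k m "row_pivots i" i] unfolding chart_domain_def by auto

lemma array_det_cong: "(\<And>i j. \<lbrakk>i < k; j < k\<rbrakk> \<Longrightarrow> T i j = T' i j) \<Longrightarrow> array_det k T = array_det k T'"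
  unfolding array_det_def mat_of_array_def by (rule arg_cong[where f = Determinant.det], rule eq_matI) auto

lemma array_det_normal_frame: "array_det k (\<lambda>i l. normal_frame V i (e l)) = array_det k (\<lambda>i l. normal_row i V (e l))"
  by (rule array_det_cong) (simp add: normal_frame_def)

lemma row_space_normal_frame_cell:
  assumes "V \<in> cell" shows "row_space k (normal_frame V) = V"
  using assms cell_subset_Gr supported_rows_lin_indep[OF supported_rows_normal_frame[OF assms]]
    dual_vector_properties(1)[OF _ cell_injective_on_columns[OF assms]]
  by (intro row_space_eqI) (auto simp: normal_frame_def)

lemma cell_subset_chart_domain: "cell \<subseteq> chart_domain"
proof
  fix V assume V: "V \<in> cell"
  note rows = supported_rows_normal_frame[OF V]
  have "array_det k (\<lambda>i l. normal_frame V i (pivot_column 0 0 l)) \<noteq> 0"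
    using cell_injective_on_columns[OF V, of 0 0] injective_on_columns_iff_det[OF supported_rows_frame[OF rows]]
      row_space_normal_frame_cell[OF V] by metis
  moreover have "array_det k (\<lambda>i l. normal_frame V i (pivot_column 0 0 l)) = array_det k (\<lambda>i l. normal_frame V i (b l))"
    by (rule array_det_cong) (use ab in \<open>force simp: pivot_column_def\<close>)
  ultimately show "V \<in> chart_domain"
    using rows V cell_subset_Gr cell_injective_on_columns[OF V] array_det_normal_frame[of V b]
    unfolding chart_domain_def supported_rows_def normal_frame_def by auto
qed

lemma normal_frame_in_frames:
  assumes V: "V \<in> chart_domain"
  shows "normal_frame V \<in> frames k m" "row_space k (normal_frame V) = V"
proof -
  have "normal_row i V \<in> cspace m" if "i < k" for i
    using chart_domainD(1,5)[OF V] that GrD(2) by blast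
  then show frame: "normal_frame V \<in> frames k m"
    by (intro frame_if_det_nonzero[where e = b])
      (use chart_domainD(4)[OF V] array_det_normal_frame[of V b] in \<open>auto simp: normal_frame_def\<close>)
  show "row_space k (normal_frame V) = V"
    by (rule row_space_eqI[OF _ _ chart_domainD(1)[OF V]])
      (use frame chart_domainD(5)[OF V] in \<open>auto simp: frames_iff normal_frame_def\<close>)
qed

lemma in_cell_if_normal_rows_supported:
  assumes V: "V \<in> chart_domain" and support: "\<And>i. i < k \<Longrightarrow> normal_row i V \<in> coord_span {a i..b i}"
  shows "V \<in> cell"
proof -
  have "normal_row i V (a i) = 1" if "i < k" for i
    using chart_domainD(6)[OF V that that] row_pivots_self by simp
  then have "supported_rows (normal_frame V)"
    using support chart_domainD(3)[OF V] by (auto simp: supported_rows_def normal_frame_def)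
  then show ?thesis
    using normal_frame_in_frames(2)[OF V] unfolding cell_def by (metis imageI mem_Collect_eq)
qed

lemma in_cell_if_ranks_le:
  assumes V: "V \<in> chart_domain" and "\<And>i. i < k \<Longrightarrow> interval_rank intervals (a i) (b i) \<le> subspace_rank V (a i) (b i)"
  shows "V \<in> cell"
  by (rule in_cell_if_normal_rows_supported[OF V]) (use normal_row_in_coord_span chart_domainD[OF V] assms(2) in auto)

lemma openin_chart_domain: "openin (Gr_top k m) chart_domain"
proof -
  let ?U = "{V \<in> Gr k m. \<forall>i<k. injective_on_columns k (row_pivots i) V}"
  let ?g = "\<lambda>V. (\<Prod>i<k. normal_row i V (b i)) * array_det k (\<lambda>i l. normal_row i V (b l))"
  have "?U = topspace (Gr_top k m) \<inter> (\<Inter>i\<in>{..<k}. {V \<in> Gr k m. injective_on_columns k (row_pivots i) V})"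
    by (auto simp: topspace_Gr_top)
  then have U: "openin (Gr_top k m) ?U"
    by (simp only:) (intro openin_Int_Inter, auto intro: openin_injective_on_columns)
  have rows: "continuous_on {A \<in> frames k m. row_space k A \<in> ?U} (\<lambda>A. normal_row i (row_space k A) p)" if "i < k" for i p
    by (rule continuous_on_dual_vector) (use that in auto)
  have "openin (Gr_top k m) {V \<in> ?U. ?g V \<in> - {0}}"
    by (intro openin_Gr_preimage U continuous_on_mult continuous_on_prod continuous_on_array_det rows) auto
  moreover have "{V \<in> ?U. ?g V \<in> - {0}} = chart_domain"
    unfolding chart_domain_def by auto
  ultimately show ?thesis by simp
qed

definition free_entries :: "(nat \<times> nat) set" where
  "free_entries = {(i, p). i < k \<and> 1 \<le> p \<and> p \<le> m \<and> p \<notin> row_pivots i ` {..<k}}"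

definition normal_entries :: "(nat \<times> nat) set" where
  "normal_entries = {(i, p) \<in> free_entries. p < a i \<or> b i < p}"

definition codim :: nat where "codim = card normal_entries"

definition entry_enum :: "nat \<Rightarrow> nat \<times> nat" where
  "entry_enum = (SOME e. bij_betw e {..<card free_entries} free_entries \<and> e ` {..<codim} = normal_entries)"

definition entry_index :: "nat \<times> nat \<Rightarrow> nat" where
  "entry_index = inv_into {..<card free_entries} entry_enum"

definition entry_coord :: "nat \<Rightarrow> (nat \<Rightarrow> complex) set \<Rightarrow> complex" where
  "entry_coord s V = normal_row (fst (entry_enum s)) V (snd (entry_enum s))"

definition chart_coords :: "(nat \<Rightarrow> complex) set \<Rightarrow> nat \<Rightarrow> real" where
  "chart_coords V = real_coords (card free_entries) (\<lambda>s. entry_coord s V)"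

definition chart_matrix :: "(nat \<Rightarrow> real) \<Rightarrow> nat \<Rightarrow> nat \<Rightarrow> complex" where
  "chart_matrix y i p = (if (i, p) \<in> free_entries then Complex (y (2 * entry_index (i, p))) (y (2 * entry_index (i, p) + 1))
     else if i < k \<and> p = a i then 1 else 0)"

definition chart_minors :: "(nat \<Rightarrow> nat \<Rightarrow> complex) \<Rightarrow> complex" where
  "chart_minors A = (\<Prod>i<k. array_det k (\<lambda>i' l. A i' (row_pivots i l)) * A i (b i)) * array_det k (\<lambda>i l. A i (b l))"

definition chart_image :: "(nat \<Rightarrow> real) set" where
  "chart_image = {y \<in> Euclidean_set (2 * card free_entries). chart_minors (chart_matrix y) \<noteq> 0}"

lemma chart_minors_nonzero_iff:
  "chart_minors A \<noteq> 0 \<longleftrightarrow> (\<forall>i<k. array_det k (\<lambda>i' l. A i' (row_pivots i l)) \<noteq> 0 \<and> A i (b i) \<noteq> 0) \<and>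
     array_det k (\<lambda>i l. A i (b l)) \<noteq> 0"
  by (auto simp: chart_minors_def)

lemma finite_free_entries: "finite free_entries"
  by (rule finite_subset[of _ "{..<k} \<times> {1..m}"]) (auto simp: free_entries_def)

lemma normal_entries_subset: "normal_entries \<subseteq> free_entries"
  by (auto simp: normal_entries_def)

lemma codim_le: "codim \<le> card free_entries"
  unfolding codim_def using finite_free_entries normal_entries_subset card_mono by blast

lemma entry_enum: "bij_betw entry_enum {..<card free_entries} free_entries" "entry_enum ` {..<codim} = normal_entries"
  using someI_ex[OF ex_enumeration_initial_subset[OF finite_free_entries normal_entries_subset]]
  unfolding entry_enum_def codim_def by auto

lemma entry_enum_in: "s < card free_entries \<Longrightarrow> entry_enum s \<in> free_entries" "s < codim \<Longrightarrow> entry_enum s \<in> normal_entries"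
  using entry_enum by (auto simp: bij_betw_def)

lemma entry_index_entry_enum: "s < card free_entries \<Longrightarrow> entry_index (entry_enum s) = s"
  using entry_enum(1) by (simp add: entry_index_def bij_betw_def)

lemma entry_enum_entry_index:
  "e \<in> free_entries \<Longrightarrow> entry_enum (entry_index e) = e" "e \<in> free_entries \<Longrightarrow> entry_index e < card free_entries"
  using entry_enum(1) f_inv_into_f[of e entry_enum] inv_into_into[of e entry_enum "{..<card free_entries}"]
  by (auto simp: entry_index_def bij_betw_def)

lemma chart_matrix_chart_coords:
  assumes V: "V \<in> chart_domain" shows "chart_matrix (chart_coords V) = normal_frame V"
proof (intro ext)
  fix i p
  show "chart_matrix (chart_coords V) i p = normal_frame V i p"
  proof (cases "(i, p) \<in> free_entries")
    case True
    let ?s = "entry_index (i, p)"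
    have "chart_matrix (chart_coords V) i p = entry_coord ?s V"
      using True entry_enum_entry_index(2)[OF True] by (simp add: chart_matrix_def chart_coords_def real_coords_def)
    also have "\<dots> = normal_row i V p"
      by (simp add: entry_coord_def entry_enum_entry_index(1)[OF True])
    finally show ?thesis
      using True by (simp add: normal_frame_def free_entries_def)
  next
    case not_free: False
    consider "\<not> i < k" | l where "i < k" "l < k" "p = row_pivots i l" | "i < k" "p \<notin> row_pivots i ` {..<k}" by auto
    then show ?thesis
    proof cases
      case (2 l)
      then show ?thesis
        using not_free chart_domainD(6)[OF V 2(1,2)] row_pivots_eq_iff by (simp add: chart_matrix_def normal_frame_def)
    next
      case 3
      then have "p \<notin> {1..m}"
        using not_free by (auto simp: free_entries_def)
      moreover have "normal_row i V \<in> cspace m"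
        using chart_domainD(1,5)[OF V] 3(1) GrD(2) by blast
      ultimately show ?thesis
        using not_free 3 ab[of i] by (auto simp: chart_matrix_def normal_frame_def cspace_def)
    qed (use not_free in \<open>simp add: chart_matrix_def normal_frame_def\<close>)
  qed
qed

lemma chart_matrix_frame:
  assumes y: "y \<in> chart_image"
  shows "chart_matrix y \<in> frames k m" "normal_frame (row_space k (chart_matrix y)) = chart_matrix y"
    "row_space k (chart_matrix y) \<in> chart_domain"
proof -
  let ?V = "row_space k (chart_matrix y)"
  have minors: "\<And>i. i < k \<Longrightarrow> array_det k (\<lambda>i' l. chart_matrix y i' (row_pivots i l)) \<noteq> 0"
    "\<And>i. i < k \<Longrightarrow> chart_matrix y i (b i) \<noteq> 0" "array_det k (\<lambda>i l. chart_matrix y i (b l)) \<noteq> 0"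
    using y unfolding chart_image_def chart_minors_nonzero_iff by auto
  have zero_rows: "chart_matrix y i = 0" if "k \<le> i" for i
    using that by (auto simp: chart_matrix_def free_entries_def)
  have "chart_matrix y i \<in> cspace m" if "i < k" for i
    using ab[OF that] by (auto simp: cspace_def chart_matrix_def free_entries_def)
  then show frame: "chart_matrix y \<in> frames k m"
    by (rule frame_if_det_nonzero[OF _ zero_rows minors(3)])
  have inj: "injective_on_columns k (row_pivots i) ?V" if "i < k" for i
    using minors(1)[OF that] injective_on_columns_iff_det[OF frame] by blast
  have rows: "normal_row i ?V = chart_matrix y i" if i: "i < k" for i
  proof (rule dual_vector_eqI[OF inj[OF i]])
    show "chart_matrix y i (row_pivots i l) = (if l = i then 1 else 0)" if "l < k" for l
      using that i row_pivots_eq_iff by (auto simp: chart_matrix_def free_entries_def)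
  qed (use row_space_in_Gr[OF frame] i in \<open>auto simp: GrD row_in_row_space\<close>)
  then show "normal_frame ?V = chart_matrix y"
    using zero_rows by (auto simp: normal_frame_def)
  have "array_det k (\<lambda>i l. normal_row i ?V (b l)) = array_det k (\<lambda>i l. chart_matrix y i (b l))"
    by (rule array_det_cong) (simp add: rows)
  then show "?V \<in> chart_domain"
    unfolding chart_domain_def using row_space_in_Gr[OF frame] inj rows minors by auto
qed

lemma chart_coords_chart_matrix:
  assumes y: "y \<in> chart_image" shows "chart_coords (row_space k (chart_matrix y)) = y"
proof
  fix j
  let ?V = "row_space k (chart_matrix y)"
  show "chart_coords ?V j = y j"
  proof (cases "j < 2 * card free_entries")
    case True
    define s where "s = j div 2"
    have s: "s < card free_entries" "j = 2 * s \<or> j = 2 * s + 1"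
      using True by (auto simp: s_def)
    note e = entry_enum_in(1)[OF s(1)]
    have "entry_coord s ?V = normal_frame ?V (fst (entry_enum s)) (snd (entry_enum s))"
      using e by (auto simp: entry_coord_def normal_frame_def free_entries_def)
    also have "\<dots> = Complex (y (2 * s)) (y (2 * s + 1))"
      using e entry_index_entry_enum[OF s(1)] by (simp add: chart_matrix_frame(2)[OF y] chart_matrix_def)
    finally show ?thesis
      using s by (auto simp: chart_coords_def real_coords_def)
  qed (use y in \<open>auto simp: chart_coords_def real_coords_def chart_image_def Euclidean_set_def\<close>)
qed

lemma chart_coords_in_chart_image:
  assumes V: "V \<in> chart_domain" shows "chart_coords V \<in> chart_image"
proof -
  have "array_det k (\<lambda>i' l. normal_frame V i' (row_pivots i l)) \<noteq> 0" if "i < k" for i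
    using chart_domainD(2)[OF V that] injective_on_columns_iff_det normal_frame_in_frames[OF V] by metis
  then have "chart_minors (normal_frame V) \<noteq> 0"
    using chart_domainD(3,4)[OF V] array_det_normal_frame[of V b]
    unfolding chart_minors_nonzero_iff by (simp add: normal_frame_def)
  moreover have "chart_coords V \<in> Euclidean_set (2 * card free_entries)"
    by (simp add: chart_coords_def real_coords_in_Euclidean_set)
  ultimately show ?thesis
    by (simp add: chart_image_def chart_matrix_chart_coords[OF V])
qed

lemma continuous_on_chart_matrix: "continuous_on S (\<lambda>y. chart_matrix y i p)"
  by (cases "(i, p) \<in> free_entries") (auto simp: chart_matrix_def Complex_eq intro!: continuous_intros)

lemma normal_entries_0_iff_cell:
  assumes V: "V \<in> chart_domain" shows "(\<forall>(i, p)\<in>normal_entries. normal_row i V p = 0) \<longleftrightarrow> V \<in> cell"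
proof
  assume zero: "\<forall>(i, p)\<in>normal_entries. normal_row i V p = 0"
  show "V \<in> cell"
  proof (rule in_cell_if_normal_rows_supported[OF V])
    fix i assume i: "i < k"
    have "a i \<le> p \<and> p \<le> b i" if nonzero: "normal_row i V p \<noteq> 0" for p
    proof (cases "p \<in> row_pivots i ` {..<k}")
      case True
      then have "p = row_pivots i i"
        using nonzero chart_domainD(6)[OF V i] by (auto split: if_splits)
      then show ?thesis
        using row_pivots_self ab[OF i] by simp
    next
      case False
      have "normal_row i V \<in> cspace m"
        using chart_domainD(1,5)[OF V] i GrD(2) by blast
      then have "(i, p) \<in> free_entries"
        using nonzero i False by (auto simp: free_entries_def cspace_def)
      moreover have "(i, p) \<notin> normal_entries"
        using zero nonzero by auto
      ultimately show ?thesis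
        by (auto simp: normal_entries_def)
    qed
    then show "normal_row i V \<in> coord_span {a i..b i}"
      unfolding in_coord_span_interval by blast
  qed
next
  assume "V \<in> cell"
  then have "normal_row i V \<in> coord_span {a i..b i}" if "i < k" for i
    using that supported_rows_normal_frame[of V] by (auto simp: supported_rows_def normal_frame_def)
  then show "\<forall>(i, p)\<in>normal_entries. normal_row i V p = 0"
    unfolding in_coord_span_interval by (fastforce simp: normal_entries_def free_entries_def)
qed

lemma in_cell_iff_chart_coords:
  assumes "V \<in> chart_domain" shows "V \<in> cell \<longleftrightarrow> chart_coords V \<in> coord_subspace (2 * codim)"
proof -
  have "chart_coords V \<in> coord_subspace (2 * codim) \<longleftrightarrow> real_coords codim (\<lambda>s. entry_coord s V) = 0"
    using codim_le by (auto simp: coord_subspace_def chart_coords_def real_coords_def fun_eq_iff)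
  also have "\<dots> \<longleftrightarrow> (\<forall>e\<in>normal_entries. normal_row (fst e) V (snd e) = 0)"
    unfolding real_coords_eq_0_iff entry_enum(2)[symmetric] entry_coord_def by auto
  finally show ?thesis
    using normal_entries_0_iff_cell[OF assms] by (auto simp: case_prod_unfold)
qed

theorem linear_chart_chart_domain:
  "linear_chart (Gr_top k m) (2 * card free_entries) (2 * codim) chart_domain chart_image chart_coords
     (\<lambda>y. row_space k (chart_matrix y))"
proof
  show "2 * codim \<le> 2 * card free_entries"
    using codim_le by simp
  show "openin (Gr_top k m) chart_domain"
    by (rule openin_chart_domain)
  have "chart_image = Euclidean_set (2 * card free_entries) \<inter> (\<lambda>y. chart_minors (chart_matrix y)) -` (- {0})"
    unfolding chart_image_def by blast
  moreover have "continuous_on (Euclidean_set (2 * card free_entries)) (\<lambda>y. chart_minors (chart_matrix y))"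
    unfolding chart_minors_def
    by (intro continuous_on_mult continuous_on_prod continuous_on_array_det continuous_on_chart_matrix)
  ultimately show "openin (Euclidean_space (2 * card free_entries)) chart_image"
    unfolding Euclidean_space_eq by (simp add: continuous_openin_preimage_gen open_Compl)
  have coord: "continuous_on {A \<in> frames k m. row_space k A \<in> chart_domain} (\<lambda>A. entry_coord s (row_space k A))"
    if "s < card free_entries" for s
    unfolding entry_coord_def
    by (rule continuous_on_dual_vector) (use entry_enum_in(1)[OF that] chart_domainD(2) in \<open>auto simp: free_entries_def\<close>)
  have "continuous_map (subtopology (Gr_top k m) chart_domain) (top_of_set chart_image) chart_coords"
    by (rule continuous_map_from_Gr[OF openin_chart_domain])
      (auto simp: chart_coords_def[abs_def] chart_coords_in_chart_image[unfolded chart_coords_def] intro!: continuous_on_real_coords coord)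
  moreover have "continuous_on chart_image chart_matrix"
    by (intro continuous_on_coordinatewise_then_product continuous_on_chart_matrix)
  then have "continuous_map (top_of_set chart_image) (top_of_set (frames k m)) chart_matrix"
    using chart_matrix_frame(1) by (auto simp: continuous_map_in_subtopology)
  from continuous_map_compose[OF this quotient_imp_continuous_map[OF quotient_map_row_space]]
  have "continuous_map (top_of_set chart_image) (subtopology (Gr_top k m) chart_domain) (\<lambda>y. row_space k (chart_matrix y))"
    using chart_matrix_frame(3) by (auto simp: continuous_map_in_subtopology o_def)
  ultimately show "homeomorphic_maps (subtopology (Gr_top k m) chart_domain) (top_of_set chart_image) chart_coords
      (\<lambda>y. row_space k (chart_matrix y))"
    by (simp add: homeomorphic_maps_def chart_matrix_chart_coords normal_frame_in_frames(2) chart_coords_chart_matrix)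
qed

lemma card_normal_entries_row:
  assumes i: "i < k"
  shows "int (card {p. (i, p) \<in> normal_entries})
    = int m - int (Suc (b i) - a i) - (int k - int (interval_rank intervals (a i) (b i)))"
proof -
  let ?I = "{a i..b i}" and ?C = "row_pivots i ` {..<k}" and ?T = "{l. l < k \<and> a i \<le> a l \<and> b l \<le> b i}"
  have "row_pivots i l \<in> ?I \<longleftrightarrow> l \<in> ?T" if "l < k" for l
    using ab[OF that] ab[OF i] that by (auto simp: pivot_column_def)
  then have "?C - ?I = row_pivots i ` ({..<k} - ?T)"
    by auto
  moreover have "card (row_pivots i ` ({..<k} - ?T)) = card ({..<k} - ?T)"
    by (rule card_image) (rule inj_on_subset[OF inj_pivot_column], auto)
  moreover have T: "card ({..<k} - ?T) = k - card ?T" "card ?T \<le> k"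
    using card_Diff_subset[of ?T "{..<k}"] card_mono[of "{..<k}" ?T] by auto
  ultimately have C: "card (?C - ?I) = k - interval_rank intervals (a i) (b i)"
    by (simp add: interval_rank_intervals)
  have I: "card ({1..m} - ?I) = m - (Suc (b i) - a i)" "Suc (b i) - a i \<le> m"
    using card_Diff_subset[of ?I "{1..m}"] ab[OF i] by auto
  have "{p. (i, p) \<in> normal_entries} = ({1..m} - ?I) - (?C - ?I)"
    using i by (auto simp: normal_entries_def free_entries_def)
  moreover have sub: "?C - ?I \<subseteq> {1..m} - ?I"
    using pivot_column_bounds by auto
  ultimately have "card {p. (i, p) \<in> normal_entries} = card ({1..m} - ?I) - card (?C - ?I)"
    by (metis card_Diff_subset finite_Diff finite_imageI finite_lessThan)
  moreover have "card (?C - ?I) \<le> card ({1..m} - ?I)"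
    by (rule card_mono[OF _ sub]) simp
  ultimately show ?thesis
    using I T(2) unfolding C interval_rank_intervals by linarith
qed

lemma codim_eq: "int codim = int k * (int m - int k) - rank_dim intervals"
proof -
  have finite_row: "finite {p. (i, p) \<in> normal_entries}" for i
    by (rule finite_subset[of _ "{1..m}"]) (auto simp: normal_entries_def free_entries_def)
  have "normal_entries = Sigma {..<k} (\<lambda>i. {p. (i, p) \<in> normal_entries})"
    by (auto simp: normal_entries_def free_entries_def)
  then have "codim = (\<Sum>i<k. card {p. (i, p) \<in> normal_entries})"
    using card_SigmaI[of "{..<k}" "\<lambda>i. {p. (i, p) \<in> normal_entries}"] finite_row by (simp add: codim_def)
  then have "int codim = (\<Sum>i<k. (int m - int k) - (int (Suc (b i) - a i) - int (interval_rank intervals (a i) (b i))))"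
    by (simp add: card_normal_entries_row algebra_simps)
  also have "\<dots> = int k * (int m - int k) - (\<Sum>i<k. int (Suc (b i) - a i) - int (interval_rank intervals (a i) (b i)))"
    unfolding sum_subtractf[of "\<lambda>_. int m - int k"] by simp
  also have "(\<Sum>i<k. int (Suc (b i) - a i) - int (interval_rank intervals (a i) (b i))) = rank_dim intervals"
    unfolding rank_dim_def by (subst (3) intervals_def, subst sum.reindex[OF inj_intervals]) simp
  finally show ?thesis .
qed

end

section \<open>The stratification of the Grassmannian by rank sets\<close>

lemma (in linear_chart) homology_vanishes_extend:
  assumes closed: "closedin X T" "closedin X (T \<union> C)" and C: "C \<subseteq> U" "T \<inter> C = {}"
    and C_chart: "\<And>x. x \<in> U \<Longrightarrow> x \<in> C \<longleftrightarrow> \<theta> x \<in> coord_subspace n"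
    and W: "openin X W" and p: "p < n" and T: "homology_vanishes p (subtopology X W) (- T)"
  shows "homology_vanishes p (subtopology X W) (- (T \<union> C))"
proof (rule homology_vanishes_triple[OF _ _ T])
  let ?Y = "subtopology X (W - T)"
  have sub: "subtopology ?Y U = subtopology X ((W - T) \<inter> U)" "subtopology (subtopology X W) (- T) = ?Y"
    by (auto simp: subtopology_subtopology Diff_eq)
  have "closedin ?Y (topspace ?Y \<inter> (T \<union> C))" "openin ?Y (topspace ?Y \<inter> U)"
    using closed(2) openU by (auto simp: closedin_subtopology openin_subtopology)
  moreover have "topspace ?Y \<inter> (T \<union> C) = topspace ?Y \<inter> C"
    by auto
  ultimately have "homology_vanishes p (subtopology X ((W - T) \<inter> U)) (- C) \<longleftrightarrow> homology_vanishes p ?Y (- C)"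
    using homology_vanishes_iso[OF excision_iso[of ?Y U C]] C(1) unfolding sub by auto
  then have "homology_vanishes p ?Y (- C)"
    using homology_vanishes_in_chart[OF openin_Int[OF openin_diff[OF W closed(1)] openU] _ C_chart p] by simp
  moreover have "topspace ?Y \<inter> - C = topspace ?Y \<inter> - (T \<union> C)"
    by auto
  ultimately show "homology_vanishes p (subtopology (subtopology X W) (- T)) (- (T \<union> C))"
    unfolding sub using relative_homology_cong(1) by blast
qed auto

definition rank_sets :: "nat \<Rightarrow> nat \<Rightarrow> (nat \<times> nat) set set" where
  "rank_sets k m = {N. rank_set N \<and> card N = k \<and> (\<forall>x\<in>N. snd x \<le> m)}"

definition rank_le :: "(nat \<times> nat) set \<Rightarrow> (nat \<times> nat) set \<Rightarrow> bool" where
  "rank_le N N' \<longleftrightarrow> (\<forall>p q. interval_rank N p q \<le> interval_rank N' p q)"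

definition stratum :: "nat \<Rightarrow> nat \<Rightarrow> (nat \<times> nat) set \<Rightarrow> (nat \<Rightarrow> complex) set set" where
  "stratum k m N = {V \<in> Gr k m. \<forall>p q. subspace_rank V p q = interval_rank N p q}"

lemma finite_rank_sets: "finite (rank_sets k m)"
proof (rule finite_subset)
  show "rank_sets k m \<subseteq> Pow ({..m} \<times> {..m})"
    unfolding rank_sets_def rank_set_def by fastforce
qed simp

lemma rank_sets_interval_family:
  assumes "N \<in> rank_sets k m"
  obtains a b where "interval_family k m a b" "interval_family.intervals k a b = N"
proof -
  have N: "rank_set N" "card N = k" "\<And>x. x \<in> N \<Longrightarrow> snd x \<le> m"
    using assms unfolding rank_sets_def by auto
  obtain e where e: "bij_betw e {0..<k} N"
    using ex_bij_betw_nat_finite[OF rank_setD(1)[OF N(1)]] N(2) by blast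
  then have image: "inj_on e {..<k}" "e ` {..<k} = N" "\<And>i. i < k \<Longrightarrow> e i \<in> N"
    by (auto simp: bij_betw_def atLeast0LessThan)
  have family: "interval_family k m (fst \<circ> e) (snd \<circ> e)"
  proof
    show "inj_on (fst \<circ> e) {..<k}" "inj_on (snd \<circ> e) {..<k}"
      using comp_inj_on[OF image(1)] rank_setD(2,3)[OF N(1)] image(2) by auto
    show "1 \<le> (fst \<circ> e) i \<and> (fst \<circ> e) i \<le> (snd \<circ> e) i \<and> (snd \<circ> e) i \<le> m" if "i < k" for i
      using image(3)[OF that] rank_setD(4,5)[OF N(1)] N(3) by simp
  qed
  moreover have "interval_family.intervals k (fst \<circ> e) (snd \<circ> e) = N"
    unfolding interval_family.intervals_def[OF family] using image(2) by simp
  ultimately show ?thesis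
    by (rule that)
qed

lemma rank_sets_inject:
  assumes "N \<in> rank_sets k m" "N' \<in> rank_sets k m" "rank_le N N'" "rank_le N' N" shows "N = N'"
  by (rule interval_rank_inject) (use assms in \<open>auto simp: rank_sets_def rank_le_def intro: order_antisym\<close>)

lemma rank_dim_less:
  assumes "N \<in> rank_sets k m" "N' \<in> rank_sets k m" "rank_le N N'" "N \<noteq> N'" shows "rank_dim N' < rank_dim N"
  by (rule rank_dim_strict_mono) (use assms in \<open>auto simp: rank_sets_def rank_le_def\<close>)

context interval_family
begin

lemma intervals_in_rank_sets: "intervals \<in> rank_sets k m"
  unfolding rank_sets_def using rank_set_intervals card_intervals ab by (auto simp: intervals_def)

lemma cell_permute:
  assumes family: "interval_family k m a' b'" and same: "interval_family.intervals k a' b' = intervals"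
    and V: "V \<in> interval_family.cell k a' b'"
  shows "V \<in> cell"
proof -
  have "(a i, b i) \<in> interval_family.intervals k a' b'" if "i < k" for i
    using that unfolding same by (simp add: intervals_def)
  then have "\<exists>j. j < k \<and> a' j = a i \<and> b' j = b i" if "i \<in> {..<k}" for i
    using that unfolding interval_family.intervals_def[OF family] by fastforce
  then have "\<forall>i\<in>{..<k}. \<exists>j. j < k \<and> a' j = a i \<and> b' j = b i"
    by (rule ballI)
  then obtain \<pi> where \<pi>: "\<forall>i\<in>{..<k}. \<pi> i < k \<and> a' (\<pi> i) = a i \<and> b' (\<pi> i) = b i"
    unfolding bchoice_iff by blast
  obtain B where B: "interval_family.supported_rows k a' b' B" "V = row_space k B"
    using V unfolding interval_family.cell_def[OF family] by blast
  let ?B = "\<lambda>i. if i < k then B (\<pi> i) else 0"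
  have "B (\<pi> i) \<in> coord_span {a i..b i} \<and> B (\<pi> i) (a i) \<noteq> 0 \<and> B (\<pi> i) (b i) \<noteq> 0" if "i < k" for i
  proof -
    have "\<pi> i < k" "a' (\<pi> i) = a i" "b' (\<pi> i) = b i"
      using \<pi> that by auto
    then show ?thesis
      using B(1) unfolding interval_family.supported_rows_def[OF family] by metis
  qed
  then have rows: "supported_rows ?B"
    by (simp add: supported_rows_def)
  have "?B i \<in> V" if "i < k" for i
    using \<pi> that by (simp add: B(2) row_in_row_space)
  then have "row_space k ?B = V"
    using V interval_family.cell_subset_Gr[OF family]
    by (intro row_space_eqI[OF supported_rows_lin_indep[OF rows]]) auto
  then show ?thesis
    unfolding cell_def by (intro image_eqI[of V "row_space k" ?B]) (use rows in auto)
qed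

lemma cell_eq_stratum: "cell = stratum k m intervals"
proof
  show "cell \<subseteq> stratum k m intervals"
    unfolding stratum_def using cell_subset_Gr subspace_rank_cell by auto
  show "stratum k m intervals \<subseteq> cell"
  proof
    fix V assume "V \<in> stratum k m intervals"
    then have V: "V \<in> Gr k m" "\<And>p q. subspace_rank V p q = interval_rank intervals p q"
      unfolding stratum_def by auto
    obtain a' b' where family: "interval_family k m a' b'" and V': "V \<in> interval_family.cell k a' b'"
      using cell_exists[OF V(1)] .
    have "interval_family.intervals k a' b' = intervals"
      by (rule interval_rank_inject[OF interval_family.rank_set_intervals[OF family] rank_set_intervals])
        (use interval_family.subspace_rank_cell[OF family V'] V(2) in simp)
    then show "V \<in> cell"
      by (rule cell_permute[OF family _ V'])
  qed
qed

lemma pivot_column_truncate: "l < k \<Longrightarrow> pivot_column (min p (Suc m)) (min q m) l = pivot_column p q l"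
  using ab[of l] unfolding pivot_column_def by auto

lemma subspace_rank_semicontinuous:
  obtains Q where "openin (Gr_top k m) Q" "cell \<subseteq> Q"
    "\<forall>V\<in>Q. \<forall>p q. subspace_rank V p q \<le> interval_rank intervals p q"
proof
  define Q where "Q = Gr k m \<inter> (\<Inter>(p, q)\<in>{..Suc m} \<times> {..m}. {V \<in> Gr k m. injective_on_columns k (pivot_column p q) V})"
  show "openin (Gr_top k m) Q"
    unfolding Q_def using openin_topspace[of "Gr_top k m"] unfolding topspace_Gr_top
    by (intro openin_Int_Inter) (auto intro: openin_injective_on_columns)
  show "cell \<subseteq> Q"
    unfolding Q_def using cell_subset_Gr cell_injective_on_columns by auto
  show "\<forall>V\<in>Q. \<forall>p q. subspace_rank V p q \<le> interval_rank intervals p q"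
  proof (intro ballI allI subspace_rank_le_interval_rank)
    fix V p q assume V: "V \<in> Q"
    show "V \<in> Gr k m"
      using V unfolding Q_def by auto
    have "(min p (Suc m), min q m) \<in> {..Suc m} \<times> {..m}"
      by auto
    then have "injective_on_columns k (pivot_column (min p (Suc m)) (min q m)) V"
      using V unfolding Q_def by blast
    then show "injective_on_columns k (pivot_column p q) V"
      unfolding injective_on_columns_def using pivot_column_truncate by simp
  qed
qed

end

lemma stratum_exists:
  assumes "V \<in> Gr k m" obtains N where "N \<in> rank_sets k m" "V \<in> stratum k m N"
proof -
  obtain a b where "interval_family k m a b" "V \<in> interval_family.cell k a b"
    using cell_exists[OF assms] .
  then show ?thesis
    using that interval_family.intervals_in_rank_sets interval_family.cell_eq_stratum by metis
qed

lemma stratum_unique: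
  assumes "N \<in> rank_sets k m" "N' \<in> rank_sets k m" "V \<in> stratum k m N" "V \<in> stratum k m N'"
  shows "N = N'"
  by (rule rank_sets_inject) (use assms in \<open>auto simp: rank_le_def stratum_def\<close>)

definition strata_union :: "nat \<Rightarrow> nat \<Rightarrow> (nat \<times> nat) set set \<Rightarrow> (nat \<Rightarrow> complex) set set" where
  "strata_union k m \<S> = (\<Union>N\<in>\<S>. stratum k m N)"

definition rank_up_closed :: "nat \<Rightarrow> nat \<Rightarrow> (nat \<times> nat) set set \<Rightarrow> bool" where
  "rank_up_closed k m \<S> \<longleftrightarrow> \<S> \<subseteq> rank_sets k m \<and> (\<forall>N\<in>\<S>. \<forall>N'\<in>rank_sets k m. rank_le N N' \<longrightarrow> N' \<in> \<S>)"

lemma closedin_strata_union: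
  assumes "rank_up_closed k m \<S>" shows "closedin (Gr_top k m) (strata_union k m \<S>)"
proof -
  have "\<exists>Q. openin (Gr_top k m) Q \<and> V \<in> Q \<and> Q \<subseteq> Gr k m - strata_union k m \<S>"
    if V: "V \<in> Gr k m - strata_union k m \<S>" for V
  proof -
    obtain N where N: "N \<in> rank_sets k m" "V \<in> stratum k m N"
      using stratum_exists V by blast
    obtain a b where family: "interval_family k m a b" and N_eq: "interval_family.intervals k a b = N"
      using rank_sets_interval_family[OF N(1)] .
    obtain Q where Q: "openin (Gr_top k m) Q" "interval_family.cell k a b \<subseteq> Q"
        "\<forall>V\<in>Q. \<forall>p q. subspace_rank V p q \<le> interval_rank (interval_family.intervals k a b) p q"
      by (rule interval_family.subspace_rank_semicontinuous[OF family])
    have "V' \<notin> strata_union k m \<S>" if V': "V' \<in> Q" for V'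
    proof
      assume "V' \<in> strata_union k m \<S>"
      then obtain N' where N': "N' \<in> \<S>" "V' \<in> stratum k m N'"
        unfolding strata_union_def by blast
      then have "rank_le N' N"
        using Q(3) V' N_eq unfolding stratum_def rank_le_def by auto
      then have "N \<in> \<S>"
        using assms N'(1) N(1) unfolding rank_up_closed_def by blast
      then show False
        using V N(2) unfolding strata_union_def by blast
    qed
    moreover have "V \<in> Q"
      using Q(2) N(2) interval_family.cell_eq_stratum[OF family] N_eq by auto
    ultimately show ?thesis
      using Q(1) openin_subset[OF Q(1)] topspace_Gr_top by auto
  qed
  then have "openin (Gr_top k m) (Gr k m - strata_union k m \<S>)"
    by (subst openin_subopen) blast
  moreover have "strata_union k m \<S> \<subseteq> Gr k m"
    unfolding strata_union_def stratum_def by auto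
  ultimately show ?thesis
    unfolding closedin_def topspace_Gr_top by blast
qed

lemma rank_up_closed_remove_max:
  assumes \<S>: "rank_up_closed k m \<S>" and max: "\<And>N'. N' \<in> \<S> \<Longrightarrow> rank_dim N' \<le> rank_dim N"
  shows "rank_up_closed k m (\<S> - {N})"
  unfolding rank_up_closed_def
proof (intro conjI ballI impI)
  fix N1 N2 assume N: "N1 \<in> \<S> - {N}" "N2 \<in> rank_sets k m" "rank_le N1 N2"
  have "N2 \<noteq> N"
    using N \<S> rank_dim_less[of N1 k m N2] max[of N1] unfolding rank_up_closed_def by force
  then show "N2 \<in> \<S> - {N}"
    using N \<S> unfolding rank_up_closed_def by blast
qed (use \<S> in \<open>auto simp: rank_up_closed_def\<close>)

theorem homology_vanishes_strata_union:
  assumes "rank_up_closed k m \<S>" "\<And>N. N \<in> \<S> \<Longrightarrow> int c \<le> int k * (int m - int k) - rank_dim N"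
    "openin (Gr_top k m) W" "p < 2 * c"
  shows "homology_vanishes p (subtopology (Gr_top k m) W) (- strata_union k m \<S>)"
  using assms
proof (induction "card \<S>" arbitrary: \<S> rule: less_induct)
  case less
  have finite: "finite \<S>"
    using less.prems(1) finite_rank_sets finite_subset unfolding rank_up_closed_def by blast
  show ?case
  proof (cases "\<S> = {}")
    case True
    then show ?thesis
      using homology_vanishes_UNIV by (simp add: strata_union_def)
  next
    case False
    then have "Max (rank_dim ` \<S>) \<in> rank_dim ` \<S>"
      using finite by (intro Max_in) auto
    then obtain N where N: "N \<in> \<S>" "Max (rank_dim ` \<S>) = rank_dim N"
      by auto
    then have max: "rank_dim N' \<le> rank_dim N" if "N' \<in> \<S>" for N'
      using finite that by (metis Max_ge finite_imageI imageI)
    have rank_sets: "\<S> \<subseteq> rank_sets k m"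
      using less.prems(1) by (simp add: rank_up_closed_def)
    obtain a b where family: "interval_family k m a b" and N_eq: "interval_family.intervals k a b = N"
      using rank_sets_interval_family N(1) rank_sets by blast
    interpret interval_family k m a b
      by (rule family)
    interpret linear_chart "Gr_top k m" "2 * card free_entries" "2 * codim" chart_domain chart_image chart_coords
        "\<lambda>y. row_space k (chart_matrix y)"
      by (rule linear_chart_chart_domain)
    let ?T = "strata_union k m (\<S> - {N})"
    have up: "rank_up_closed k m (\<S> - {N})"
      by (rule rank_up_closed_remove_max[OF less.prems(1) max])
    have union: "strata_union k m \<S> = ?T \<union> cell"
      using N unfolding cell_eq_stratum N_eq strata_union_def by blast
    have "homology_vanishes p (subtopology (Gr_top k m) W) (- (?T \<union> cell))"
    proof (rule homology_vanishes_extend[OF _ _ cell_subset_chart_domain _ in_cell_iff_chart_coords less.prems(3)])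
      show "closedin (Gr_top k m) ?T" "closedin (Gr_top k m) (?T \<union> cell)"
        using closedin_strata_union up less.prems(1) unfolding union[symmetric] by auto
      show "?T \<inter> cell = {}"
        using stratum_unique rank_sets N unfolding cell_eq_stratum N_eq strata_union_def by blast
      show "p < 2 * codim"
        using less.prems(2)[OF N(1)] less.prems(4) codim_eq N_eq by simp
      show "homology_vanishes p (subtopology (Gr_top k m) W) (- ?T)"
        by (rule less.hyps[OF card_Diff1_less[OF finite N(1)] up]) (use less.prems in auto)
    qed
    then show ?thesis
      unfolding union .
  qed
qed

context interval_family
begin

definition rank_locus :: "(nat \<Rightarrow> complex) set set" where
  "rank_locus = {V \<in> Gr k m. \<forall>p q. interval_rank intervals p q \<le> subspace_rank V p q}"

lemma rank_locus_eq_strata_union: "rank_locus = strata_union k m {N \<in> rank_sets k m. rank_le intervals N}"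
proof
  show "rank_locus \<subseteq> strata_union k m {N \<in> rank_sets k m. rank_le intervals N}"
  proof
    fix V assume V: "V \<in> rank_locus"
    then have "V \<in> Gr k m"
      by (simp add: rank_locus_def)
    then obtain N where "N \<in> rank_sets k m" "V \<in> stratum k m N"
      by (rule stratum_exists)
    then show "V \<in> strata_union k m {N \<in> rank_sets k m. rank_le intervals N}"
      using V unfolding strata_union_def rank_locus_def stratum_def rank_le_def by auto
  qed
qed (auto simp: strata_union_def rank_locus_def stratum_def rank_le_def)

lemma rank_up_closed_above: "rank_up_closed k m {N \<in> rank_sets k m. rank_le intervals N}"
  unfolding rank_up_closed_def rank_le_def using order.trans by blast

lemma closedin_rank_locus: "closedin (Gr_top k m) rank_locus"
  unfolding rank_locus_eq_strata_union by (rule closedin_strata_union[OF rank_up_closed_above])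

lemma cell_subset_rank_locus: "cell \<subseteq> rank_locus"
  using cell_subset_Gr subspace_rank_cell by (auto simp: rank_locus_def)

lemma rank_locus_Int_chart_domain: "rank_locus \<inter> chart_domain \<subseteq> cell"
  using in_cell_if_ranks_le by (auto simp: rank_locus_def)

lemma rank_locus_minus_cell:
  "rank_locus - cell = strata_union k m {N \<in> rank_sets k m. rank_le intervals N \<and> N \<noteq> intervals}"
  using intervals_in_rank_sets stratum_unique[OF intervals_in_rank_sets]
  unfolding rank_locus_eq_strata_union cell_eq_stratum strata_union_def by blast

lemma homology_vanishes_rank_locus_minus_cell:
  assumes W: "openin (Gr_top k m) W" and p: "p \<le> Suc (2 * codim)"
  shows "homology_vanishes p (subtopology (Gr_top k m) W) (- (rank_locus - cell))"
  unfolding rank_locus_minus_cell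
proof (rule homology_vanishes_strata_union[OF _ _ W])
  let ?S = "{N \<in> rank_sets k m. rank_le intervals N \<and> N \<noteq> intervals}"
  have "rank_dim N \<le> rank_dim intervals" if "N \<in> {N \<in> rank_sets k m. rank_le intervals N}" for N
    using that rank_dim_less[OF intervals_in_rank_sets, of N] by fastforce
  from rank_up_closed_remove_max[OF rank_up_closed_above this] show "rank_up_closed k m ?S"
    by (rule back_subst) auto
  show "int (Suc codim) \<le> int k * (int m - int k) - rank_dim N" if "N \<in> ?S" for N
  proof -
    have "rank_dim N < rank_dim intervals"
      by (rule rank_dim_less[OF intervals_in_rank_sets]) (use that in blast)+
    then show ?thesis
      using codim_eq by simp
  qed
  show "p < 2 * Suc codim"
    using p by simp
qed

theorem linear_chart_pair_between:
  assumes Z: "closedin (Gr_top k m) Z" "cell \<subseteq> Z" "Z \<subseteq> rank_locus"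
  shows "linear_chart_pair (Gr_top k m) (2 * card free_entries) (2 * codim) chart_domain chart_image chart_coords
    (\<lambda>y. row_space k (chart_matrix y)) Z (Z - cell)"
proof (intro linear_chart_pair.intro[OF linear_chart_chart_domain] linear_chart_pair_axioms.intro)
  have Z_chart: "Z \<inter> chart_domain = cell"
    using Z rank_locus_Int_chart_domain cell_subset_chart_domain by blast
  then show "chart_domain \<inter> (Z - cell) = {}" "Z - (Z - cell) \<subseteq> chart_domain"
    by blast+
  show "V \<in> Z \<longleftrightarrow> chart_coords V \<in> coord_subspace (2 * codim)" if "V \<in> chart_domain" for V
    using in_cell_iff_chart_coords[OF that] Z_chart that by blast
  show "homology_vanishes p (subtopology (Gr_top k m) W) (- (Z - cell))"
    if p: "p \<le> Suc (2 * codim)" and W: "openin (Gr_top k m) W" for p W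
  proof (rule homology_vanishes_larger)
    show "- (rank_locus - cell) \<subseteq> - (Z - cell)"
      using Z(3) by blast
    show "homology_vanishes p (subtopology (Gr_top k m) W) (- (rank_locus - cell))"
      by (rule homology_vanishes_rank_locus_minus_cell[OF W p])
    have "Z - cell = Z - chart_domain"
      using Z_chart by blast
    then have "openin (Gr_top k m) (W - (Z - cell))"
      using W closedin_diff[OF Z(1) openin_chart_domain] by (simp add: openin_diff)
    then show "p = 0 \<or> homology_vanishes (p - 1) (subtopology (subtopology (Gr_top k m) W) (- (Z - cell))) (- (rank_locus - cell))"
      using homology_vanishes_rank_locus_minus_cell[of "W - (Z - cell)" "p - 1"] p
      by (simp add: subtopology_subtopology Diff_eq)
  qed
qed (use Z in auto)

lemma supported_rows_pencil:
  assumes A: "A \<in> frames k m" "\<And>i. i < k \<Longrightarrow> A i \<in> coord_span {a i..b i}"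
    and E: "E = (\<lambda>z i. A i + cscale z (if i < k then Defs.unit_vec (a i) + Defs.unit_vec (b i) else 0))"
    and ends: "\<And>i. i < k \<Longrightarrow> E z i (a i) \<noteq> 0 \<and> E z i (b i) \<noteq> 0"
  shows "supported_rows (E z)"
  unfolding supported_rows_def
proof (intro conjI allI impI)
  fix i
  show "E z i \<in> coord_span {a i..b i}" if "i < k"
    using A(2)[OF that] ab[OF that] that unfolding E in_coord_span_interval
    by (auto simp: cscale_def Defs.unit_vec_def split: if_splits)
  show "E z i = 0" if "k \<le> i"
    using A(1) that by (simp add: E frames_iff cscale_def zero_fun_def)
qed (use ends in auto)

lemma has_intersection_ranks_in_closure:
  assumes V: "has_intersection_ranks V" shows "V \<in> Gr_top k m closure_of cell"
proof -
  obtain A where A: "A \<in> frames k m" "row_space k A = V" "\<And>i. i < k \<Longrightarrow> A i \<in> coord_span {a i..b i}"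
    using adapted_frame_exists[OF V] by blast
  define E where "E = (\<lambda>z i. A i + cscale z (if i < k then Defs.unit_vec (a i) + Defs.unit_vec (b i) else 0))"
  have continuous: "continuous_on UNIV E"
    unfolding E_def cscale_def
    by (intro continuous_on_coordinatewise_then_product) (auto intro!: continuous_intros)
  define bad where "bad = (\<Union>i<k. {z. E z i (a i) = 0} \<union> {z. E z i (b i) = 0})"
  have "finite {z :: complex. x + z * w = 0}" if "w \<noteq> 0" for x w
    by (rule finite_subset[of _ "{- x / w}"]) (use that in \<open>auto simp: field_simps eq_neg_iff_add_eq_0\<close>)
  then have finite: "finite bad"
    unfolding bad_def E_def by (auto simp: cscale_def Defs.unit_vec_def)
  have good: "supported_rows (E z)" if "z \<notin> bad" for z
    by (rule supported_rows_pencil[OF A(1,3) E_def]) (use that in \<open>auto simp: bad_def\<close>)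
  have "\<exists>V'. V' \<in> cell \<and> V' \<in> Q" if Q: "V \<in> Q" "openin (Gr_top k m) Q" for Q
  proof -
    obtain T where T: "open T" "{A \<in> frames k m. row_space k A \<in> Q} = frames k m \<inter> T"
      using Q(2) unfolding openin_Gr_top openin_open by blast
    have "E 0 = A"
      by (simp add: E_def cscale_def fun_eq_iff)
    then have "0 \<in> E -` T"
      using A Q(1) T(2) by blast
    moreover have "open (E -` T)"
      using continuous T(1) by (simp add: continuous_on_open_vimage)
    ultimately have "\<not> E -` T \<subseteq> bad"
      using finite_imp_not_open finite finite_subset by blast
    then obtain z where "E z \<in> T" "z \<notin> bad"
      by blast
    then show ?thesis
      using good[of z] supported_rows_frame[of "E z"] T(2) unfolding cell_def by blast
  qed
  then show ?thesis
    using V unfolding in_closure_of topspace_Gr_top has_intersection_ranks_def by blast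
qed

theorem rank_variety_eq_closure_cell: "rank_variety m intervals = Gr_top k m closure_of cell"
proof -
  have inter: "{a i..b i} \<inter> {a l..b l} = {max (a i) (a l)..min (b i) (b l)}" for i l
    by auto
  have "cell \<subseteq> Collect has_intersection_ranks"
    using cell_subset_Gr subspace_rank_cell
    unfolding has_intersection_ranks_def inter card_intervals_in[OF rank_set_intervals] subspace_rank_def by auto
  then have "Gr_top k m closure_of Collect has_intersection_ranks = Gr_top k m closure_of cell"
    using has_intersection_ranks_in_closure
    by (intro subset_antisym closure_of_mono closure_of_minimal closedin_closure_of) auto
  moreover have "Collect has_intersection_ranks = {V \<in> Gr k m. \<forall>(a, b)\<in>intervals. \<forall>(c, d)\<in>intervals.
        cdim (V \<inter> coord_span ({a..b} \<inter> {c..d})) = card (intervals_in ({a..b} \<inter> {c..d}) intervals)}"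
    by (auto simp: has_intersection_ranks_def) (auto simp: intervals_def)
  ultimately show ?thesis
    by (simp add: rank_variety_def card_intervals)
qed

end

section \<open>First-order expansions along frames\<close>

definition matrices :: "nat \<Rightarrow> nat \<Rightarrow> (nat \<Rightarrow> nat \<Rightarrow> complex) set" where
  "matrices k m = {E. \<forall>i p. (i, p) \<notin> {..<k} \<times> {1..m} \<longrightarrow> E i p = 0}"

definition entry_norm :: "nat \<Rightarrow> nat \<Rightarrow> (nat \<Rightarrow> nat \<Rightarrow> complex) \<Rightarrow> real" where
  "entry_norm k m E = (\<Sum>e\<in>{..<k} \<times> {1..m}. cmod (E (fst e) (snd e)))"

definition frame_deriv ::
    "nat \<Rightarrow> nat \<Rightarrow> ((nat \<Rightarrow> complex) set \<Rightarrow> complex) \<Rightarrow> (nat \<Rightarrow> nat \<Rightarrow> complex) \<Rightarrow> (nat \<Rightarrow> nat \<Rightarrow> complex) \<Rightarrow> complex" where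
  "frame_deriv k m f B E = (\<Sum>e\<in>{..<k} \<times> {1..m}. E (fst e) (snd e) * Gr_partial k f B (fst e) (snd e))"

definition matrix_comb :: "nat \<Rightarrow> (nat \<Rightarrow> complex) \<Rightarrow> (nat \<Rightarrow> nat \<Rightarrow> nat \<Rightarrow> complex) \<Rightarrow> nat \<Rightarrow> nat \<Rightarrow> complex" where
  "matrix_comb c y R = (\<lambda>i p. \<Sum>t<c. y t * R t i p)"

lemma matrices_scale: "E \<in> matrices k m \<Longrightarrow> (\<lambda>i p. z * E i p) \<in> matrices k m"
  by (auto simp: matrices_def)

lemma matrix_comb_in_matrices: "(\<And>t. t < c \<Longrightarrow> R t \<in> matrices k m) \<Longrightarrow> matrix_comb c y R \<in> matrices k m"
  unfolding matrices_def matrix_comb_def by (auto intro!: sum.neutral)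

lemma entry_norm_nonneg: "entry_norm k m E \<ge> 0"
  unfolding entry_norm_def by (intro sum_nonneg) auto

lemma entry_norm_scale: "entry_norm k m (\<lambda>i p. z * E i p) = cmod z * entry_norm k m E"
  by (simp add: entry_norm_def norm_mult sum_distrib_left)

lemma entry_norm_matrix_comb: "entry_norm k m (matrix_comb c y R) \<le> (\<Sum>t<c. cmod (y t) * entry_norm k m (R t))"
proof -
  have "entry_norm k m (matrix_comb c y R) \<le> (\<Sum>e\<in>{..<k} \<times> {1..m}. \<Sum>t<c. cmod (y t) * cmod (R t (fst e) (snd e)))"
    unfolding entry_norm_def matrix_comb_def by (intro sum_mono order_trans[OF norm_sum]) (simp add: norm_mult)
  also have "\<dots> = (\<Sum>t<c. cmod (y t) * entry_norm k m (R t))"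
    unfolding entry_norm_def sum_distrib_left by (rule sum.swap)
  finally show ?thesis .
qed

lemma frame_deriv_scale: "frame_deriv k m f B (\<lambda>i p. z * E i p) = z * frame_deriv k m f B E"
  by (simp add: frame_deriv_def sum_distrib_left mult.assoc)

lemma frame_deriv_matrix_comb: "frame_deriv k m f B (matrix_comb c y R) = (\<Sum>t<c. y t * frame_deriv k m f B (R t))"
  unfolding frame_deriv_def matrix_comb_def sum_distrib_left sum_distrib_right mult.assoc by (rule sum.swap)

lemma frame_nonzero_minor:
  assumes "B \<in> frames k m" obtains e where "array_det k (\<lambda>i l. B i (e l)) \<noteq> 0"
proof -
  obtain a b where "interval_family k m a b" "row_space k B \<in> interval_family.cell k a b"
    using cell_exists[OF row_space_in_Gr[OF assms]] .
  then show ?thesis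
    using that interval_family.cell_injective_on_columns injective_on_columns_iff_det[OF assms] by blast
qed

lemma matrices_in_polydisc: "E \<in> matrices k m \<Longrightarrow> case_prod E \<in> polydisc ({..<k} \<times> {1..m}) (entry_norm k m E)"
  unfolding polydisc_def entry_norm_def matrices_def
  by (auto intro!: member_le_sum[of "(_, _)" _ "\<lambda>e. cmod (E (fst e) (snd e))", simplified])

lemma eventually_small_matrices:
  assumes "\<forall>\<^sub>F d in at_right 0. \<forall>x\<in>polydisc ({..<k} \<times> {1..m}) d. P (curry x)"
  shows "\<forall>\<^sub>F d in at_right 0. \<forall>E\<in>matrices k m. entry_norm k m E \<le> d \<longrightarrow> P E"
  using assms
proof (rule eventually_mono)
  fix d assume P: "\<forall>x\<in>polydisc ({..<k} \<times> {1..m}) d. P (curry x)"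
  have "P E" if "E \<in> matrices k m" "entry_norm k m E \<le> d" for E
    using bspec[OF P, of "case_prod E"] matrices_in_polydisc[OF that(1)] polydisc_mono[OF that(2)] by auto
  then show "\<forall>E\<in>matrices k m. entry_norm k m E \<le> d \<longrightarrow> P E"
    by blast
qed

lemma continuous_on_add_curry: "continuous_on S (\<lambda>x. B + curry x :: nat \<Rightarrow> nat \<Rightarrow> complex)"
  by (intro continuous_on_coordinatewise_then_product) (auto simp: curry_def intro!: continuous_intros)

lemma eventually_frames_polydisc:
  assumes B: "B \<in> frames k m" and U: "openin (Gr_top k m) U" "row_space k B \<in> U"
  shows "\<forall>\<^sub>F d in at_right 0. \<forall>x\<in>polydisc ({..<k} \<times> {1..m}) d. B + curry x \<in> frames k m \<and> row_space k (B + curry x) \<in> U"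
proof -
  obtain e where e: "array_det k (\<lambda>i l. B i (e l)) \<noteq> 0"
    using frame_nonzero_minor[OF B] .
  obtain T where T: "open T" "{A \<in> frames k m. row_space k A \<in> U} = frames k m \<inter> T"
    using U unfolding openin_Gr_top openin_open by blast
  let ?det = "\<lambda>x. array_det k (\<lambda>i l. (B + curry x) i (e l))"
  let ?N = "?det -` (- {0}) \<inter> (\<lambda>x. B + curry x) -` T"
  have "continuous_on UNIV (\<lambda>x. (B + curry x) i p)" for i p
    by (rule continuous_on_compose2[OF continuous_on_entry[of UNIV] continuous_on_add_curry]) simp
  then have "open (?det -` (- {0}))"
    by (intro open_vimage continuous_on_array_det) auto
  moreover have "open ((\<lambda>x. B + curry x) -` T)"
    by (rule open_vimage[OF T(1) continuous_on_add_curry])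
  ultimately have "open ?N"
    by (rule open_Int)
  moreover have "B + curry 0 = B"
    by (simp add: curry_def fun_eq_iff)
  then have "0 \<in> ?N"
    using e B U(2) T(2) by auto
  ultimately have "\<forall>\<^sub>F d in at_right 0. polydisc ({..<k} \<times> {1..m}) d \<subseteq> ?N"
    by (intro eventually_polydisc_subset) auto
  then show ?thesis
  proof (rule eventually_mono, intro ballI)
    fix d x assume N: "polydisc ({..<k} \<times> {1..m}) d \<subseteq> ?N" and x: "x \<in> polydisc ({..<k} \<times> {1..m}) d"
    have outside: "x (i, p) = 0" if "(i, p) \<notin> {..<k} \<times> {1..m}" for i p
      using x that by (simp add: polydisc_def)
    have "B + curry x \<in> frames k m"
    proof (rule frame_if_det_nonzero)
      show "(B + curry x) i \<in> cspace m" if "i < k" for i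
        using B outside that unfolding frames_iff cspace_def by auto
      show "(B + curry x) i = 0" if "k \<le> i" for i
        using B outside that unfolding frames_iff by (simp add: fun_eq_iff)
      show "array_det k (\<lambda>i l. (B + curry x) i (e l)) \<noteq> 0"
        using N x by blast
    qed
    then show "B + curry x \<in> frames k m \<and> row_space k (B + curry x) \<in> U"
      using T(2) N x by blast
  qed
qed

lemma entry_slice_add_curry: "g (B + curry (x((i, p) := z))) = entry_slice g (B + curry x) i p (B i p + z)"
  unfolding entry_slice_def by (rule arg_cong[where f = g]) (auto simp: fun_eq_iff)

theorem Gr_holomorphic_first_order:
  assumes f: "Gr_holomorphic_on k m f U" and B: "B \<in> frames k m"
    and U: "openin (Gr_top k m) U" "row_space k B \<in> U" and e: "e > 0"
  shows "\<forall>\<^sub>F d in at_right 0. \<forall>E\<in>matrices k m. entry_norm k m E \<le> d \<longrightarrow>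
    cmod (f (row_space k (B + E)) - f (row_space k B) - frame_deriv k m f B E) \<le> e * entry_norm k m E"
proof -
  let ?I = "{..<k} \<times> {1..m}" and ?P = "{A \<in> frames k m. row_space k A \<in> U}"
  have f_cont: "continuous_on ?P (\<lambda>A. f (row_space k A))"
    and f_diff: "\<And>A i j. \<lbrakk>A \<in> ?P; i < k; j \<in> {1..m}\<rbrakk> \<Longrightarrow> entry_slice (f \<circ> row_space k) A i j field_differentiable at (A i j)"
    using f unfolding Gr_holomorphic_on_def o_def by auto
  obtain \<rho> where "\<rho> > 0" and \<rho>: "\<And>x. x \<in> polydisc ?I \<rho> \<Longrightarrow> B + curry x \<in> ?P"
    using eventually_happens'[OF _ eventually_conj[OF eventually_frames_polydisc[OF B U] eventually_at_right_less]] by auto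
  let ?g = "\<lambda>x. (f \<circ> row_space k) (B + curry x)"
  have slice: "(\<lambda>z. ?g (x(i := z))) = entry_slice (f \<circ> row_space k) (B + curry x) (fst i) (snd i) \<circ> (+) (B (fst i) (snd i))" for x i
    using entry_slice_add_curry[of "f \<circ> row_space k" B x "fst i" "snd i"] by auto
  have "\<forall>\<^sub>F d in at_right 0. \<forall>x\<in>polydisc ?I d.
      cmod (?g x - ?g 0 - (\<Sum>i\<in>?I. x i * deriv (\<lambda>z. ?g (0(i := z))) 0)) \<le> e * (\<Sum>i\<in>?I. cmod (x i))"
  proof (rule osgood[OF _ _ \<open>\<rho> > 0\<close> _ e])
    show "continuous_on (polydisc ?I \<rho>) ?g"
      unfolding o_def by (rule continuous_on_compose2[OF f_cont continuous_on_add_curry]) (use \<rho> in blast)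
    show "(\<lambda>z. ?g (x(i := z))) field_differentiable at z"
      if x: "x \<in> polydisc ?I \<rho>" and i: "i \<in> ?I" and z: "cmod z < \<rho>" for x i z
    proof -
      have "B + curry (x(i := z)) \<in> ?P"
        using \<rho> polydisc_update[OF x i] z by simp
      then have "entry_slice (f \<circ> row_space k) (B + curry (x(i := z))) (fst i) (snd i) field_differentiable at (B (fst i) (snd i) + z)"
        using f_diff[of "B + curry (x(i := z))" "fst i" "snd i"] i by auto
      then have "(\<lambda>z'. ?g ((x(i := z))(i := z'))) field_differentiable at z"
        unfolding slice by (intro field_differentiable_compose field_differentiable_add) auto
      then show ?thesis
        by simp
    qed
  qed simp
  moreover have "deriv (\<lambda>z. ?g (0(i := z))) 0 = Gr_partial k f B (fst i) (snd i)" for i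
    using deriv_shift_0[of "entry_slice (f \<circ> row_space k) B (fst i) (snd i)" "B (fst i) (snd i)"]
    unfolding slice Gr_partial_def by (simp add: curry_def zero_fun_def[symmetric])
  moreover have "?g 0 = f (row_space k B)"
    by (simp add: curry_def zero_fun_def[symmetric])
  ultimately show ?thesis
    by (intro eventually_small_matrices) (simp add: frame_deriv_def entry_norm_def curry_def)
qed

lemma eventually_frames:
  assumes "B \<in> frames k m" "openin (Gr_top k m) U" "row_space k B \<in> U"
  shows "\<forall>\<^sub>F d in at_right 0. \<forall>E\<in>matrices k m. entry_norm k m E \<le> d \<longrightarrow> B + E \<in> frames k m \<and> row_space k (B + E) \<in> U"
  by (rule eventually_small_matrices[OF eventually_frames_polydisc[OF assms]])

lemma eventually_frames_line:
  assumes B: "B \<in> frames k m" and U: "openin (Gr_top k m) U" "row_space k B \<in> U" and E: "E \<in> matrices k m"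
  shows "\<forall>\<^sub>F z in at_right (0 :: real). B + (\<lambda>i p. of_real z * E i p) \<in> frames k m \<and>
    row_space k (B + (\<lambda>i p. of_real z * E i p)) \<in> U"
proof -
  obtain \<delta> where \<delta>: "\<delta> > 0" "\<forall>E\<in>matrices k m. entry_norm k m E \<le> \<delta> \<longrightarrow> B + E \<in> frames k m \<and> row_space k (B + E) \<in> U"
    using eventually_happens'[OF _ eventually_conj[OF eventually_at_right_less eventually_frames[OF B U]]] by auto
  have "((\<lambda>z. z * entry_norm k m E) \<longlongrightarrow> 0) (at_right 0)"
    by (auto intro!: tendsto_eq_intros)
  then have "\<forall>\<^sub>F z in at_right 0. z * entry_norm k m E < \<delta>"
    using \<delta>(1) by (rule order_tendstoD)
  then show ?thesis
    using eventually_at_right_less[of "0 :: real"]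
    by eventually_elim (use \<delta>(2) matrices_scale[OF E] in \<open>simp add: entry_norm_scale\<close>)
qed

lemma frame_deriv_eqI:
  assumes f: "Gr_holomorphic_on k m f U" and B: "B \<in> frames k m" and U: "openin (Gr_top k m) U" "row_space k B \<in> U"
    and E: "E \<in> matrices k m"
    and linear: "\<forall>\<^sub>F z in at_right 0. B + (\<lambda>i p. of_real z * E i p) \<in> frames k m \<longrightarrow> row_space k (B + (\<lambda>i p. of_real z * E i p)) \<in> U \<longrightarrow>
      f (row_space k (B + (\<lambda>i p. of_real z * E i p))) = f (row_space k B) + of_real z * d"
  shows "frame_deriv k m f B E = d"
proof -
  let ?D = "frame_deriv k m f B E" and ?K = "entry_norm k m E + 1"
  have K: "?K > 0"
    using entry_norm_nonneg[of k m E] by linarith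
  have "cmod (d - ?D) \<le> 0 + \<epsilon>" if \<epsilon>: "\<epsilon> > 0" for \<epsilon>
  proof -
    have "\<epsilon> / ?K > 0"
      using \<epsilon> K by simp
    from eventually_happens'[OF _ eventually_conj[OF eventually_at_right_less
          eventually_conj[OF eventually_frames[OF B U] Gr_holomorphic_first_order[OF f B U this]]]]
    obtain \<delta> where \<delta>: "\<delta> > 0" "\<forall>E\<in>matrices k m. entry_norm k m E \<le> \<delta> \<longrightarrow> B + E \<in> frames k m \<and> row_space k (B + E) \<in> U"
        "\<forall>E\<in>matrices k m. entry_norm k m E \<le> \<delta> \<longrightarrow>
          cmod (f (row_space k (B + E)) - f (row_space k B) - frame_deriv k m f B E) \<le> \<epsilon> / ?K * entry_norm k m E"
      by auto
    have "((\<lambda>z. z * entry_norm k m E) \<longlongrightarrow> 0) (at_right 0)"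
      by (auto intro!: tendsto_eq_intros)
    then have "\<forall>\<^sub>F z in at_right 0. z * entry_norm k m E < \<delta>"
      using \<delta>(1) by (rule order_tendstoD)
    from eventually_happens'[OF _ eventually_conj[OF eventually_at_right_less eventually_conj[OF this linear]]]
    obtain z where z: "0 < z" "z * entry_norm k m E < \<delta>"
      and linear_z: "B + (\<lambda>i p. of_real z * E i p) \<in> frames k m \<longrightarrow> row_space k (B + (\<lambda>i p. of_real z * E i p)) \<in> U \<longrightarrow>
        f (row_space k (B + (\<lambda>i p. of_real z * E i p))) = f (row_space k B) + of_real z * d"
      by auto
    let ?E = "\<lambda>i p. complex_of_real z * E i p"
    have small: "entry_norm k m ?E \<le> \<delta>"
      using z by (simp add: entry_norm_scale)
    have "f (row_space k (B + ?E)) = f (row_space k B) + of_real z * d"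
      using linear_z \<delta>(2) matrices_scale[OF E] small by blast
    then have "f (row_space k (B + ?E)) - f (row_space k B) - frame_deriv k m f B ?E = of_real z * (d - ?D)"
      by (simp add: frame_deriv_scale right_diff_distrib)
    then have "z * cmod (d - ?D) \<le> \<epsilon> / ?K * (z * entry_norm k m E)"
      using \<delta>(3) matrices_scale[OF E] small z(1) by (metis entry_norm_scale norm_mult norm_of_real abs_of_pos)
    then have "cmod (d - ?D) \<le> \<epsilon> / ?K * entry_norm k m E"
      unfolding mult.left_commute[of "\<epsilon> / ?K"] mult_le_cancel_left_pos[OF z(1)] .
    also have "\<dots> \<le> \<epsilon> / ?K * ?K"
      using \<epsilon> K by (intro mult_left_mono) auto
    finally show ?thesis
      using K by simp
  qed
  then show ?thesis
    using field_le_epsilon[of "cmod (d - ?D)" 0] by simp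
qed

subsection \<open>Simplices normal to the zero set of a submersion\<close>

lemma cmod_simplex_coords_le:
  assumes x: "x \<in> standard_simplex n" and r: "r > 0"
  shows "cmod (simplex_coords r x t) \<le> 2 * r"
proof -
  have bounds: "0 \<le> x i \<and> x i \<le> 1" for i
    using x unfolding standard_simplex_def by auto
  have "cmod (Complex (x (2 * t + 1) - x 0) (x (2 * t + 2) - x 0)) \<le> \<bar>x (2 * t + 1) - x 0\<bar> + \<bar>x (2 * t + 2) - x 0\<bar>"
    using cmod_le[of "Complex (x (2 * t + 1) - x 0) (x (2 * t + 2) - x 0)"] by simp
  also have "\<dots> \<le> 2"
    using bounds[of 0] bounds[of "2 * t + 1"] bounds[of "2 * t + 2"] by linarith
  finally show ?thesis
    using r by (simp add: simplex_coords_def norm_mult)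
qed

lemma eventually_simplex_comb_small:
  assumes \<delta>: "\<delta> > 0"
  shows "\<forall>\<^sub>F r in at_right 0. \<forall>x\<in>standard_simplex (2 * c). entry_norm k m (matrix_comb c (simplex_coords r x) R) \<le> \<delta>"
proof -
  let ?K = "\<Sum>t<c. entry_norm k m (R t)"
  have "((\<lambda>r. 2 * r * ?K) \<longlongrightarrow> 0) (at_right 0)"
    by (auto intro!: tendsto_eq_intros)
  then have "\<forall>\<^sub>F r in at_right 0. 2 * r * ?K < \<delta>"
    using \<delta> by (rule order_tendstoD)
  then show ?thesis
    using eventually_at_right_less[of "0 :: real"]
  proof eventually_elim
    case (elim r)
    have "entry_norm k m (matrix_comb c (simplex_coords r x) R) \<le> \<delta>" if x: "x \<in> standard_simplex (2 * c)" for x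
    proof -
      have "(\<Sum>t<c. cmod (simplex_coords r x t) * entry_norm k m (R t)) \<le> (\<Sum>t<c. 2 * r * entry_norm k m (R t))"
        by (intro sum_mono mult_right_mono cmod_simplex_coords_le[OF x elim(2)] entry_norm_nonneg)
      then show ?thesis
        using entry_norm_matrix_comb[of k m c "simplex_coords r x" R] elim(1) by (simp add: sum_distrib_left)
    qed
    then show ?case
      by blast
  qed
qed

lemma eventually_simplex_close_to_linear:
  assumes U: "openin (Gr_top k m) U" and f: "\<forall>s<c. Gr_holomorphic_on k m (f s) U"
    and B: "B \<in> frames k m" "row_space k B \<in> U" and f0: "\<forall>s<c. f s (row_space k B) = 0"
    and R: "\<forall>t<c. R t \<in> matrices k m" and \<mu>: "\<mu> > 0"
  shows "\<forall>\<^sub>F r in at_right 0. \<forall>x\<in>standard_simplex (2 * c). (let V = row_space k (B + matrix_comb c (simplex_coords r x) R) in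
    B + matrix_comb c (simplex_coords r x) R \<in> frames k m \<and> V \<in> U \<and>
    (\<Sum>s<c. cmod (f s V - array_apply c (\<lambda>s t. frame_deriv k m (f s) B (R t)) (simplex_coords r x) s))
      \<le> \<mu> * (\<Sum>t<c. cmod (simplex_coords r x t)))"
proof -
  define K where "K = 1 + (\<Sum>t<c. entry_norm k m (R t))"
  have K: "K > 0" "t < c \<Longrightarrow> entry_norm k m (R t) \<le> K" for t
    using member_le_sum[of t "{..<c}" "\<lambda>t. entry_norm k m (R t)"] entry_norm_nonneg
    by (auto simp: K_def intro!: add_pos_nonneg sum_nonneg)
  define e where "e = \<mu> / (K * (real c + 1))"
  have e: "e > 0" "real c * (e * K) \<le> \<mu>"
    using \<mu> K(1) by (auto simp: e_def divide_simps)
  have "\<forall>\<^sub>F d in at_right 0. \<forall>s\<in>{..<c}. \<forall>E\<in>matrices k m. entry_norm k m E \<le> d \<longrightarrow>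
      cmod (f s (row_space k (B + E)) - f s (row_space k B) - frame_deriv k m (f s) B E) \<le> e * entry_norm k m E"
    by (intro eventually_ball_finite ballI Gr_holomorphic_first_order[OF _ B(1) U B(2) e(1)]) (use f in auto)
  from eventually_happens'[OF _ eventually_conj[OF eventually_at_right_less eventually_conj[OF eventually_frames[OF B(1) U B(2)] this]]]
  obtain \<delta> where \<delta>: "\<delta> > 0" "\<forall>E\<in>matrices k m. entry_norm k m E \<le> \<delta> \<longrightarrow> B + E \<in> frames k m \<and> row_space k (B + E) \<in> U"
      "\<forall>s\<in>{..<c}. \<forall>E\<in>matrices k m. entry_norm k m E \<le> \<delta> \<longrightarrow>
        cmod (f s (row_space k (B + E)) - f s (row_space k B) - frame_deriv k m (f s) B E) \<le> e * entry_norm k m E"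
    by auto
  show ?thesis
    using eventually_simplex_comb_small[OF \<delta>(1), of c k m R]
  proof (eventually_elim, intro ballI)
    case (elim r)
    fix x assume x: "x \<in> standard_simplex (2 * c)"
    let ?y = "simplex_coords r x"
    let ?E = "matrix_comb c ?y R" and ?Y = "\<Sum>t<c. cmod (?y t)"
    have E: "?E \<in> matrices k m" "entry_norm k m ?E \<le> \<delta>"
      using matrix_comb_in_matrices[of c R k m] R elim x by auto
    have "(\<Sum>t<c. cmod (?y t) * entry_norm k m (R t)) \<le> (\<Sum>t<c. cmod (?y t) * K)"
      using K(2) by (intro sum_mono mult_left_mono) auto
    then have norm_E: "entry_norm k m ?E \<le> K * ?Y"
      using entry_norm_matrix_comb[of k m c ?y R] by (simp add: sum_distrib_left mult.commute)
    have "cmod (f s (row_space k (B + ?E)) - array_apply c (\<lambda>s t. frame_deriv k m (f s) B (R t)) ?y s) \<le> e * (K * ?Y)"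
      if s: "s < c" for s
    proof -
      have "cmod (f s (row_space k (B + ?E)) - f s (row_space k B) - frame_deriv k m (f s) B ?E) \<le> e * entry_norm k m ?E"
        using \<delta>(3) s E by blast
      also have "\<dots> \<le> e * (K * ?Y)"
        using norm_E e(1) by simp
      finally show ?thesis
        using f0 s by (simp add: frame_deriv_matrix_comb array_apply_def mult.commute)
    qed
    then have "(\<Sum>s<c. cmod (f s (row_space k (B + ?E)) - array_apply c (\<lambda>s t. frame_deriv k m (f s) B (R t)) ?y s))
        \<le> (\<Sum>s<c. e * (K * ?Y))"
      by (intro sum_mono) auto
    also have "\<dots> = real c * (e * K) * ?Y"
      by simp
    also have "\<dots> \<le> \<mu> * ?Y"
      by (intro mult_right_mono e(2) sum_nonneg) auto
    finally show "let V = row_space k (B + ?E) in B + ?E \<in> frames k m \<and> V \<in> U \<and>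
        (\<Sum>s<c. cmod (f s V - array_apply c (\<lambda>s t. frame_deriv k m (f s) B (R t)) ?y s)) \<le> \<mu> * ?Y"
      using \<delta>(2) E by (simp add: Let_def)
  qed
qed

definition frame_simplex ::
    "nat \<Rightarrow> nat \<Rightarrow> (nat \<Rightarrow> nat \<Rightarrow> complex) \<Rightarrow> (nat \<Rightarrow> nat \<Rightarrow> nat \<Rightarrow> complex) \<Rightarrow> real \<Rightarrow> (nat \<Rightarrow> real) \<Rightarrow> (nat \<Rightarrow> complex) set" where
  "frame_simplex k c B R r = (\<lambda>x\<in>standard_simplex (2 * c). row_space k (B + matrix_comb c (simplex_coords r x) R))"

lemma continuous_on_simplex_comb: "continuous_on S (\<lambda>x. B + matrix_comb c (simplex_coords r x) R)"
  unfolding matrix_comb_def plus_fun_def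
  by (intro continuous_on_coordinatewise_then_product continuous_intros continuous_on_simplex_coords)

lemma singular_simplex_frame_simplex:
  assumes "\<And>x. x \<in> standard_simplex (2 * c) \<Longrightarrow> B + matrix_comb c (simplex_coords r x) R \<in> {A \<in> frames k m. row_space k A \<in> U}"
  shows "singular_simplex (2 * c) (subtopology (Gr_top k m) U) (frame_simplex k c B R r)"
proof -
  let ?\<Delta> = "standard_simplex (2 * c)"
  have "continuous_map (top_of_set ?\<Delta>) (top_of_set (frames k m)) (\<lambda>x. B + matrix_comb c (simplex_coords r x) R)"
    using continuous_on_simplex_comb assms by (auto simp: continuous_map_in_subtopology)
  from continuous_map_compose[OF this quotient_imp_continuous_map[OF quotient_map_row_space]]
  have "continuous_map (top_of_set ?\<Delta>) (subtopology (Gr_top k m) U) (\<lambda>x. row_space k (B + matrix_comb c (simplex_coords r x) R))"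
    using assms by (auto simp: continuous_map_in_subtopology o_def)
  then have "continuous_map (top_of_set ?\<Delta>) (subtopology (Gr_top k m) U) (frame_simplex k c B R r)"
    by (rule continuous_map_eq) (auto simp: frame_simplex_def)
  then show ?thesis
    by (simp add: singular_simplex_def frame_simplex_def euclidean_product_topology)
qed

definition zero_map :: "nat \<Rightarrow> (nat \<Rightarrow> (nat \<Rightarrow> complex) set \<Rightarrow> complex) \<Rightarrow> (nat \<Rightarrow> complex) set \<Rightarrow> nat \<Rightarrow> real" where
  "zero_map c f V = real_coords c (\<lambda>s. f s V)"

theorem eventually_frame_simplex_degree:
  assumes U: "openin (Gr_top k m) U" and f: "\<forall>s<c. Gr_holomorphic_on k m (f s) U"
    and B: "B \<in> frames k m" "row_space k B \<in> U" and f0: "\<forall>s<c. f s (row_space k B) = 0"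
    and R: "\<forall>t<c. R t \<in> matrices k m" and D: "array_inj c (\<lambda>s t. frame_deriv k m (f s) B (R t))"
  shows "\<forall>\<^sub>F r in at_right 0.
    singular_simplex (2 * c) (subtopology (Gr_top k m) U) (frame_simplex k c B R r) \<and>
    (\<forall>x\<in>standard_simplex (2 * c). \<forall>j\<le>2 * c. x j = 0 \<longrightarrow> (\<exists>s<c. f s (frame_simplex k c B R r x) \<noteq> 0)) \<and>
    local_degree (2 * c) (chain_map (2 * c) (zero_map c f) (frag_of (frame_simplex k c B R r))) = 1"
proof -
  let ?\<Delta> = "standard_simplex (2 * c)" and ?D = "\<lambda>s t. frame_deriv k m (f s) B (R t)"
  let ?A = "\<lambda>r x. B + matrix_comb c (simplex_coords r x) R" and ?P = "{A \<in> frames k m. row_space k A \<in> U}"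
  obtain \<mu> where \<mu>: "\<mu> > 0"
    "\<And>r F. \<lbrakk>r > 0; \<And>s. s < c \<Longrightarrow> continuous_on ?\<Delta> (\<lambda>x. F x s);
        \<And>x. x \<in> ?\<Delta> \<Longrightarrow> (\<Sum>s<c. cmod (F x s - array_apply c ?D (simplex_coords r x) s)) \<le> \<mu> * (\<Sum>t<c. cmod (simplex_coords r x t))\<rbrakk> \<Longrightarrow>
      (\<forall>x\<in>?\<Delta>. \<forall>j\<le>2 * c. x j = 0 \<longrightarrow> (\<exists>s<c. F x s \<noteq> 0)) \<and> local_degree (2 * c) (frag_of (coords_simplex c F)) = 1"
    using local_degree_perturbed_linear[OF D] by blast
  show ?thesis
    using eventually_simplex_close_to_linear[OF U f B f0 R \<mu>(1)] eventually_at_right_less[of "0 :: real"]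
  proof eventually_elim
    case (elim r)
    have A: "?A r x \<in> ?P" if "x \<in> ?\<Delta>" for x
      using elim(1) that by (auto simp: Let_def)
    let ?F = "\<lambda>x s. f s (row_space k (?A r x))"
    have "continuous_on ?\<Delta> (\<lambda>x. ?F x s)" if "s < c" for s
    proof (rule continuous_on_compose2[OF _ continuous_on_simplex_comb])
      show "continuous_on ?P (\<lambda>A. f s (row_space k A))"
        using f that unfolding Gr_holomorphic_on_def o_def by blast
    qed (use A in blast)
    then have "(\<forall>x\<in>?\<Delta>. \<forall>j\<le>2 * c. x j = 0 \<longrightarrow> (\<exists>s<c. ?F x s \<noteq> 0)) \<and> local_degree (2 * c) (frag_of (coords_simplex c ?F)) = 1"
      using elim by (intro \<mu>(2)) (auto simp: Let_def)
    moreover have "chain_map (2 * c) (zero_map c f) (frag_of (frame_simplex k c B R r)) = frag_of (coords_simplex c ?F)"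
      unfolding frame_simplex_def chain_map_restrict coords_simplex_def zero_map_def ..
    ultimately show ?case
      using singular_simplex_frame_simplex[OF A] by (simp add: frame_simplex_def)
  qed
qed

subsection \<open>Derivatives of local equations of a cell\<close>

definition unit_matrix :: "nat \<Rightarrow> nat \<Rightarrow> nat \<Rightarrow> nat \<Rightarrow> complex" where
  "unit_matrix i p = (\<lambda>i' p'. of_bool (i' = i \<and> p' = p))"

lemma unit_matrix_in_matrices: "\<lbrakk>i < k; p \<in> {1..m}\<rbrakk> \<Longrightarrow> unit_matrix i p \<in> matrices k m"
  by (auto simp: unit_matrix_def matrices_def)

lemma frame_deriv_unit_matrix:
  assumes "i < k" "p \<in> {1..m}" shows "frame_deriv k m f B (unit_matrix i p) = Gr_partial k f B i p"
proof -
  have "frame_deriv k m f B (unit_matrix i p) = (\<Sum>e\<in>{..<k} \<times> {1..m}. if e = (i, p) then Gr_partial k f B i p else 0)"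
    unfolding frame_deriv_def unit_matrix_def by (intro sum.cong) auto
  then show ?thesis
    using assms by simp
qed

lemma frame_deriv_row:
  assumes "i < k"
  shows "frame_deriv k m f B (\<lambda>i'. if i' = i then w else 0) = (\<Sum>p\<in>{1..m}. w p * Gr_partial k f B i p)"
proof -
  have "frame_deriv k m f B (\<lambda>i'. if i' = i then w else 0)
      = (\<Sum>i'<k. \<Sum>p\<in>{1..m}. (if i' = i then w else 0) p * Gr_partial k f B i' p)"
    by (simp add: frame_deriv_def sum.cartesian_product case_prod_beta)
  also have "\<dots> = (\<Sum>i'<k. if i' = i then (\<Sum>p\<in>{1..m}. w p * Gr_partial k f B i p) else 0)"
    by (intro sum.cong) auto
  finally have "frame_deriv k m f B (\<lambda>i'. if i' = i then w else 0)
      = (\<Sum>i'<k. if i' = i then (\<Sum>p\<in>{1..m}. w p * Gr_partial k f B i p) else 0)" .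
  then show ?thesis
    using assms by simp
qed

lemma frame_deriv_along_row_space:
  assumes f: "Gr_holomorphic_on k m f U" and B: "B \<in> frames k m" and U: "openin (Gr_top k m) U" "row_space k B \<in> U"
    and i: "i < k" and w: "w \<in> row_space k B"
  shows "(\<Sum>p\<in>{1..m}. w p * Gr_partial k f B i p) = 0"
proof -
  let ?V = "row_space k B" and ?E = "\<lambda>i'. if i' = i then w else 0"
  have V: "?V \<in> Gr k m"
    by (rule row_space_in_Gr[OF B])
  have "row_space k (B + (\<lambda>i' p. z * ?E i' p)) = ?V" if frame: "B + (\<lambda>i' p. z * ?E i' p) \<in> frames k m" for z
  proof (rule row_space_eqI[OF _ _ V])
    show "lin_indep {..<k} (B + (\<lambda>i' p. z * ?E i' p))"
      using frame by (simp add: frames_iff)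
    show "(B + (\<lambda>i' p. z * ?E i' p)) i' \<in> ?V" if "i' < k" for i'
    proof -
      have "(B + (\<lambda>i' p. z * ?E i' p)) i' = B i' + cscale (if i' = i then z else 0) w"
        by (auto simp: cscale_def fun_eq_iff)
      then show ?thesis
        using GrD(1)[OF V] row_in_row_space[OF that] w by (metis cvec.subspace_add cvec.subspace_scale)
    qed
  qed
  moreover have "?E \<in> matrices k m"
    using GrD(2)[OF V] w i by (auto simp: matrices_def cspace_def)
  ultimately have "frame_deriv k m f B ?E = 0"
    by (intro frame_deriv_eqI[OF f B U] always_eventually) auto
  then show ?thesis
    using frame_deriv_row[OF i] by simp
qed

context interval_family
begin

lemma functional_eq_0_if_normal_entries_0:
  assumes V: "V \<in> Gr k m" "injective_on_columns k (row_pivots i) V" and i: "i < k"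
    and vanish: "\<And>w. w \<in> V \<Longrightarrow> (\<Sum>p\<in>{1..m}. w p * g p) = 0"
    and normal: "\<And>p. (i, p) \<in> normal_entries \<Longrightarrow> g p = 0" and inside: "\<And>p. a i \<le> p \<Longrightarrow> p \<le> b i \<Longrightarrow> g p = 0"
    and p: "p \<in> {1..m}"
  shows "g p = 0"
proof (cases "(i, p) \<in> free_entries")
  case True
  then show ?thesis
    using normal[of p] inside[of p] by (cases "p < a i \<or> b i < p") (auto simp: normal_entries_def)
next
  case False
  have free: "g p' = 0" if "(i, p') \<in> free_entries" for p'
    using that normal[of p'] inside[of p'] by (cases "p' < a i \<or> b i < p'") (auto simp: normal_entries_def)
  obtain l where l: "l < k" "p = row_pivots i l"
    using False p i by (auto simp: free_entries_def)
  let ?w = "dual_vector k (row_pivots i) l V"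
  note w = dual_vector_properties[OF V l(1)]
  have "?w p' * g p' = (if p' = p then g p else 0)" if p': "p' \<in> {1..m}" for p'
  proof (cases "(i, p') \<in> free_entries")
    case True
    then show ?thesis
      using free False by auto
  next
    case False
    then obtain l' where l': "l' < k" "p' = row_pivots i l'"
      using p' i by (auto simp: free_entries_def)
    then have "p' = p \<longleftrightarrow> l' = l"
      using inj_on_eq_iff[OF inj_pivot_column, of l' l] l by auto
    then show ?thesis
      using w(2)[OF l'(1)] l' by auto
  qed
  then have "(\<Sum>p'\<in>{1..m}. ?w p' * g p') = (\<Sum>p'\<in>{1..m}. if p' = p then g p else 0)"
    by (intro sum.cong) auto
  then show ?thesis
    using vanish[OF w(1)] p by simp
qed

lemma eventually_supported_rows_line:
  assumes B: "supported_rows B" and i: "i < k" and p: "a i \<le> p" "p \<le> b i"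
  shows "\<forall>\<^sub>F z in at_right (0 :: real). supported_rows (B + (\<lambda>i' p'. of_real z * unit_matrix i p i' p'))"
proof -
  have rows: "B l \<in> coord_span {a l..b l}" "B l (a l) \<noteq> 0" "B l (b l) \<noteq> 0" if "l < k" for l
    using B that unfolding supported_rows_def by auto
  have nonzero: "\<forall>\<^sub>F z in at_right (0 :: real). w + of_real z * c \<noteq> 0" if "w \<noteq> 0" for w c :: complex
    by (rule tendsto_imp_eventually_ne[OF _ that]) (auto intro!: tendsto_eq_intros)
  have "\<forall>\<^sub>F z in at_right (0 :: real). \<forall>l\<in>{..<k}. B l (a l) + of_real z * unit_matrix i p l (a l) \<noteq> 0 \<and>
      B l (b l) + of_real z * unit_matrix i p l (b l) \<noteq> 0"
    by (intro eventually_ball_finite ballI eventually_conj nonzero rows) auto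
  then show ?thesis
  proof eventually_elim
    case (elim z)
    have "B l + (\<lambda>p'. of_real z * unit_matrix i p l p') \<in> coord_span {a l..b l}" if "l < k" for l
      using rows(1)[OF that] p unfolding in_coord_span_interval by (auto simp: unit_matrix_def)
    moreover have "B l + (\<lambda>p'. of_real z * unit_matrix i p l p') = 0" if "k \<le> l" for l
      using B that i unfolding supported_rows_def by (auto simp: unit_matrix_def fun_eq_iff)
    ultimately show ?case
      using elim unfolding supported_rows_def by (simp add: plus_fun_def)
  qed
qed

lemma Gr_partial_eq_0_inside_interval:
  assumes f: "Gr_holomorphic_on k m f U" and U: "openin (Gr_top k m) U" "row_space k B \<in> U" and B: "supported_rows B"
    and vanish: "\<And>V. V \<in> cell \<inter> U \<Longrightarrow> f V = 0" and i: "i < k" and p: "a i \<le> p" "p \<le> b i"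
  shows "Gr_partial k f B i p = 0"
proof -
  have m: "p \<in> {1..m}"
    using p ab[OF i] by auto
  have "frame_deriv k m f B (unit_matrix i p) = 0"
  proof (rule frame_deriv_eqI[OF f supported_rows_frame[OF B] U unit_matrix_in_matrices[OF i m]])
    show "\<forall>\<^sub>F z in at_right 0. B + (\<lambda>i' p'. of_real z * unit_matrix i p i' p') \<in> frames k m \<longrightarrow>
      row_space k (B + (\<lambda>i' p'. of_real z * unit_matrix i p i' p')) \<in> U \<longrightarrow>
      f (row_space k (B + (\<lambda>i' p'. of_real z * unit_matrix i p i' p'))) = f (row_space k B) + of_real z * 0"
      using eventually_supported_rows_line[OF B i p]
    proof eventually_elim
      case (elim z)
      then show ?case
        using vanish B U(2) unfolding cell_def by simp
    qed
  qed
  then show ?thesis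
    using frame_deriv_unit_matrix[OF i m] by simp
qed

definition normal_dir :: "nat \<Rightarrow> nat \<Rightarrow> nat \<Rightarrow> complex" where
  "normal_dir t = unit_matrix (fst (entry_enum t)) (snd (entry_enum t))"

lemma normal_dir_in_matrices: "t < codim \<Longrightarrow> normal_dir t \<in> matrices k m"
  using entry_enum_in(2)[of t] unfolding normal_dir_def
  by (intro unit_matrix_in_matrices) (auto simp: normal_entries_def free_entries_def)

lemma frame_deriv_normal_dir:
  "t < codim \<Longrightarrow> frame_deriv k m f B (normal_dir t) = Gr_partial k f B (fst (entry_enum t)) (snd (entry_enum t))"
  using entry_enum_in(2)[of t] unfolding normal_dir_def
  by (intro frame_deriv_unit_matrix) (auto simp: normal_entries_def free_entries_def)

lemma Gr_partial_comb_eq_0: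
  assumes f: "\<And>s. s < c \<Longrightarrow> Gr_holomorphic_on k m (f s) U" and U: "openin (Gr_top k m) U" "V \<in> U" and V: "V \<in> cell"
    and vanish: "\<And>s V. \<lbrakk>s < c; V \<in> cell \<inter> U\<rbrakk> \<Longrightarrow> f s V = 0"
    and g: "\<And>t. t < codim \<Longrightarrow> (\<Sum>s<c. g s * frame_deriv k m (f s) (normal_frame V) (normal_dir t)) = 0"
    and i: "i < k" and p: "p \<in> {1..m}"
  shows "(\<Sum>s<c. g s * Gr_partial k (f s) (normal_frame V) i p) = 0"
proof -
  have Gr: "V \<in> Gr k m"
    using V cell_subset_Gr by blast
  have rows: "supported_rows (normal_frame V)"
    by (rule supported_rows_normal_frame[OF V])
  have V_eq: "row_space k (normal_frame V) = V"
    by (rule row_space_normal_frame_cell[OF V])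
  let ?g = "\<lambda>p. \<Sum>s<c. g s * Gr_partial k (f s) (normal_frame V) i p"
  show ?thesis
  proof (rule functional_eq_0_if_normal_entries_0[OF Gr cell_injective_on_columns[OF V] i _ _ _ p, where g = ?g])
    fix w assume w: "w \<in> V"
    have "(\<Sum>p\<in>{1..m}. w p * ?g p) = (\<Sum>s<c. g s * (\<Sum>p\<in>{1..m}. w p * Gr_partial k (f s) (normal_frame V) i p))"
      unfolding sum_distrib_left by (subst sum.swap) (simp add: mult_ac)
    also have "\<dots> = 0"
      by (intro sum.neutral ballI)
        (use frame_deriv_along_row_space[OF f supported_rows_frame[OF rows] U(1)] V_eq U(2) i w in auto)
    finally show "(\<Sum>p\<in>{1..m}. w p * ?g p) = 0" .
  next
    fix p assume "(i, p) \<in> normal_entries"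
    then obtain t where "t < codim" "entry_enum t = (i, p)"
      using entry_enum(2) by (metis imageE lessThan_iff)
    then show "?g p = 0"
      using g[of t] frame_deriv_normal_dir[of t] by simp
  next
    fix p assume "a i \<le> p" "p \<le> b i"
    then show "?g p = 0"
      by (intro sum.neutral ballI) (use Gr_partial_eq_0_inside_interval[OF f U(1) _ rows vanish i] V_eq U(2) in auto)
  qed
qed

end

section \<open>The fundamental cocycle\<close>

definition homology_functional :: "nat \<Rightarrow> 'a topology \<Rightarrow> 'a set \<Rightarrow> ('a chain \<Rightarrow> int) \<Rightarrow> bool" where
  "homology_functional p X S u \<longleftrightarrow>
     (\<forall>a b. singular_relcycle p X S a \<longrightarrow> singular_relcycle p X S b \<longrightarrow> u (a + b) = u a + u b) \<and>
     (\<forall>a. singular_relboundary p X S a \<longrightarrow> u a = 0)"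

lemma homology_functional_diff:
  assumes "homology_functional p X S u" "singular_relcycle p X S a" "singular_relcycle p X S b"
  shows "u (a - b) = u a - u b"
proof -
  have "u (a - b + b) = u (a - b) + u b"
    using assms singular_relcycle_diff unfolding homology_functional_def by blast
  then show ?thesis
    by simp
qed

lemma homology_functional_cong:
  assumes u: "homology_functional p X S u" and h: "homologous_rel p X S a b" and a: "singular_relcycle p X S a"
  shows "u a = u b"
proof -
  have "u (a - b) = 0"
    using u h unfolding homology_functional_def homologous_rel_def by blast
  then show ?thesis
    using homology_functional_diff[OF u a] homologous_rel_singular_relcycle[OF h] a by simp
qed

lemma homology_functional_0: "homology_functional p X S (\<lambda>_. 0)"
  by (simp add: homology_functional_def)

lemma homology_functionals_eqI:
  assumes gen: "homology_generated_by p X S {\<tau>. singular_relcycle p X S (frag_of \<tau>) \<and> u (frag_of \<tau>) = v (frag_of \<tau>)}"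
    and u: "homology_functional p X S u" and v: "homology_functional p X S v" and z: "singular_relcycle p X S z"
  shows "u z = v z"
proof -
  let ?G = "{\<tau>. singular_relcycle p X S (frag_of \<tau>) \<and> u (frag_of \<tau>) = v (frag_of \<tau>)}"
  have generated: "singular_relcycle p X S c \<and> u c = v c" if "Poly_Mapping.keys c \<subseteq> ?G" for c
    using that
  proof (induction c rule: frag_induction)
    case zero
    then show ?case
      using homology_functional_diff[OF u, of 0 0] homology_functional_diff[OF v, of 0 0] by simp
  next
    case (diff a b)
    then show ?case
      using homology_functional_diff[OF u] homology_functional_diff[OF v] by (simp add: singular_relcycle_diff)
  qed auto
  obtain c where c: "Poly_Mapping.keys c \<subseteq> ?G" "homologous_rel p X S z c"
    using gen z unfolding homology_generated_by_def by blast
  then show ?thesis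
    using generated[OF c(1)] homology_functional_cong[OF u c(2) z] homology_functional_cong[OF v c(2) z] by simp
qed

lemma cocycle_homology_functional:
  assumes \<phi>: "\<phi> \<in> cocycles p X" and vanish: "\<forall>d. singular_chain p (subtopology X S) d \<longrightarrow> \<phi> d = 0"
  shows "homology_functional p (subtopology X W) S \<phi>"
  unfolding homology_functional_def
proof (intro conjI allI impI)
  have add: "\<phi> (a + b) = \<phi> a + \<phi> b" if "singular_chain p X a" "singular_chain p X b" for a b
    using \<phi> that unfolding cocycles_def cochain_group_carrier_iff by blast
  show "\<phi> (a + b) = \<phi> a + \<phi> b"
    if "singular_relcycle p (subtopology X W) S a" "singular_relcycle p (subtopology X W) S b" for a b
    using that by (intro add) (auto simp: singular_relcycle_def singular_chain_subtopology)
  fix a assume "singular_relboundary p (subtopology X W) S a"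
  then obtain d e where d: "singular_chain (Suc p) X d" and e: "singular_chain p (subtopology X S) e" "singular_chain p X e"
    and boundary: "chain_boundary (Suc p) d = a + e"
    unfolding singular_relboundary_alt by (auto simp: singular_chain_subtopology)
  have "singular_chain p X (a + e - e)"
    using singular_chain_boundary[OF d] e(2) unfolding boundary by (intro singular_chain_diff) auto
  then have "\<phi> (chain_boundary (Suc p) d) = \<phi> a + \<phi> e"
    using add e(2) unfolding boundary by simp
  moreover have "coboundary_map p X \<phi> d = 0"
    using \<phi> d by (auto simp: cocycles_def cochain_group_one)
  ultimately show "\<phi> a = 0"
    using vanish e(1) d by (simp add: coboundary_map_def)
qed

subsection \<open>The degree defined by local equations\<close>

lemma local_equationsD:
  assumes "local_equations k m c Z W f"
  shows "openin (Gr_top k m) W" "\<forall>s<c. Gr_holomorphic_on k m (f s) W"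
    "\<And>A t s. \<lbrakk>A \<in> frames k m; row_space k A \<in> W; \<And>i j. \<lbrakk>i < k; j \<in> {1..m}\<rbrakk> \<Longrightarrow> (\<Sum>s<c. t s * Gr_partial k (f s) A i j) = 0; s < c\<rbrakk> \<Longrightarrow> t s = 0"
    "\<And>V. V \<in> W \<Longrightarrow> V \<in> Z \<longleftrightarrow> (\<forall>s<c. f s V = 0)"
  using assms unfolding local_equations_def by blast+

definition zero_degree :: "nat \<Rightarrow> (nat \<Rightarrow> (nat \<Rightarrow> complex) set \<Rightarrow> complex) \<Rightarrow> (nat \<Rightarrow> complex) set chain \<Rightarrow> int" where
  "zero_degree c f z = local_degree (2 * c) (chain_map (2 * c) (zero_map c f) z)"

lemma zero_map_eq_0_iff: "zero_map c f V = 0 \<longleftrightarrow> (\<forall>s<c. f s V = 0)"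
  by (simp add: zero_map_def real_coords_eq_0_iff)

lemma continuous_map_zero_map:
  assumes "openin (Gr_top k m) W" "\<forall>s<c. Gr_holomorphic_on k m (f s) W"
  shows "continuous_map (subtopology (Gr_top k m) W) (Euclidean_space (2 * c)) (zero_map c f)"
  unfolding Euclidean_space_eq zero_map_def[abs_def]
  by (rule continuous_map_from_Gr[OF assms(1) continuous_on_real_coords])
    (use assms(2) real_coords_in_Euclidean_set in \<open>auto simp: Gr_holomorphic_on_def o_def\<close>)

lemma zero_degree_homology_functional:
  assumes eq: "local_equations k m c Z W f"
  shows "homology_functional (2 * c) (subtopology (Gr_top k m) W) (- Z) (zero_degree c f)"
  unfolding homology_functional_def
proof (intro conjI allI impI)
  let ?W = "subtopology (Gr_top k m) W"
  note continuous = continuous_map_zero_map[OF local_equationsD(1,2)[OF eq]]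
  have off: "zero_map c f \<in> topspace ?W \<inter> - Z \<rightarrow> - {0}"
    using local_equationsD(4)[OF eq] by (auto simp: zero_map_eq_0_iff)
  have push: "singular_relcycle (2 * c) (Euclidean_space (2 * c)) (- {0}) (chain_map (2 * c) (zero_map c f) a)"
    if "singular_relcycle (2 * c) ?W (- Z) a" for a
    by (rule singular_relcycle_chain_map_gen[OF that continuous off])
  show "zero_degree c f (a + b) = zero_degree c f a + zero_degree c f b"
    if "singular_relcycle (2 * c) ?W (- Z) a" "singular_relcycle (2 * c) ?W (- Z) b" for a b
    unfolding zero_degree_def chain_map_add by (rule local_degree_add[OF push[OF that(1)] push[OF that(2)]])
  fix a assume "singular_relboundary (2 * c) ?W (- Z) a"
  then have "homologous_rel (2 * c) ?W (- Z) a 0"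
    by (simp add: homologous_rel_def)
  from homologous_rel_chain_map[OF this continuous off]
  show "zero_degree c f a = 0"
    unfolding zero_degree_def by (intro local_degree_relboundary) (simp add: homologous_rel_def)
qed

lemma eventually_frame_simplex_zero_degree:
  assumes eq: "local_equations k m c Z W f" and B: "B \<in> frames k m" "row_space k B \<in> Z \<inter> W"
    and R: "\<forall>t<c. R t \<in> matrices k m" and D: "array_inj c (\<lambda>s t. frame_deriv k m (f s) B (R t))"
  shows "\<forall>\<^sub>F r in at_right 0. singular_relcycle (2 * c) (subtopology (Gr_top k m) W) (- Z) (frag_of (frame_simplex k c B R r)) \<and>
    zero_degree c f (frag_of (frame_simplex k c B R r)) = 1"
proof -
  have "row_space k B \<in> W" "\<forall>s<c. f s (row_space k B) = 0"
    using B(2) local_equationsD(4)[OF eq] by auto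
  from eventually_frame_simplex_degree[OF local_equationsD(1,2)[OF eq] B(1) this R D]
  show ?thesis
  proof (rule eventually_mono, intro conjI)
    fix r
    let ?\<sigma> = "frame_simplex k c B R r"
    assume \<sigma>: "singular_simplex (2 * c) (subtopology (Gr_top k m) W) ?\<sigma> \<and>
      (\<forall>x\<in>standard_simplex (2 * c). \<forall>j\<le>2 * c. x j = 0 \<longrightarrow> (\<exists>s<c. f s (?\<sigma> x) \<noteq> 0)) \<and>
      local_degree (2 * c) (chain_map (2 * c) (zero_map c f) (frag_of ?\<sigma>)) = 1"
    then have "?\<sigma> x \<in> W" if "x \<in> standard_simplex (2 * c)" for x
      using that unfolding singular_simplex_def continuous_map_def by (auto simp: Pi_def)
    then show "singular_relcycle (2 * c) (subtopology (Gr_top k m) W) (- Z) (frag_of ?\<sigma>)"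
      using \<sigma> local_equationsD(4)[OF eq] by (intro singular_relcycle_of_simplex) blast+
    show "zero_degree c f (frag_of ?\<sigma>) = 1"
      using \<sigma> by (simp add: zero_degree_def)
  qed
qed

lemma normal_simplex_relcycle:
  assumes eq: "local_equations k m c Z W f" and r: "r > 0"
    and \<sigma>: "singular_simplex (2 * c) (subtopology (Gr_top k m) W) \<sigma>"
    and f: "\<forall>x\<in>standard_simplex (2 * c). \<forall>s<c. f s (\<sigma> x) = simplex_coords r x s"
  shows "singular_relcycle (2 * c) (subtopology (Gr_top k m) W) (- Z) (frag_of \<sigma>)" "zero_degree c f (frag_of \<sigma>) = 1"
proof -
  have "\<sigma> x \<in> W" if "x \<in> standard_simplex (2 * c)" for x
    using \<sigma> that unfolding singular_simplex_def continuous_map_def by (auto simp: Pi_def)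
  then show "singular_relcycle (2 * c) (subtopology (Gr_top k m) W) (- Z) (frag_of \<sigma>)"
    using f local_equationsD(4)[OF eq] simplex_coords_boundary_nonzero[OF _ _ _ r]
    by (intro singular_relcycle_of_simplex[OF \<sigma>]) (metis ComplI)
  have "simplex_map (2 * c) (zero_map c f) \<sigma> = coords_simplex c (simplex_coords r)"
    using f by (auto simp: simplex_map_def coords_simplex_def zero_map_def fun_eq_iff real_coords_def)
  then show "zero_degree c f (frag_of \<sigma>) = 1"
    by (simp add: zero_degree_def chain_map_of coords_simplex_simplex_coords local_degree_transverse_simplex[OF r])
qed

lemma array_inj_if_left_kernel_0:
  assumes "\<forall>g. (\<forall>t<c. (\<Sum>s<c. g s * D s t) = 0) \<longrightarrow> (\<forall>s<c. g s = 0)"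
  shows "array_inj c D"
proof -
  have "mat_of_array c (\<lambda>i j. D j i) = transpose_mat (mat_of_array c D)"
    by (rule eq_matI) (auto simp: mat_of_array_def)
  then have "array_det c (\<lambda>i j. D j i) = array_det c D"
    unfolding array_det_def using det_transpose[OF mat_of_array_carrier] by metis
  then show ?thesis
    using assms by (simp add: array_inj_iff_det array_det_nonzero_iff[of c D])
qed

text \<open>The conjugate gradients of local equations are directions in which their derivative is a Gram matrix.\<close>

lemma array_inj_conjugate_gradients:
  assumes eq: "local_equations k m c Z W f" and A: "A \<in> frames k m" "row_space k A \<in> W"
    and R: "R = (\<lambda>t i p. if (i, p) \<in> {..<k} \<times> {1..m} then cnj (Gr_partial k (f t) A i p) else 0)"
  shows "array_inj c (\<lambda>s t. frame_deriv k m (f s) A (R t))"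
  unfolding array_inj_def
proof (intro allI impI)
  fix y t assume kernel: "\<forall>s<c. array_apply c (\<lambda>s t. frame_deriv k m (f s) A (R t)) y s = 0" and t: "t < c"
  let ?I = "{..<k} \<times> {1..m}" and ?G = "\<lambda>s e. Gr_partial k (f s) A (fst e) (snd e)"
  define w where "w = (\<lambda>e. \<Sum>s<c. cnj (y s) * ?G s e)"
  have "array_apply c (\<lambda>s t. frame_deriv k m (f s) A (R t)) y s = (\<Sum>e\<in>?I. ?G s e * cnj (w e))" for s
    unfolding array_apply_def frame_deriv_def w_def R cnj_sum sum_distrib_left sum_distrib_right
    by (subst sum.swap) (auto intro!: sum.cong simp: mult_ac)
  then have "0 = (\<Sum>s<c. cnj (y s) * (\<Sum>e\<in>?I. ?G s e * cnj (w e)))"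
    using kernel by simp
  also have "\<dots> = (\<Sum>e\<in>?I. w e * cnj (w e))"
    unfolding w_def sum_distrib_left sum_distrib_right by (subst sum.swap) (simp add: mult.assoc w_def)
  also have "\<dots> = of_real (\<Sum>e\<in>?I. (cmod (w e))\<^sup>2)"
    by (simp add: complex_norm_square del: of_real_power)
  finally have "(\<Sum>e\<in>?I. (cmod (w e))\<^sup>2) = 0"
    using of_real_eq_0_iff by metis
  then have "w e = 0" if "e \<in> ?I" for e
    using that by (subst (asm) sum_nonneg_eq_0_iff) auto
  then have "cnj (y t) = 0"
    using local_equationsD(3)[OF eq A _ t, where t = "\<lambda>s. cnj (y s)"] unfolding w_def by auto
  then show "y t = 0"
    by simp
qed

lemma codim_le_if_homology_vanishes_below:
  assumes eq: "local_equations k m c Z W f" and V: "V \<in> Z \<inter> W" "V \<in> Gr k m"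
    and vanish: "\<And>p. p < n \<Longrightarrow> homology_vanishes p (subtopology (Gr_top k m) W) (- Z)"
  shows "n \<le> 2 * c"
proof (rule ccontr)
  assume "\<not> n \<le> 2 * c"
  obtain A where A: "A \<in> frames k m" "row_space k A = V"
    using Gr_frame[OF V(2)] .
  define R where "R = (\<lambda>t i p. if (i, p) \<in> {..<k} \<times> {1..m} then cnj (Gr_partial k (f t) A i p) else 0)"
  have "\<forall>t<c. R t \<in> matrices k m"
    by (auto simp: R_def matrices_def)
  from eventually_happens'[OF _ eventually_frame_simplex_zero_degree[OF eq A(1) _ this array_inj_conjugate_gradients[OF eq A(1) _ R_def]]]
  obtain r where r: "singular_relcycle (2 * c) (subtopology (Gr_top k m) W) (- Z) (frag_of (frame_simplex k c A R r))"
      "zero_degree c f (frag_of (frame_simplex k c A R r)) = 1"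
    using A(2) V(1) by auto
  then have "zero_degree c f (frag_of (frame_simplex k c A R r)) = 0"
    using vanish[of "2 * c"] \<open>\<not> n \<le> 2 * c\<close> zero_degree_homology_functional[OF eq]
    unfolding homology_vanishes_def homology_functional_def by simp
  then show False
    using r(2) by simp
qed

subsection \<open>Local equations of a cell\<close>

context interval_family
begin

lemma cell_nonempty: "cell \<noteq> {}"
proof -
  have "supported_rows (\<lambda>i p. if i < k \<and> (p = a i \<or> p = b i) then 1 else 0)"
    unfolding supported_rows_def in_coord_span_interval using ab by (auto simp: fun_eq_iff split: if_splits)
  then show ?thesis
    unfolding cell_def by blast
qed

lemma in_cell_iff_entry_coord:
  assumes "V \<in> chart_domain" shows "V \<in> cell \<longleftrightarrow> (\<forall>s<codim. entry_coord s V = 0)"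
  unfolding normal_entries_0_iff_cell[OF assms, symmetric] entry_enum(2)[symmetric] entry_coord_def
  by (auto simp: case_prod_beta)

lemma entry_coord_holomorphic: "s < codim \<Longrightarrow> Gr_holomorphic_on k m (entry_coord s) chart_domain"
  unfolding entry_coord_def[abs_def] using entry_enum_in(2)[of s] chart_domainD(2)
  by (intro holomorphic_dual_vector) (auto simp: normal_entries_def free_entries_def)

lemma normal_row_row_space:
  assumes "row_space k A \<in> chart_domain" "\<And>l. l < k \<Longrightarrow> A i (row_pivots i l) = (if l = i then 1 else 0)" "i < k"
  shows "normal_row i (row_space k A) = A i"
  by (rule dual_vector_eqI) (use assms chart_domainD(1,2)[OF assms(1)] GrD(1) row_in_row_space in auto)

lemma entry_coord_row_space:
  assumes A: "row_space k A \<in> chart_domain" "A = normal_frame V + E" and V: "V \<in> chart_domain"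
    and E: "\<And>i p. (i, p) \<notin> free_entries \<Longrightarrow> E i p = 0" and s: "s < codim"
  shows "entry_coord s (row_space k A) = entry_coord s V + E (fst (entry_enum s)) (snd (entry_enum s))"
proof -
  have i: "fst (entry_enum s) < k"
    using entry_enum_in(2)[OF s] by (auto simp: normal_entries_def free_entries_def)
  have "(fst (entry_enum s), row_pivots (fst (entry_enum s)) l) \<notin> free_entries" if "l < k" for l
    using that by (auto simp: free_entries_def)
  then have "normal_row (fst (entry_enum s)) (row_space k A) = A (fst (entry_enum s))"
    using chart_domainD(6)[OF V i] i E by (intro normal_row_row_space[OF A(1)]) (auto simp: A(2) normal_frame_def)
  then show ?thesis
    using i by (simp add: entry_coord_def A(2) normal_frame_def)
qed

lemma entry_enum_eq_iff: "\<lbrakk>s < codim; t < codim\<rbrakk> \<Longrightarrow> entry_enum s = entry_enum t \<longleftrightarrow> s = t"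
  using inj_on_eq_iff[OF bij_betw_imp_inj_on[OF entry_enum(1)], of s t] codim_le by simp

text \<open>In a frame \<open>A = g M\<close>, where \<open>M\<close> is the normal frame of the row space, the normal entry \<open>s0\<close> of
  \<open>M\<close> is moved by adding a column of \<open>g\<close> to a column of \<open>A\<close>.\<close>

lemma entry_coord_derivative:
  assumes A: "A \<in> frames k m" "row_space k A \<in> chart_domain" and s0: "s0 < codim"
  obtains E where "E \<in> matrices k m" "\<forall>s<codim. frame_deriv k m (entry_coord s) A E = (if s = s0 then 1 else 0)"
proof -
  let ?V = "row_space k A"
  let ?M = "normal_frame ?V"
  note M = normal_frame_in_frames[OF A(2)]
  obtain i0 p0 where e0: "entry_enum s0 = (i0, p0)"
    by (cases "entry_enum s0")
  then have n0: "i0 < k" "p0 \<in> {1..m}" "(i0, p0) \<in> free_entries"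
    using entry_enum_in(2)[OF s0] by (auto simp: normal_entries_def free_entries_def)
  have "\<forall>i\<in>{..<k}. \<exists>g. A i = lincomb {..<k} g ?M"
    using row_in_row_space[of _ k A] in_row_space_iff[of _ k ?M] M(2) by auto
  then obtain g where g: "\<forall>i\<in>{..<k}. A i = lincomb {..<k} (g i) ?M"
    unfolding bchoice_iff by blast
  define E where "E = (\<lambda>i p. if i < k \<and> p = p0 then g i i0 else 0)"
  have outside_free_entries: "unit_matrix i0 p0 i p = 0" if "(i, p) \<notin> free_entries" for i p
    using n0(3) that by (auto simp: unit_matrix_def)
  have E: "E \<in> matrices k m"
    using n0 by (auto simp: E_def matrices_def)
  let ?A = "\<lambda>z :: real. A + (\<lambda>i p. of_real z * E i p)" and ?N = "\<lambda>z :: real. ?M + (\<lambda>i p. of_real z * unit_matrix i0 p0 i p)"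
  have rows: "?A z i = lincomb {..<k} (g i) (?N z)" if i: "i < k" for z i
  proof
    fix p
    have "lincomb {..<k} (g i) (?N z) p
        = lincomb {..<k} (g i) ?M p + (\<Sum>l<k. if l = i0 then of_real z * g i i0 * of_bool (p = p0) else 0)"
      unfolding lincomb_def sum.distrib[symmetric] by (intro sum.cong) (auto simp: unit_matrix_def algebra_simps)
    then show "?A z i p = lincomb {..<k} (g i) (?N z) p"
      using g i n0(1) by (simp add: E_def)
  qed
  have "frame_deriv k m (entry_coord s) A E = (if s = s0 then 1 else 0)" if s: "s < codim" for s
  proof (rule frame_deriv_eqI[OF entry_coord_holomorphic[OF s] A(1) openin_chart_domain A(2) E])
    have M_domain: "row_space k ?M \<in> chart_domain"
      using M(2) A(2) by simp
    show "\<forall>\<^sub>F z in at_right 0. ?A z \<in> frames k m \<longrightarrow> row_space k (?A z) \<in> chart_domain \<longrightarrow>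
        entry_coord s (row_space k (?A z)) = entry_coord s ?V + of_real z * (if s = s0 then 1 else 0)"
      using eventually_frames_line[OF M(1) openin_chart_domain M_domain unit_matrix_in_matrices[OF n0(1,2)]]
    proof (eventually_elim, intro impI)
      fix z assume N: "?N z \<in> frames k m \<and> row_space k (?N z) \<in> chart_domain" and frame: "?A z \<in> frames k m"
      have "row_space k (?A z) = row_space k (?N z)"
      proof (rule row_space_eqI)
        show "?A z i \<in> row_space k (?N z)" if "i < k" for i
          unfolding in_row_space_iff using rows[OF that] by blast
      qed (use frame N row_space_in_Gr frames_iff in blast)+
      moreover have "entry_coord s (row_space k (?N z))
          = entry_coord s ?V + of_real z * unit_matrix i0 p0 (fst (entry_enum s)) (snd (entry_enum s))"
        using entry_coord_row_space[of "?N z" ?V "\<lambda>i p. of_real z * unit_matrix i0 p0 i p" s, OF _ refl A(2) _ s] N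
          outside_free_entries by simp
      moreover have "unit_matrix i0 p0 (fst (entry_enum s)) (snd (entry_enum s)) = (if s = s0 then 1 else 0)"
        using entry_enum_eq_iff[OF s s0] e0 by (auto simp: unit_matrix_def prod_eq_iff)
      ultimately show "entry_coord s (row_space k (?A z)) = entry_coord s ?V + of_real z * (if s = s0 then 1 else 0)"
        by simp
    qed
  qed
  then show ?thesis
    using that[OF E] by blast
qed

lemma entry_coord_independent:
  assumes A: "A \<in> frames k m" "row_space k A \<in> chart_domain"
    and t: "\<And>i j. \<lbrakk>i < k; j \<in> {1..m}\<rbrakk> \<Longrightarrow> (\<Sum>s<codim. t s * Gr_partial k (entry_coord s) A i j) = 0" and s0: "s0 < codim"
  shows "t s0 = 0"
proof -
  obtain E where E: "\<forall>s<codim. frame_deriv k m (entry_coord s) A E = (if s = s0 then 1 else 0)"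
    using entry_coord_derivative[OF A s0] .
  have "t s0 = (\<Sum>s<codim. if s = s0 then t s0 else 0)"
    using s0 by simp
  also have "\<dots> = (\<Sum>s<codim. t s * frame_deriv k m (entry_coord s) A E)"
    using E by (intro sum.cong) auto
  also have "\<dots> = (\<Sum>e\<in>{..<k} \<times> {1..m}. E (fst e) (snd e) * (\<Sum>s<codim. t s * Gr_partial k (entry_coord s) A (fst e) (snd e)))"
    unfolding frame_deriv_def sum_distrib_left by (subst sum.swap) (simp add: mult_ac)
  also have "\<dots> = 0"
    using t by (intro sum.neutral) auto
  finally show ?thesis .
qed

lemma local_equations_entry_coord:
  assumes Z: "cell \<subseteq> Z" "Z \<subseteq> rank_locus"
  shows "local_equations k m codim Z chart_domain entry_coord"
  unfolding local_equations_def
proof (intro conjI allI impI ballI)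
  show "t s = 0" if "A \<in> frames k m" "row_space k A \<in> chart_domain"
    "\<forall>i<k. \<forall>j\<in>{1..m}. (\<Sum>s<codim. t s * Gr_partial k (entry_coord s) A i j) = 0" "s < codim" for A t s
    using entry_coord_independent[of A t s] that by blast
  have "Z \<inter> chart_domain = cell"
    using Z rank_locus_Int_chart_domain cell_subset_chart_domain by blast
  then show "Z \<inter> chart_domain = {V \<in> chart_domain. \<forall>s<codim. entry_coord s V = 0}"
    using in_cell_iff_entry_coord cell_subset_chart_domain by blast
qed (rule openin_chart_domain, rule entry_coord_holomorphic)

definition normal_cell_simplex :: "(nat \<Rightarrow> complex) set \<Rightarrow> real \<Rightarrow> (nat \<Rightarrow> real) \<Rightarrow> (nat \<Rightarrow> complex) set" where
  "normal_cell_simplex V = frame_simplex k codim (normal_frame V) normal_dir"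

lemma matrix_comb_normal_dir:
  "matrix_comb codim y normal_dir i p = (if (i, p) \<in> normal_entries then y (entry_index (i, p)) else 0)"
proof (cases "(i, p) \<in> normal_entries")
  case True
  then obtain s where s: "s < codim" "entry_enum s = (i, p)"
    using entry_enum(2) by (metis imageE lessThan_iff)
  then have index: "entry_index (i, p) = s"
    using entry_index_entry_enum[of s] codim_le by simp
  have "normal_dir t i p = of_bool (t = s)" if "t < codim" for t
    using entry_enum_eq_iff[OF that s(1)] s(2) by (auto simp: normal_dir_def unit_matrix_def prod_eq_iff)
  then have "matrix_comb codim y normal_dir i p = (\<Sum>t<codim. if t = s then y s else 0)"
    unfolding matrix_comb_def by (intro sum.cong) auto
  then show ?thesis
    using s True index by simp
next
  case False
  have "normal_dir t i p = 0" if "t < codim" for t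
    using False entry_enum_in(2)[OF that] by (auto simp: normal_dir_def unit_matrix_def)
  then show ?thesis
    using False by (simp add: matrix_comb_def)
qed

lemma chart_matrix_transverse_simplex:
  assumes V: "V \<in> cell" and x: "x \<in> standard_simplex (2 * codim)"
  shows "chart_matrix (transverse_simplex (2 * codim) (chart_coords V) r x)
    = normal_frame V + matrix_comb codim (simplex_coords r x) normal_dir"
proof (intro ext)
  fix i p
  let ?s = "entry_index (i, p)" and ?y = "transverse_simplex (2 * codim) (chart_coords V) r x"
  have domain: "V \<in> chart_domain"
    using V cell_subset_chart_domain by blast
  note frame = fun_cong[OF fun_cong[OF chart_matrix_chart_coords[OF domain]], of i p]
  consider "(i, p) \<in> normal_entries" | "(i, p) \<in> free_entries" "(i, p) \<notin> normal_entries" | "(i, p) \<notin> free_entries"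
    by blast
  then show "chart_matrix ?y i p = (normal_frame V + matrix_comb codim (simplex_coords r x) normal_dir) i p"
  proof cases
    case 1
    then obtain s where "s < codim" "entry_enum s = (i, p)"
      using entry_enum(2) by (metis imageE lessThan_iff)
    then have s: "?s < codim"
      using entry_index_entry_enum[of s] codim_le by simp
    have "normal_row i V p = 0"
      using normal_entries_0_iff_cell[OF domain] V 1 by blast
    moreover have "chart_matrix ?y i p = simplex_coords r x ?s"
      using 1 normal_entries_subset s x by (auto simp: chart_matrix_def transverse_simplex_def simplex_coords_def complex_eq_iff)
    ultimately show ?thesis
      using 1 by (auto simp: matrix_comb_normal_dir normal_frame_def normal_entries_def free_entries_def)
  next
    case 2
    have "\<not> ?s < codim"
      using 2 entry_enum_in(2)[of ?s] entry_enum_entry_index(1)[OF 2(1)] by auto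
    then show ?thesis
      using 2 x frame by (simp add: matrix_comb_normal_dir chart_matrix_def transverse_simplex_def)
  next
    case 3
    then show ?thesis
      using normal_entries_subset frame by (auto simp: matrix_comb_normal_dir chart_matrix_def)
  qed
qed

lemma simplex_map_transverse_simplex:
  assumes "V \<in> cell"
  shows "simplex_map (2 * codim) (\<lambda>y. row_space k (chart_matrix y)) (transverse_simplex (2 * codim) (chart_coords V) r)
    = normal_cell_simplex V r"
  unfolding simplex_map_def normal_cell_simplex_def frame_simplex_def
  by (rule restrict_ext) (simp add: chart_matrix_transverse_simplex[OF assms])

lemma has_normal_simplices_normal_cell_simplex:
  assumes "\<And>V. V \<in> cell \<inter> W \<Longrightarrow> \<forall>\<^sub>F r in at_right 0. normal_cell_simplex V r \<in> G"
  shows "linear_chart.has_normal_simplices (2 * codim) chart_domain chart_coords (\<lambda>y. row_space k (chart_matrix y)) W G"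
  unfolding linear_chart.has_normal_simplices_def[OF linear_chart_chart_domain]
proof (intro ballI impI)
  fix V assume V: "V \<in> W \<inter> chart_domain" "chart_coords V \<in> coord_subspace (2 * codim)"
  then have cell: "V \<in> cell"
    using in_cell_iff_chart_coords by blast
  have "\<exists>\<^sub>F r in at_right 0. normal_cell_simplex V r \<in> G"
    by (rule eventually_frequently[OF _ assms]) (use V cell in auto)
  then show "\<exists>\<^sub>F r in at_right 0. simplex_map (2 * codim) (\<lambda>y. row_space k (chart_matrix y))
      (transverse_simplex (2 * codim) (chart_coords V) r) \<in> G"
    unfolding simplex_map_transverse_simplex[OF cell] .
qed

end

locale cell_completion = interval_family +
  fixes Z
  assumes closedin_completion: "closedin (Gr_top k m) Z" and completion: "cell \<subseteq> Z" "Z \<subseteq> rank_locus"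
begin

sublocale linear_chart_pair "Gr_top k m" "2 * card free_entries" "2 * codim" chart_domain chart_image chart_coords
  "\<lambda>y. row_space k (chart_matrix y)" Z "Z - cell"
  by (rule linear_chart_pair_between[OF closedin_completion completion])

lemma array_inj_normal_dirs:
  assumes eq: "local_equations k m codim Z W f" and V: "V \<in> cell \<inter> W"
  shows "array_inj codim (\<lambda>s t. frame_deriv k m (f s) (normal_frame V) (normal_dir t))"
proof (intro array_inj_if_left_kernel_0 allI impI)
  note f = local_equationsD[OF eq]
  fix g s assume g: "\<forall>t<codim. (\<Sum>s<codim. g s * frame_deriv k m (f s) (normal_frame V) (normal_dir t)) = 0" and s: "s < codim"
  show "g s = 0"
  proof (rule f(3)[OF _ _ _ s])
    show "normal_frame V \<in> frames k m" "row_space k (normal_frame V) \<in> W"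
      using V normal_frame_in_frames cell_subset_chart_domain by auto
    show "(\<Sum>s<codim. g s * Gr_partial k (f s) (normal_frame V) i p) = 0" if "i < k" "p \<in> {1..m}" for i p
      by (rule Gr_partial_comb_eq_0[where U = W and c = codim]) (use f V g that completion in auto)
  qed
qed

lemma eventually_normal_cell_simplex:
  assumes eq: "local_equations k m codim Z W f" and V: "V \<in> cell \<inter> W"
  shows "\<forall>\<^sub>F r in at_right 0.
    singular_relcycle (2 * codim) (subtopology (Gr_top k m) W) (- Z) (frag_of (normal_cell_simplex V r)) \<and>
    zero_degree codim f (frag_of (normal_cell_simplex V r)) = 1"
proof -
  have "V \<in> chart_domain"
    using V cell_subset_chart_domain by blast
  then have "normal_frame V \<in> frames k m" "row_space k (normal_frame V) \<in> Z \<inter> W"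
    using normal_frame_in_frames V completion by auto
  then show ?thesis
    unfolding normal_cell_simplex_def using normal_dir_in_matrices array_inj_normal_dirs[OF eq V]
    by (intro eventually_frame_simplex_zero_degree[OF eq]) auto
qed

lemmas entry_coord_equations = local_equations_entry_coord[OF completion]

lemma homology_vanishes_below_codim_Gr: "p < 2 * codim \<Longrightarrow> homology_vanishes p (Gr_top k m) (- Z)"
  using homology_vanishes_below_codim[OF openin_topspace] by simp

lemma normal_coords_eq_zero_map: "normal_coords = zero_map codim entry_coord"
  using codim_le by (auto simp: normal_coords_def zero_map_def take_coords_def chart_coords_def real_coords_def fun_eq_iff)

lemma cocycle_eq_zero_degree:
  assumes \<phi>: "\<phi> \<in> cocycles (2 * codim) (Gr_top k m)" "\<forall>d. singular_chain (2 * codim) (subtopology (Gr_top k m) (- Z)) d \<longrightarrow> \<phi> d = 0"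
    and chart: "\<forall>z. singular_relcycle (2 * codim) (subtopology (Gr_top k m) chart_domain) (- Z) z \<longrightarrow> \<phi> z = zero_degree codim entry_coord z"
    and eq: "local_equations k m codim Z W f" and z: "singular_relcycle (2 * codim) (subtopology (Gr_top k m) W) (- Z) z"
  shows "\<phi> z = zero_degree codim f z"
proof (rule homology_functionals_eqI[OF homology_generated_by_normal_simplices[OF local_equationsD(1)[OF eq]]
      cocycle_homology_functional[OF \<phi>] zero_degree_homology_functional[OF eq] z])
  let ?G = "{\<tau>. singular_relcycle (2 * codim) (subtopology (Gr_top k m) W) (- Z) (frag_of \<tau>) \<and> \<phi> (frag_of \<tau>) = zero_degree codim f (frag_of \<tau>)}"
  have "\<forall>\<^sub>F r in at_right 0. normal_cell_simplex V r \<in> ?G" if V: "V \<in> cell \<inter> W" for V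
  proof -
    have "V \<in> cell \<inter> chart_domain"
      using V cell_subset_chart_domain by blast
    from eventually_normal_cell_simplex[OF eq V] eventually_normal_cell_simplex[OF entry_coord_equations this]
    show ?thesis
      by eventually_elim (use chart in simp)
  qed
  then show "has_normal_simplices W ?G"
    by (rule has_normal_simplices_normal_cell_simplex)
qed

theorem fundamental_cocycle_exists:
  obtains \<phi> where "fundamental_cocycle k m codim Z \<phi>"
    "\<And>z. singular_relcycle (2 * codim) (subtopology (Gr_top k m) chart_domain) (- Z) z \<Longrightarrow> \<phi> z = zero_degree codim entry_coord z"
proof -
  obtain h :: "(nat \<Rightarrow> complex) set chain \<Rightarrow> int" where h:
    "\<And>a b. \<lbrakk>singular_relcycle (2 * codim) (Gr_top k m) (- Z) a; singular_relcycle (2 * codim) (Gr_top k m) (- Z) b\<rbrakk> \<Longrightarrow> h (a + b) = h a + h b"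
    "\<And>a. singular_relboundary (2 * codim) (Gr_top k m) (- Z) a \<Longrightarrow> h a = 0"
    "\<And>e. singular_relcycle (2 * codim) (subtopology (Gr_top k m) chart_domain) (- Z) e \<Longrightarrow>
      h e = local_degree (2 * codim) (chain_map (2 * codim) normal_coords e)"
    using local_degree_extends by blast
  obtain \<phi> where \<phi>: "\<phi> \<in> cocycles (2 * codim) (Gr_top k m)" "\<And>d. singular_chain (2 * codim) (subtopology (Gr_top k m) (- Z)) d \<Longrightarrow> \<phi> d = 0"
    "\<And>z. singular_relcycle (2 * codim) (Gr_top k m) (- Z) z \<Longrightarrow> \<phi> z = h z"
    using cocycle_of_relative_functional[of "2 * codim" "Gr_top k m" "- Z" h, OF homology_vanishes_below_codim_Gr h(1,2)] by blast
  have chart: "\<phi> z = zero_degree codim entry_coord z"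
    if "singular_relcycle (2 * codim) (subtopology (Gr_top k m) chart_domain) (- Z) z" for z
    using \<phi>(3)[OF singular_relcycle_subtopology[OF that]] h(3)[OF that] by (simp add: zero_degree_def normal_coords_eq_zero_map)
  have "\<phi> (frag_of \<sigma>) = 1" if normal: "normal_simplex k m codim Z \<sigma>" for \<sigma>
  proof -
    obtain W f r where eq: "local_equations k m codim Z W f" and \<sigma>: "r > 0"
      "singular_simplex (2 * codim) (subtopology (Gr_top k m) W) \<sigma>"
      "\<forall>x\<in>standard_simplex (2 * codim). \<forall>s<codim. f s (\<sigma> x) = simplex_coords r x s"
      using normal unfolding normal_simplex_def simplex_coords_def[symmetric] by (elim exE conjE) (rule that; assumption)
    show ?thesis
      using cocycle_eq_zero_degree[OF \<phi>(1) _ _ eq] \<phi>(2) chart normal_simplex_relcycle[OF eq \<sigma>] by simp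
  qed
  then have "fundamental_cocycle k m codim Z \<phi>"
    unfolding fundamental_cocycle_def using \<phi>(1,2) by blast
  then show ?thesis
    using that chart by blast
qed

theorem cocycle_is_coboundary:
  assumes \<delta>: "\<delta> \<in> cocycles (2 * codim) (Gr_top k m)" "\<forall>d. singular_chain (2 * codim) (subtopology (Gr_top k m) (- Z)) d \<longrightarrow> \<delta> d = 0"
    and normal: "\<And>V. V \<in> cell \<Longrightarrow> \<forall>\<^sub>F r in at_right 0. \<delta> (frag_of (normal_cell_simplex V r)) = 0"
  shows "\<delta> \<in> coboundaries (2 * codim) (Gr_top k m)"
proof (rule cocycle_vanishing_on_relcycles_is_coboundary[OF homology_vanishes_below_codim_Gr \<delta>(1)])
  fix z assume z: "singular_relcycle (2 * codim) (Gr_top k m) (- Z) z"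
  let ?W = "topspace (Gr_top k m)"
  have sub: "subtopology (Gr_top k m) ?W = Gr_top k m"
    by simp
  show "\<delta> z = 0"
  proof (rule homology_functionals_eqI[OF homology_generated_by_normal_simplices[OF openin_topspace, unfolded sub]
        cocycle_homology_functional[OF \<delta>, of ?W, unfolded sub] homology_functional_0 z])
    let ?G = "{\<tau>. singular_relcycle (2 * codim) (Gr_top k m) (- Z) (frag_of \<tau>) \<and> \<delta> (frag_of \<tau>) = 0}"
    have "\<forall>\<^sub>F r in at_right 0. normal_cell_simplex V r \<in> ?G" if V: "V \<in> cell \<inter> ?W" for V
    proof -
      have "V \<in> cell \<inter> chart_domain"
        using V cell_subset_chart_domain by blast
      from eventually_normal_cell_simplex[OF entry_coord_equations this] normal[OF IntD1[OF V]]
      show ?thesis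
        by eventually_elim (auto intro: singular_relcycle_subtopology)
    qed
    then show "has_normal_simplices ?W ?G"
      by (rule has_normal_simplices_normal_cell_simplex)
  qed
qed

lemma codim_unique:
  assumes V: "V \<in> cell \<inter> W" and eq: "local_equations k m c Z W f"
  shows "c = codim"
proof (rule antisym)
  note f = local_equationsD[OF eq]
  define v where "v = (\<lambda>s t. if t < codim then frame_deriv k m (f s) (normal_frame V) (normal_dir t) else 0)"
  have "lin_indep {..<c} v"
    unfolding lin_indep_def
  proof (intro allI impI ballI)
    fix g s assume zero: "lincomb {..<c} g v = 0" and s: "s \<in> {..<c}"
    show "g s = 0"
    proof (rule f(3)[of "normal_frame V"])
      show "normal_frame V \<in> frames k m" "row_space k (normal_frame V) \<in> W"
        using V normal_frame_in_frames cell_subset_chart_domain by auto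
      have "(\<Sum>s<c. g s * frame_deriv k m (f s) (normal_frame V) (normal_dir t)) = 0" if "t < codim" for t
        using fun_cong[OF zero, of t] that by (simp add: lincomb_def v_def)
      then show "(\<Sum>s<c. g s * Gr_partial k (f s) (normal_frame V) i p) = 0" if "i < k" "p \<in> {1..m}" for i p
        by (intro Gr_partial_comb_eq_0[where U = W and c = c]) (use f V that completion in auto)
    qed (use s in simp)
  qed
  moreover have "v ` {..<c} \<subseteq> coord_span {..<codim}"
    by (auto simp: v_def coord_span_eq)
  ultimately show "c \<le> codim"
    using lin_indep_card_le[of "{..<c}" v "coord_span {..<codim}" "{..<codim}"] cdim_coord_span[of "{..<codim}"] by simp
  have "2 * codim \<le> 2 * c"
    by (rule codim_le_if_homology_vanishes_below[OF eq, of V])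
      (use V cell_subset_Gr completion homology_vanishes_below_codim[OF f(1)] in auto)
  then show "codim \<le> c"
    by simp
qed

lemma eventually_fundamental_cocycle_1:
  assumes \<phi>: "fundamental_cocycle k m codim Z \<phi>" and V: "V \<in> cell"
  shows "\<forall>\<^sub>F r in at_right 0. singular_chain (2 * codim) (Gr_top k m) (frag_of (normal_cell_simplex V r)) \<and>
    \<phi> (frag_of (normal_cell_simplex V r)) = 1"
proof -
  have domain: "V \<in> chart_domain" "V \<in> cell \<inter> chart_domain"
    using V cell_subset_chart_domain by auto
  from eventually_normal_cell_simplex[OF entry_coord_equations domain(2)] eventually_at_right_less[of "0 :: real"]
  show ?thesis
  proof eventually_elim
    case (elim r)
    let ?A = "\<lambda>x. normal_frame V + matrix_comb codim (simplex_coords r x) normal_dir"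
    have \<sigma>: "singular_simplex (2 * codim) (subtopology (Gr_top k m) chart_domain) (normal_cell_simplex V r)"
      using elim(1) by (simp add: singular_relcycle_def singular_chain_of)
    have "entry_coord s (normal_cell_simplex V r x) = simplex_coords r x s"
      if x: "x \<in> standard_simplex (2 * codim)" and s: "s < codim" for x s
    proof -
      have "row_space k (?A x) \<in> chart_domain"
        using \<sigma> x unfolding singular_simplex_def continuous_map_def normal_cell_simplex_def frame_simplex_def by (auto simp: Pi_def)
      then have "entry_coord s (row_space k (?A x)) = entry_coord s V +
          matrix_comb codim (simplex_coords r x) normal_dir (fst (entry_enum s)) (snd (entry_enum s))"
        using normal_entries_subset by (intro entry_coord_row_space[OF _ refl domain(1) _ s]) (auto simp: matrix_comb_normal_dir)
      then show ?thesis
        using x s in_cell_iff_entry_coord[OF domain(1)] V entry_enum_in(2)[OF s] entry_index_entry_enum[of s] codim_le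
        by (simp add: matrix_comb_normal_dir normal_cell_simplex_def frame_simplex_def)
    qed
    then have "normal_simplex k m codim Z (normal_cell_simplex V r)"
      unfolding normal_simplex_def simplex_coords_def[symmetric] using entry_coord_equations elim(2) \<sigma> by blast
    then show ?case
      using \<phi> \<sigma> unfolding fundamental_cocycle_def by (simp add: singular_chain_of singular_simplex_subtopology)
  qed
qed

theorem Gr_codim_completion:
  assumes "Z \<subseteq> Gr_top k m closure_of cell" shows "Gr_codim k m Z = codim"
  unfolding Gr_codim_def
proof (rule the_equality)
  have "cell \<subseteq> regular_points k m codim Z"
    unfolding regular_points_def using entry_coord_equations completion cell_subset_chart_domain by blast
  then show "Z \<subseteq> Gr_top k m closure_of regular_points k m codim Z"
    using assms closure_of_mono by blast
  fix c assume c: "Z \<subseteq> Gr_top k m closure_of regular_points k m c Z"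
  obtain V where "V \<in> cell"
    using cell_nonempty by blast
  then have "V \<in> Gr_top k m closure_of regular_points k m c Z" "V \<in> chart_domain"
    using c completion cell_subset_chart_domain by auto
  then obtain V' where V': "V' \<in> regular_points k m c Z" "V' \<in> chart_domain"
    using openin_chart_domain unfolding in_closure_of by blast
  then have "V' \<in> cell"
    using completion rank_locus_Int_chart_domain unfolding regular_points_def by blast
  then show "c = codim"
    using V'(1) codim_unique unfolding regular_points_def by blast
qed

end

section \<open>Pullback of cohomology classes\<close>

lemma cocycles_iff:
  "\<phi> \<in> cocycles p X \<longleftrightarrow> \<phi> \<in> carrier (cochain_group p X) \<and>
     (\<forall>c. singular_chain (Suc p) X c \<longrightarrow> \<phi> (chain_boundary (Suc p) c) = 0)"
  by (auto simp: cocycles_def coboundary_map_def cochain_group_one fun_eq_iff restrict_def)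

lemma cochain_pullback_carrier:
  assumes f: "continuous_map X Y f" and \<phi>: "\<phi> \<in> carrier (cochain_group p Y)"
  shows "cochain_pullback p X f \<phi> \<in> carrier (cochain_group p X)"
  using \<phi> singular_chain_chain_map[OF _ f] unfolding cochain_group_carrier_iff cochain_pullback_def
  by (auto simp: chain_map_add singular_chain_add)

lemma cochain_pullback_coboundary_map:
  assumes f: "continuous_map X Y f"
  shows "cochain_pullback (Suc p) X f (coboundary_map p Y \<phi>) = coboundary_map p X (cochain_pullback p X f \<phi>)"
proof
  fix c
  show "cochain_pullback (Suc p) X f (coboundary_map p Y \<phi>) c = coboundary_map p X (cochain_pullback p X f \<phi>) c"
  proof (cases "singular_chain (Suc p) X c")
    case True
    then show ?thesis
      using singular_chain_chain_map[OF True f] singular_chain_boundary_alt[OF True] chain_boundary_chain_map[OF True, of f]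
      by (simp add: cochain_pullback_def coboundary_map_def)
  qed (simp add: cochain_pullback_def coboundary_map_def)
qed

lemma coboundaries_pullback:
  assumes f: "continuous_map X Y f" and \<phi>: "\<phi> \<in> coboundaries p Y"
  shows "cochain_pullback p X f \<phi> \<in> coboundaries p X"
proof (cases p)
  case 0
  then show ?thesis
    using \<phi> singular_chain_chain_map[OF _ f]
    by (auto simp: coboundaries_def cochain_group_one cochain_pullback_def fun_eq_iff)
next
  case (Suc q)
  then show ?thesis
    using \<phi> cochain_pullback_coboundary_map[OF f] cochain_pullback_carrier[OF f] by (auto simp: coboundaries_def)
qed

lemma cocycles_pullback:
  assumes f: "continuous_map X Y f" and \<phi>: "\<phi> \<in> cocycles p Y"
  shows "cochain_pullback p X f \<phi> \<in> cocycles p X"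
  unfolding cocycles_iff
proof (intro conjI allI impI)
  show "cochain_pullback p X f \<phi> \<in> carrier (cochain_group p X)"
    using cochain_pullback_carrier[OF f] \<phi> by (simp add: cocycles_iff)
  fix c assume c: "singular_chain (Suc p) X c"
  have "\<phi> (chain_map p f (chain_boundary (Suc p) c)) = 0"
    using \<phi> singular_chain_chain_map[OF c f] chain_boundary_chain_map[OF c, of f] unfolding cocycles_iff by fastforce
  then show "cochain_pullback p X f \<phi> (chain_boundary (Suc p) c) = 0"
    using singular_chain_boundary_alt[OF c] by (simp add: cochain_pullback_def)
qed

definition cochain_diff :: "nat \<Rightarrow> 'a topology \<Rightarrow> 'a cochain \<Rightarrow> 'a cochain \<Rightarrow> 'a cochain" where
  "cochain_diff p X \<phi> \<psi> = (\<lambda>c\<in>singular_chain_set p X. \<phi> c - \<psi> c)"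

lemma cocycles_diff: "\<lbrakk>\<phi> \<in> cocycles p X; \<psi> \<in> cocycles p X\<rbrakk> \<Longrightarrow> cochain_diff p X \<phi> \<psi> \<in> cocycles p X"
  unfolding cocycles_iff cochain_group_carrier_iff cochain_diff_def
  by (auto simp: singular_chain_add singular_chain_boundary_alt)

lemma homology_vanishes_cylinder_bottom:
  "homology_vanishes i (prod_topology (top_of_set {0..1 :: real}) X) {z. fst z = 0}"
  unfolding homology_vanishes_iff_trivial_group
proof (rule trivial_relative_homology_group_gen)
  let ?I = "top_of_set {0..1 :: real}"
  let ?C = "prod_topology ?I X" and ?S = "{z. fst z = 0}" and ?r = "\<lambda>z. (0 :: real, snd z)"
  have r: "continuous_map ?C ?C ?r"
    by (simp add: continuous_map_pairwise o_def continuous_map_snd)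
  then show "continuous_map ?C (subtopology ?C ?S) ?r"
    by (auto intro: continuous_map_into_subtopology)
  show "homotopic_with (\<lambda>h. True) (subtopology ?C ?S) (subtopology ?C ?S) ?r id"
    by (rule homotopic_with_equal)
      (auto simp: prod_eq_iff intro!: continuous_map_into_subtopology continuous_map_from_subtopology[OF r])
  let ?h = "\<lambda>w :: real \<times> real \<times> 'a. (fst w * fst (snd w), snd (snd w))"
  have "continuous_map (prod_topology ?I ?C) ?I (\<lambda>w. fst w * fst (snd w))"
  proof (rule continuous_map_into_subtopology)
    have "continuous_map (prod_topology ?I ?C) euclideanreal fst" "continuous_map (prod_topology ?I ?C) euclideanreal (fst \<circ> snd)"
      using continuous_map_fst[of ?I ?C] continuous_map_compose[OF continuous_map_snd continuous_map_fst, of ?I ?I X]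
      by (simp_all add: continuous_map_in_subtopology)
    then show "continuous_map (prod_topology ?I ?C) euclideanreal (\<lambda>w. fst w * fst (snd w))"
      using continuous_map_real_mult by (fastforce simp: o_def)
  qed (auto simp: mult_le_one)
  moreover have "continuous_map (prod_topology ?I ?C) X (\<lambda>w. snd (snd w))"
    using continuous_map_compose[OF continuous_map_snd continuous_map_snd, of ?I ?I X] by (simp add: o_def)
  ultimately have "continuous_map (prod_topology ?I ?C) ?C ?h"
    by (simp add: continuous_map_pairwise o_def)
  then show "homotopic_with (\<lambda>h. True) ?C ?C ?r id"
    unfolding homotopic_with_def by (intro exI[of _ ?h]) auto
qed

theorem homotopic_pullback_coboundary:
  assumes h: "homotopic_with (\<lambda>x. True) X Y f g" and \<phi>: "\<phi> \<in> cocycles p Y"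
  shows "cochain_diff p X (cochain_pullback p X g \<phi>) (cochain_pullback p X f \<phi>) \<in> coboundaries p X"
proof -
  let ?C = "prod_topology (top_of_set {0..1 :: real}) X" and ?S = "{z :: real \<times> 'a. fst z = 0}" and ?r = "\<lambda>z :: real \<times> 'a. (0 :: real, snd z)"
  obtain H where H: "continuous_map ?C Y H" "\<And>x. H (0, x) = f x" "\<And>x. H (1, x) = g x"
    using h unfolding homotopic_with_def by blast
  have "continuous_map ?C ?C ?r"
    by (simp add: continuous_map_pairwise o_def continuous_map_snd)
  then have Hr: "continuous_map ?C Y (\<lambda>z. H (?r z))"
    using continuous_map_compose[OF _ H(1)] by (fastforce simp: o_def)
  let ?\<delta> = "cochain_diff p ?C (cochain_pullback p ?C H \<phi>) (cochain_pullback p ?C (\<lambda>z. H (?r z)) \<phi>)"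
  have \<delta>: "?\<delta> \<in> cocycles p ?C"
    by (rule cocycles_diff[OF cocycles_pullback[OF H(1) \<phi>] cocycles_pullback[OF Hr \<phi>]])
  have zero: "\<forall>d. singular_chain p (subtopology ?C ?S) d \<longrightarrow> ?\<delta> d = 0"
  proof (intro allI impI)
    fix d assume d: "singular_chain p (subtopology ?C ?S) d"
    have "chain_map p (\<lambda>z. H (?r z)) d = chain_map p H d"
      by (rule chain_map_eq[OF d]) (auto simp: prod_eq_iff intro!: arg_cong[where f = H])
    then show "?\<delta> d = 0"
      using d by (simp add: cochain_diff_def cochain_pullback_def singular_chain_subtopology)
  qed
  have "?\<delta> \<in> coboundaries p ?C"
  proof (rule cocycle_vanishing_on_relcycles_is_coboundary[OF homology_vanishes_cylinder_bottom \<delta>])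
    fix z assume "singular_relcycle p ?C ?S z"
    then show "?\<delta> z = 0"
      using homology_vanishes_cylinder_bottom[of p X] cocycle_homology_functional[OF \<delta> zero, of "topspace ?C"]
      unfolding homology_vanishes_def homology_functional_def subtopology_topspace by blast
  qed
  moreover have top: "continuous_map X ?C (Pair 1)"
    by (simp add: continuous_map_pairwise o_def)
  ultimately have "cochain_pullback p X (Pair 1) ?\<delta> \<in> coboundaries p X"
    by (intro coboundaries_pullback)
  also have "cochain_pullback p X (Pair 1) ?\<delta> = cochain_diff p X (cochain_pullback p X g \<phi>) (cochain_pullback p X f \<phi>)"
    using singular_chain_chain_map[OF _ top] by (auto simp: cochain_diff_def cochain_pullback_def chain_map_chain_map H fun_eq_iff)
  finally show ?thesis .
qed

lemma cocycle_group_mult: "\<phi> \<otimes>\<^bsub>cocycle_group p X\<^esub> \<psi> = (\<lambda>c\<in>singular_chain_set p X. \<phi> c + \<psi> c)"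
  unfolding cocycle_group_def by (simp add: cochain_group_mult)

lemma group_cocycle_group: "group (cocycle_group p X)"
  unfolding cocycle_group_def by (intro group.group_subgroup_generated comm_group.axioms(2)[OF comm_group_cochain_group])

lemma subgroup_coboundaries_cocycle_group: "subgroup (coboundaries p X) (cocycle_group p X)"
  unfolding cocycle_group_def
  by (intro group.subgroup_of_subgroup_generated coboundaries_subset_cocycles subgroup_coboundaries
      comm_group.axioms(2)[OF comm_group_cochain_group])

lemma cochain_diff_trans:
  assumes "cochain_diff p X \<phi> \<psi> \<in> coboundaries p X" "cochain_diff p X \<psi> \<xi> \<in> coboundaries p X"
  shows "cochain_diff p X \<phi> \<xi> \<in> coboundaries p X"
proof -
  have "cochain_diff p X \<phi> \<xi> = cochain_diff p X \<phi> \<psi> \<otimes>\<^bsub>cocycle_group p X\<^esub> cochain_diff p X \<psi> \<xi>"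
    unfolding cocycle_group_mult cochain_diff_def by (auto simp: fun_eq_iff)
  then show ?thesis
    using subgroup.m_closed[OF subgroup_coboundaries_cocycle_group assms] by simp
qed

lemma cohom_class_eqI:
  assumes \<phi>: "\<phi> \<in> cocycles p X" "\<psi> \<in> cocycles p X" and diff: "cochain_diff p X \<phi> \<psi> \<in> coboundaries p X"
  shows "cohom_class p X \<phi> = cohom_class p X \<psi>"
proof -
  have "\<phi> = cochain_diff p X \<phi> \<psi> \<otimes>\<^bsub>cocycle_group p X\<^esub> \<psi>"
    unfolding cocycle_group_mult cochain_diff_def using \<phi>(1)
    by (auto simp: fun_eq_iff cocycles_iff cochain_group_carrier_iff extensional_def)
  then have "\<phi> \<in> coboundaries p X #>\<^bsub>cocycle_group p X\<^esub> \<psi>"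
    unfolding r_coset_def using diff by blast
  then show ?thesis
    unfolding cohom_class_def
    using group.repr_independence[OF group_cocycle_group _ _ subgroup_coboundaries_cocycle_group] \<phi>(2) carrier_cocycle_group by metis
qed

lemma cochain_pullback_hom:
  assumes f: "continuous_map X Y f"
  shows "cochain_pullback p X f \<in> hom (cocycle_group p Y) (cocycle_group p X)"
proof (rule homI)
  show "cochain_pullback p X f (\<phi> \<otimes>\<^bsub>cocycle_group p Y\<^esub> \<psi>)
      = cochain_pullback p X f \<phi> \<otimes>\<^bsub>cocycle_group p X\<^esub> cochain_pullback p X f \<psi>" for \<phi> \<psi>
    unfolding cocycle_group_mult cochain_pullback_def using singular_chain_chain_map[OF _ f] by (auto simp: fun_eq_iff)
qed (use cocycles_pullback[OF f] in \<open>simp add: carrier_cocycle_group\<close>)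

theorem pullback_cohom_class:
  assumes f: "continuous_map X Y f" and \<phi>: "\<phi> \<in> cocycles p Y"
  shows "coboundaries p X <#>\<^bsub>cocycle_group p X\<^esub> (cochain_pullback p X f ` cohom_class p Y \<phi>)
    = cohom_class p X (cochain_pullback p X f \<phi>)"
proof -
  interpret X: group "cocycle_group p X" by (rule group_cocycle_group)
  interpret Y: group "cocycle_group p Y" by (rule group_cocycle_group)
  interpret B: subgroup "coboundaries p X" "cocycle_group p X" by (rule subgroup_coboundaries_cocycle_group)
  let ?f = "cochain_pullback p X f"
  have B_Y: "coboundaries p Y \<subseteq> carrier (cocycle_group p Y)"
    unfolding carrier_cocycle_group by (rule coboundaries_subset_cocycles)
  have \<phi>': "\<phi> \<in> carrier (cocycle_group p Y)" "?f \<phi> \<in> carrier (cocycle_group p X)"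
    unfolding carrier_cocycle_group using \<phi> cocycles_pullback[OF f] by auto
  have "?f (\<xi> \<otimes>\<^bsub>cocycle_group p Y\<^esub> \<phi>) = ?f \<xi> \<otimes>\<^bsub>cocycle_group p X\<^esub> ?f \<phi>" if "\<xi> \<in> coboundaries p Y" for \<xi>
    using hom_mult[OF cochain_pullback_hom[OF f] _ \<phi>'(1)] that B_Y by blast
  then have image: "?f ` cohom_class p Y \<phi> = (?f ` coboundaries p Y) #>\<^bsub>cocycle_group p X\<^esub> ?f \<phi>"
    unfolding cohom_class_def r_coset_def image_UN by simp
  have sub: "?f ` coboundaries p Y \<subseteq> coboundaries p X"
    using coboundaries_pullback[OF f] by blast
  have one: "\<one>\<^bsub>cocycle_group p X\<^esub> \<in> ?f ` coboundaries p Y"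
    using hom_one[OF cochain_pullback_hom[OF f, of p] group_cocycle_group group_cocycle_group]
      subgroup.one_closed[OF subgroup_coboundaries_cocycle_group[of p Y]] by (intro image_eqI) simp_all
  have "coboundaries p X <#>\<^bsub>cocycle_group p X\<^esub> (?f ` coboundaries p Y) = coboundaries p X"
  proof (rule subset_antisym)
    show "coboundaries p X <#>\<^bsub>cocycle_group p X\<^esub> (?f ` coboundaries p Y) \<subseteq> coboundaries p X"
      by (auto simp: set_mult_def intro!: B.m_closed coboundaries_pullback[OF f])
    show "coboundaries p X \<subseteq> coboundaries p X <#>\<^bsub>cocycle_group p X\<^esub> (?f ` coboundaries p Y)"
    proof
      fix \<xi> assume \<xi>: "\<xi> \<in> coboundaries p X"
      then have "\<xi> \<otimes>\<^bsub>cocycle_group p X\<^esub> \<one>\<^bsub>cocycle_group p X\<^esub> = \<xi>"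
        using B.subset by (intro X.r_one) blast
      then show "\<xi> \<in> coboundaries p X <#>\<^bsub>cocycle_group p X\<^esub> (?f ` coboundaries p Y)"
        unfolding set_mult_def using \<xi> one by blast
    qed
  qed
  then show ?thesis
    unfolding image unfolding cohom_class_def
    by (simp add: X.setmult_rcos_assoc[OF B.subset order_trans[OF sub B.subset] \<phi>'(2)])
qed

lemma one_cohomology_group: "\<one>\<^bsub>cohomology_group p X\<^esub> = cohom_class p X \<one>\<^bsub>cocycle_group p X\<^esub>"
  unfolding cohomology_group_def cohom_class_def FactGroup_def
  using group.coset_mult_one[OF group_cocycle_group[of p X]] coboundaries_subset_cocycles[of p X]
  by (simp add: carrier_cocycle_group)

lemma pullback_one:
  assumes f: "continuous_map X Y f"
  shows "coboundaries p X <#>\<^bsub>cocycle_group p X\<^esub> (cochain_pullback p X f ` \<one>\<^bsub>cohomology_group p Y\<^esub>) = \<one>\<^bsub>cohomology_group p X\<^esub>"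
proof -
  have "\<one>\<^bsub>cocycle_group p Y\<^esub> \<in> cocycles p Y"
    using group.is_monoid[OF group_cocycle_group, THEN monoid.one_closed] carrier_cocycle_group by blast
  moreover have "cochain_pullback p X f \<one>\<^bsub>cocycle_group p Y\<^esub> = \<one>\<^bsub>cocycle_group p X\<^esub>"
    by (rule hom_one[OF cochain_pullback_hom[OF f] group_cocycle_group group_cocycle_group])
  ultimately show ?thesis
    unfolding one_cohomology_group using pullback_cohom_class[OF f] by metis
qed

section \<open>Linear inclusions\<close>

lemma linear_inclusionD:
  assumes "linear_inclusion n m j"
  shows "v \<in> cspace n \<Longrightarrow> j v \<in> cspace m" "inj_on j (cspace n)"
    "\<lbrakk>v \<in> cspace n; w \<in> cspace n\<rbrakk> \<Longrightarrow> j (v + w) = j v + j w" "v \<in> cspace n \<Longrightarrow> j (cscale c v) = cscale c (j v)" "j 0 = 0"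
proof -
  show scale: "v \<in> cspace n \<Longrightarrow> j (cscale c v) = cscale c (j v)" for c v
    using assms unfolding linear_inclusion_def by blast
  show "j 0 = 0"
    using scale[of 0 0] cvec.subspace_0[OF cspace_subspace] by simp
qed (use assms in \<open>auto simp: linear_inclusion_def\<close>)

lemma linear_inclusion_lincomb:
  assumes j: "linear_inclusion n m j" and T: "finite T" "\<And>l. l \<in> T \<Longrightarrow> v l \<in> cspace n"
  shows "j (lincomb T c v) = lincomb T c (\<lambda>l. j (v l))"
  using T
proof (induction T)
  case empty
  then show ?case
    by (simp add: lincomb_def linear_inclusionD(5)[OF j, unfolded zero_fun_def])
next
  case (insert t T)
  have "lincomb T c v \<in> cspace n"
    by (rule lincomb_in_subspace[OF cspace_subspace]) (use insert.prems in auto)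
  moreover have "v t \<in> cspace n"
    using insert.prems by simp
  ultimately have "j (cscale (c t) (v t) + lincomb T c v) = cscale (c t) (j (v t)) + j (lincomb T c v)"
    using linear_inclusionD(3,4)[OF j] cvec.subspace_scale[OF cspace_subspace] by metis
  moreover have "j (lincomb T c v) = lincomb T c (\<lambda>l. j (v l))"
    using insert by blast
  ultimately show ?case
    unfolding lincomb_insert[OF insert.hyps(1,2)] by (simp only:)
qed

lemma linear_inclusion_row_space:
  assumes j: "linear_inclusion n m j" and A: "\<And>i. i < k \<Longrightarrow> A i \<in> cspace n"
  shows "j ` row_space k A = row_space k (\<lambda>i. j (A i))"
proof -
  have "j (lincomb {..<k} c A) = lincomb {..<k} c (\<lambda>i. j (A i))" for c
    by (rule linear_inclusion_lincomb[OF j]) (use A in auto)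
  from this[symmetric] show ?thesis
    unfolding set_eq_iff image_iff Bex_def in_row_space_iff by auto
qed

lemma linear_inclusion_frame:
  assumes j: "linear_inclusion n m j" and A: "A \<in> frames k n"
  shows "(\<lambda>i. j (A i)) \<in> frames k m"
proof -
  have A': "\<And>i. i < k \<Longrightarrow> A i \<in> cspace n" "\<And>i. k \<le> i \<Longrightarrow> A i = 0" "lin_indep {..<k} A"
    using A frames_iff by auto
  have lincomb: "j (lincomb {..<k} c A) = lincomb {..<k} c (\<lambda>i. j (A i))" for c
    by (rule linear_inclusion_lincomb[OF j]) (use A' in auto)
  have "lincomb {..<k} c A = 0" if zero: "lincomb {..<k} c (\<lambda>i. j (A i)) = 0" for c
  proof (rule inj_onD[OF linear_inclusionD(2)[OF j]])
    show "j (lincomb {..<k} c A) = j 0"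
      by (simp only: lincomb zero linear_inclusionD(5)[OF j])
    show "lincomb {..<k} c A \<in> cspace n"
      by (rule lincomb_in_subspace[OF cspace_subspace]) (use A' in auto)
  qed (rule cvec.subspace_0[OF cspace_subspace])
  then show ?thesis
    unfolding frames_iff lin_indep_def
    using A'(1,2) linear_inclusionD(1,5)[OF j] lin_indepD[OF A'(3)] by simp
qed

definition frame_map :: "nat \<Rightarrow> (nat \<Rightarrow> nat \<Rightarrow> complex) \<Rightarrow> (nat \<Rightarrow> complex) \<Rightarrow> nat \<Rightarrow> complex" where
  "frame_map n F v = lincomb {..<n} (\<lambda>l. v (Suc l)) F"

lemma linear_inclusion_frame_map:
  assumes "F \<in> frames n m" shows "linear_inclusion n m (frame_map n F)"
  unfolding linear_inclusion_def
proof (intro conjI ballI allI)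
  have F: "\<And>i. i < n \<Longrightarrow> F i \<in> cspace m" "lin_indep {..<n} F"
    using assms frames_iff by auto
  show "frame_map n F \<in> cspace n \<rightarrow> cspace m"
    unfolding frame_map_def using F(1) by (auto intro!: lincomb_in_subspace[OF cspace_subspace])
  show "inj_on (frame_map n F) (cspace n)"
  proof (rule inj_onI)
    fix v w assume vw: "v \<in> cspace n" "w \<in> cspace n" "frame_map n F v = frame_map n F w"
    then have "lincomb {..<n} (\<lambda>l. v (Suc l) - w (Suc l)) F = 0"
      using lincomb_diff[of "{..<n}" "\<lambda>l. v (Suc l)" F "\<lambda>l. w (Suc l)"] by (simp add: frame_map_def)
    then have "v (Suc l) = w (Suc l)" if "l < n" for l
      using lin_indepD[OF F(2), of "\<lambda>l. v (Suc l) - w (Suc l)" l] that by simp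
    then have "v p = w p" if "p \<in> {1..n}" for p
      using that by (cases p) auto
    moreover have "v p = w p" if "p \<notin> {1..n}" for p
      using vw(1,2) that by (simp add: cspace_def)
    ultimately show "v = w"
      by blast
  qed
  show "frame_map n F (v + w) = frame_map n F v + frame_map n F w" for v w
    by (simp add: frame_map_def lincomb_def fun_eq_iff distrib_right sum.distrib)
  show "frame_map n F (cscale c v) = cscale c (frame_map n F v)" for c v
    by (simp add: frame_map_def lincomb_def cscale_def sum_distrib_left mult.assoc)
qed

lemma linear_inclusion_eq_frame_map:
  assumes j: "linear_inclusion n m j"
  obtains F where "F \<in> frames n m" "\<And>v. v \<in> cspace n \<Longrightarrow> j v = frame_map n F v"
proof
  define E where "E = (\<lambda>l. if l < n then Defs.unit_vec (Suc l) else 0)"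
  have expand: "lincomb {..<n} (\<lambda>l. v (Suc l)) E = v" if "v \<in> cspace n" for v
  proof
    fix p
    have "lincomb {..<n} (\<lambda>l. v (Suc l)) E p = (\<Sum>l<n. if Suc l = p then v p else 0)"
      unfolding lincomb_def E_def by (intro sum.cong) (auto simp: Defs.unit_vec_def)
    then show "lincomb {..<n} (\<lambda>l. v (Suc l)) E p = v p"
      using that by (cases p) (auto simp: cspace_def)
  qed
  have E: "E l \<in> cspace n" for l
    by (auto simp: E_def cspace_def Defs.unit_vec_def)
  have coeff: "lincomb {..<n} c E (Suc l) = c l" if "l < n" for c l
    using that by (subst lincomb_single[of _ l]) (auto simp: E_def Defs.unit_vec_def)
  have "c l = 0" if "lincomb {..<n} c E = 0" "l < n" for c l
    using coeff[OF that(2), of c] that(1) by simp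
  moreover have "E l = 0" if "n \<le> l" for l
    using that by (simp add: E_def)
  ultimately have "E \<in> frames n n"
    unfolding frames_iff lin_indep_def using E by simp
  then show "(\<lambda>l. j (E l)) \<in> frames n m"
    by (rule linear_inclusion_frame[OF j])
  show "j v = frame_map n (\<lambda>l. j (E l)) v" if "v \<in> cspace n" for v
    using linear_inclusion_lincomb[OF j, of "{..<n}" E "\<lambda>l. v (Suc l)"] E expand[OF that]
    by (simp add: frame_map_def)
qed

text \<open>A complex line through two frames meets the complement of the space of frames in finitely many points.\<close>

lemma frames_path:
  assumes F: "F \<in> frames n m" and G: "G \<in> frames n m"
  obtains \<gamma> :: "real \<Rightarrow> nat \<Rightarrow> nat \<Rightarrow> complex" where
    "continuous_on {0..1} \<gamma>" "\<gamma> 0 = F" "\<gamma> 1 = G" "\<gamma> ` {0..1} \<subseteq> frames n m"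
proof -
  let ?L = "\<lambda>z l p. (1 - z) * F l p + z * G l p"
  let ?bad = "{z. ?L z \<notin> frames n m}"
  obtain e where e: "array_det n (\<lambda>i l. F i (e l)) \<noteq> 0"
    using frame_nonzero_minor[OF F] .
  obtain P where P: "\<And>z. poly P z = array_det n (\<lambda>i l. (1 - z) * F i (e l) + z * G i (e l))"
    using array_det_pencil_poly[of n "\<lambda>i l. F i (e l)" "\<lambda>i l. G i (e l)"] by blast
  have "?L z \<in> frames n m" if "poly P z \<noteq> 0" for z
    by (rule frame_if_det_nonzero[where e = e]) (use F G that in \<open>auto simp: P frames_iff cspace_def fun_eq_iff\<close>)
  moreover have "poly P 0 \<noteq> 0"
    using e by (simp add: P)
  ultimately have "?bad \<subseteq> {z. poly P z = 0}" "P \<noteq> 0"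
    by auto
  then have finite: "finite ?bad"
    using poly_roots_finite finite_subset by blast
  define Q where "Q = (\<Prod>z\<in>?bad. [:- z, 1:])"
  have Q: "poly Q z = 0 \<longleftrightarrow> z \<in> ?bad" for z
    using finite by (auto simp: Q_def poly_prod)
  have "poly Q 0 \<noteq> 0" "poly Q 1 \<noteq> 0"
    unfolding Q using F G by auto
  then obtain \<zeta> :: "real \<Rightarrow> complex" where \<zeta>: "continuous_on {0..1} \<zeta>" "\<zeta> 0 = 0" "\<zeta> 1 = 1"
      "\<And>\<tau>. \<tau> \<in> {0..1} \<Longrightarrow> poly Q (\<zeta> \<tau>) \<noteq> 0"
    using path_avoiding_roots by blast
  show ?thesis
  proof (rule that[of "\<lambda>\<tau>. ?L (\<zeta> \<tau>)"])
    show "continuous_on {0..1} (\<lambda>\<tau>. ?L (\<zeta> \<tau>))"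
      by (intro continuous_on_coordinatewise_then_product continuous_intros \<zeta>(1))
  qed (use \<zeta> Q in auto)
qed

lemma homotopic_frame_maps:
  assumes F: "F \<in> frames n m" and G: "G \<in> frames n m"
  shows "homotopic_with (\<lambda>_. True) (Gr_top k n) (Gr_top k m) (\<lambda>V. frame_map n F ` V) (\<lambda>V. frame_map n G ` V)"
proof -
  obtain \<gamma> :: "real \<Rightarrow> nat \<Rightarrow> nat \<Rightarrow> complex" where \<gamma>: "continuous_on {0..1} \<gamma>" "\<gamma> 0 = F" "\<gamma> 1 = G" "\<gamma> ` {0..1} \<subseteq> frames n m"
    using frames_path[OF F G] .
  let ?I = "top_of_set {0..1 :: real}" and ?H = "\<lambda>(\<tau>, V). frame_map n (\<gamma> \<tau>) ` V"
  let ?A = "\<lambda>z i. frame_map n (\<gamma> (fst z)) (snd z i)"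
  have inclusion: "linear_inclusion n m (frame_map n (\<gamma> \<tau>))" if "\<tau> \<in> {0..1}" for \<tau>
    using linear_inclusion_frame_map \<gamma>(4) that by blast
  have "continuous_on ({0..1} \<times> frames k n) (\<lambda>z. ?A z i p)" for i p
    unfolding frame_map_def lincomb_def
  proof (intro continuous_on_sum continuous_on_mult)
    show "continuous_on ({0..1} \<times> frames k n) (\<lambda>z. \<gamma> (fst z) l p)" for l
      by (rule continuous_on_compose2[OF continuous_on_entry[of UNIV] continuous_on_compose2[OF \<gamma>(1) continuous_on_fst[OF continuous_on_id]]]) auto
    show "continuous_on ({0..1} \<times> frames k n) (\<lambda>z. snd z i (Suc l))" for l
      by (rule continuous_on_compose2[OF continuous_on_entry[of UNIV] continuous_on_snd[OF continuous_on_id]]) auto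
  qed
  then have "continuous_map (top_of_set ({0..1} \<times> frames k n)) (top_of_set (frames k m)) ?A"
    using linear_inclusion_frame[OF inclusion]
    by (auto simp: continuous_map_in_subtopology intro!: continuous_on_coordinatewise_then_product)
  from continuous_map_compose[OF this quotient_imp_continuous_map[OF quotient_map_row_space]]
  have "continuous_map (prod_topology ?I (top_of_set (frames k n))) (Gr_top k m) (\<lambda>z. row_space k (?A z))"
    by (simp add: prod_topology_top_of_set o_def)
  moreover have "row_space k (?A z) = (?H \<circ> (\<lambda>(\<tau>, A). (\<tau>, row_space k A))) z" if "z \<in> {0..1} \<times> frames k n" for z
    using linear_inclusion_row_space[OF inclusion, of "fst z" k "snd z"] that by (simp add: case_prod_beta mem_Times_iff frames_iff)
  ultimately have "continuous_map (prod_topology ?I (top_of_set (frames k n))) (Gr_top k m) (?H \<circ> (\<lambda>(\<tau>, A). (\<tau>, row_space k A)))"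
    by (rule continuous_map_eq) simp
  moreover have "quotient_map (prod_topology ?I (top_of_set (frames k n))) (prod_topology ?I (Gr_top k n)) (\<lambda>(\<tau>, A). (\<tau>, row_space k A))"
    by (intro quotient_map_prod_right quotient_map_row_space)
      (auto simp: compact_imp_locally_compact_space compact_space_subtopology Hausdorff_space_subtopology)
  ultimately have "continuous_map (prod_topology ?I (Gr_top k n)) (Gr_top k m) ?H"
    using continuous_compose_quotient_map by blast
  then show ?thesis
    unfolding homotopic_with_def using \<gamma>(2,3) by (intro exI[of _ ?H]) auto
qed

theorem homotopic_linear_inclusions:
  assumes i: "linear_inclusion n m i" and j: "linear_inclusion n m j"
  shows "homotopic_with (\<lambda>_. True) (Gr_top k n) (Gr_top k m) (\<lambda>V. i ` V) (\<lambda>V. j ` V)"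
proof -
  obtain F G where FG: "F \<in> frames n m" "\<And>v. v \<in> cspace n \<Longrightarrow> i v = frame_map n F v"
      "G \<in> frames n m" "\<And>v. v \<in> cspace n \<Longrightarrow> j v = frame_map n G v"
    using linear_inclusion_eq_frame_map[OF i] linear_inclusion_eq_frame_map[OF j] by metis
  show ?thesis
  proof (rule homotopic_with_eq[OF homotopic_frame_maps[OF FG(1,3)]])
    fix V assume "V \<in> topspace (Gr_top k n)"
    then have "V \<subseteq> cspace n"
      using GrD(2) topspace_Gr_top by blast
    then show "i ` V = frame_map n F ` V" "j ` V = frame_map n G ` V"
      using FG(2,4) by (auto intro!: image_cong)
  qed simp
qed

text \<open>The inclusion \<open>e\<^sub>p \<mapsto> e\<^sub>p - e\<^sub>p\<^sub>+\<^sub>1\<close>.\<close>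

definition difference_map :: "(nat \<Rightarrow> complex) \<Rightarrow> nat \<Rightarrow> complex" where
  "difference_map v = (\<lambda>p. v p - v (p - 1))"

lemma difference_map_support:
  assumes v: "v \<in> cspace m" and support: "difference_map v \<in> coord_span {p..Suc q}"
  shows "v \<in> coord_span {p..q}"
  unfolding in_coord_span_interval
proof (intro allI impI)
  have const: "v i = v (i - 1)" if "i < p \<or> Suc q < i" for i
    using support that unfolding in_coord_span_interval difference_map_def by force
  have below: "v i = 0" if "i < p" for i
    using that
  proof (induction i)
    case (Suc i)
    then show ?case
      using const[of "Suc i"] by simp
  qed (use v in \<open>simp add: cspace_def\<close>)
  have above: "v (i + d) = v i" if "q < i" for i d
    using that
  proof (induction d)
    case (Suc d)
    then show ?case
      using const[of "Suc (i + d)"] by simp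
  qed simp
  fix i assume nonzero: "v i \<noteq> 0"
  have "v (i + Suc m) = 0"
    using v by (simp add: cspace_def)
  then show "p \<le> i \<and> i \<le> q"
    using nonzero below[of i] above[of i "Suc m"] by (metis not_less)
qed

lemma linear_inclusion_difference_map: "linear_inclusion n (Suc n) difference_map"
  unfolding linear_inclusion_def
proof (intro conjI ballI allI)
  show "difference_map \<in> cspace n \<rightarrow> cspace (Suc n)"
  proof
    fix v assume v: "v \<in> cspace n"
    have "v i = 0 \<and> v (i - 1) = 0" if "i \<notin> {1..Suc n}" for i
      using v that by (cases i) (auto simp: cspace_def)
    then show "difference_map v \<in> cspace (Suc n)"
      by (simp add: cspace_def difference_map_def)
  qed
  show "inj_on difference_map (cspace n)"
  proof (rule inj_onI)
    fix v w assume vw: "v \<in> cspace n" "w \<in> cspace n" "difference_map v = difference_map w"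
    have "difference_map (v - w) = difference_map v - difference_map w"
      by (simp add: difference_map_def fun_eq_iff)
    then have "difference_map (v - w) \<in> coord_span {1..Suc 0}"
      using vw(3) unfolding in_coord_span_interval by simp
    from difference_map_support[OF cvec.subspace_diff[OF cspace_subspace vw(1,2)] this] show "v = w"
      unfolding in_coord_span_interval by (auto simp: fun_eq_iff)
  qed
  show "difference_map (v + w) = difference_map v + difference_map w" for v w
    by (simp add: difference_map_def fun_eq_iff)
  show "difference_map (cscale c v) = cscale c (difference_map v)" for c v
    by (simp add: difference_map_def cscale_def right_diff_distrib)
qed

lemma difference_map_matrix_comb:
  "(\<lambda>i. difference_map ((B + matrix_comb c y R) i)) = (\<lambda>i. difference_map (B i)) + matrix_comb c y (\<lambda>t i. difference_map (R t i))"
  by (simp add: difference_map_def matrix_comb_def fun_eq_iff algebra_simps sum_subtractf)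

lemma difference_map_in_matrices:
  assumes "R \<in> matrices k m" shows "(\<lambda>i. difference_map (R i)) \<in> matrices k (Suc m)"
proof -
  have "R i p = 0 \<and> R i (p - 1) = 0" if "(i, p) \<notin> {..<k} \<times> {1..Suc m}" for i p
    using assms that by (cases p) (auto simp: matrices_def)
  then show ?thesis
    by (simp add: matrices_def difference_map_def)
qed

lemma difference_map_summation_by_parts:
  assumes w: "w \<in> cspace m"
  shows "(\<Sum>q\<in>{1..Suc m}. difference_map w q * g q) = (\<Sum>p\<in>{1..m}. w p * (g p - g (Suc p)))"
proof -
  have ends: "w 0 = 0" "w (Suc m) = 0"
    using w by (auto simp: cspace_def)
  have "(\<Sum>q\<in>{1..Suc m}. w (q - 1) * g q) = (\<Sum>p\<in>{0..m}. w p * g (Suc p))"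
    by (rule sum.reindex_bij_witness[of _ Suc "\<lambda>q. q - 1"]) auto
  also have "\<dots> = (\<Sum>p\<in>{1..m}. w p * g (Suc p))"
    using ends by (simp add: sum.atLeast_Suc_atMost)
  finally show ?thesis
    using ends by (simp add: difference_map_def algebra_simps sum_subtractf)
qed

section \<open>Pulling back the class of a rank variety\<close>

context cell_completion
begin

lemma fundamental_cocycle_unique:
  assumes \<phi>: "fundamental_cocycle k m codim Z \<phi>" and \<psi>: "fundamental_cocycle k m codim Z \<psi>"
  shows "cohom_class (2 * codim) (Gr_top k m) \<phi> = cohom_class (2 * codim) (Gr_top k m) \<psi>"
proof (rule cohom_class_eqI)
  let ?\<delta> = "cochain_diff (2 * codim) (Gr_top k m) \<phi> \<psi>"
  show cocycles: "\<phi> \<in> cocycles (2 * codim) (Gr_top k m)" "\<psi> \<in> cocycles (2 * codim) (Gr_top k m)"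
    using \<phi> \<psi> by (auto simp: fundamental_cocycle_def)
  show "?\<delta> \<in> coboundaries (2 * codim) (Gr_top k m)"
  proof (rule cocycle_is_coboundary[OF cocycles_diff[OF cocycles]])
    show "\<forall>d. singular_chain (2 * codim) (subtopology (Gr_top k m) (- Z)) d \<longrightarrow> ?\<delta> d = 0"
      using \<phi> \<psi> by (auto simp: fundamental_cocycle_def cochain_diff_def singular_chain_subtopology)
    show "\<forall>\<^sub>F r in at_right 0. ?\<delta> (frag_of (normal_cell_simplex V r)) = 0" if "V \<in> cell" for V
      using eventually_fundamental_cocycle_1[OF \<phi> that] eventually_fundamental_cocycle_1[OF \<psi> that]
      by eventually_elim (simp add: cochain_diff_def)
  qed
qed

lemma subvariety_class_eq:
  assumes Z: "Z \<subseteq> Gr_top k m closure_of cell" and \<phi>: "fundamental_cocycle k m codim Z \<phi>"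
  shows "subvariety_class k m Z
    = (\<lambda>p. \<one>\<^bsub>cohomology_group p (Gr_top k m)\<^esub>)(2 * codim := cohom_class (2 * codim) (Gr_top k m) \<phi>)"
proof -
  have "(THE \<xi>. \<exists>\<phi>. fundamental_cocycle k m codim Z \<phi> \<and> \<xi> = cohom_class (2 * codim) (Gr_top k m) \<phi>)
      = cohom_class (2 * codim) (Gr_top k m) \<phi>"
    by (rule the_equality) (use \<phi> fundamental_cocycle_unique in blast)+
  then show ?thesis
    by (simp add: subvariety_class_def Gr_codim_completion[OF Z] Let_def)
qed

end

context interval_family
begin

lemma cell_completion_rank_locus: "cell_completion k m a b rank_locus"
  by unfold_locales (rule closedin_rank_locus, rule cell_subset_rank_locus, rule subset_refl)

lemma cell_completion_rank_variety: "cell_completion k m a b (rank_variety m intervals)"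
  unfolding rank_variety_eq_closure_cell
  using closure_of_subset[of cell "Gr_top k m"] cell_subset_Gr closure_of_minimal[OF cell_subset_rank_locus closedin_rank_locus]
  by unfold_locales (auto simp: topspace_Gr_top)

lemma interval_family_kappa: "interval_family k (Suc m) a (\<lambda>i. Suc (b i))"
  by unfold_locales (use inj_a inj_b ab in \<open>auto simp: inj_on_def le_SucI\<close>)

interpretation kappa: interval_family k "Suc m" a "\<lambda>i. Suc (b i)"
  by (rule interval_family_kappa)

lemma intervals_kappa: "kappa.intervals = kappa intervals"
  unfolding kappa.intervals_def kappa_def intervals_def by auto

lemma interval_rank_kappa: "interval_rank kappa.intervals p (Suc q) = interval_rank intervals p q"
  unfolding interval_rank_intervals kappa.interval_rank_intervals by simp

lemma codim_kappa: "kappa.codim = codim"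
proof -
  have "rank_dim kappa.intervals = (\<Sum>i<k. int (Suc (Suc (b i)) - a i) - int (interval_rank intervals (a i) (b i)))"
    unfolding rank_dim_def by (subst (2) kappa.intervals_def, subst sum.reindex[OF kappa.inj_intervals]) (simp add: interval_rank_kappa)
  also have "\<dots> = (\<Sum>i<k. (int (Suc (b i) - a i) - int (interval_rank intervals (a i) (b i))) + 1)"
    by (intro sum.cong) (use ab in \<open>auto simp: Suc_diff_le le_SucI\<close>)
  also have "\<dots> = rank_dim intervals + int k"
    unfolding rank_dim_def sum.distrib by (subst (3) intervals_def, subst sum.reindex[OF inj_intervals]) simp
  finally show ?thesis
    using codim_eq kappa.codim_eq by (simp add: algebra_simps)
qed

lemma rank_locus_difference_map:
  assumes V: "V \<in> Gr k m" and image: "difference_map ` V \<in> kappa.rank_locus"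
  shows "V \<in> rank_locus"
  unfolding rank_locus_def
proof (intro CollectI conjI allI V)
  fix p q
  let ?W = "V \<inter> coord_span {p..q}"
  have W: "csubspace ?W" "?W \<subseteq> coord_span {1..m}"
    using GrD[OF V] unfolding cspace_eq_coord_span by (auto intro: cvec.subspace_inter csubspace_coord_span)
  obtain v where v: "lin_indep {..<cdim ?W} v" "\<And>i. v i \<in> ?W" "\<And>w. w \<in> ?W \<Longrightarrow> \<exists>c. w = lincomb {..<cdim ?W} c v"
    using coord_span_subspace_family_basis[OF W(1) finite_atLeastAtMost W(2)] by blast
  have "difference_map ` V \<inter> coord_span {p..Suc q} \<subseteq> cspan ((\<lambda>i. difference_map (v i)) ` {..<cdim ?W})"
  proof
    fix x assume "x \<in> difference_map ` V \<inter> coord_span {p..Suc q}"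
    then obtain w where w: "w \<in> V" "x = difference_map w" "difference_map w \<in> coord_span {p..Suc q}"
      by auto
    then have "w \<in> ?W"
      using difference_map_support GrD(2)[OF V] by blast
    then obtain c where "w = lincomb {..<cdim ?W} c v"
      using v(3) by blast
    moreover have "v i \<in> cspace m" for i
      using v(2) GrD(2)[OF V] by blast
    ultimately have "x = lincomb {..<cdim ?W} c (\<lambda>i. difference_map (v i))"
      using w(2) linear_inclusion_lincomb[OF linear_inclusion_difference_map[of m]] by simp
    then show "x \<in> cspan ((\<lambda>i. difference_map (v i)) ` {..<cdim ?W})"
      using in_span_image_iff[of "{..<cdim ?W}" x "\<lambda>i. difference_map (v i)"] by blast
  qed
  then have "subspace_rank (difference_map ` V) p (Suc q) \<le> card ((\<lambda>i. difference_map (v i)) ` {..<cdim ?W})"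
    unfolding subspace_rank_def by (rule cvec.dim_le_card) simp
  also have "\<dots> \<le> subspace_rank V p q"
    using card_image_le[of "{..<cdim ?W}" "\<lambda>i. difference_map (v i)"] by (simp add: subspace_rank_def)
  finally have "subspace_rank (difference_map ` V) p (Suc q) \<le> subspace_rank V p q" .
  moreover have "interval_rank kappa.intervals p (Suc q) \<le> subspace_rank (difference_map ` V) p (Suc q)"
    using image unfolding kappa.rank_locus_def by blast
  ultimately show "interval_rank intervals p q \<le> subspace_rank V p q"
    using interval_rank_kappa[of p q] by linarith
qed

lemma supported_rows_difference_map:
  assumes B: "supported_rows B" shows "kappa.supported_rows (\<lambda>i. difference_map (B i))"
  unfolding kappa.supported_rows_def
proof (intro conjI allI impI)
  fix i
  show "difference_map (B i) = 0" if "k \<le> i"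
    using B that by (simp add: supported_rows_def difference_map_def zero_fun_def)
  assume i: "i < k"
  have row: "B i \<in> coord_span {a i..b i}" and ends: "B i (a i) \<noteq> 0" "B i (b i) \<noteq> 0"
    using B i unfolding supported_rows_def by auto
  have support: "B i p = 0" if "p < a i \<or> b i < p" for p
    using spec[OF row[unfolded in_coord_span_interval], of p] that by auto
  show "difference_map (B i) (a i) \<noteq> 0" "difference_map (B i) (Suc (b i)) \<noteq> 0"
    using support[of "a i - 1"] support[of "Suc (b i)"] ends ab[OF i] by (auto simp: difference_map_def)
  have outside: "difference_map (B i) p = 0" if "p < a i \<or> Suc (b i) < p" for p
  proof -
    have "p < a i \<or> b i < p" "p - 1 < a i \<or> b i < p - 1"
      using that by auto
    then show ?thesis
      by (simp add: difference_map_def support)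
  qed
  show "difference_map (B i) \<in> coord_span {a i..Suc (b i)}"
    unfolding in_coord_span_interval by (intro allI impI) (use outside not_less in blast)
qed

lemma difference_map_normal_frame:
  assumes V: "V \<in> cell" and B: "B = (\<lambda>i. difference_map (normal_frame V i))"
  shows "kappa.supported_rows B" "row_space k B \<in> kappa.cell" "row_space k B = difference_map ` V"
proof -
  note rows = supported_rows_normal_frame[OF V]
  show supported: "kappa.supported_rows B"
    unfolding B by (rule supported_rows_difference_map[OF rows])
  then show "row_space k B \<in> kappa.cell"
    unfolding kappa.cell_def by (intro imageI) simp
  have "normal_frame V i \<in> cspace m" if "i < k" for i
    using supported_rows_frame[OF rows] that by (simp add: frames_iff)
  then show "row_space k B = difference_map ` V"
    using linear_inclusion_row_space[OF linear_inclusion_difference_map, of k "normal_frame V" m] row_space_normal_frame_cell[OF V]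
    by (simp add: B)
qed

lemma frame_deriv_difference_unit_matrix:
  assumes "i < k" "p \<in> {1..m}"
  shows "frame_deriv k (Suc m) f B (\<lambda>i'. difference_map (unit_matrix i p i')) = Gr_partial k f B i p - Gr_partial k f B i (Suc p)"
proof -
  have "(\<lambda>i'. difference_map (unit_matrix i p i')) = unit_matrix i p - unit_matrix i (Suc p)"
    using assms(2) by (auto simp: difference_map_def unit_matrix_def fun_eq_iff)
  then have "frame_deriv k (Suc m) f B (\<lambda>i'. difference_map (unit_matrix i p i'))
      = frame_deriv k (Suc m) f B (unit_matrix i p) - frame_deriv k (Suc m) f B (unit_matrix i (Suc p))"
    by (simp add: frame_deriv_def left_diff_distrib sum_subtractf)
  then show ?thesis
    using assms frame_deriv_unit_matrix[of i k _ "Suc m" f B] by simp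
qed

text \<open>A functional on \<open>\<complex>\<^sup>m\<^sup>+\<^sup>1\<close> vanishing on \<open>difference_map ` V\<close> and on the normal directions has equal
  values on all basis vectors; one of these values is \<open>0\<close>.\<close>

lemma Gr_partial_comb_difference_eq_0:
  assumes V: "V \<in> cell" and B: "B = (\<lambda>i. difference_map (normal_frame V i))"
    and g: "\<forall>t<codim. (\<Sum>s<codim. g s * frame_deriv k (Suc m) (kappa.entry_coord s) B (\<lambda>i. difference_map (normal_dir t i))) = 0"
    and i: "i < k" and q: "q \<in> {1..Suc m}"
  shows "(\<Sum>s<codim. g s * Gr_partial k (kappa.entry_coord s) B i q) = 0"
proof -
  let ?l = "\<lambda>q. \<Sum>s<codim. g s * Gr_partial k (kappa.entry_coord s) B i q"
  have Gr: "V \<in> Gr k m"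
    using V cell_subset_Gr by blast
  note rows = difference_map_normal_frame(1)[OF V B] and image = difference_map_normal_frame(3)[OF V B]
  have domain: "row_space k B \<in> kappa.chart_domain"
    using difference_map_normal_frame(2)[OF V B] kappa.cell_subset_chart_domain by blast
  have holomorphic: "Gr_holomorphic_on k (Suc m) (kappa.entry_coord s) kappa.chart_domain" if "s < codim" for s
    using kappa.entry_coord_holomorphic that codim_kappa by simp
  have inside: "?l p = 0" if "a i \<le> p" "p \<le> Suc (b i)" for p
  proof (intro sum.neutral ballI)
    fix s assume "s \<in> {..<codim}"
    then have "Gr_partial k (kappa.entry_coord s) B i p = 0"
      using kappa.in_cell_iff_entry_coord codim_kappa that
      by (intro kappa.Gr_partial_eq_0_inside_interval[OF holomorphic kappa.openin_chart_domain domain rows _ i]) auto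
    then show "g s * Gr_partial k (kappa.entry_coord s) B i p = 0"
      by simp
  qed
  have step: "?l p - ?l (Suc p) = 0" if p: "p \<in> {1..m}" for p
  proof (rule functional_eq_0_if_normal_entries_0[OF Gr cell_injective_on_columns[OF V] i _ _ _ p, where g = "\<lambda>p. ?l p - ?l (Suc p)"])
    fix w assume w: "w \<in> V"
    have "(\<Sum>q\<in>{1..Suc m}. difference_map w q * ?l q)
        = (\<Sum>s<codim. g s * (\<Sum>q\<in>{1..Suc m}. difference_map w q * Gr_partial k (kappa.entry_coord s) B i q))"
      unfolding sum_distrib_left by (subst sum.swap) (simp add: mult_ac)
    also have "\<dots> = 0"
      by (intro sum.neutral ballI)
        (use frame_deriv_along_row_space[OF holomorphic kappa.supported_rows_frame[OF rows] kappa.openin_chart_domain domain i] image w in simp)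
    finally show "(\<Sum>p\<in>{1..m}. w p * (?l p - ?l (Suc p))) = 0"
      using difference_map_summation_by_parts[of w m ?l] w GrD(2)[OF Gr] by auto
  next
    fix p assume normal: "(i, p) \<in> normal_entries"
    then obtain t where t: "t < codim" "entry_enum t = (i, p)"
      using entry_enum(2) by (metis imageE lessThan_iff)
    have "p \<in> {1..m}"
      using normal by (simp add: normal_entries_def free_entries_def)
    then show "?l p - ?l (Suc p) = 0"
      using g t frame_deriv_difference_unit_matrix[OF i] by (force simp: normal_dir_def right_diff_distrib sum_subtractf)
  next
    fix p assume "a i \<le> p" "p \<le> b i"
    then show "?l p - ?l (Suc p) = 0"
      using inside[of p] inside[of "Suc p"] by simp
  qed
  have const: "?l (Suc p) = ?l 1" if "p \<le> m" for p
    using that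
  proof (induction p)
    case (Suc p)
    then show ?case
      using step[of "Suc p"] by simp
  qed simp
  have le: "q - 1 \<le> m" "a i - 1 \<le> m" and Suc: "Suc (q - 1) = q" "Suc (a i - 1) = a i"
    using q ab[OF i] by auto
  have "?l q = ?l (a i)"
    using const[OF le(1)] const[OF le(2)] unfolding Suc by (simp only:)
  then show ?thesis
    using inside[of "a i"] ab[OF i] by simp
qed

lemma array_inj_difference_map:
  assumes V: "V \<in> cell" and B: "B = (\<lambda>i. difference_map (normal_frame V i))"
  shows "array_inj codim (\<lambda>s t. frame_deriv k (Suc m) (kappa.entry_coord s) B (\<lambda>i. difference_map (normal_dir t i)))"
proof (intro array_inj_if_left_kernel_0 allI impI)
  fix g s
  assume g: "\<forall>t<codim. (\<Sum>s<codim. g s * frame_deriv k (Suc m) (kappa.entry_coord s) B (\<lambda>i. difference_map (normal_dir t i))) = 0"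
    and s: "s < codim"
  have frame: "B \<in> frames k (Suc m)" "row_space k B \<in> kappa.chart_domain"
    using kappa.supported_rows_frame difference_map_normal_frame[OF V B] kappa.cell_subset_chart_domain by auto
  show "g s = 0"
    by (rule kappa.entry_coord_independent[OF frame, of g])
      (use Gr_partial_comb_difference_eq_0[OF V B g] s codim_kappa in simp_all)
qed

theorem pullback_fundamental_cocycle:
  assumes \<phi>: "fundamental_cocycle k (Suc m) codim (rank_variety (Suc m) kappa.intervals) \<phi>"
    and degree: "\<And>z. singular_relcycle (2 * codim) (subtopology (Gr_top k (Suc m)) kappa.chart_domain) (- rank_variety (Suc m) kappa.intervals) z \<Longrightarrow>
      \<phi> z = zero_degree codim kappa.entry_coord z"
    and \<psi>: "fundamental_cocycle k m codim (rank_variety m intervals) \<psi>"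
    and continuous: "continuous_map (Gr_top k m) (Gr_top k (Suc m)) (\<lambda>V. difference_map ` V)"
  shows "cochain_diff (2 * codim) (Gr_top k m) (cochain_pullback (2 * codim) (Gr_top k m) (\<lambda>V. difference_map ` V) \<phi>) \<psi>
    \<in> coboundaries (2 * codim) (Gr_top k m)" (is "?\<delta> \<in> _")
proof -
  let ?S = "\<lambda>V. difference_map ` V" and ?ZK = "rank_variety (Suc m) kappa.intervals" and ?ZM = "rank_variety m intervals"
  interpret locus: cell_completion k m a b rank_locus
    by (rule cell_completion_rank_locus)
  interpret ZM: cell_completion k m a b ?ZM
    by (rule cell_completion_rank_variety)
  interpret ZK: cell_completion k "Suc m" a "\<lambda>i. Suc (b i)" ?ZK
    by (rule kappa.cell_completion_rank_variety)
  show ?thesis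
  proof (rule locus.cocycle_is_coboundary)
    show "?\<delta> \<in> cocycles (2 * codim) (Gr_top k m)"
      by (intro cocycles_diff cocycles_pullback[OF continuous]) (use \<phi> \<psi> in \<open>auto simp: fundamental_cocycle_def\<close>)
    show "\<forall>d. singular_chain (2 * codim) (subtopology (Gr_top k m) (- rank_locus)) d \<longrightarrow> ?\<delta> d = 0"
    proof (intro allI impI)
      fix d assume d: "singular_chain (2 * codim) (subtopology (Gr_top k m) (- rank_locus)) d"
      have "continuous_map (subtopology (Gr_top k m) (- rank_locus)) (subtopology (Gr_top k (Suc m)) (- ?ZK)) ?S"
        using rank_locus_difference_map ZK.completion(2)
        by (intro continuous_map_into_subtopology continuous_map_from_subtopology[OF continuous]) (auto simp: topspace_Gr_top)
      then have "\<phi> (chain_map (2 * codim) ?S d) = 0"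
        using \<phi> singular_chain_chain_map[OF d] unfolding fundamental_cocycle_def by blast
      moreover have "singular_chain (2 * codim) (subtopology (Gr_top k m) (- ?ZM)) d"
        using d ZM.completion(2) by (auto simp: singular_chain_subtopology)
      then have "\<psi> d = 0"
        using \<psi> unfolding fundamental_cocycle_def by blast
      ultimately show "?\<delta> d = 0"
        using d by (simp add: cochain_diff_def cochain_pullback_def singular_chain_subtopology)
    qed
    fix V assume V: "V \<in> cell"
    define B where "B = (\<lambda>i. difference_map (normal_frame V i))"
    let ?R = "\<lambda>t i. difference_map (normal_dir t i)"
    note B = difference_map_normal_frame[OF V B_def]
    have "row_space k B \<in> ?ZK \<inter> kappa.chart_domain"
      using B(2) ZK.completion(1) kappa.cell_subset_chart_domain by blast
    moreover have "\<forall>t<codim. ?R t \<in> matrices k (Suc m)"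
      using difference_map_in_matrices normal_dir_in_matrices by blast
    ultimately have "\<forall>\<^sub>F r in at_right 0.
        singular_relcycle (2 * codim) (subtopology (Gr_top k (Suc m)) kappa.chart_domain) (- ?ZK) (frag_of (frame_simplex k codim B ?R r)) \<and>
        zero_degree codim kappa.entry_coord (frag_of (frame_simplex k codim B ?R r)) = 1"
      by (rule eventually_frame_simplex_zero_degree[OF ZK.entry_coord_equations[unfolded codim_kappa]
            kappa.supported_rows_frame[OF B(1)] _ _ array_inj_difference_map[OF V B_def]])
    then show "\<forall>\<^sub>F r in at_right 0. ?\<delta> (frag_of (normal_cell_simplex V r)) = 0"
      using ZM.eventually_fundamental_cocycle_1[OF \<psi> V]
    proof eventually_elim
      case (elim r)
      have "(normal_frame V + matrix_comb codim y normal_dir) i \<in> cspace m" if "i < k" for i y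
        using supported_rows_frame[OF supported_rows_normal_frame[OF V]] that
          matrix_comb_in_matrices[where c = codim and y = y, OF normal_dir_in_matrices] by (auto simp: frames_iff cspace_def matrices_def)
      then have "?S (row_space k (normal_frame V + matrix_comb codim y normal_dir)) = row_space k (B + matrix_comb codim y ?R)" for y
        using linear_inclusion_row_space[OF linear_inclusion_difference_map] unfolding B_def difference_map_matrix_comb[symmetric] by blast
      then have "chain_map (2 * codim) ?S (frag_of (normal_cell_simplex V r)) = frag_of (frame_simplex k codim B ?R r)"
        unfolding normal_cell_simplex_def frame_simplex_def chain_map_restrict by simp
      then show ?case
        using elim degree by (simp add: cochain_diff_def cochain_pullback_def)
    qed
  qed
qed

theorem pullback_rank_variety_class:
  assumes j: "linear_inclusion m (Suc m) j"
  shows "cohom_pullback (Gr_top k m) (\<lambda>V. j ` V) (subvariety_class k (Suc m) (rank_variety (Suc m) kappa.intervals))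
    = subvariety_class k m (rank_variety m intervals)"
proof -
  let ?X = "Gr_top k m" and ?Y = "Gr_top k (Suc m)" and ?n = "2 * codim"
  let ?j = "\<lambda>V. j ` V" and ?S = "\<lambda>V. difference_map ` V"
  interpret ZM: cell_completion k m a b "rank_variety m intervals"
    by (rule cell_completion_rank_variety)
  interpret ZK: cell_completion k "Suc m" a "\<lambda>i. Suc (b i)" "rank_variety (Suc m) kappa.intervals"
    by (rule kappa.cell_completion_rank_variety)
  note homotopic = homotopic_linear_inclusions[OF linear_inclusion_difference_map j, of k]
  have continuous: "continuous_map ?X ?Y ?j" "continuous_map ?X ?Y ?S"
    using homotopic_with_imp_continuous_maps[OF homotopic] by auto
  obtain \<phi> where \<phi>: "fundamental_cocycle k (Suc m) codim (rank_variety (Suc m) kappa.intervals) \<phi>"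
    and degree: "\<And>z. singular_relcycle ?n (subtopology ?Y kappa.chart_domain) (- rank_variety (Suc m) kappa.intervals) z \<Longrightarrow>
      \<phi> z = zero_degree codim kappa.entry_coord z"
    using ZK.fundamental_cocycle_exists[unfolded codim_kappa] by blast
  obtain \<psi> where \<psi>: "fundamental_cocycle k m codim (rank_variety m intervals) \<psi>"
    using ZM.fundamental_cocycle_exists by blast
  have cocycles: "\<phi> \<in> cocycles ?n ?Y" "\<psi> \<in> cocycles ?n ?X"
    using \<phi> \<psi> by (auto simp: fundamental_cocycle_def)
  have "cochain_diff ?n ?X (cochain_pullback ?n ?X ?j \<phi>) \<psi> \<in> coboundaries ?n ?X"
    by (rule cochain_diff_trans[OF homotopic_pullback_coboundary[OF homotopic cocycles(1)]
          pullback_fundamental_cocycle[OF \<phi> degree \<psi> continuous(2)]])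
  then have "cohom_class ?n ?X (cochain_pullback ?n ?X ?j \<phi>) = cohom_class ?n ?X \<psi>"
    by (rule cohom_class_eqI[OF cocycles_pullback[OF continuous(1) cocycles(1)] cocycles(2)])
  then have "cohom_pullback ?X ?j ((\<lambda>p. \<one>\<^bsub>cohomology_group p ?Y\<^esub>)(?n := cohom_class ?n ?Y \<phi>))
      = (\<lambda>p. \<one>\<^bsub>cohomology_group p ?X\<^esub>)(?n := cohom_class ?n ?X \<psi>)"
    using pullback_cohom_class[OF continuous(1) cocycles(1)] pullback_one[OF continuous(1)]
    by (auto simp: cohom_pullback_def fun_eq_iff)
  moreover have "subvariety_class k (Suc m) (rank_variety (Suc m) kappa.intervals)
      = (\<lambda>p. \<one>\<^bsub>cohomology_group p ?Y\<^esub>)(?n := cohom_class ?n ?Y \<phi>)"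
    using ZK.subvariety_class_eq[unfolded codim_kappa, OF _ \<phi>] kappa.rank_variety_eq_closure_cell by simp
  moreover have "subvariety_class k m (rank_variety m intervals) = (\<lambda>p. \<one>\<^bsub>cohomology_group p ?X\<^esub>)(?n := cohom_class ?n ?X \<psi>)"
    using ZM.subvariety_class_eq[OF _ \<psi>] rank_variety_eq_closure_cell by simp
  ultimately show ?thesis
    by simp
qed

end

theorem theorem4p4:
  fixes M :: "(nat \<times> nat) set" and k n :: nat
    and j :: "(nat \<Rightarrow> complex) \<Rightarrow> (nat \<Rightarrow> complex)"
  assumes "rank_set M"
    and "card M = k"
    and "\<forall>(a, b)\<in>M. {a..b} \<subseteq> {1..n}"
    and "linear_inclusion n (n + 1) j"
  shows "cohom_pullback (Gr_top k n) (\<lambda>V. j ` V)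
           (subvariety_class k (n + 1) (rank_variety (n + 1) (kappa M)))
         = subvariety_class k n (rank_variety n M)"
proof -
  have "snd x \<le> n" if "x \<in> M" for x
    using assms(3) that rank_setD(5)[OF assms(1) that] by (cases x) fastforce
  then have "M \<in> rank_sets k n"
    using assms(1,2) by (simp add: rank_sets_def)
  then obtain a b where "interval_family k n a b" "interval_family.intervals k a b = M"
    by (rule rank_sets_interval_family)
  then show ?thesis
    using interval_family.pullback_rank_variety_class[of k n a b j] interval_family.intervals_kappa[of k n a b] assms(4) by simp
qed

end
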